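(* Let $E$ be a Lusin space, $m$ a fully supported $\sigma$-finite measure on $E$, and $X$ an $m$-symmetric Markov process on $E$ associated with a quasi-regular Dirichlet form $(\mathcal{E},\mathcal{F})$ on $L^2(E,m)$. Assume that $X$ is irreducible and transient, and that its semigroup $(P_t)$ is strong Feller, i.e. $P_t(\mathcal{B}_b(E))\subset C_b(E)$ for each $t>0$. Let $\mu=\mu^+-\mu^-$ be a signed smooth measure and $F=F^+-F^-$ a bounded symmetric function on $E\times E\setminus d$, and let $\rho^\pm$, $X^{A^-}$, $\mathcal{H}^+$, $(\mathcal{E}^{-A,h},\mathcal{F}^{-A,h})$ and the classes $\mathbf{S}^1_D(X)$, $\mathbf{S}^1_{EK}(X^{A^-})$ be as defined in the context. Assume that $\rho^-\in\mathbf{S}^1_D(X)$ and $\rho^+\in\mathbf{S}^1_{EK}(X^{A^-})$. If for some $h\in\mathcal{H}^+$ the form $(\mathcal{E}^{-A,h},\mathcal{F}^{-A,h})$ is recurrent (resp. transient), then for every $h\in\mathcal{H}^+$ the form $(\mathcal{E}^{-A,h},\mathcal{F}^{-A,h})$ is recurrent (resp. transient).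
   Context: Standard notions from the theory of symmetric Dirichlet forms (quasi-regularity, quasi-continuity, q.e., smooth measures and smooth measures in the strict sense, Revuz correspondence, transience, recurrence, irreducibility) are used. Here $\mathcal{B}_b(E)$, $C_b(E)$ are the bounded Borel and bounded continuous functions, and $d$ is the diagonal of $E\times E$. Functions on $E$ are set to $0$ at the cemetery. Process data. $(N,H)$ is the Lévy system of $X$ and $\mu_H$ the Revuz measure of $H$. For a function $\Phi$ on $E\times E\setminus d$, $N\Phi(x)=\int_E\Phi(x,y)N(x,dy)$. Additive functionals. $\mu=\mu^+-\mu^-$ is the natural decomposition of $\mu$ into positive smooth measures, $A^{\mu^\pm}$ are the positive continuous additive functionals of $\mu^\pm$. $F(x,y)=F(y,x)$ is bounded, $F^+=F\vee 0$, $F^-=-(F\wedge 0)$. Put $$A^\pm_t=A^{\mu^\pm}_t+\sum_{s\le t}F^\pm(X_{s-},X_s),\qquad A_t=A^+_t-A^-_t .$$ Feynman–Kac semigroup: $P^{-A}_tf(x)=\mathbf{E}_x\big(f(X_t)e^{A_t}\big)$. Functions and measures. $G^-=1-e^{-F^-}$, $G^+=(e^{F^+}-1)e^{-F^-}$, $G=G^+-G^-$; $\rho^\pm=\mu^\pm+NG^\pm\cdot\mu_H$. Killed process. $X^{A^-}$ is the subprocess of $X$ with semigroup $P^{A^-}_tf(x)=\mathbf{E}_x(f(X_t)e^{-A^-_t})$. Schrödinger form. $(\mathcal{E}^{-A},\mathcal{F}^{-A})$ is the quadratic form on $L^2(E,m)$ associated with $(P^{-A}_t)$; under the present hypotheses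 $\mathcal{F}^{-A}=\mathcal{F}$ and $$\mathcal{E}^{-A}(u,v)=\mathcal{E}(u,v)-\int_E uv\,d\mu-\int_E\int_E u(x)v(y)G(x,y)N(x,dy)\mu_H(dx).$$ Superharmonic functions. $\mathcal{H}^+$ is the set of functions $h$ with $0<h<\infty$ q.e., $h$ quasi-continuous, and $P^{-A}_th\le h$ for each $t$ (quasi-notions relative to $(\mathcal{E},\mathcal{F})$). For $h\in\mathcal{H}^+$, the form $$\mathcal{F}^{-A,h}=\{u:uh\in\mathcal{F}^{-A}\},\qquad \mathcal{E}^{-A,h}(u,v)=\mathcal{E}^{-A}(uh,vh)$$ is a Dirichlet form on $L^2(E,h^2\cdot m)$, associated with the semigroup $f\mapsto h^{-1}P^{-A}_t(fh)$. Classes. For a symmetric process $Z$ with $\alpha$-resolvent kernels $R^Z_\alpha(x,y)$ and $R^Z_\alpha\nu(x)=\int_E R^Z_\alpha(x,y)\nu(dy)$, a smooth measure $\nu$ in the strict sense belongs to $\mathbf{S}^1_D(Z)$ (Dynkin class) if $\sup_{x\in E}R^Z_\alpha|\nu|(x)<\infty$ for some $\alpha>0$, and to $\mathbf{S}^1_{EK}(Z)$ (extended Kato class) if $\lim_{\alpha\to\infty}\sup_{x\in E}R^Z_\alpha|\nu|(x)<1$. *)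

theory Defs
  imports "HOL-Probability.Probability"
begin

text \<open>
  Conventions.  The state space is the whole of a type \<open>'a\<close>, and the cemetery is \<open>None\<close> in
  \<open>'a option\<close>.  Time is indexed by \<open>ennreal\<close>, with \<open>X \<top> = None\<close>.  Expectations are taken with
  respect to the completion of the law, because quasi-continuous functions and additive functionals
  are in general only measurable with respect to completions; for the same reason the reference
  measure of a form is passed as the completion of \<open>m\<close>.
\<close>

section \<open>State space\<close>

text \<open>Homeomorphic to a Borel subset of a compact metric space.  A compact metric space has at most
  the cardinality of the continuum, so taking its carrier inside \<open>real\<close> (with an arbitrary metric)
  is no restriction.\<close>

definition lusin_space :: "'a topology \<Rightarrow> bool" where
  "lusin_space T \<longleftrightarrow> (\<exists>(K :: real metric) B. compact_space (mtopology_of K)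
     \<and> B \<in> sigma_sets (mspace K) {U. openin (mtopology_of K) U}
     \<and> T homeomorphic_space (subtopology (mtopology_of K) B))"

definition full_support :: "'a::topological_space measure \<Rightarrow> bool" where
  "full_support m \<longleftrightarrow> (\<forall>U. open U \<and> U \<noteq> {} \<longrightarrow> 0 < emeasure m U)"

section \<open>Dirichlet forms\<close>

text \<open>Elements of \<open>L\<^sup>2\<close> are represented by functions; form domains are required to be saturated under
  almost everywhere equality.\<close>

definition L2 :: "'a measure \<Rightarrow> ('a \<Rightarrow> real) set" where
  "L2 M = {u \<in> borel_measurable M. integrable M (\<lambda>x. (u x)\<^sup>2)}"

type_synonym 'a form = "('a \<Rightarrow> real) \<Rightarrow> ('a \<Rightarrow> real) \<Rightarrow> real"

definition form1 :: "'a measure \<Rightarrow> 'a form \<Rightarrow> 'a form" where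
  "form1 M \<E> u v = \<E> u v + (\<integral>x. u x * v x \<partial>M)"

definition dirichlet_form :: "'a measure \<Rightarrow> 'a form \<Rightarrow> ('a \<Rightarrow> real) set \<Rightarrow> bool" where
  "dirichlet_form M \<E> D \<longleftrightarrow>
     D \<subseteq> L2 M
   \<and> (\<forall>u\<in>D. \<forall>v\<in>borel_measurable M. (AE x in M. u x = v x) \<longrightarrow> v \<in> D \<and> (\<forall>w\<in>D. \<E> u w = \<E> v w))
   \<and> (\<lambda>_. 0) \<in> D
   \<and> (\<forall>u\<in>D. \<forall>v\<in>D. \<forall>a b. (\<lambda>x. a * u x + b * v x) \<in> D
        \<and> (\<forall>w\<in>D. \<E> (\<lambda>x. a * u x + b * v x) w = a * \<E> u w + b * \<E> v w))
   \<and> (\<forall>u\<in>D. \<forall>v\<in>D. \<E> u v = \<E> v u)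
   \<and> (\<forall>u\<in>D. 0 \<le> \<E> u u)
   \<and> (\<forall>u\<in>L2 M. \<forall>e>0. \<exists>v\<in>D. (\<integral>x. (u x - v x)\<^sup>2 \<partial>M) < e)
   \<and> (\<forall>u :: nat \<Rightarrow> 'a \<Rightarrow> real. (\<forall>n. u n \<in> D)
        \<and> (\<forall>e>0. \<exists>n0. \<forall>i\<ge>n0. \<forall>j\<ge>n0. form1 M \<E> (\<lambda>x. u i x - u j x) (\<lambda>x. u i x - u j x) < e)
        \<longrightarrow> (\<exists>v\<in>D. (\<lambda>n. form1 M \<E> (\<lambda>x. u n x - v x) (\<lambda>x. u n x - v x)) \<longlonglongrightarrow> 0))
   \<and> (\<forall>u\<in>D. (\<lambda>x. min 1 (max 0 (u x))) \<in> D
        \<and> \<E> (\<lambda>x. min 1 (max 0 (u x))) (\<lambda>x. min 1 (max 0 (u x))) \<le> \<E> u u)"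

definition nest :: "'a::topological_space measure \<Rightarrow> 'a form \<Rightarrow> ('a \<Rightarrow> real) set \<Rightarrow> (nat \<Rightarrow> 'a set) \<Rightarrow> bool" where
  "nest M \<E> D K \<longleftrightarrow> incseq K \<and> (\<forall>k. closed (K k))
     \<and> (\<forall>u\<in>D. \<forall>e>0. \<exists>k. \<exists>v\<in>D. (AE x in M. x \<notin> K k \<longrightarrow> v x = 0)
            \<and> form1 M \<E> (\<lambda>x. u x - v x) (\<lambda>x. u x - v x) < e)"

definition exceptional :: "'a::topological_space measure \<Rightarrow> 'a form \<Rightarrow> ('a \<Rightarrow> real) set \<Rightarrow> 'a set \<Rightarrow> bool" where
  "exceptional M \<E> D S \<longleftrightarrow> (\<exists>K. nest M \<E> D K \<and> S \<subseteq> (\<Inter>k. - K k))"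

definition quasi_everywhere :: "'a::topological_space measure \<Rightarrow> 'a form \<Rightarrow> ('a \<Rightarrow> real) set \<Rightarrow> ('a \<Rightarrow> bool) \<Rightarrow> bool" where
  "quasi_everywhere M \<E> D p \<longleftrightarrow> exceptional M \<E> D {x. \<not> p x}"

definition quasi_continuous :: "'a::topological_space measure \<Rightarrow> 'a form \<Rightarrow> ('a \<Rightarrow> real) set
    \<Rightarrow> ('a \<Rightarrow> 'b::topological_space) \<Rightarrow> bool" where
  "quasi_continuous M \<E> D f \<longleftrightarrow> (\<exists>K. nest M \<E> D K \<and> (\<forall>k. continuous_on (K k) f))"

definition qc_version :: "'a::topological_space measure \<Rightarrow> 'a form \<Rightarrow> ('a \<Rightarrow> real) set
    \<Rightarrow> ('a \<Rightarrow> real) \<Rightarrow> ('a \<Rightarrow> real) \<Rightarrow> bool" where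
  "qc_version M \<E> D u w \<longleftrightarrow> quasi_continuous M \<E> D w \<and> (AE x in M. w x = u x)"

definition quasi_regular :: "'a::topological_space measure \<Rightarrow> 'a form \<Rightarrow> ('a \<Rightarrow> real) set \<Rightarrow> bool" where
  "quasi_regular M \<E> D \<longleftrightarrow>
     (\<exists>K. nest M \<E> D K \<and> (\<forall>k. compact (K k)))
   \<and> (\<exists>D0\<subseteq>D. (\<forall>u\<in>D0. \<exists>w. qc_version M \<E> D u w)
        \<and> (\<forall>u\<in>D. \<forall>e>0. \<exists>v\<in>D0. form1 M \<E> (\<lambda>x. u x - v x) (\<lambda>x. u x - v x) < e))
   \<and> (\<exists>w :: nat \<Rightarrow> 'a \<Rightarrow> real. \<exists>S. exceptional M \<E> D S
        \<and> (\<forall>n. \<exists>u\<in>D. qc_version M \<E> D u (w n))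
        \<and> (\<forall>x y. x \<notin> S \<and> y \<notin> S \<and> x \<noteq> y \<longrightarrow> (\<exists>n. w n x \<noteq> w n y)))"

definition smooth :: "'a::topological_space measure \<Rightarrow> 'a form \<Rightarrow> ('a \<Rightarrow> real) set \<Rightarrow> 'a measure \<Rightarrow> bool" where
  "smooth M \<E> D \<nu> \<longleftrightarrow> sets \<nu> = sets borel
     \<and> (\<forall>S\<in>sets borel. exceptional M \<E> D S \<longrightarrow> emeasure \<nu> S = 0)
     \<and> (\<exists>K. nest M \<E> D K \<and> (\<forall>k. emeasure \<nu> (K k) < \<infinity>))"

text \<open>\<open>\<nu>p - \<nu>m\<close> is the Jordan decomposition of a signed smooth measure.  The difference itself
  need not be defined on all Borel sets, so the pair represents it.\<close>

definition signed_smooth :: "'a::topological_space measure \<Rightarrow> 'a form \<Rightarrow> ('a \<Rightarrow> real) set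
    \<Rightarrow> 'a measure \<Rightarrow> 'a measure \<Rightarrow> bool" where
  "signed_smooth M \<E> D \<nu>p \<nu>m \<longleftrightarrow> smooth M \<E> D \<nu>p \<and> smooth M \<E> D \<nu>m
     \<and> (\<exists>S\<in>sets borel. emeasure \<nu>p S = 0 \<and> emeasure \<nu>m (- S) = 0)"

text \<open>The class \<open>S\<^sub>0\<^sub>0\<close>: finite measures of finite energy integral with bounded 1-potential \<open>U\<close>.\<close>

definition S00 :: "'a::topological_space measure \<Rightarrow> 'a form \<Rightarrow> ('a \<Rightarrow> real) set \<Rightarrow> 'a measure \<Rightarrow> bool" where
  "S00 M \<E> D \<nu> \<longleftrightarrow> sets \<nu> = sets borel \<and> emeasure \<nu> UNIV < \<infinity>
     \<and> (\<forall>S\<in>sets borel. exceptional M \<E> D S \<longrightarrow> emeasure \<nu> S = 0)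
     \<and> (\<exists>C. \<forall>v\<in>D. \<forall>w. qc_version M \<E> D v w \<longrightarrow>
          integrable (completion \<nu>) w \<and> (\<integral>x. \<bar>w x\<bar> \<partial>completion \<nu>) \<le> C * sqrt (form1 M \<E> v v))
     \<and> (\<exists>U\<in>D. (\<forall>v\<in>D. \<forall>w. qc_version M \<E> D v w \<longrightarrow> form1 M \<E> U v = (\<integral>x. w x \<partial>completion \<nu>))
          \<and> (\<exists>C. AE x in M. \<bar>U x\<bar> \<le> C))"

subsection \<open>Transience and recurrence\<close>

text \<open>\<open>u\<close> is the \<open>\<alpha>\<close>-resolvent \<open>G\<^sub>\<alpha> f\<close> of the form.\<close>

definition form_resolvent :: "'a measure \<Rightarrow> 'a form \<Rightarrow> ('a \<Rightarrow> real) set \<Rightarrow> real \<Rightarrow> ('a \<Rightarrow> real) \<Rightarrow> ('a \<Rightarrow> real) \<Rightarrow> bool" where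
  "form_resolvent M \<E> D \<alpha> f u \<longleftrightarrow>
     u \<in> D \<and> (\<forall>v\<in>D. \<E> u v + \<alpha> * (\<integral>x. u x * v x \<partial>M) = (\<integral>x. f x * v x \<partial>M))"

text \<open>\<open>w\<close> is the potential \<open>G f = \<integral>\<^sub>0\<^sup>\<infinity> T\<^sub>t f dt\<close> of the semigroup of the form, for \<open>f \<ge> 0\<close> in \<open>L\<^sup>1\<close>,
  as the increasing limit of \<open>G\<^sub>1\<^sub>/\<^sub>n f\<close> for \<open>n \<longlongrightarrow> \<infinity>\<close>; the truncations \<open>min f k\<close> put the
  argument in \<open>L\<^sup>2\<close>.\<close>

definition form_potential :: "'a measure \<Rightarrow> 'a form \<Rightarrow> ('a \<Rightarrow> real) set \<Rightarrow> ('a \<Rightarrow> real) \<Rightarrow> ('a \<Rightarrow> ennreal) \<Rightarrow> bool" where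
  "form_potential M \<E> D f w \<longleftrightarrow>
     (\<exists>u :: nat \<Rightarrow> nat \<Rightarrow> 'a \<Rightarrow> real.
        (\<forall>n k. form_resolvent M \<E> D (1 / real (Suc n)) (\<lambda>x. min (f x) (real k)) (u n k))
      \<and> (AE x in M. w x = (SUP n. SUP k. ennreal (u n k x))))"

definition transient_form :: "'a measure \<Rightarrow> 'a form \<Rightarrow> ('a \<Rightarrow> real) set \<Rightarrow> bool" where
  "transient_form M \<E> D \<longleftrightarrow>
     (\<exists>f. integrable M f \<and> (AE x in M. 0 < f x)
        \<and> (\<exists>w. form_potential M \<E> D f w \<and> (AE x in M. w x < \<infinity>)))"

definition recurrent_form :: "'a measure \<Rightarrow> 'a form \<Rightarrow> ('a \<Rightarrow> real) set \<Rightarrow> bool" where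
  "recurrent_form M \<E> D \<longleftrightarrow>
     (\<forall>f. integrable M f \<and> (AE x in M. 0 \<le> f x)
        \<longrightarrow> (\<exists>w. form_potential M \<E> D f w \<and> (AE x in M. w x = 0 \<or> w x = \<infinity>)))"

subsection \<open>The form of a symmetric semigroup\<close>

definition semigroup_form :: "'a measure \<Rightarrow> (real \<Rightarrow> ('a \<Rightarrow> real) \<Rightarrow> 'a \<Rightarrow> real) \<Rightarrow> 'a form" where
  "semigroup_form M T u v = Lim (at_right 0) (\<lambda>t. (\<integral>x. (u x - T t u x) * v x \<partial>M) / t)"

definition semigroup_dom :: "'a measure \<Rightarrow> (real \<Rightarrow> ('a \<Rightarrow> real) \<Rightarrow> 'a \<Rightarrow> real) \<Rightarrow> ('a \<Rightarrow> real) set" where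
  "semigroup_dom M T =
     {u \<in> L2 M. \<exists>c. ((\<lambda>t. (\<integral>x. (u x - T t u x) * u x \<partial>M) / t) \<longlongrightarrow> c) (at_right 0)}"

text \<open>Extension of a positive operator on \<open>[0,\<infinity>]\<close>-valued functions to real functions.\<close>

definition real_op :: "(real \<Rightarrow> ('a \<Rightarrow> ennreal) \<Rightarrow> 'a \<Rightarrow> ennreal) \<Rightarrow> real \<Rightarrow> ('a \<Rightarrow> real) \<Rightarrow> 'a \<Rightarrow> real" where
  "real_op K t f x = enn2real (K t (\<lambda>y. ennreal (f y)) x) - enn2real (K t (\<lambda>y. ennreal (- f y)) x)"

definition irreducible_semigroup :: "'a measure \<Rightarrow> (real \<Rightarrow> ('a \<Rightarrow> real) \<Rightarrow> 'a \<Rightarrow> real) \<Rightarrow> bool" where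
  "irreducible_semigroup M T \<longleftrightarrow>
     (\<forall>B\<in>sets M. (\<forall>t>0. \<forall>f\<in>L2 M. AE x in M. T t (\<lambda>y. indicator B y * f y) x = indicator B x * T t f x)
        \<longrightarrow> emeasure M B = 0 \<or> emeasure M (space M - B) = 0)"

section \<open>Markov processes\<close>

definition cemetery_borel :: "'a::topological_space option measure" where
  "cemetery_borel = sigma UNIV ((`) Some ` sets borel)"

definition ext0 :: "('a \<Rightarrow> ennreal) \<Rightarrow> 'a option \<Rightarrow> ennreal" where
  "ext0 f z = (case z of None \<Rightarrow> 0 | Some y \<Rightarrow> f y)"

definition nat_filtration :: "(ennreal \<Rightarrow> 'w \<Rightarrow> 'a::topological_space option) \<Rightarrow> ennreal \<Rightarrow> 'w measure" where
  "nat_filtration X t = sigma UNIV {X s -` B | s B. s \<le> t \<and> B \<in> sets cemetery_borel}"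

definition right_filtration :: "(ennreal \<Rightarrow> 'w \<Rightarrow> 'a::topological_space option) \<Rightarrow> ennreal \<Rightarrow> 'w measure" where
  "right_filtration X t =
     (if t = \<top> then nat_filtration X \<top> else sigma UNIV (\<Inter>s\<in>{t<..}. sets (nat_filtration X s)))"

text \<open>Borel right process with laws \<open>P\<close>, paths \<open>X\<close> and shifts \<open>\<theta>\<close>.  The strong Markov property is
  stated for the optional times of the raw filtration; it extends to all initial laws by integration
  and to the augmented filtration by completion.\<close>

definition right_process :: "('a::topological_space option \<Rightarrow> 'w measure) \<Rightarrow> (ennreal \<Rightarrow> 'w \<Rightarrow> 'a option)
    \<Rightarrow> (ennreal \<Rightarrow> 'w \<Rightarrow> 'w) \<Rightarrow> bool" where
  "right_process P X \<theta> \<longleftrightarrow>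
     P \<in> cemetery_borel \<rightarrow>\<^sub>M prob_algebra (nat_filtration X \<top>)
   \<and> (\<forall>z. AE \<omega> in P z. X 0 \<omega> = z)
   \<and> (\<forall>\<omega>. X \<top> \<omega> = None)
   \<and> (\<forall>\<omega> s t. s \<le> t \<and> X s \<omega> = None \<longrightarrow> X t \<omega> = None)
   \<and> (\<forall>\<omega> s t. s < \<top> \<longrightarrow> X t (\<theta> s \<omega>) = X (s + t) \<omega>)
   \<and> (\<forall>\<omega> t y U. t < \<top> \<and> X t \<omega> = Some y \<and> open U \<and> y \<in> U
        \<longrightarrow> (\<forall>\<^sub>F r in at_right t. X r \<omega> \<in> Some ` U))
   \<and> (\<forall>T. stopping_time (right_filtration X) T \<longrightarrow>
        (\<forall>z. \<forall>\<Lambda>\<in>sets (filtration.pre_sigma UNIV (right_filtration X) T). \<forall>s. \<forall>B\<in>sets cemetery_borel.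
           emeasure (P z) {\<omega>\<in>\<Lambda>. X (T \<omega> + s) \<omega> \<in> B}
           = (\<integral>\<^sup>+\<omega>\<in>\<Lambda>. emeasure (P (X (T \<omega>) \<omega>)) {\<omega>'. X s \<omega>' \<in> B} \<partial>P z)))"

definition lifetime :: "(ennreal \<Rightarrow> 'w \<Rightarrow> 'a option) \<Rightarrow> 'w \<Rightarrow> ennreal" where
  "lifetime X \<omega> = Inf {t. X t \<omega> = None}"

definition hitting_time :: "(ennreal \<Rightarrow> 'w \<Rightarrow> 'a option) \<Rightarrow> 'a set \<Rightarrow> 'w \<Rightarrow> ennreal" where
  "hitting_time X B \<omega> = Inf {t. 0 < t \<and> X t \<omega> \<in> Some ` B}"

text \<open>From here on \<open>Q x\<close> is the law of the process started at the point \<open>x\<close> of the state space.\<close>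

definition process_semigroup :: "('a \<Rightarrow> 'w measure) \<Rightarrow> (ennreal \<Rightarrow> 'w \<Rightarrow> 'a option)
    \<Rightarrow> real \<Rightarrow> ('a \<Rightarrow> ennreal) \<Rightarrow> 'a \<Rightarrow> ennreal" where
  "process_semigroup Q X t f x = (\<integral>\<^sup>+\<omega>. ext0 f (X (ennreal t) \<omega>) \<partial>completion (Q x))"

definition symmetric_process :: "'a::topological_space measure \<Rightarrow> ('a \<Rightarrow> 'w measure)
    \<Rightarrow> (ennreal \<Rightarrow> 'w \<Rightarrow> 'a option) \<Rightarrow> bool" where
  "symmetric_process m Q X \<longleftrightarrow>
     (\<forall>t>0. \<forall>f\<in>borel_measurable borel. \<forall>g\<in>borel_measurable borel.
        (\<integral>\<^sup>+x. f x * process_semigroup Q X t g x \<partial>m) = (\<integral>\<^sup>+x. process_semigroup Q X t f x * g x \<partial>m))"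

definition strong_feller :: "('a::topological_space \<Rightarrow> 'w measure) \<Rightarrow> (ennreal \<Rightarrow> 'w \<Rightarrow> 'a option) \<Rightarrow> bool" where
  "strong_feller Q X \<longleftrightarrow>
     (\<forall>t>0. \<forall>f\<in>borel_measurable borel. bounded (range f)
        \<longrightarrow> continuous_on UNIV (real_op (process_semigroup Q X) t f)
          \<and> bounded (range (real_op (process_semigroup Q X) t f)))"

definition process_form :: "'a measure \<Rightarrow> ('a \<Rightarrow> 'w measure) \<Rightarrow> (ennreal \<Rightarrow> 'w \<Rightarrow> 'a option) \<Rightarrow> 'a form" where
  "process_form m Q X = semigroup_form (completion m) (real_op (process_semigroup Q X))"

definition process_dom :: "'a measure \<Rightarrow> ('a \<Rightarrow> 'w measure) \<Rightarrow> (ennreal \<Rightarrow> 'w \<Rightarrow> 'a option) \<Rightarrow> ('a \<Rightarrow> real) set" where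
  "process_dom m Q X = semigroup_dom (completion m) (real_op (process_semigroup Q X))"

definition associated :: "'a measure \<Rightarrow> ('a \<Rightarrow> 'w measure) \<Rightarrow> (ennreal \<Rightarrow> 'w \<Rightarrow> 'a option)
    \<Rightarrow> 'a form \<Rightarrow> ('a \<Rightarrow> real) set \<Rightarrow> bool" where
  "associated m Q X \<E> D \<longleftrightarrow>
     D = process_dom m Q X \<and> (\<forall>u\<in>D. \<forall>v\<in>D. \<E> u v = process_form m Q X u v)"

subsection \<open>The classes of smooth measures\<close>

definition smooth_strict :: "'a::topological_space measure \<Rightarrow> ('a \<Rightarrow> 'w measure)
    \<Rightarrow> (ennreal \<Rightarrow> 'w \<Rightarrow> 'a option) \<Rightarrow> 'a measure \<Rightarrow> bool" where
  "smooth_strict m Q X \<nu> \<longleftrightarrow> sets \<nu> = sets borel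
     \<and> (\<exists>B :: nat \<Rightarrow> 'a set. incseq B \<and> (\<forall>n. B n \<in> sets borel) \<and> (\<Union>n. B n) = UNIV
          \<and> (\<forall>n. S00 (completion m) (process_form m Q X) (process_dom m Q X) (density \<nu> (indicator (B n))))
          \<and> (\<forall>x. AE \<omega> in Q x. lifetime X \<omega> \<le> (SUP n. hitting_time X (- B n) \<omega>)))"

definition process_resolvent :: "('a \<Rightarrow> 'w measure) \<Rightarrow> (ennreal \<Rightarrow> 'w \<Rightarrow> 'a option)
    \<Rightarrow> real \<Rightarrow> ('a \<Rightarrow> ennreal) \<Rightarrow> 'a \<Rightarrow> ennreal" where
  "process_resolvent Q X \<alpha> f x =
     (\<integral>\<^sup>+t\<in>{0..}. ennreal (exp (- \<alpha> * t)) * process_semigroup Q X t f x \<partial>lborel)"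

text \<open>The symmetric, \<open>\<alpha>\<close>-excessive densities of the resolvent; excessiveness makes them unique at
  every point, not only almost everywhere.\<close>

definition resolvent_kernel :: "'a::topological_space measure \<Rightarrow> ('a \<Rightarrow> 'w measure)
    \<Rightarrow> (ennreal \<Rightarrow> 'w \<Rightarrow> 'a option) \<Rightarrow> (real \<Rightarrow> 'a \<Rightarrow> 'a \<Rightarrow> ennreal) \<Rightarrow> bool" where
  "resolvent_kernel m Q X r \<longleftrightarrow>
     (\<forall>\<alpha>>0. (\<lambda>(x, y). r \<alpha> x y) \<in> borel_measurable (borel \<Otimes>\<^sub>M borel)
      \<and> (\<forall>x y. r \<alpha> x y = r \<alpha> y x)
      \<and> (\<forall>f\<in>borel_measurable borel. \<forall>x. process_resolvent Q X \<alpha> f x = (\<integral>\<^sup>+y. r \<alpha> x y * f y \<partial>m))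
      \<and> (\<forall>x y. (\<forall>t>0. ennreal (exp (- \<alpha> * t)) * process_semigroup Q X t (\<lambda>z. r \<alpha> z y) x \<le> r \<alpha> x y)
           \<and> ((\<lambda>t. ennreal (exp (- \<alpha> * t)) * process_semigroup Q X t (\<lambda>z. r \<alpha> z y) x) \<longlongrightarrow> r \<alpha> x y)
                (at_right 0)))"

definition dynkin_class :: "'a::topological_space measure \<Rightarrow> ('a \<Rightarrow> 'w measure)
    \<Rightarrow> (ennreal \<Rightarrow> 'w \<Rightarrow> 'a option) \<Rightarrow> 'a measure \<Rightarrow> bool" where
  "dynkin_class m Q X \<nu> \<longleftrightarrow> smooth_strict m Q X \<nu>
     \<and> (\<exists>r. resolvent_kernel m Q X r \<and> (\<exists>\<alpha>>0. (SUP x. \<integral>\<^sup>+y. r \<alpha> x y \<partial>\<nu>) < \<infinity>))"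

definition extended_kato_class :: "'a::topological_space measure \<Rightarrow> ('a \<Rightarrow> 'w measure)
    \<Rightarrow> (ennreal \<Rightarrow> 'w \<Rightarrow> 'a option) \<Rightarrow> 'a measure \<Rightarrow> bool" where
  "extended_kato_class m Q X \<nu> \<longleftrightarrow> smooth_strict m Q X \<nu>
     \<and> (\<exists>r. resolvent_kernel m Q X r
          \<and> (\<exists>L<1. ((\<lambda>\<alpha>. SUP x. \<integral>\<^sup>+y. r \<alpha> x y \<partial>\<nu>) \<longlongrightarrow> L) at_top))"

section \<open>Additive functionals\<close>

text \<open>The minimal augmented admissible filtration: completion with respect to \<open>P\<^sub>\<mu>\<close>, intersected over
  all initial laws \<open>\<mu>\<close>.\<close>

definition aug_filtration :: "('a::topological_space option \<Rightarrow> 'w measure) \<Rightarrow> (ennreal \<Rightarrow> 'w \<Rightarrow> 'a option)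
    \<Rightarrow> ennreal \<Rightarrow> 'w measure" where
  "aug_filtration P X t = sigma UNIV
     {\<Lambda>. \<forall>\<mu>\<in>space (prob_algebra cemetery_borel). \<exists>\<Lambda>0\<in>sets (nat_filtration X t).
           (\<Lambda> - \<Lambda>0) \<union> (\<Lambda>0 - \<Lambda>) \<in> null_sets (completion (\<mu> \<bind> P))}"

text \<open>Positive continuous additive functional in the strict sense, i.e. with empty exceptional set.\<close>

definition pcaf_strict :: "('a::topological_space option \<Rightarrow> 'w measure) \<Rightarrow> (ennreal \<Rightarrow> 'w \<Rightarrow> 'a option)
    \<Rightarrow> (ennreal \<Rightarrow> 'w \<Rightarrow> 'w) \<Rightarrow> (ennreal \<Rightarrow> 'w \<Rightarrow> ennreal) \<Rightarrow> bool" where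
  "pcaf_strict P X \<theta> A \<longleftrightarrow>
     (\<forall>t<\<top>. A t \<in> borel_measurable (aug_filtration P X t))
   \<and> (\<exists>\<Lambda>\<in>sets (aug_filtration P X \<top>).
        (\<forall>x. AE \<omega> in P (Some x). \<omega> \<in> \<Lambda>)
      \<and> (\<forall>\<omega>\<in>\<Lambda>. (\<forall>t<\<top>. \<theta> t \<omega> \<in> \<Lambda>)
           \<and> A 0 \<omega> = 0
           \<and> (\<forall>t<lifetime X \<omega>. A t \<omega> < \<top>)
           \<and> (\<forall>t\<ge>lifetime X \<omega>. A t \<omega> = A (lifetime X \<omega>) \<omega>)
           \<and> continuous_on {..<\<top>} (\<lambda>t. A t \<omega>)
           \<and> (\<forall>s<\<top>. \<forall>t<\<top>. A (s + t) \<omega> = A s \<omega> + A t (\<theta> s \<omega>))))"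

text \<open>\<open>\<integral>\<^sub>0\<^sup>t f(X\<^sub>s) dA\<^sub>s\<close>.  Since \<open>A\<close> may explode at the lifetime, the Stieltjes integral is taken for
  \<open>A\<close> stopped at \<open>r\<close> before the lifetime, and then the supremum over \<open>r\<close>.\<close>

definition pcaf_integral :: "(ennreal \<Rightarrow> 'w \<Rightarrow> 'a option) \<Rightarrow> (ennreal \<Rightarrow> 'w \<Rightarrow> ennreal)
    \<Rightarrow> ('a \<Rightarrow> ennreal) \<Rightarrow> real \<Rightarrow> 'w \<Rightarrow> ennreal" where
  "pcaf_integral X A f t \<omega> =
     (SUP r\<in>{r. 0 \<le> r \<and> r \<le> t \<and> X (ennreal r) \<omega> \<noteq> None}.
        \<integral>\<^sup>+s. ext0 f (X (ennreal s) \<omega>) \<partial>interval_measure (\<lambda>s. enn2real (A (ennreal (min s r)) \<omega>)))"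

text \<open>The outer integral is over the completion because the expectation is only universally measurable
  in the starting point.\<close>

definition revuz :: "'a::topological_space measure \<Rightarrow> ('a \<Rightarrow> 'w measure) \<Rightarrow> (ennreal \<Rightarrow> 'w \<Rightarrow> 'a option)
    \<Rightarrow> (ennreal \<Rightarrow> 'w \<Rightarrow> ennreal) \<Rightarrow> 'a measure \<Rightarrow> bool" where
  "revuz m Q X A \<nu> \<longleftrightarrow> sets \<nu> = sets borel
     \<and> (\<forall>f\<in>borel_measurable borel.
          ((\<lambda>t. (\<integral>\<^sup>+x. (\<integral>\<^sup>+\<omega>. pcaf_integral X A f t \<omega> \<partial>completion (Q x)) \<partial>completion m) / ennreal t)
             \<longlongrightarrow> (\<integral>\<^sup>+x. f x \<partial>\<nu>)) (at_right 0))"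

text \<open>\<open>\<Sum>\<^sub>s\<^sub>\<le>\<^sub>t \<Phi>(X\<^sub>s\<^sub>-, X\<^sub>s)\<close>, over the jumps within the state space: \<open>\<Phi>\<close> vanishes at the cemetery.\<close>

definition left_limit :: "(ennreal \<Rightarrow> 'w \<Rightarrow> 'a::t2_space option) \<Rightarrow> real \<Rightarrow> 'w \<Rightarrow> 'a" where
  "left_limit X s \<omega> = Lim (at_left s) (\<lambda>r. the (X (ennreal r) \<omega>))"

definition jump_sum :: "(ennreal \<Rightarrow> 'w \<Rightarrow> 'a::t2_space option) \<Rightarrow> ('a \<Rightarrow> 'a \<Rightarrow> ennreal)
    \<Rightarrow> ennreal \<Rightarrow> 'w \<Rightarrow> ennreal" where
  "jump_sum X \<Phi> t \<omega> =
     infsum (\<lambda>s. \<Phi> (left_limit X s \<omega>) (the (X (ennreal s) \<omega>)))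
       {s. 0 < s \<and> ennreal s \<le> t \<and> X (ennreal s) \<omega> \<noteq> None \<and> left_limit X s \<omega> \<noteq> the (X (ennreal s) \<omega>)}"

text \<open>\<open>N\<Phi>(x) = \<integral> \<Phi>(x,y) N(x,dy)\<close>, for \<open>\<Phi>\<close> given off the diagonal.\<close>

definition kernel_integral :: "('a \<Rightarrow> 'a measure) \<Rightarrow> ('a \<Rightarrow> 'a \<Rightarrow> ennreal) \<Rightarrow> 'a \<Rightarrow> ennreal" where
  "kernel_integral N \<Phi> x = (\<integral>\<^sup>+y\<in>- {x}. \<Phi> x y \<partial>N x)"

text \<open>Only the part of the Levy system on \<open>E \<times> E\<close> is recorded (not the jumps to the cemetery).\<close>

definition levy_system :: "('a::t2_space option \<Rightarrow> 'w measure) \<Rightarrow> (ennreal \<Rightarrow> 'w \<Rightarrow> 'a option)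
    \<Rightarrow> (ennreal \<Rightarrow> 'w \<Rightarrow> 'w) \<Rightarrow> ('a \<Rightarrow> 'a measure) \<Rightarrow> (ennreal \<Rightarrow> 'w \<Rightarrow> ennreal) \<Rightarrow> bool" where
  "levy_system P X \<theta> N H \<longleftrightarrow>
     (\<forall>x. sets (N x) = sets borel \<and> emeasure (N x) {x} = 0)
   \<and> pcaf_strict P X \<theta> H
   \<and> (\<forall>\<Phi>. (\<lambda>(x, y). \<Phi> x y) \<in> borel_measurable (borel \<Otimes>\<^sub>M borel) \<longrightarrow>
        kernel_integral N \<Phi> \<in> borel_measurable borel
      \<and> (\<forall>x. \<forall>t\<ge>0. (\<integral>\<^sup>+\<omega>. jump_sum X \<Phi> (ennreal t) \<omega> \<partial>completion (P (Some x)))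
            = (\<integral>\<^sup>+\<omega>. pcaf_integral X H (kernel_integral N \<Phi>) t \<omega> \<partial>completion (P (Some x)))))"

section \<open>Feynman-Kac perturbation\<close>

definition bounded_symmetric_off_diagonal :: "('a::topological_space \<Rightarrow> 'a \<Rightarrow> real) \<Rightarrow> bool" where
  "bounded_symmetric_off_diagonal F \<longleftrightarrow>
     (\<lambda>(x, y). if x = y then 0 else F x y) \<in> borel_measurable (borel \<Otimes>\<^sub>M borel)
   \<and> (\<forall>x y. x \<noteq> y \<longrightarrow> F x y = F y x)
   \<and> (\<exists>C. \<forall>x y. x \<noteq> y \<longrightarrow> \<bar>F x y\<bar> \<le> C)"

definition F_plus :: "('a \<Rightarrow> 'a \<Rightarrow> real) \<Rightarrow> 'a \<Rightarrow> 'a \<Rightarrow> real" where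
  "F_plus F x y = max (F x y) 0"

definition F_minus :: "('a \<Rightarrow> 'a \<Rightarrow> real) \<Rightarrow> 'a \<Rightarrow> 'a \<Rightarrow> real" where
  "F_minus F x y = - min (F x y) 0"

definition G_plus :: "('a \<Rightarrow> 'a \<Rightarrow> real) \<Rightarrow> 'a \<Rightarrow> 'a \<Rightarrow> real" where
  "G_plus F x y = (exp (F_plus F x y) - 1) * exp (- F_minus F x y)"

definition G_minus :: "('a \<Rightarrow> 'a \<Rightarrow> real) \<Rightarrow> 'a \<Rightarrow> 'a \<Rightarrow> real" where
  "G_minus F x y = 1 - exp (- F_minus F x y)"

definition rho :: "'a::topological_space measure \<Rightarrow> ('a \<Rightarrow> 'a measure) \<Rightarrow> 'a measure \<Rightarrow> ('a \<Rightarrow> 'a \<Rightarrow> real) \<Rightarrow> 'a measure" where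
  "rho \<nu> N \<mu>H G = measure_of UNIV (sets borel)
     (\<lambda>B. emeasure \<nu> B + (\<integral>\<^sup>+x\<in>B. kernel_integral N (\<lambda>x y. ennreal (G x y)) x \<partial>\<mu>H))"

definition additive_functional :: "(ennreal \<Rightarrow> 'w \<Rightarrow> 'a::t2_space option) \<Rightarrow> (ennreal \<Rightarrow> 'w \<Rightarrow> ennreal)
    \<Rightarrow> ('a \<Rightarrow> 'a \<Rightarrow> real) \<Rightarrow> ennreal \<Rightarrow> 'w \<Rightarrow> ennreal" where
  "additive_functional X A F t \<omega> = A t \<omega> + jump_sum X (\<lambda>x y. ennreal (F x y)) t \<omega>"

definition enn_exp :: "ennreal \<Rightarrow> ennreal" where
  "enn_exp a = (if a = \<top> then \<top> else ennreal (exp (enn2real a)))"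

text \<open>The weight is \<open>exp(A\<^sup>+\<^sub>t - A\<^sup>-\<^sub>t)\<close>; in \<open>ennreal\<close> the quotient is \<open>0\<close> where \<open>A\<^sup>-\<^sub>t = \<infinity>\<close>.\<close>

definition feynman_kac :: "('a \<Rightarrow> 'w measure) \<Rightarrow> (ennreal \<Rightarrow> 'w \<Rightarrow> 'a option) \<Rightarrow> (ennreal \<Rightarrow> 'w \<Rightarrow> ennreal)
    \<Rightarrow> (ennreal \<Rightarrow> 'w \<Rightarrow> ennreal) \<Rightarrow> real \<Rightarrow> ('a \<Rightarrow> ennreal) \<Rightarrow> 'a \<Rightarrow> ennreal" where
  "feynman_kac Q X Ap Am t f x =
     (\<integral>\<^sup>+\<omega>. ext0 f (X (ennreal t) \<omega>) * (enn_exp (Ap (ennreal t) \<omega>) / enn_exp (Am (ennreal t) \<omega>))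
        \<partial>completion (Q x))"

text \<open>The subprocess with semigroup \<open>E\<^sub>x (f(X\<^sub>t) exp(-A\<^sub>t))\<close>, in its canonical construction: the path
  is killed when \<open>A\<close> reaches an independent exponential variable of parameter 1.\<close>

definition killed_law :: "('a \<Rightarrow> 'w measure) \<Rightarrow> 'a \<Rightarrow> ('w \<times> real) measure" where
  "killed_law Q x = completion (Q x) \<Otimes>\<^sub>M density lborel (\<lambda>l. ennreal (exponential_density 1 l))"

definition killed_path :: "(ennreal \<Rightarrow> 'w \<Rightarrow> 'a option) \<Rightarrow> (ennreal \<Rightarrow> 'w \<Rightarrow> ennreal)
    \<Rightarrow> ennreal \<Rightarrow> 'w \<times> real \<Rightarrow> 'a option" where
  "killed_path X A t \<omega>l = (if A t (fst \<omega>l) < ennreal (snd \<omega>l) then X t (fst \<omega>l) else None)"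

definition superharmonic :: "'a::topological_space measure \<Rightarrow> 'a form \<Rightarrow> ('a \<Rightarrow> real) set
    \<Rightarrow> (real \<Rightarrow> ('a \<Rightarrow> ennreal) \<Rightarrow> 'a \<Rightarrow> ennreal) \<Rightarrow> ('a \<Rightarrow> ennreal) set" where
  "superharmonic M \<E> D K =
     {h. quasi_continuous M \<E> D h
       \<and> quasi_everywhere M \<E> D (\<lambda>x. 0 < h x \<and> h x < \<infinity>)
       \<and> (\<forall>t>0. quasi_everywhere M \<E> D (\<lambda>x. K t h x \<le> h x))}"

definition h_measure :: "'a measure \<Rightarrow> ('a \<Rightarrow> ennreal) \<Rightarrow> 'a measure" where
  "h_measure M h = density M (\<lambda>x. (h x)\<^sup>2)"

definition h_form :: "'a form \<Rightarrow> ('a \<Rightarrow> ennreal) \<Rightarrow> 'a form" where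
  "h_form \<E> h u v = \<E> (\<lambda>x. u x * enn2real (h x)) (\<lambda>x. v x * enn2real (h x))"

definition h_dom :: "('a \<Rightarrow> real) set \<Rightarrow> ('a \<Rightarrow> ennreal) \<Rightarrow> ('a \<Rightarrow> real) set" where
  "h_dom D h = {u. (\<lambda>x. u x * enn2real (h x)) \<in> D}"

end

theory Submission
  imports Defs
begin

text \<open>
  The semigroup \<open>K\<^sub>t f(x) = E\<^sub>x (f(X\<^sub>t) exp (A\<^sup>+\<^sub>t - A\<^sup>-\<^sub>t))\<close> is \<open>m\<close>-symmetric: given its end points, the
  path of \<open>X\<close> on \<open>[0,t]\<close> is reversible, and the weight is invariant under time reversal.  For the continuous
  part this is seen from a discrete compensator, and the jump part is symmetric because \<open>F\<close> is.  Existence of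
  left limits also follows from reversibility and right continuity.  A superharmonic \<open>h\<close> makes \<open>K\<^sub>t\<close> a
  contraction in \<open>L\<^sup>2(m)\<close> by Schur's test.  The potential of the form \<open>\<E>\<^sup>-\<^sup>A\<^sup>,\<^sup>h\<close> is
  \<open>f \<mapsto> h\<^sup>-\<^sup>1 R\<^sub>0(f h)\<close>, where \<open>R\<^sub>0 = \<integral>\<^sub>0\<^sup>\<infinity> K\<^sub>t dt\<close>.
  Hence recurrence means that \<open>R\<^sub>0 g\<close> has only the values \<open>0\<close> and \<open>\<infinity>\<close> for all \<open>g \<ge> 0\<close>, and transience that
  \<open>R\<^sub>0 g\<close> is finite for some \<open>g > 0\<close>; neither condition depends on \<open>h\<close>.
\<close>

text \<open>Two obstacles shape the proof. Measurability in t is therefore obtained for scalar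
  pairings only: t -> <u, T_t u> is monotone, hence Borel, and polarization and suprema give the
  rest; the potential R_0 is then a Radon-Nikodym density. The form is matched with it by weak
  increments, since only difference quotients define its domain. Second, symmetry of X yields
  reversal only for laws of the positions at dyadic fractions of [0,t], whereas the functionals are
  measurable for an augmented filtration and involve left limits. Each of them must first be
  rewritten, almost surely for m-almost every starting point, as a Borel function of the dyadic
  path; the predicate \<open>reversible\<close> records such a function together with its value on
  the reversed path. Left limits are taken in an embedding into a sequence space, and a second use
  of reversal shows that they stay in the image of E.\<close>

lemma (in complete_measure) borel_measurable_AE_cong:
  fixes f g :: "'a \<Rightarrow> 'b::topological_space"
  assumes f: "f \<in> borel_measurable M" and eq: "AE x in M. f x = g x"
  shows "g \<in> borel_measurable M"
proof (rule measurableI)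
  fix A :: "'b set" assume A: "A \<in> sets borel"
  have fA: "f -` A \<inter> space M \<in> sets M"
    using measurable_sets[OF f A] .
  from eq obtain N where N: "N \<in> null_sets M" "{x\<in>space M. f x \<noteq> g x} \<subseteq> N"
    by (auto simp: eventually_ae_filter)
  have 1: "(g -` A \<inter> space M) - N = (f -` A \<inter> space M) - N"
    using N(2) by auto
  have 2: "(g -` A \<inter> space M) \<inter> N \<in> sets M"
    by (rule complete[OF _ N(1)]) auto
  have 3: "((f -` A \<inter> space M) - N) \<union> ((g -` A \<inter> space M) \<inter> N) \<in> sets M"
    using fA N(1) 2 by auto
  have "((f -` A \<inter> space M) - N) \<union> ((g -` A \<inter> space M) \<inter> N) = g -` A \<inter> space M"
    using 1 by blast
  with 3 show "g -` A \<inter> space M \<in> sets M"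
    by simp
qed auto

section \<open>Square integrable functions\<close>

lemma mult_le_half_squares: "\<bar>a * b\<bar> \<le> a\<^sup>2 + (b::real)\<^sup>2"
proof -
  have "0 \<le> (\<bar>a\<bar> - \<bar>b\<bar>)\<^sup>2" by simp
  then have "2 * (\<bar>a\<bar> * \<bar>b\<bar>) \<le> \<bar>a\<bar>\<^sup>2 + \<bar>b\<bar>\<^sup>2"
    unfolding power2_diff by linarith
  moreover have "0 \<le> \<bar>a\<bar> * \<bar>b\<bar>" by simp
  ultimately show ?thesis
    unfolding power2_abs abs_mult by linarith
qed

lemma L2D[measurable_dest, dest]: "u \<in> L2 M \<Longrightarrow> u \<in> borel_measurable M"
  by (auto simp: L2_def)

lemma L2_integrable_mult:
  assumes "u \<in> L2 M" "v \<in> L2 M"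
  shows "integrable M (\<lambda>x. u x * v x)"
proof (rule Bochner_Integration.integrable_bound)
  show "integrable M (\<lambda>x. (u x)\<^sup>2 + (v x)\<^sup>2)"
    using assms by (auto simp: L2_def)
  show "(\<lambda>x. u x * v x) \<in> borel_measurable M"
    using assms by (auto simp: L2_def)
  show "AE x in M. norm (u x * v x) \<le> norm ((u x)\<^sup>2 + (v x)\<^sup>2)"
    using mult_le_half_squares by (intro always_eventually allI) auto
qed

lemma L2_lincomb:
  assumes u: "u \<in> L2 M" and v: "v \<in> L2 M"
  shows "(\<lambda>x. a * u x + b * v x) \<in> L2 M"
proof -
  have "(\<lambda>x. (a * u x + b * v x)\<^sup>2) = (\<lambda>x. a\<^sup>2 * (u x)\<^sup>2 + b\<^sup>2 * (v x)\<^sup>2 + 2 * a * b * (u x * v x))"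
    by (auto simp: power2_eq_square algebra_simps)
  moreover have "integrable M (\<lambda>x. a\<^sup>2 * (u x)\<^sup>2 + b\<^sup>2 * (v x)\<^sup>2 + 2 * a * b * (u x * v x))"
    using L2_integrable_mult[OF u v] u v by (auto simp: L2_def)
  ultimately show ?thesis
    using u v by (auto simp: L2_def)
qed

lemma L2_add: "u \<in> L2 M \<Longrightarrow> v \<in> L2 M \<Longrightarrow> (\<lambda>x. u x + v x) \<in> L2 M"
  using L2_lincomb[of u M v 1 1] by simp

lemma L2_diff: "u \<in> L2 M \<Longrightarrow> v \<in> L2 M \<Longrightarrow> (\<lambda>x. u x - v x) \<in> L2 M"
  using L2_lincomb[of u M v 1 "-1"] by simp

lemma L2_uminus: "u \<in> L2 M \<Longrightarrow> (\<lambda>x. - u x) \<in> L2 M"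
  using L2_lincomb[of u M u "-1" 0] by simp

lemma L2_cong_AE:
  assumes u: "u \<in> L2 M" and v: "v \<in> borel_measurable M" and "AE x in M. u x = v x"
  shows "v \<in> L2 M"
proof -
  have "integrable M (\<lambda>x. (u x)\<^sup>2) = integrable M (\<lambda>x. (v x)\<^sup>2)"
    using assms by (intro integrable_cong_AE) auto
  then show ?thesis using u v by (auto simp: L2_def)
qed

lemma L2_iff_nn_integral:
  "u \<in> L2 M \<longleftrightarrow> u \<in> borel_measurable M \<and> (\<integral>\<^sup>+x. ennreal ((u x)\<^sup>2) \<partial>M) < \<infinity>"
  by (auto simp: L2_def integrable_iff_bounded)

lemma nn_integral_square_pos_part:
  assumes u: "u \<in> L2 M"
  shows "(\<integral>\<^sup>+x. (ennreal (u x))\<^sup>2 \<partial>M) < \<infinity>"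
proof -
  have "(\<integral>\<^sup>+x. (ennreal (u x))\<^sup>2 \<partial>M) \<le> (\<integral>\<^sup>+x. ennreal ((u x)\<^sup>2) \<partial>M)"
  proof (intro nn_integral_mono)
    fix x show "(ennreal (u x))\<^sup>2 \<le> ennreal ((u x)\<^sup>2)"
      by (cases "0 \<le> u x") (auto simp: ennreal_power ennreal_neg)
  qed
  then show ?thesis using u by (auto simp: L2_iff_nn_integral)
qed

lemma enn2real_pos_minus_neg: "enn2real (ennreal a) - enn2real (ennreal (- a)) = a"
  by (cases "0 \<le> a") (auto simp: ennreal_neg)

lemma L2_enn2real:
  assumes f: "f \<in> borel_measurable M" and 2: "(\<integral>\<^sup>+x. (f x)\<^sup>2 \<partial>M) < \<infinity>"
  shows "(\<lambda>x. enn2real (f x)) \<in> L2 M" "AE x in M. f x < \<infinity>"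
proof -
  have "(\<integral>\<^sup>+x. ennreal ((enn2real (f x))\<^sup>2) \<partial>M) \<le> (\<integral>\<^sup>+x. (f x)\<^sup>2 \<partial>M)"
  proof (intro nn_integral_mono)
    fix x show "ennreal ((enn2real (f x))\<^sup>2) \<le> (f x)\<^sup>2"
      by (cases "f x") (auto simp: ennreal_power)
  qed
  then show "(\<lambda>x. enn2real (f x)) \<in> L2 M"
    using f 2 by (auto simp: L2_iff_nn_integral)
  have "AE x in M. (f x)\<^sup>2 \<noteq> \<infinity>"
    using f 2 by (intro nn_integral_noteq_infinite) auto
  then show "AE x in M. f x < \<infinity>"
    by eventually_elim (auto simp: power2_eq_square less_top ennreal_mult_eq_top_iff)
qed

section \<open>Symmetric contraction semigroups of positive operators\<close>

text \<open>The laws are required only almost everywhere and one time at a time: this is what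
  survives when Feynman-Kac operators are compared through versions. \<open>K_contraction\<close> is
  the L2 contraction written as a bilinear inequality, which makes sense in [0,\<infinity>] without
  roots.\<close>

locale symmetric_semigroup = complete_measure M + sigma_finite_measure M
  for M :: "'a measure" +
  fixes K :: "real \<Rightarrow> ('a \<Rightarrow> ennreal) \<Rightarrow> 'a \<Rightarrow> ennreal"
  assumes K_measurable: "\<And>t f. 0 < t \<Longrightarrow> f \<in> borel_measurable M \<Longrightarrow> K t f \<in> borel_measurable M"
    and K_cong: "\<And>t f g. 0 < t \<Longrightarrow> f \<in> borel_measurable M \<Longrightarrow> g \<in> borel_measurable M \<Longrightarrow>
        AE x in M. f x = g x \<Longrightarrow> AE x in M. K t f x = K t g x"
    and K_add: "\<And>t f g. 0 < t \<Longrightarrow> f \<in> borel_measurable M \<Longrightarrow> g \<in> borel_measurable M \<Longrightarrow>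
        AE x in M. K t (\<lambda>y. f y + g y) x = K t f x + K t g x"
    and K_cmult: "\<And>t f c. 0 < t \<Longrightarrow> f \<in> borel_measurable M \<Longrightarrow>
        AE x in M. K t (\<lambda>y. c * f y) x = c * K t f x"
    and K_SUP: "\<And>t f. 0 < t \<Longrightarrow> (\<And>i::nat. f i \<in> borel_measurable M) \<Longrightarrow> incseq f \<Longrightarrow>
        AE x in M. K t (\<lambda>y. SUP i. f i y) x = (SUP i. K t (f i) x)"
    and K_symmetric: "\<And>t f g. 0 < t \<Longrightarrow> f \<in> borel_measurable M \<Longrightarrow> g \<in> borel_measurable M \<Longrightarrow>
        (\<integral>\<^sup>+x. f x * K t g x \<partial>M) = (\<integral>\<^sup>+x. K t f x * g x \<partial>M)"
    and K_semigroup: "\<And>s t f. 0 < s \<Longrightarrow> 0 < t \<Longrightarrow> f \<in> borel_measurable M \<Longrightarrow>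
        AE x in M. K s (K t f) x = K (s + t) f x"
    and K_contraction: "\<And>t f g. 0 < t \<Longrightarrow> f \<in> borel_measurable M \<Longrightarrow> g \<in> borel_measurable M \<Longrightarrow>
        2 * (\<integral>\<^sup>+x. f x * K t g x \<partial>M) \<le> (\<integral>\<^sup>+x. (f x)\<^sup>2 \<partial>M) + (\<integral>\<^sup>+x. (g x)\<^sup>2 \<partial>M)"
begin

abbreviation BM :: "('a \<Rightarrow> 'b::topological_space) set" where
  "BM \<equiv> borel_measurable M"

definition bil :: "real \<Rightarrow> ('a \<Rightarrow> ennreal) \<Rightarrow> ('a \<Rightarrow> ennreal) \<Rightarrow> ennreal" where
  "bil t f g = (\<integral>\<^sup>+x. f x * K t g x \<partial>M)"

abbreviation T :: "real \<Rightarrow> ('a \<Rightarrow> real) \<Rightarrow> 'a \<Rightarrow> real" where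
  "T \<equiv> real_op K"

definition ip :: "('a \<Rightarrow> real) \<Rightarrow> ('a \<Rightarrow> real) \<Rightarrow> real" where
  "ip u v = (\<integral>x. u x * v x \<partial>M)"

lemma K_measurable'[measurable (raw)]:
  "0 < t \<Longrightarrow> f \<in> BM \<Longrightarrow> (\<lambda>x. K t f x) \<in> BM"
  using K_measurable by simp

lemma K_mono:
  assumes "0 < t" and [measurable]: "f \<in> BM" "g \<in> BM" and le: "AE x in M. f x \<le> g x"
  shows "AE x in M. K t f x \<le> K t g x"
proof -
  have "AE x in M. g x = f x + (g x - f x)"
    using le by eventually_elim (metis add.commute diff_add_cancel_ennreal)
  then have "AE x in M. K t g x = K t (\<lambda>x. f x + (g x - f x)) x"
    using assms(1) by (intro K_cong) auto
  moreover have "AE x in M. K t (\<lambda>x. f x + (g x - f x)) x = K t f x + K t (\<lambda>x. g x - f x) x"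
    using assms(1) by (intro K_add) auto
  ultimately show ?thesis by eventually_elim auto
qed

lemma bil_sym:
  "0 < t \<Longrightarrow> f \<in> BM \<Longrightarrow> g \<in> BM \<Longrightarrow> bil t f g = bil t g f"
  unfolding bil_def by (subst K_symmetric) (auto simp: mult.commute)

text \<open>By symmetry and the semigroup law the squared norm of K_t f is the pairing of f with
  K_(2t) f, to which the contraction applies.\<close>

lemma nn_integral_K_square:
  assumes t: "0 < t" and [measurable]: "f \<in> BM"
  shows "(\<integral>\<^sup>+x. (K t f x)\<^sup>2 \<partial>M) \<le> (\<integral>\<^sup>+x. (f x)\<^sup>2 \<partial>M)"
proof -
  have "(\<integral>\<^sup>+x. (K t f x)\<^sup>2 \<partial>M) = (\<integral>\<^sup>+x. K t f x * K t f x \<partial>M)"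
    by (simp add: power2_eq_square)
  also have "\<dots> = (\<integral>\<^sup>+x. f x * K t (K t f) x \<partial>M)"
    by (rule K_symmetric[symmetric]) (use t in auto)
  also have "\<dots> = (\<integral>\<^sup>+x. f x * K (t + t) f x \<partial>M)"
    by (rule nn_integral_cong_AE) (use K_semigroup[OF t t, of f] in auto)
  finally have "2 * (\<integral>\<^sup>+x. (K t f x)\<^sup>2 \<partial>M) \<le> (\<integral>\<^sup>+x. (f x)\<^sup>2 \<partial>M) + (\<integral>\<^sup>+x. (f x)\<^sup>2 \<partial>M)"
    using K_contraction[of "t + t" f f] t by auto
  then have "2 * (\<integral>\<^sup>+x. (K t f x)\<^sup>2 \<partial>M) \<le> 2 * (\<integral>\<^sup>+x. (f x)\<^sup>2 \<partial>M)"
    by (simp add: mult_2)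
  then show ?thesis
    by (subst (asm) ennreal_mult_le_mult_iff) auto
qed

lemma K_L2:
  assumes "0 < t" "f \<in> BM" "(\<integral>\<^sup>+x. (f x)\<^sup>2 \<partial>M) < \<infinity>"
  shows "(\<integral>\<^sup>+x. (K t f x)\<^sup>2 \<partial>M) < \<infinity>" "AE x in M. K t f x < \<infinity>"
proof -
  show "(\<integral>\<^sup>+x. (K t f x)\<^sup>2 \<partial>M) < \<infinity>"
    using nn_integral_K_square[OF assms(1,2)] assms(3) by auto
  then show "AE x in M. K t f x < \<infinity>"
    using assms by (intro L2_enn2real) auto
qed

text \<open>Two representations of u as a difference give u+ + g = u- + f almost everywhere. K_t
  preserves this identity, and finiteness of the four images, from square integrability, permits the
  subtraction. Additivity and the semigroup law of \<open>T\<close> are reduced to this independence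
  of the representation.\<close>

lemma T_decompose:
  assumes t: "0 < t" and [measurable]: "f \<in> BM" "g \<in> BM" "u \<in> BM"
    and f: "(\<integral>\<^sup>+x. (f x)\<^sup>2 \<partial>M) < \<infinity>" and g: "(\<integral>\<^sup>+x. (g x)\<^sup>2 \<partial>M) < \<infinity>" and u2: "u \<in> L2 M"
    and u: "AE x in M. u x = enn2real (f x) - enn2real (g x)"
  shows "AE x in M. T t u x = enn2real (K t f x) - enn2real (K t g x)"
proof -
  let ?p = "\<lambda>x. ennreal (u x)" and ?n = "\<lambda>x. ennreal (- u x)"
  have p2: "(\<integral>\<^sup>+x. (?p x)\<^sup>2 \<partial>M) < \<infinity>" "(\<integral>\<^sup>+x. (?n x)\<^sup>2 \<partial>M) < \<infinity>"
    using nn_integral_square_pos_part[OF u2] nn_integral_square_pos_part[OF L2_uminus[OF u2]] by auto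
  have "AE x in M. f x < \<infinity>" "AE x in M. g x < \<infinity>"
    using L2_enn2real(2)[OF _ f] L2_enn2real(2)[OF _ g] by auto
  with u have "AE x in M. ?p x + g x = ?n x + f x"
  proof eventually_elim
    case (elim x)
    then show ?case
      by (cases "f x"; cases "g x")
         (auto simp: ennreal_neg ennreal_plus[symmetric] simp del: ennreal_plus split: if_splits,
          (cases "u x \<ge> 0"; auto simp: ennreal_neg ennreal_plus[symmetric] simp del: ennreal_plus)+)
  qed
  then have "AE x in M. K t (\<lambda>x. ?p x + g x) x = K t (\<lambda>x. ?n x + f x) x"
    using t by (intro K_cong) auto
  moreover have "AE x in M. K t (\<lambda>x. ?p x + g x) x = K t ?p x + K t g x"
    using t by (intro K_add) auto
  moreover have "AE x in M. K t (\<lambda>x. ?n x + f x) x = K t ?n x + K t f x"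
    using t by (intro K_add) auto
  moreover note K_L2(2)[OF t _ f] K_L2(2)[OF t _ g] K_L2(2)[OF t _ p2(1)] K_L2(2)[OF t _ p2(2)]
  ultimately have "AE x in M. K t ?p x + K t g x = K t ?n x + K t f x \<and>
     K t ?p x < \<infinity> \<and> K t g x < \<infinity> \<and> K t ?n x < \<infinity> \<and> K t f x < \<infinity>"
    by auto
  then show ?thesis
  proof eventually_elim
    case (elim x)
    then have "enn2real (K t ?p x) + enn2real (K t g x) = enn2real (K t ?n x) + enn2real (K t f x)"
      by (metis enn2real_plus infinity_ennreal_def)
    then show ?case
      by (simp add: real_op_def)
  qed
qed

lemma T_measurable[measurable (raw)]:
  assumes t: "0 < t" and [measurable]: "u \<in> BM"
  shows "T t u \<in> BM"
  unfolding real_op_def using t by measurable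

lemma T_L2:
  assumes t: "0 < t" and u: "u \<in> L2 M"
  shows "T t u \<in> L2 M"
proof -
  have [measurable]: "u \<in> BM" using u by auto
  have "(\<lambda>x. enn2real (K t (\<lambda>x. ennreal (u x)) x)) \<in> L2 M"
    using t by (intro L2_enn2real K_L2 nn_integral_square_pos_part[OF u]) auto
  moreover have "(\<lambda>x. enn2real (K t (\<lambda>x. ennreal (- u x)) x)) \<in> L2 M"
    using t by (intro L2_enn2real K_L2 nn_integral_square_pos_part[OF L2_uminus[OF u]]) auto
  ultimately show ?thesis
    unfolding real_op_def by (rule L2_diff)
qed

lemma T_cong:
  assumes "0 < t" "u \<in> BM" "v \<in> BM" "AE x in M. u x = v x"
  shows "AE x in M. T t u x = T t v x"
proof -
  have "AE x in M. K t (\<lambda>x. ennreal (u x)) x = K t (\<lambda>x. ennreal (v x)) x"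
    using assms by (intro K_cong) auto
  moreover have "AE x in M. K t (\<lambda>x. ennreal (- u x)) x = K t (\<lambda>x. ennreal (- v x)) x"
    using assms by (intro K_cong) auto
  ultimately show ?thesis
    by eventually_elim (simp add: real_op_def)
qed

lemma T_add:
  assumes t: "0 < t" and u: "u \<in> L2 M" and v: "v \<in> L2 M"
  shows "AE x in M. T t (\<lambda>x. u x + v x) x = T t u x + T t v x"
proof -
  have [measurable]: "u \<in> BM" "v \<in> BM" using u v by auto
  let ?up = "\<lambda>x. ennreal (u x)" and ?un = "\<lambda>x. ennreal (- u x)"
  let ?vp = "\<lambda>x. ennreal (v x)" and ?vn = "\<lambda>x. ennreal (- v x)"
  note sq = nn_integral_square_pos_part[OF u] nn_integral_square_pos_part[OF L2_uminus[OF u]]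
     nn_integral_square_pos_part[OF v] nn_integral_square_pos_part[OF L2_uminus[OF v]]
  have *: "(\<integral>\<^sup>+x. (f x + g x)\<^sup>2 \<partial>M) < \<infinity>"
    if [measurable]: "f \<in> BM" "g \<in> BM"
    and "(\<integral>\<^sup>+x. (f x)\<^sup>2 \<partial>M) < \<infinity>" "(\<integral>\<^sup>+x. (g x)\<^sup>2 \<partial>M) < \<infinity>" for f g :: "'a \<Rightarrow> ennreal"
  proof -
    have "(\<integral>\<^sup>+x. (f x + g x)\<^sup>2 \<partial>M) \<le> (\<integral>\<^sup>+x. 2 * (f x)\<^sup>2 + 2 * (g x)\<^sup>2 \<partial>M)"
    proof (intro nn_integral_mono)
      fix x
      have "0 \<le> (enn2real (f x) - enn2real (g x))\<^sup>2" by simp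
      then show "(f x + g x)\<^sup>2 \<le> 2 * (f x)\<^sup>2 + 2 * (g x)\<^sup>2"
        by (cases "f x"; cases "g x")
           (auto simp: ennreal_plus[symmetric] ennreal_power ennreal_mult''[symmetric] ennreal_mult_top
              ennreal_numeral[symmetric] power2_eq_square algebra_simps
              simp del: ennreal_plus ennreal_numeral intro!: ennreal_leI)
    qed
    also have "\<dots> = 2 * (\<integral>\<^sup>+x. (f x)\<^sup>2 \<partial>M) + 2 * (\<integral>\<^sup>+x. (g x)\<^sup>2 \<partial>M)"
      by (subst nn_integral_add) (auto simp: nn_integral_cmult)
    also have "\<dots> < \<infinity>" using that by (auto simp: ennreal_mult_less_top)
    finally show ?thesis .
  qed
  have "AE x in M. T t (\<lambda>x. u x + v x) x = enn2real (K t (\<lambda>x. ?up x + ?vp x) x) - enn2real (K t (\<lambda>x. ?un x + ?vn x) x)"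
  proof (intro T_decompose * L2_add sq t u v AE_I2)
    fix x show "u x + v x = enn2real (?up x + ?vp x) - enn2real (?un x + ?vn x)"
      using enn2real_pos_minus_neg[of "u x"] enn2real_pos_minus_neg[of "v x"]
        enn2real_plus[of "?up x" "?vp x"] enn2real_plus[of "?un x" "?vn x"]
      by (simp only: ennreal_less_top simp_thms True_implies_equals)
  qed auto
  moreover have "AE x in M. K t (\<lambda>x. ?up x + ?vp x) x = K t ?up x + K t ?vp x"
    "AE x in M. K t (\<lambda>x. ?un x + ?vn x) x = K t ?un x + K t ?vn x"
    using t by (auto intro!: K_add)
  moreover have "AE x in M. K t ?up x < \<infinity>" "AE x in M. K t ?un x < \<infinity>"
    "AE x in M. K t ?vp x < \<infinity>" "AE x in M. K t ?vn x < \<infinity>"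
    using K_L2(2)[OF t _ sq(1)] K_L2(2)[OF t _ sq(2)] K_L2(2)[OF t _ sq(3)] K_L2(2)[OF t _ sq(4)] by auto
  ultimately show ?thesis
    by eventually_elim (simp add: enn2real_plus real_op_def)
qed

end

section \<open>Monotonicity, limits at 0 and measurability in time of the pairings\<close>

lemma tendsto_at_right_antimono:
  fixes g :: "real \<Rightarrow> real"
  assumes mono: "\<And>s t. 0 < s \<Longrightarrow> s < t \<Longrightarrow> g t \<le> g s" and bdd: "\<And>t. 0 < t \<Longrightarrow> g t \<le> C"
  shows "\<exists>l. (g \<longlongrightarrow> l) (at_right 0)"
proof
  let ?l = "SUP t\<in>{0<..}. g t"
  have b: "bdd_above (g ` {0<..})"
    using bdd by (intro bdd_aboveI[of _ C]) auto
  show "(g \<longlongrightarrow> ?l) (at_right 0)"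
  proof (rule order_tendstoI)
    fix a assume "a < ?l"
    then obtain t where t: "0 < t" "a < g t"
      using b by (subst (asm) less_cSUP_iff) auto
    show "\<forall>\<^sub>F x in at_right 0. a < g x"
      unfolding eventually_at_right_field
    proof (intro exI[of _ t] conjI allI impI t)
      fix y assume "0 < y" "y < t" then show "a < g y"
        using mono[of y t] t by auto
    qed
  next
    fix a assume a: "?l < a"
    have "g t < a" if "0 < t" for t
      using a cSUP_upper[OF _ b, of t] that by auto
    then show "\<forall>\<^sub>F x in at_right 0. g x < a"
      unfolding eventually_at_right_field by (intro exI[of _ 1]) auto
  qed
qed

text \<open>Applied to t -> <u, T_t u>, this is the source of the measurability in t of
  \<open>bil\<close> and of the integrand of \<open>U\<close>.\<close>

lemma borel_measurable_antimono_pos: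
  fixes g :: "real \<Rightarrow> real"
  assumes mono: "\<And>s t. 0 < s \<Longrightarrow> s < t \<Longrightarrow> g t \<le> g s"
  shows "(\<lambda>t. indicator {0<..} t * g t) \<in> borel_measurable borel"
proof -
  have "mono_on {0<..} (\<lambda>t. - g t)"
    using mono by (force simp: mono_on_def le_less)
  then have "(\<lambda>t. - g t) \<in> borel_measurable (restrict_space borel {0<..})"
    by (rule borel_measurable_mono_on_fnc)
  then have "(\<lambda>t. - (- g t)) \<in> borel_measurable (restrict_space borel {0<..})"
    by (rule borel_measurable_uminus)
  then show ?thesis
    by (subst (asm) borel_measurable_restrict_space_iff) auto
qed

context symmetric_semigroup
begin

lemma ip_commute: "ip u v = ip v u"
  by (simp add: ip_def mult.commute)

lemma ip_add_left: "u \<in> L2 M \<Longrightarrow> v \<in> L2 M \<Longrightarrow> w \<in> L2 M \<Longrightarrow> ip (\<lambda>x. u x + v x) w = ip u w + ip v w"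
  unfolding ip_def by (simp add: distrib_right L2_integrable_mult)

lemma ip_diff_left: "u \<in> L2 M \<Longrightarrow> v \<in> L2 M \<Longrightarrow> w \<in> L2 M \<Longrightarrow> ip (\<lambda>x. u x - v x) w = ip u w - ip v w"
  unfolding ip_def by (simp add: left_diff_distrib L2_integrable_mult)

lemma ip_add_right: "u \<in> L2 M \<Longrightarrow> v \<in> L2 M \<Longrightarrow> w \<in> L2 M \<Longrightarrow> ip w (\<lambda>x. u x + v x) = ip w u + ip w v"
  using ip_add_left by (simp add: ip_commute)

lemma ip_diff_right: "u \<in> L2 M \<Longrightarrow> v \<in> L2 M \<Longrightarrow> w \<in> L2 M \<Longrightarrow> ip w (\<lambda>x. u x - v x) = ip w u - ip w v"
  using ip_diff_left by (simp add: ip_commute)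

lemma ip_cong:
  assumes "u \<in> BM" "v \<in> BM" "w \<in> BM"
    and "AE x in M. u x = v x"
  shows "ip u w = ip v w" "ip w u = ip w v"
proof -
  show "ip u w = ip v w"
    unfolding ip_def using assms by (intro integral_cong_AE) auto
  then show "ip w u = ip w v" by (simp add: ip_commute)
qed

lemma bil_cong:
  assumes "0 < t" "f \<in> BM" "f' \<in> BM" "g \<in> BM" "g' \<in> BM"
    and "AE x in M. f x = f' x" "AE x in M. g x = g' x"
  shows "bil t f g = bil t f' g'"
proof -
  have "AE x in M. K t g x = K t g' x" using assms by (intro K_cong) auto
  then show ?thesis
    unfolding bil_def using assms(6) by (intro nn_integral_cong_AE) auto
qed

lemma bil_bound:
  assumes t: "0 < t" and "f \<in> BM" "g \<in> BM"
    and "(\<integral>\<^sup>+x. (f x)\<^sup>2 \<partial>M) \<le> ennreal a" "(\<integral>\<^sup>+x. (g x)\<^sup>2 \<partial>M) \<le> ennreal b" "0 \<le> a" "0 \<le> b"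
  shows "bil t f g \<le> ennreal ((a + b) / 2)"
proof -
  have "2 * bil t f g \<le> ennreal a + ennreal b"
    using K_contraction[OF assms(1-3)] assms(4,5) unfolding bil_def by (meson add_mono order_trans)
  then have "2 * bil t f g \<le> ennreal (a + b)"
    using assms by simp
  also have "\<dots> = 2 * ennreal ((a + b) / 2)"
  proof -
    have "ennreal (a + b) = ennreal (2 * ((a + b) / 2))" by (rule arg_cong[where f=ennreal]) simp
    also have "\<dots> = ennreal 2 * ennreal ((a + b) / 2)"
      using assms by (intro ennreal_mult) auto
    finally show ?thesis by simp
  qed
  finally show ?thesis
    by (subst (asm) ennreal_mult_le_mult_iff) auto
qed

lemma bil_finite:
  assumes "0 < t" "f \<in> BM" "g \<in> BM"
    and "(\<integral>\<^sup>+x. (f x)\<^sup>2 \<partial>M) < \<infinity>" "(\<integral>\<^sup>+x. (g x)\<^sup>2 \<partial>M) < \<infinity>"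
  shows "bil t f g < \<infinity>"
proof -
  have "bil t f g \<le> ennreal ((enn2real (\<integral>\<^sup>+x. (f x)\<^sup>2 \<partial>M) + enn2real (\<integral>\<^sup>+x. (g x)\<^sup>2 \<partial>M)) / 2)"
    using assms by (intro bil_bound) auto
  also have "\<dots> < \<infinity>" by simp
  finally show ?thesis .
qed

lemma ip_enn2real_K:
  assumes t: "0 < t" and [measurable]: "f \<in> BM" "g \<in> BM"
    and f2: "(\<integral>\<^sup>+x. (f x)\<^sup>2 \<partial>M) < \<infinity>" and g2: "(\<integral>\<^sup>+x. (g x)\<^sup>2 \<partial>M) < \<infinity>"
  shows "ip (\<lambda>x. enn2real (f x)) (\<lambda>x. enn2real (K t g x)) = enn2real (bil t f g)"
proof -
  have [measurable]: "K t g \<in> BM" using t by auto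
  have "ip (\<lambda>x. enn2real (f x)) (\<lambda>x. enn2real (K t g x))
      = enn2real (\<integral>\<^sup>+x. ennreal (enn2real (f x) * enn2real (K t g x)) \<partial>M)"
    unfolding ip_def by (intro integral_eq_nn_integral) auto
  also have "(\<integral>\<^sup>+x. ennreal (enn2real (f x) * enn2real (K t g x)) \<partial>M) = bil t f g"
    unfolding bil_def
    using L2_enn2real(2)[OF _ f2] K_L2(2)[OF t _ g2]
    by (intro nn_integral_cong_AE) (auto simp: ennreal_mult)
  finally show ?thesis .
qed

lemma ip_T:
  assumes t: "0 < t" and u: "u \<in> L2 M" and v: "v \<in> L2 M"
  shows "ip u (T t v) =
    enn2real (bil t (\<lambda>x. ennreal (u x)) (\<lambda>x. ennreal (v x))) - enn2real (bil t (\<lambda>x. ennreal (u x)) (\<lambda>x. ennreal (- v x)))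
    - enn2real (bil t (\<lambda>x. ennreal (- u x)) (\<lambda>x. ennreal (v x))) + enn2real (bil t (\<lambda>x. ennreal (- u x)) (\<lambda>x. ennreal (- v x)))"
proof -
  let ?up = "\<lambda>x. ennreal (u x)" and ?un = "\<lambda>x. ennreal (- u x)"
  let ?vp = "\<lambda>x. ennreal (v x)" and ?vn = "\<lambda>x. ennreal (- v x)"
  have [measurable]: "u \<in> BM" "v \<in> BM" using u v by auto
  note sq = nn_integral_square_pos_part[OF u] nn_integral_square_pos_part[OF L2_uminus[OF u]]
     nn_integral_square_pos_part[OF v] nn_integral_square_pos_part[OF L2_uminus[OF v]]
  have l2: "(\<lambda>x. enn2real (?up x)) \<in> L2 M" "(\<lambda>x. enn2real (?un x)) \<in> L2 M"
      "(\<lambda>x. enn2real (K t ?vp x)) \<in> L2 M" "(\<lambda>x. enn2real (K t ?vn x)) \<in> L2 M"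
    using t sq by (auto intro!: L2_enn2real K_L2 simp del: enn2real_ennreal)
  have "ip u (T t v) = ip (\<lambda>x. enn2real (?up x) - enn2real (?un x)) (\<lambda>x. enn2real (K t ?vp x) - enn2real (K t ?vn x))"
    by (simp only: enn2real_pos_minus_neg real_op_def[abs_def])
  also have "\<dots> = ip (\<lambda>x. enn2real (?up x)) (\<lambda>x. enn2real (K t ?vp x)) - ip (\<lambda>x. enn2real (?up x)) (\<lambda>x. enn2real (K t ?vn x))
    - ip (\<lambda>x. enn2real (?un x)) (\<lambda>x. enn2real (K t ?vp x)) + ip (\<lambda>x. enn2real (?un x)) (\<lambda>x. enn2real (K t ?vn x))"
    using l2 by (simp add: ip_diff_left ip_diff_right L2_diff)
  also have "\<dots> = enn2real (bil t ?up ?vp) - enn2real (bil t ?up ?vn) - enn2real (bil t ?un ?vp) + enn2real (bil t ?un ?vn)"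
    using t sq by (simp add: ip_enn2real_K)
  finally show ?thesis .
qed

lemma T_symmetric:
  assumes t: "0 < t" and u: "u \<in> L2 M" and v: "v \<in> L2 M"
  shows "ip u (T t v) = ip (T t u) v"
proof -
  have [measurable]: "u \<in> BM" "v \<in> BM" using u v by auto
  show ?thesis
    unfolding ip_commute[of "T t u" v] ip_T[OF t u v] ip_T[OF t v u]
    using t by (simp add: bil_sym[of t "\<lambda>x. ennreal (u x)"] bil_sym[of t "\<lambda>x. ennreal (- u x)"])
qed

lemma T_semigroup:
  assumes s: "0 < s" and t: "0 < t" and u: "u \<in> L2 M"
  shows "AE x in M. T s (T t u) x = T (s + t) u x"
proof -
  have [measurable]: "u \<in> BM" using u by auto
  note sq = nn_integral_square_pos_part[OF u] nn_integral_square_pos_part[OF L2_uminus[OF u]]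
  have "AE x in M. T s (T t u) x = enn2real (K s (K t (\<lambda>x. ennreal (u x))) x) - enn2real (K s (K t (\<lambda>x. ennreal (- u x))) x)"
    using s t sq u by (intro T_decompose K_L2 T_L2 AE_I2) (auto simp: real_op_def simp del: enn2real_ennreal)
  moreover have "AE x in M. K s (K t (\<lambda>x. ennreal (u x))) x = K (s + t) (\<lambda>x. ennreal (u x)) x"
    "AE x in M. K s (K t (\<lambda>x. ennreal (- u x))) x = K (s + t) (\<lambda>x. ennreal (- u x)) x"
    using s t by (auto intro!: K_semigroup)
  ultimately show ?thesis
    by eventually_elim (simp add: real_op_def)
qed

lemma T_uminus: "T t (\<lambda>x. - u x) x = - T t u x"
  by (simp add: real_op_def)

lemma T_diff:
  assumes "0 < t" "u \<in> L2 M" "v \<in> L2 M"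
  shows "AE x in M. T t (\<lambda>x. u x - v x) x = T t u x - T t v x"
  using T_add[OF assms(1,2) L2_uminus[OF assms(3)]] by (simp add: T_uminus)

lemma nn_integral_square_eq_ip:
  assumes u: "u \<in> L2 M"
  shows "(\<integral>\<^sup>+x. (ennreal (u x))\<^sup>2 \<partial>M) \<le> ennreal (ip u u)" "(\<integral>\<^sup>+x. (ennreal (- u x))\<^sup>2 \<partial>M) \<le> ennreal (ip u u)"
    "(\<integral>\<^sup>+x. (ennreal (u x))\<^sup>2 \<partial>M) + (\<integral>\<^sup>+x. (ennreal (- u x))\<^sup>2 \<partial>M) = ennreal (ip u u)"
proof -
  have [measurable]: "u \<in> BM" using u by auto
  have "(\<integral>\<^sup>+x. (ennreal (u x))\<^sup>2 \<partial>M) + (\<integral>\<^sup>+x. (ennreal (- u x))\<^sup>2 \<partial>M)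
     = (\<integral>\<^sup>+x. (ennreal (u x))\<^sup>2 + (ennreal (- u x))\<^sup>2 \<partial>M)"
    by (rule nn_integral_add[symmetric]) auto
  also have "\<dots> = (\<integral>\<^sup>+x. ennreal (u x * u x) \<partial>M)"
  proof (rule nn_integral_cong)
    fix x show "(ennreal (u x))\<^sup>2 + (ennreal (- u x))\<^sup>2 = ennreal (u x * u x)"
      by (cases "0 \<le> u x") (auto simp: ennreal_power ennreal_neg power2_eq_square[of "u x"] ennreal_mult''[symmetric] power2_eq_square)
  qed
  also have "\<dots> = ennreal (ip u u)"
    unfolding ip_def using L2_integrable_mult[OF u u] by (intro nn_integral_eq_integral) auto
  finally show *: "(\<integral>\<^sup>+x. (ennreal (u x))\<^sup>2 \<partial>M) + (\<integral>\<^sup>+x. (ennreal (- u x))\<^sup>2 \<partial>M) = ennreal (ip u u)" .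
  show "(\<integral>\<^sup>+x. (ennreal (u x))\<^sup>2 \<partial>M) \<le> ennreal (ip u u)" "(\<integral>\<^sup>+x. (ennreal (- u x))\<^sup>2 \<partial>M) \<le> ennreal (ip u u)"
    unfolding *[symmetric] by auto
qed

lemma ip_self_nonneg: "0 \<le> ip u u"
  by (simp add: ip_def)

lemma ip_T_self_le:
  assumes t: "0 < t" and u: "u \<in> L2 M"
  shows "ip u (T t u) \<le> ip u u"
proof -
  have [measurable]: "u \<in> BM" using u by auto
  let ?up = "\<lambda>x. ennreal (u x)" and ?un = "\<lambda>x. ennreal (- u x)"
  note sq = nn_integral_square_pos_part[OF u] nn_integral_square_pos_part[OF L2_uminus[OF u]]
  have fin: "bil t ?up ?up < \<infinity>" "bil t ?un ?un < \<infinity>"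
    using bil_finite[OF t _ _ sq(1,1)] bil_finite[OF t _ _ sq(2,2)] by auto
  have "2 * (bil t ?up ?up + bil t ?un ?un) \<le>
     2 * ((\<integral>\<^sup>+x. (?up x)\<^sup>2 \<partial>M) + (\<integral>\<^sup>+x. (?un x)\<^sup>2 \<partial>M))"
    using K_contraction[OF t, of ?up ?up] K_contraction[OF t, of ?un ?un]
    by (auto simp: bil_def distrib_left mult_2 intro: add_mono)
  then have "bil t ?up ?up + bil t ?un ?un \<le> ennreal (ip u u)"
    unfolding nn_integral_square_eq_ip(3)[OF u] by (subst (asm) ennreal_mult_le_mult_iff) auto
  then have "enn2real (bil t ?up ?up + bil t ?un ?un) \<le> ip u u"
    by (intro enn2real_leI ip_self_nonneg)
  then have "enn2real (bil t ?up ?up) + enn2real (bil t ?un ?un) \<le> ip u u"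
    using fin by (simp add: enn2real_plus)
  then show ?thesis
    unfolding ip_T[OF t u u] by (smt (verit) enn2real_nonneg)
qed

text \<open>Each of the four pairings in \<open>ip_T\<close> lies between 0 and half of
  \<open>ip u u + ip v v\<close>. The constant 2 is generous; the bound serves for integrability of
  Laplace transforms.\<close>

lemma ip_T_bound:
  assumes t: "0 < t" and u: "u \<in> L2 M" and v: "v \<in> L2 M"
  shows "\<bar>ip u (T t v)\<bar> \<le> 2 * (ip u u + ip v v)"
proof -
  have [measurable]: "u \<in> BM" "v \<in> BM" using u v by auto
  have *: "enn2real (bil t f g) \<le> (ip u u + ip v v) / 2"
    if "f \<in> {\<lambda>x. ennreal (u x), \<lambda>x. ennreal (- u x)}" "g \<in> {\<lambda>x. ennreal (v x), \<lambda>x. ennreal (- v x)}" for f g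
    using that t nn_integral_square_eq_ip(1,2)[OF u] nn_integral_square_eq_ip(1,2)[OF v] ip_self_nonneg[of u] ip_self_nonneg[of v]
    by (intro enn2real_leI bil_bound) auto
  show ?thesis
    unfolding ip_T[OF t u v]
    using *[of "\<lambda>x. ennreal (u x)" "\<lambda>x. ennreal (v x)", OF insertI1 insertI1]
      *[of "\<lambda>x. ennreal (- u x)" "\<lambda>x. ennreal (v x)", OF insertI2[OF insertI1] insertI1]
      *[of "\<lambda>x. ennreal (u x)" "\<lambda>x. ennreal (- v x)", OF insertI1 insertI2[OF insertI1]]
      *[of "\<lambda>x. ennreal (- u x)" "\<lambda>x. ennreal (- v x)", OF insertI2[OF insertI1] insertI2[OF insertI1]]
      enn2real_nonneg[of "bil t (\<lambda>x. ennreal (u x)) (\<lambda>x. ennreal (v x))"] enn2real_nonneg[of "bil t (\<lambda>x. ennreal (- u x)) (\<lambda>x. ennreal (v x))"]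
      enn2real_nonneg[of "bil t (\<lambda>x. ennreal (u x)) (\<lambda>x. ennreal (- v x))"] enn2real_nonneg[of "bil t (\<lambda>x. ennreal (- u x)) (\<lambda>x. ennreal (- v x))"]
    unfolding abs_le_iff by (intro conjI; linarith)
qed

lemma ip_T_split:
  assumes s: "0 < s" and t: "0 < t" and u: "u \<in> L2 M" and v: "v \<in> L2 M"
  shows "ip u (T (s + t) v) = ip (T s u) (T t v)"
proof -
  have [measurable]: "u \<in> BM" "v \<in> BM" using u v by auto
  have "ip u (T (s + t) v) = ip u (T s (T t v))"
    using s t by (intro ip_cong) (auto intro!: AE_symmetric[OF T_semigroup] v)
  also have "\<dots> = ip (T s u) (T t v)"
    using s t u v by (intro T_symmetric T_L2) auto
  finally show ?thesis .
qed

text \<open>With w = T_(s/2) u the two sides are <w, T_(t-s) w> and <w, w>, so the claim is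
  \<open>ip_T_self_le\<close> for w.\<close>

lemma ip_T_antimono:
  assumes s: "0 < s" and t: "s < t" and u: "u \<in> L2 M"
  shows "ip u (T t u) \<le> ip u (T s u)"
proof -
  have [measurable]: "u \<in> BM" using u by auto
  let ?w = "T (s / 2) u"
  have w: "?w \<in> L2 M" using s u by (intro T_L2) auto
  have [measurable]: "?w \<in> BM" using w by auto
  have "ip u (T t u) = ip ?w (T (t - s + s / 2) u)"
    using ip_T_split[of "s / 2" "t - s + s / 2" u u] s t u by (simp add: field_simps)
  also have "\<dots> = ip ?w (T (t - s) ?w)"
    using s t u by (intro ip_cong AE_symmetric[OF T_semigroup]) auto
  also have "\<dots> \<le> ip ?w ?w"
    using t w by (intro ip_T_self_le) auto
  also have "\<dots> = ip u (T s u)"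
    using ip_T_split[of "s / 2" "s / 2" u u] s u by simp
  finally show ?thesis .
qed

text \<open>Passes from the quadratic expressions, which are monotone in t, to arbitrary pairs;
  \<open>T_symmetric\<close> identifies the two mixed terms.\<close>

lemma polarization:
  assumes t: "0 < t" and u: "u \<in> L2 M" and v: "v \<in> L2 M"
  shows "ip u (T t v) = (ip (\<lambda>x. u x + v x) (T t (\<lambda>x. u x + v x)) - ip (\<lambda>x. u x - v x) (T t (\<lambda>x. u x - v x))) / 4"
proof -
  have [measurable]: "u \<in> BM" "v \<in> BM" using u v by auto
  note L = T_L2[OF t u] T_L2[OF t v] u v L2_add[OF u v] L2_diff[OF u v]
  have "ip (\<lambda>x. u x + v x) (T t (\<lambda>x. u x + v x)) = ip (\<lambda>x. u x + v x) (\<lambda>x. T t u x + T t v x)"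
    using t T_add[OF t u v] by (intro ip_cong) auto
  moreover have "ip (\<lambda>x. u x - v x) (T t (\<lambda>x. u x - v x)) = ip (\<lambda>x. u x - v x) (\<lambda>x. T t u x - T t v x)"
    using t T_diff[OF t u v] by (intro ip_cong) auto
  moreover have "ip v (T t u) = ip u (T t v)"
    using T_symmetric[OF t v u] by (simp add: ip_commute)
  ultimately show ?thesis
    using L by (simp add: ip_add_left ip_add_right ip_diff_left ip_diff_right)
qed

text \<open>Monotonicity and polarization give existence of the limit but not its value. On the form
  domain the value is identified later, in \<open>dom_tendsto\<close>.\<close>

lemma ip_T_convergent:
  assumes u: "u \<in> L2 M" and v: "v \<in> L2 M"
  shows "\<exists>l. ((\<lambda>t. ip u (T t v)) \<longlongrightarrow> l) (at_right 0)"
proof -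
  have "\<exists>l. ((\<lambda>t. ip w (T t w)) \<longlongrightarrow> l) (at_right 0)" if "w \<in> L2 M" for w
    using that by (intro tendsto_at_right_antimono[where C="ip w w"] ip_T_antimono ip_T_self_le)
  from this[OF L2_add[OF u v]] this[OF L2_diff[OF u v]] obtain a b where
    "((\<lambda>t. ip (\<lambda>x. u x + v x) (T t (\<lambda>x. u x + v x))) \<longlongrightarrow> a) (at_right 0)"
    "((\<lambda>t. ip (\<lambda>x. u x - v x) (T t (\<lambda>x. u x - v x))) \<longlongrightarrow> b) (at_right 0)" by auto
  then have "((\<lambda>t. (ip (\<lambda>x. u x + v x) (T t (\<lambda>x. u x + v x)) - ip (\<lambda>x. u x - v x) (T t (\<lambda>x. u x - v x))) / 4) \<longlongrightarrow> (a - b) / 4) (at_right 0)"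
    by (intro tendsto_intros) auto
  then have "((\<lambda>t. ip u (T t v)) \<longlongrightarrow> (a - b) / 4) (at_right 0)"
    by (rule Lim_transform_eventually)
       (use eventually_at_right_less[of 0] in eventually_elim, auto simp: polarization u v)
  then show ?thesis by auto
qed

lemma ip_T_measurable:
  assumes u: "u \<in> L2 M" and v: "v \<in> L2 M"
  shows "(\<lambda>t. indicator {0<..} t * ip u (T t v)) \<in> borel_measurable borel"
proof -
  have [measurable]: "(\<lambda>t. indicator {0<..} t * ip w (T t w)) \<in> borel_measurable borel" if "w \<in> L2 M" for w
    using that by (intro borel_measurable_antimono_pos ip_T_antimono)
  note [measurable] = this[OF L2_add[OF u v]] this[OF L2_diff[OF u v]]
  have "(\<lambda>t. (indicator {0<..} t * ip (\<lambda>x. u x + v x) (T t (\<lambda>x. u x + v x))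
      - indicator {0<..} t * ip (\<lambda>x. u x - v x) (T t (\<lambda>x. u x - v x))) / 4) \<in> borel_measurable borel"
    by measurable
  also have "(\<lambda>t. (indicator {0<..} t * ip (\<lambda>x. u x + v x) (T t (\<lambda>x. u x + v x))
      - indicator {0<..} t * ip (\<lambda>x. u x - v x) (T t (\<lambda>x. u x - v x))) / 4) = (\<lambda>t. indicator {0<..} t * ip u (T t v))"
    by (auto simp: polarization u v fun_eq_iff indicator_def)
  finally show ?thesis .
qed

end

section \<open>Pairings with values in [0,\<infinity>] and densities of potentials\<close>

context symmetric_semigroup
begin

lemma bil_SUP_right:
  assumes t: "0 < t" and [measurable]: "f \<in> BM" "\<And>i::nat. g i \<in> BM" and g: "incseq g"
  shows "bil t f (\<lambda>x. SUP i. g i x) = (SUP i. bil t f (g i))"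
proof -
  have [measurable]: "K t (g i) \<in> BM" for i using t by auto
  have mono: "AE x in M. \<forall>i. K t (g i) x \<le> K t (g (Suc i)) x"
    using t g by (subst AE_all_countable, intro allI K_mono) (auto simp: incseq_Suc_iff le_fun_def)
  have "bil t f (\<lambda>x. SUP i. g i x) = (\<integral>\<^sup>+x. (SUP i. f x * K t (g i) x) \<partial>M)"
    unfolding bil_def SUP_mult_left_ennreal[symmetric]
    using K_SUP[OF t _ g] by (intro nn_integral_cong_AE) auto
  also have "\<dots> = (SUP i. bil t f (g i))"
    unfolding bil_def using mono
    by (intro nn_integral_monotone_convergence_SUP_AE) (auto elim!: eventually_mono intro: mult_left_mono)
  finally show ?thesis .
qed

lemma bil_SUP_left:
  assumes t: "0 < t" and [measurable]: "f \<in> BM" "\<And>i::nat. g i \<in> BM" and g: "incseq g"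
  shows "bil t (\<lambda>x. SUP i. g i x) f = (SUP i. bil t (g i) f)"
  using bil_SUP_right[OF assms] t by (simp add: bil_sym[of t _ f])

lemma
  assumes t: "0 < t" and u: "u \<in> L2 M" "AE x in M. 0 \<le> u x" and v: "v \<in> L2 M" "AE x in M. 0 \<le> v x"
  shows bil_ennreal: "bil t (\<lambda>x. ennreal (u x)) (\<lambda>x. ennreal (v x)) = ennreal (ip u (T t v))"
    and ip_T_nonneg: "0 \<le> ip u (T t v)"
proof -
  have [measurable]: "u \<in> BM" "v \<in> BM" using u v by auto
  have z: "bil t f (\<lambda>x. ennreal (- v x)) = 0" "bil t (\<lambda>x. ennreal (- u x)) f = 0" if [measurable]: "f \<in> BM" for f
  proof -
    have "bil t (\<lambda>x. 0) g = 0" for g by (simp add: bil_def)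
    moreover have "bil t f (\<lambda>x. ennreal (- v x)) = bil t f (\<lambda>x. 0)"
      using t v by (intro bil_cong) (auto simp: ennreal_neg)
    moreover have "bil t (\<lambda>x. ennreal (- u x)) f = bil t (\<lambda>x. 0) f"
      using t u by (intro bil_cong) (auto simp: ennreal_neg)
    ultimately show "bil t f (\<lambda>x. ennreal (- v x)) = 0" "bil t (\<lambda>x. ennreal (- u x)) f = 0"
      using t bil_sym[of t f "\<lambda>_. 0"] by auto
  qed
  have "bil t (\<lambda>x. ennreal (u x)) (\<lambda>x. ennreal (v x)) < \<infinity>"
    using t nn_integral_square_pos_part[OF u(1)] nn_integral_square_pos_part[OF v(1)] by (intro bil_finite) auto
  then show "bil t (\<lambda>x. ennreal (u x)) (\<lambda>x. ennreal (v x)) = ennreal (ip u (T t v))"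
    unfolding ip_T[OF t u(1) v(1)] by (simp add: z)
  show "0 \<le> ip u (T t v)"
    unfolding ip_T[OF t u(1) v(1)] by (simp add: z)
qed

lemma ex_L2_approx:
  assumes [measurable]: "f \<in> BM"
  shows "\<exists>u :: nat \<Rightarrow> 'a \<Rightarrow> real. (\<forall>k. u k \<in> L2 M) \<and> (\<forall>k x. 0 \<le> u k x) \<and> incseq (\<lambda>k x. ennreal (u k x))
    \<and> (\<forall>x\<in>space M. f x = (SUP k. ennreal (u k x)))"
proof -
  obtain A :: "nat \<Rightarrow> 'a set" where A: "range A \<subseteq> sets M" "(\<Union>i. A i) = space M" "\<And>i. emeasure M (A i) \<noteq> \<infinity>" "incseq A"
    using sigma_finite_incseq by blast
  have [measurable]: "A i \<in> sets M" for i using A by auto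
  define g :: "nat \<Rightarrow> 'a \<Rightarrow> ennreal" where "g k x = min (f x) (of_nat k) * indicator (A k) x" for k x
  have [measurable]: "g k \<in> BM" for k unfolding g_def by measurable
  have gfin: "g k x < \<infinity>" for k x
  proof -
    have "g k x \<le> of_nat k" unfolding g_def by (auto simp: indicator_def)
    also have "\<dots> < \<infinity>" by (simp add: of_nat_less_top)
    finally show ?thesis .
  qed
  have "(\<lambda>x. enn2real (g k x)) \<in> L2 M" for k
  proof (rule L2_enn2real)
    have "(\<integral>\<^sup>+x. (g k x)\<^sup>2 \<partial>M) \<le> (\<integral>\<^sup>+x. (of_nat k)\<^sup>2 * indicator (A k) x \<partial>M)"
      by (intro nn_integral_mono) (auto simp: g_def indicator_def power_mono)
    also have "\<dots> = (of_nat k)\<^sup>2 * emeasure M (A k)"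
      by (subst nn_integral_cmult_indicator) auto
    also have "\<dots> < \<infinity>"
      using A(3)[of k] by (auto simp: ennreal_mult_less_top power2_eq_square less_top of_nat_less_top)
    finally show "(\<integral>\<^sup>+x. (g k x)\<^sup>2 \<partial>M) < \<infinity>" .
  qed measurable
  moreover have inc: "incseq g"
  proof (rule incseq_SucI, rule le_funI)
    fix n x
    show "g n x \<le> g (Suc n) x"
      unfolding g_def using incseq_SucD[OF A(4), of n]
      by (intro mult_mono min.mono) (auto simp: indicator_def)
  qed
  moreover have "f x = (SUP k. g k x)" if x: "x \<in> space M" for x
  proof (rule antisym)
    obtain k0 where k0: "x \<in> A k0" using A(2) x by auto
    then have k: "x \<in> A k" if "k \<ge> k0" for k using incseqD[OF A(4) that] by auto
    have "f x \<le> (SUP k. min (f x) (of_nat k))"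
    proof (cases "f x = \<top>")
      case True
      then show ?thesis by (simp add: ennreal_SUP_of_nat_eq_top)
    next
      case False
      then obtain n :: nat where "f x < of_nat n"
        using ennreal_Ex_less_of_nat[of "f x"] by (auto simp: less_top)
      then show ?thesis
        by (intro SUP_upper2[of n]) auto
    qed
    also have "\<dots> \<le> (SUP k. g k x)"
    proof (rule SUP_mono)
      fix n :: nat
      show "\<exists>m\<in>UNIV. min (f x) (of_nat n) \<le> g m x"
        using k[of "max n k0"] by (intro bexI[of _ "max n k0"]) (auto simp: g_def intro: min.coboundedI2)
    qed
    finally show "f x \<le> (SUP k. g k x)" .
    show "(SUP k. g k x) \<le> f x"
      by (rule SUP_least) (auto simp: g_def indicator_def)
  qed
  ultimately show ?thesis
    using gfin by (intro exI[of _ "\<lambda>k x. enn2real (g k x)"]) (auto simp: less_top)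
qed

text \<open>Both arguments are approximated from below by square integrable functions, for which the
  pairing is real and \<open>ip_T_measurable\<close> applies. The indicator discards t \<le> 0,
  where \<open>K\<close> is unconstrained.\<close>

lemma bil_measurable:
  assumes [measurable]: "f \<in> BM" "g \<in> BM"
  shows "(\<lambda>t. indicator {0<..} t * bil t f g) \<in> borel_measurable borel"
proof -
  obtain u where u: "\<And>k. u k \<in> L2 M" "\<And>k x. 0 \<le> u k x" "incseq (\<lambda>k x. ennreal (u k x))"
     "\<And>x. x \<in> space M \<Longrightarrow> f x = (SUP k::nat. ennreal (u k x))"
    using ex_L2_approx[OF assms(1)] by metis
  obtain v where v: "\<And>k. v k \<in> L2 M" "\<And>k x. 0 \<le> v k x" "incseq (\<lambda>k x. ennreal (v k x))"
     "\<And>x. x \<in> space M \<Longrightarrow> g x = (SUP k::nat. ennreal (v k x))"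
    using ex_L2_approx[OF assms(2)] by metis
  have [measurable]: "u k \<in> BM" "v k \<in> BM" for k using u(1) v(1) by auto
  have "indicator {0<..} t * bil t f g = (SUP k. SUP j. ennreal (indicator {0<..} t * ip (u k) (T t (v j))))" for t
  proof (cases "0 < t")
    case True
    have "bil t f g = bil t (\<lambda>x. SUP k. ennreal (u k x)) (\<lambda>x. SUP j. ennreal (v j x))"
      using True u(4) v(4) by (intro bil_cong) auto
    also have "\<dots> = (SUP k. SUP j. bil t (\<lambda>x. ennreal (u k x)) (\<lambda>x. ennreal (v j x)))"
      using True u(3) v(3) by (subst bil_SUP_left) (auto simp: bil_SUP_right)
    also have "\<dots> = (SUP k. SUP j. ennreal (ip (u k) (T t (v j))))"
      using True u v by (simp add: bil_ennreal)
    finally show ?thesis using True by simp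
  qed simp
  moreover note [measurable] = ip_T_measurable[OF u(1) v(1)]
  have "(\<lambda>t. SUP k. SUP j. ennreal (indicator {0<..} t * ip (u k) (T t (v j)))) \<in> borel_measurable borel"
    by measurable
  ultimately show ?thesis by simp
qed

lemma bil_add_right:
  assumes "0 < t" and [measurable]: "f \<in> BM" "g \<in> BM" "g' \<in> BM"
  shows "bil t f (\<lambda>x. g x + g' x) = bil t f g + bil t f g'"
proof -
  have [measurable]: "K t g \<in> BM" "K t g' \<in> BM" using assms by auto
  have "bil t f (\<lambda>x. g x + g' x) = (\<integral>\<^sup>+x. f x * K t g x + f x * K t g' x \<partial>M)"
    unfolding bil_def using K_add[OF assms(1,3,4)]
    by (intro nn_integral_cong_AE) (auto simp: distrib_left)
  then show ?thesis
    unfolding bil_def by (simp add: nn_integral_add)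
qed

lemma bil_cmult_right:
  assumes "0 < t" and [measurable]: "f \<in> BM" "g \<in> BM"
  shows "bil t f (\<lambda>x. c * g x) = c * bil t f g"
proof -
  have [measurable]: "K t g \<in> BM" using assms by auto
  have "bil t f (\<lambda>x. c * g x) = (\<integral>\<^sup>+x. c * (f x * K t g x) \<partial>M)"
    unfolding bil_def using K_cmult[OF assms(1,3), of c]
    by (intro nn_integral_cong_AE) (auto simp: ac_simps)
  then show ?thesis
    unfolding bil_def by (simp add: nn_integral_cmult)
qed

text \<open>The pairing of g with the \<alpha>-potential of f, integrated over time before any
  function of the state is formed: K_t f is fixed only up to a null set depending on t, so a
  pointwise integral over t would not be well defined.\<close>

definition U :: "real \<Rightarrow> ('a \<Rightarrow> ennreal) \<Rightarrow> ('a \<Rightarrow> ennreal) \<Rightarrow> ennreal" where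
  "U \<alpha> f g = (\<integral>\<^sup>+t. ennreal (exp (- \<alpha> * t)) * (indicator {0<..} t * bil t f g) \<partial>lborel)"

lemma U_cong_bil: "(\<And>t. 0 < t \<Longrightarrow> bil t f g = bil t f' g') \<Longrightarrow> U c f g = U c f' g'"
  unfolding U_def by (intro nn_integral_cong) (auto simp: indicator_def)

lemma U_mono_bil: "(\<And>t. 0 < t \<Longrightarrow> bil t f g \<le> bil t f' g') \<Longrightarrow> U c f g \<le> U c f' g'"
  unfolding U_def by (intro nn_integral_mono) (auto simp: indicator_def intro!: mult_left_mono)

lemma bil_mono_left: "AE x in M. f x \<le> f' x \<Longrightarrow> bil t f g \<le> bil t f' g"
  unfolding bil_def by (intro nn_integral_mono_AE) (auto elim!: eventually_mono intro: mult_right_mono)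

lemma bil_mono_right:
  assumes t: "0 < t" and "f \<in> BM" "g \<in> BM" "g' \<in> BM" "AE x in M. g x \<le> g' x"
  shows "bil t f g \<le> bil t f g'"
  using bil_mono_left[of g g' t f] assms by (simp add: bil_sym[of t f])

lemma U_SUP_right:
  assumes [measurable]: "f \<in> BM" "\<And>i::nat. g i \<in> BM" and g: "incseq g"
  shows "U c f (\<lambda>x. SUP i. g i x) = (SUP i. U c f (g i))"
proof -
  have [measurable]: "(\<lambda>t. indicator {0<..} t * bil t f (g i)) \<in> borel_measurable borel" for i
    by (intro bil_measurable) auto
  have "U c f (\<lambda>x. SUP i. g i x) = (\<integral>\<^sup>+t. (SUP i. ennreal (exp (- c * t)) * (indicator {0<..} t * bil t f (g i))) \<partial>lborel)"
    unfolding U_def SUP_mult_left_ennreal[symmetric]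
    by (intro nn_integral_cong) (auto simp: indicator_def bil_SUP_right g)
  also have "\<dots> = (SUP i. U c f (g i))"
    unfolding U_def
  proof (rule nn_integral_monotone_convergence_SUP)
    show "incseq (\<lambda>i t. ennreal (exp (- c * t)) * (indicator {0<..} t * bil t f (g i)))"
      using g by (intro incseq_SucI le_funI)
        (auto simp: indicator_def incseq_Suc_iff le_fun_def intro!: mult_left_mono bil_mono_right)
  qed measurable
  finally show ?thesis .
qed

lemma U_sym: "f \<in> BM \<Longrightarrow> g \<in> BM \<Longrightarrow> U c f g = U c g f"
  by (intro U_cong_bil bil_sym)

lemma U_SUP_left:
  assumes "f \<in> BM" "\<And>i::nat. g i \<in> BM" "incseq g"
  shows "U c (\<lambda>x. SUP i. g i x) f = (SUP i. U c (g i) f)"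
  using U_SUP_right[OF assms] assms(1,2) by (simp add: U_sym[of _ f])

lemma U_add_right:
  assumes [measurable]: "f \<in> BM" "g \<in> BM" "g' \<in> BM"
  shows "U c f (\<lambda>x. g x + g' x) = U c f g + U c f g'"
proof -
  have [measurable]: "(\<lambda>t. indicator {0<..} t * bil t f g) \<in> borel_measurable borel"
    "(\<lambda>t. indicator {0<..} t * bil t f g') \<in> borel_measurable borel"
    by (auto intro!: bil_measurable)
  have "U c f (\<lambda>x. g x + g' x) = (\<integral>\<^sup>+t. ennreal (exp (- c * t)) * (indicator {0<..} t * bil t f g)
       + ennreal (exp (- c * t)) * (indicator {0<..} t * bil t f g') \<partial>lborel)"
    unfolding U_def by (intro nn_integral_cong) (auto simp: indicator_def bil_add_right distrib_left)
  then show ?thesis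
    unfolding U_def by (simp add: nn_integral_add)
qed

lemma U_cmult_right:
  assumes [measurable]: "f \<in> BM" "g \<in> BM"
  shows "U a f (\<lambda>x. c * g x) = c * U a f g"
proof -
  have [measurable]: "(\<lambda>t. indicator {0<..} t * bil t f g) \<in> borel_measurable borel"
    by (auto intro!: bil_measurable)
  have "U a f (\<lambda>x. c * g x) = (\<integral>\<^sup>+t. c * (ennreal (exp (- a * t)) * (indicator {0<..} t * bil t f g)) \<partial>lborel)"
    unfolding U_def by (intro nn_integral_cong) (auto simp: indicator_def bil_cmult_right ac_simps)
  then show ?thesis
    unfolding U_def by (simp add: nn_integral_cmult)
qed

lemma ex_resolvent_density:
  assumes f[measurable]: "f \<in> BM"
  shows "\<exists>W\<in>BM. \<forall>g\<in>BM. (\<integral>\<^sup>+x. W x * g x \<partial>M) = U a f g"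
proof -
  define \<nu> where "\<nu> = measure_of (space M) (sets M) (\<lambda>A. U a f (indicator A))"
  have U0: "U a f (\<lambda>_. 0) = 0"
    using U_cmult_right[OF f, of "\<lambda>_. 0" a 0] by simp
  have \<nu>: "emeasure \<nu> A = U a f (indicator A)" if "A \<in> sets M" for A
    unfolding \<nu>_def
  proof (rule emeasure_measure_of_sigma)
    show "positive (sets M) (\<lambda>A. U a f (indicator A))"
      using U0 by (simp add: positive_def indicator_def[abs_def])
    show "countably_additive (sets M) (\<lambda>A. U a f (indicator A))"
    proof (rule countably_additiveI)
      fix A :: "nat \<Rightarrow> 'a set" assume A: "range A \<subseteq> sets M" "disjoint_family A"
      then have [measurable]: "A i \<in> sets M" for i by auto
      have "(\<Sum>i. U a f (indicator (A i))) = (SUP n. \<Sum>i<n. U a f (indicator (A i)))"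
        by (rule suminf_eq_SUP)
      also have "\<dots> = (SUP n. U a f (\<lambda>x. \<Sum>i<n. indicator (A i) x))"
      proof (rule SUP_cong[OF refl])
        fix n show "(\<Sum>i<n. U a f (indicator (A i))) = U a f (\<lambda>x. \<Sum>i<n. indicator (A i) x)"
          by (induction n) (simp_all add: U0 U_add_right)
      qed
      also have "(SUP n. U a f (\<lambda>x. \<Sum>i<n. indicator (A i) x)) = U a f (\<lambda>x. SUP n. \<Sum>i<n. indicator (A i) x)"
      proof (rule U_SUP_right[symmetric])
        show "incseq (\<lambda>n x. \<Sum>i<n. indicator (A i) x :: ennreal)"
          by (rule incseq_SucI, rule le_funI) simp
      qed measurable
      also have "(\<lambda>x. SUP n. \<Sum>i<n. indicator (A i) x) = (indicator (\<Union>i. A i) :: 'a \<Rightarrow> ennreal)"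
      proof
        fix x
        have "(SUP n. \<Sum>i<n. indicator (A i) x) = (\<Sum>i. indicator (A i) x :: ennreal)"
          by (rule suminf_eq_SUP[symmetric])
        also have "\<dots> = indicator (\<Union>i. A i) x"
          by (rule suminf_indicator[OF A(2)])
        finally show "(SUP n. \<Sum>i<n. indicator (A i) x) = (indicator (\<Union>i. A i) x :: ennreal)" .
      qed
      finally show "(\<Sum>i. U a f (indicator (A i))) = U a f (indicator (\<Union>i. A i))" .
    qed
  qed (rule sets.sigma_algebra_axioms that)+
  have sets[simp]: "sets \<nu> = sets M" unfolding \<nu>_def by simp
  have "absolutely_continuous M \<nu>"
    unfolding absolutely_continuous_def
  proof safe
    fix A assume A: "A \<in> null_sets M"
    then have [measurable]: "A \<in> sets M" by auto
    have "U a f (indicator A) = U a f (\<lambda>_. 0)"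
    proof (intro U_cong_bil bil_cong)
      show "AE x in M. indicator A x = (0::ennreal)"
        using AE_not_in[OF A] by eventually_elim auto
    qed auto
    then show "A \<in> null_sets \<nu>"
      by (intro null_setsI) (auto simp: \<nu> U0)
  qed
  then obtain W where W[measurable]: "W \<in> BM" and d: "density M W = \<nu>"
    using Radon_Nikodym[of \<nu>] by auto
  have "(\<integral>\<^sup>+x. W x * g x \<partial>M) = U a f g" if "g \<in> BM" for g
    using that
  proof (induction rule: borel_measurable_induct)
    case (cong f' g')
    have "U a f f' = U a f g'" using cong by (intro U_cong_bil bil_cong) auto
    moreover have "(\<integral>\<^sup>+x. W x * f' x \<partial>M) = (\<integral>\<^sup>+x. W x * g' x \<partial>M)"
      using cong by (intro nn_integral_cong) auto
    ultimately show ?case using cong by simp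
  next
    case (set A)
    then show ?case using \<nu>[OF set] by (simp add: d[symmetric] emeasure_density)
  next
    case (mult u c)
    then have [measurable]: "u \<in> BM" by simp
    have "(\<integral>\<^sup>+x. W x * (c * u x) \<partial>M) = (\<integral>\<^sup>+x. c * (W x * u x) \<partial>M)"
      by (simp add: mult.left_commute)
    also have "\<dots> = c * (\<integral>\<^sup>+x. W x * u x \<partial>M)"
      by (rule nn_integral_cmult) auto
    finally show ?case using mult by (simp add: U_cmult_right)
  next
    case (add u v)
    then show ?case by (simp add: U_add_right nn_integral_add distrib_left)
  next
    case (seq Us)
    then have [measurable]: "Us i \<in> BM" for i by auto
    have "(SUP i. Us i) = (\<lambda>x. SUP i. Us i x)" by (rule ext) (simp only: SUP_apply)
    moreover have "(\<integral>\<^sup>+x. (SUP i. W x * Us i x) \<partial>M) = (SUP i. \<integral>\<^sup>+x. W x * Us i x \<partial>M)"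
      using seq by (intro nn_integral_monotone_convergence_SUP)
        (auto simp: incseq_def le_fun_def intro!: mult_left_mono)
    ultimately show ?case
      using seq by (simp add: U_SUP_right SUP_mult_left_ennreal)
  qed
  then show ?thesis using W by blast
qed

text \<open>By \<open>AE_eq_of_nn_integral_eq\<close> the density is unique up to null sets, so the
  arbitrary choice is harmless in statements that hold almost everywhere.\<close>

definition R :: "real \<Rightarrow> ('a \<Rightarrow> ennreal) \<Rightarrow> 'a \<Rightarrow> ennreal" where
  "R \<alpha> f = (SOME W. W \<in> BM \<and> (\<forall>g\<in>BM. (\<integral>\<^sup>+x. W x * g x \<partial>M) = U \<alpha> f g))"

lemma R:
  assumes "f \<in> BM"
  shows R_measurable: "R c f \<in> BM"
    and nn_integral_R: "g \<in> BM \<Longrightarrow> (\<integral>\<^sup>+x. R c f x * g x \<partial>M) = U c f g"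
proof -
  have "\<exists>W. W \<in> BM \<and> (\<forall>g\<in>BM. (\<integral>\<^sup>+x. W x * g x \<partial>M) = U c f g)"
    using ex_resolvent_density[OF assms, of c] by blast
  from someI_ex[OF this] have "R c f \<in> BM \<and> (\<forall>g\<in>BM. (\<integral>\<^sup>+x. R c f x * g x \<partial>M) = U c f g)"
    unfolding R_def[symmetric] .
  then show "R c f \<in> BM" "g \<in> BM \<Longrightarrow> (\<integral>\<^sup>+x. R c f x * g x \<partial>M) = U c f g"
    by auto
qed

lemma AE_eq_of_nn_integral_eq:
  assumes W[measurable]: "W \<in> BM" "W' \<in> BM"
    and eq: "\<And>g. g \<in> BM \<Longrightarrow> (\<integral>\<^sup>+x. W x * g x \<partial>M) = (\<integral>\<^sup>+x. W' x * g x \<partial>M)"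
  shows "AE x in M. W x = W' x"
proof -
  have "density M W = density M W'"
    by (rule measure_eqI) (auto simp: emeasure_density eq)
  then show ?thesis
    using density_unique_iff[OF W] by simp
qed

lemma R_eqI:
  assumes "f \<in> BM" "W \<in> BM"
    and "\<And>g. g \<in> BM \<Longrightarrow> (\<integral>\<^sup>+x. W x * g x \<partial>M) = U c f g"
  shows "AE x in M. W x = R c f x"
  using assms by (intro AE_eq_of_nn_integral_eq) (auto simp: R_measurable nn_integral_R)

lemma AE_le_of_nn_integral_le:
  assumes [measurable]: "W \<in> BM" "W' \<in> BM"
    and le: "\<And>g. g \<in> BM \<Longrightarrow> (\<integral>\<^sup>+x. W x * g x \<partial>M) \<le> (\<integral>\<^sup>+x. W' x * g x \<partial>M)"
  shows "AE x in M. W x \<le> W' x"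
proof -
  obtain A :: "nat \<Rightarrow> 'a set" where A: "range A \<subseteq> sets M" "(\<Union>i. A i) = space M" "\<And>i. emeasure M (A i) \<noteq> \<infinity>" "incseq A"
    using sigma_finite_incseq by blast
  have [measurable]: "A i \<in> sets M" for i using A by auto
  \<comment> \<open>On S k the integral of W' is finite, so that the two integrals may be
    subtracted; the sets S k exhaust the set where W' < W.\<close>
  define S where "S k = {x\<in>A k. W' x < W x \<and> W' x \<le> of_nat k}" for k
  have S_eq: "S k = {x\<in>space M. x \<in> A k \<and> W' x < W x \<and> W' x \<le> of_nat k}" for k
    using A(2) by (auto simp: S_def)
  have [measurable]: "S k \<in> sets M" for k unfolding S_eq by measurable
  have "AE x in M. x \<notin> S k" for k
  proof -
    let ?g = "indicator (S k) :: 'a \<Rightarrow> ennreal"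
    have "(\<integral>\<^sup>+x. W' x * ?g x \<partial>M) \<le> (\<integral>\<^sup>+x. of_nat k * indicator (A k) x \<partial>M)"
      by (intro nn_integral_mono) (auto simp: S_def indicator_def)
    also have "\<dots> < \<infinity>"
      using A(3)[of k] by (subst nn_integral_cmult_indicator) (auto simp: ennreal_mult_less_top of_nat_less_top less_top)
    finally have fin: "(\<integral>\<^sup>+x. W' x * ?g x \<partial>M) \<noteq> \<infinity>" by auto
    have "(\<integral>\<^sup>+x. W x * ?g x - W' x * ?g x \<partial>M) = (\<integral>\<^sup>+x. W x * ?g x \<partial>M) - (\<integral>\<^sup>+x. W' x * ?g x \<partial>M)"
      using fin by (intro nn_integral_diff AE_I2) (auto simp: S_def indicator_def)
    also have "\<dots> = 0" using le[of ?g] fin by (simp add: diff_eq_0_iff_ennreal less_top[symmetric]) (metis neq_top_trans)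
    finally have "AE x in M. W x * ?g x - W' x * ?g x = 0"
      by (subst (asm) nn_integral_0_iff_AE) auto
    then show ?thesis
    proof eventually_elim
      case (elim x)
      then show ?case
        by (cases "x \<in> S k") (auto simp: S_def diff_eq_0_iff_ennreal)
    qed
  qed
  then have "AE x in M. \<forall>k. x \<notin> S k"
    by (subst AE_all_countable) auto
  then show ?thesis
  proof (rule AE_mp, intro AE_I2 impI)
    fix x assume x: "x \<in> space M" "\<forall>k. x \<notin> S k"
    show "W x \<le> W' x"
    proof (rule ccontr)
      assume "\<not> ?thesis"
      then have lt: "W' x < W x" by simp
      then obtain n where "W' x < of_nat n"
        using ennreal_Ex_less_of_nat[of "W' x"] by (cases "W' x = \<top>") (auto simp: less_top)
      moreover have "(of_nat n :: ennreal) \<le> of_nat (max k n)" for k by simp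
      ultimately have "W' x \<le> of_nat (max k n)" for k
        by (meson less_imp_le order_trans)
      moreover obtain k where "x \<in> A k" using A(2) x by auto
      then have "x \<in> A (max k n)"
        using incseqD[OF A(4), of k "max k n"] by auto
      ultimately have "x \<in> S (max k n)"
        using lt by (simp add: S_def)
      with x show False by auto
    qed
  qed
qed

lemma R_mono:
  assumes "f \<in> BM" "f' \<in> BM"
    and "\<And>g. g \<in> BM \<Longrightarrow> U c f g \<le> U b f' g"
  shows "AE x in M. R c f x \<le> R b f' x"
  using assms by (intro AE_le_of_nn_integral_le) (auto simp: R_measurable nn_integral_R)

end

section \<open>Laplace transforms, weak resolvents and the form domain\<close>

lemma integrable_exp_minus:
  assumes "0 < c"
  shows "integrable lborel (\<lambda>t. exp (- c * t) * indicator {0<..} t :: real)"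
proof -
  have "integrable lborel (exponential_density c)"
  proof (rule integrableI_nonneg)
    interpret prob_space "density lborel (exponential_density c)"
      by (rule prob_space_exponential_density[OF assms])
    have "(\<integral>\<^sup>+x. ennreal (exponential_density c x) \<partial>lborel) = 1"
      using emeasure_space_1 by (simp add: emeasure_density)
    then show "(\<integral>\<^sup>+x. ennreal (exponential_density c x) \<partial>lborel) < \<infinity>" by simp
  qed (use assms in \<open>auto simp: exponential_density_nonneg\<close>)
  then have "integrable lborel (\<lambda>t. exponential_density c t / c)"
    by simp
  then show ?thesis
  proof (rule Bochner_Integration.integrable_bound)
    show "AE t in lborel. norm (exp (- c * t) * indicator {0<..} t) \<le> norm (exponential_density c t / c)"
      using assms by (intro always_eventually allI) (auto simp: exponential_density_def indicator_def ac_simps)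
  qed measurable
qed

lemma average_tendsto:
  fixes p :: "real \<Rightarrow> real"
  assumes int: "integrable lborel (\<lambda>t. indicator {0<..} t * p t)" and p: "(p \<longlongrightarrow> l) (at_right 0)"
  shows "((\<lambda>s. (\<integral>t. indicator {0<..s} t * p t \<partial>lborel) / s) \<longlongrightarrow> l) (at_right 0)"
proof (rule tendstoI)
  fix e :: real assume "0 < e"
  then have "\<forall>\<^sub>F t in at_right 0. dist (p t) l < e / 2"
    using p by (intro tendstoD) auto
  then obtain b where b: "0 < b" "\<And>t. 0 < t \<Longrightarrow> t < b \<Longrightarrow> dist (p t) l < e / 2"
    by (auto simp: eventually_at_right_field)
  show "\<forall>\<^sub>F s in at_right 0. dist ((\<integral>t. indicator {0<..s} t * p t \<partial>lborel) / s) l < e"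
    unfolding eventually_at_right_field
  proof (intro exI[of _ b] conjI allI impI b)
    fix s assume s: "0 < s" "s < b"
    have i1: "integrable lborel (\<lambda>t. indicator {0<..s} t * p t)"
    proof -
      have "integrable lborel (\<lambda>t. indicator {..s} t *\<^sub>R (indicator {0<..} t * p t))"
        by (intro integrable_mult_indicator int) auto
      also have "(\<lambda>t. indicator {..s} t *\<^sub>R (indicator {0<..} t * p t)) = (\<lambda>t. indicator {0<..s} t * p t)"
        by (auto simp: indicator_def fun_eq_iff)
      finally show ?thesis .
    qed
    have i2: "integrable lborel (\<lambda>t. indicator {0<..s} t * c)" for c :: real
      by (intro integrable_mult_left) (use s in \<open>auto simp: integrable_indicator_iff emeasure_lborel_Ioc\<close>)
    have c: "(\<integral>t. indicator {0<..s} t * c \<partial>lborel) = s * c" for c :: real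
      using s by simp
    have "(\<integral>t. indicator {0<..s} t * p t \<partial>lborel) - s * l = (\<integral>t. indicator {0<..s} t * (p t - l) \<partial>lborel)"
      unfolding c[symmetric] using i1 i2 by (simp add: right_diff_distrib)
    also have "norm \<dots> \<le> (\<integral>t. indicator {0<..s} t * (e / 2) \<partial>lborel)"
    proof (rule Bochner_Integration.integral_norm_bound_integral)
      show "integrable lborel (\<lambda>t. indicator {0<..s} t * (p t - l))"
        using i1 i2 by (simp add: right_diff_distrib)
      show "integrable lborel (\<lambda>t. indicator {0<..s} t * (e / 2))" by (rule i2)
      fix t show "norm (indicator {0<..s} t * (p t - l)) \<le> indicator {0<..s} t * (e / 2)"
        using b(2)[of t] s by (auto simp: indicator_def dist_real_def)
    qed
    also have "\<dots> = s * (e / 2)" by (rule c)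
    finally have "\<bar>(\<integral>t. indicator {0<..s} t * p t \<partial>lborel) - s * l\<bar> \<le> s * (e / 2)" by simp
    then have "\<bar>(\<integral>t. indicator {0<..s} t * p t \<partial>lborel) - s * l\<bar> / s \<le> e / 2"
      using s by (simp add: pos_divide_le_eq mult.commute)
    also have "\<bar>(\<integral>t. indicator {0<..s} t * p t \<partial>lborel) - s * l\<bar> / s = \<bar>(\<integral>t. indicator {0<..s} t * p t \<partial>lborel) / s - l\<bar>"
    proof -
      have "(\<integral>t. indicator {0<..s} t * p t \<partial>lborel) / s - l = ((\<integral>t. indicator {0<..s} t * p t \<partial>lborel) - s * l) / s"
        using s by (simp add: diff_divide_distrib)
      then show ?thesis using s by simp
    qed
    finally show "dist ((\<integral>t. indicator {0<..s} t * p t \<partial>lborel) / s) l < e"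
      using \<open>0 < e\<close> by (simp add: dist_real_def)
  qed
qed

context symmetric_semigroup
begin

definition J :: "real \<Rightarrow> ('a \<Rightarrow> real) \<Rightarrow> ('a \<Rightarrow> real) \<Rightarrow> real" where
  "J \<alpha> \<phi> v = (\<integral>t. indicator {0<..} t * (exp (- \<alpha> * t) * ip \<phi> (T t v)) \<partial>lborel)"

text \<open>The integral of exp (- \<alpha> t) T_t phi over t > 0, understood weakly: testing
  against all of L2 replaces an integral with values in L2.\<close>

definition weak_resolvent :: "real \<Rightarrow> ('a \<Rightarrow> real) \<Rightarrow> ('a \<Rightarrow> real) \<Rightarrow> bool" where
  "weak_resolvent \<alpha> \<phi> u \<longleftrightarrow> u \<in> L2 M \<and> (\<forall>v\<in>L2 M. ip u v = J \<alpha> \<phi> v)"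

lemma J_integrable:
  assumes "0 < c" and u: "u \<in> L2 M" and v: "v \<in> L2 M"
  shows "integrable lborel (\<lambda>t. indicator {0<..} t * (exp (- c * t) * ip u (T t v)))"
proof (rule Bochner_Integration.integrable_bound)
  show "integrable lborel (\<lambda>t. (exp (- c * t) * indicator {0<..} t) * (2 * (ip u u + ip v v)))"
    by (intro integrable_mult_left integrable_exp_minus assms)
  have [measurable]: "(\<lambda>t. indicator {0<..} t * ip u (T t v)) \<in> borel_measurable borel"
    by (rule ip_T_measurable[OF u v])
  have "(\<lambda>t. exp (- c * t) * (indicator {0<..} t * ip u (T t v))) \<in> borel_measurable lborel"
    by measurable
  then show "(\<lambda>t. indicator {0<..} t * (exp (- c * t) * ip u (T t v))) \<in> borel_measurable lborel"
    by (simp add: mult.left_commute)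
  show "AE t in lborel. norm (indicator {0<..} t * (exp (- c * t) * ip u (T t v)))
     \<le> norm ((exp (- c * t) * indicator {0<..} t) * (2 * (ip u u + ip v v)))"
  proof (intro always_eventually allI)
    fix t
    show "norm (indicator {0<..} t * (exp (- c * t) * ip u (T t v)))
       \<le> norm ((exp (- c * t) * indicator {0<..} t) * (2 * (ip u u + ip v v)))"
      using ip_T_bound[OF _ u v, of t] by (cases "0 < t") (auto simp: abs_mult intro!: mult_left_mono)
  qed
qed

lemma J_sym:
  assumes "u \<in> L2 M" "v \<in> L2 M"
  shows "J c u v = J c v u"
  unfolding J_def
proof (intro Bochner_Integration.integral_cong refl)
  fix t
  show "indicator {0<..} t * (exp (- c * t) * ip u (T t v)) = indicator {0<..} t * (exp (- c * t) * ip v (T t u))"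
    using T_symmetric[OF _ assms, of t] ip_commute[of v "T t u"] by (cases "0 < t") auto
qed

lemma J_diff_right:
  assumes c: "0 < c" and u: "u \<in> L2 M" and v: "v \<in> L2 M" and w: "w \<in> L2 M"
  shows "J c u (\<lambda>x. v x - w x) = J c u v - J c u w"
proof -
  have [measurable]: "u \<in> BM" "v \<in> BM" "w \<in> BM" using u v w by auto
  have "ip u (T t (\<lambda>x. v x - w x)) = ip u (T t v) - ip u (T t w)" if t: "0 < t" for t
  proof -
    have "ip u (T t (\<lambda>x. v x - w x)) = ip u (\<lambda>x. T t v x - T t w x)"
      using t T_diff[OF t v w] by (intro ip_cong) auto
    then show ?thesis using T_L2[OF t v] T_L2[OF t w] u by (simp add: ip_diff_right)
  qed
  then have "J c u (\<lambda>x. v x - w x) = (\<integral>t. indicator {0<..} t * (exp (- c * t) * ip u (T t v))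
      - indicator {0<..} t * (exp (- c * t) * ip u (T t w)) \<partial>lborel)"
    unfolding J_def by (intro Bochner_Integration.integral_cong) (auto simp: indicator_def right_diff_distrib)
  also have "\<dots> = J c u v - J c u w"
    unfolding J_def by (intro Bochner_Integration.integral_diff J_integrable assms)
  finally show ?thesis .
qed

text \<open>Shifting the integration variable gives T_s u as exp (c s) times the Laplace integral
  over (s,\<infinity>); the integral over (0,s] is what remains in u - T_s u.\<close>

lemma weak_increment:
  assumes c: "0 < c" and f: "f \<in> L2 M" and u: "weak_resolvent c f u" and s: "0 < s" and v: "v \<in> L2 M"
  shows "ip (\<lambda>x. u x - T s u x) v = (1 - exp (c * s)) * ip u v
     + exp (c * s) * (\<integral>t. indicator {0<..s} t * (exp (- c * t) * ip f (T t v)) \<partial>lborel)"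
proof -
  have uL: "u \<in> L2 M" and uJ: "\<And>v. v \<in> L2 M \<Longrightarrow> ip u v = J c f v"
    using u by (auto simp: weak_resolvent_def)
  have [measurable]: "f \<in> BM" "v \<in> BM" using f v by auto
  let ?w = "\<lambda>t. exp (- c * t) * ip f (T t v)"
  have i: "integrable lborel (\<lambda>t. indicator {0<..} t * ?w t)"
    by (rule J_integrable[OF c f v])
  have i': "integrable lborel (\<lambda>t. indicator A t * (indicator {0<..} t * ?w t))" if "A \<in> sets borel" for A
    using integrable_mult_indicator[OF _ i, of A] that by simp
  have "J c f (T s v) = (\<integral>t. exp (c * s) * (indicator {s<..} (s + 1 * t) * ?w (s + 1 * t)) \<partial>lborel)"
    unfolding J_def
  proof (intro Bochner_Integration.integral_cong refl)
    fix t
    have "ip f (T t (T s v)) = ip f (T (s + t) v)" if "0 < t"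
      using that s T_semigroup[OF that s v] by (intro ip_cong) (auto simp: add.commute)
    moreover have "exp (- c * t) = exp (c * s) * exp (- c * (s + t))"
      by (simp add: exp_add[symmetric] algebra_simps)
    ultimately show "indicator {0<..} t * (exp (- c * t) * ip f (T t (T s v)))
       = exp (c * s) * (indicator {s<..} (s + 1 * t) * ?w (s + 1 * t))"
      by (auto simp: indicator_def)
  qed
  also have "\<dots> = exp (c * s) * (\<integral>t. indicator {s<..} t * ?w t \<partial>lborel)"
    using lborel_integral_real_affine[of 1 "\<lambda>t. indicator {s<..} t * ?w t" s] by simp
  also have "(\<integral>t. indicator {s<..} t * ?w t \<partial>lborel)
     = (\<integral>t. indicator {0<..} t * ?w t - indicator {..s} t * (indicator {0<..} t * ?w t) \<partial>lborel)"
    using s by (intro Bochner_Integration.integral_cong) (auto simp: indicator_def)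
  also have "\<dots> = J c f v - (\<integral>t. indicator {..s} t * (indicator {0<..} t * ?w t) \<partial>lborel)"
    unfolding J_def using i i' by (intro Bochner_Integration.integral_diff) auto
  also have "(\<integral>t. indicator {..s} t * (indicator {0<..} t * ?w t) \<partial>lborel) = (\<integral>t. indicator {0<..s} t * ?w t \<partial>lborel)"
    by (intro Bochner_Integration.integral_cong) (auto simp: indicator_def)
  finally have "J c f (T s v) = exp (c * s) * (J c f v - (\<integral>t. indicator {0<..s} t * ?w t \<partial>lborel))" .
  moreover have "ip (\<lambda>x. u x - T s u x) v = ip u v - ip u (T s v)"
    using uL v T_L2[OF s uL] by (simp add: ip_diff_left T_symmetric[OF s uL v])
  ultimately show ?thesis
    using uJ[OF T_L2[OF s v]] uJ[OF v] by (simp add: algebra_simps)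
qed

text \<open>First order expansion of \<open>weak_increment\<close>: the average over (0,s] tends to
  l, and (1 - exp (a s)) / s tends to -a. This is the weak form of (a - L) u = f for the generator
  L, with l in the place of <f, v>.\<close>

lemma weak_increment_tendsto:
  assumes a: "0 < a" and f: "f \<in> L2 M" and u: "weak_resolvent a f u" and v: "v \<in> L2 M"
    and l: "((\<lambda>t. ip f (T t v)) \<longlongrightarrow> l) (at_right 0)"
  shows "((\<lambda>s. ip (\<lambda>x. u x - T s u x) v / s) \<longlongrightarrow> l - a * ip u v) (at_right 0)"
proof -
  have e: "((\<lambda>t. exp (c * t)) \<longlongrightarrow> 1) (at_right (0::real))" for c :: real
  proof -
    have "((\<lambda>t. exp (c * t)) \<longlongrightarrow> exp (c * 0)) (at_right (0::real))"
      by (intro tendsto_intros)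
    then show ?thesis by simp
  qed
  have "((\<lambda>t. exp (- a * t) * ip f (T t v)) \<longlongrightarrow> 1 * l) (at_right 0)"
    by (intro tendsto_mult e l)
  then have 1: "((\<lambda>s. (\<integral>t. indicator {0<..s} t * (exp (- a * t) * ip f (T t v)) \<partial>lborel) / s) \<longlongrightarrow> l) (at_right 0)"
    by (intro average_tendsto J_integrable a f v) simp
  have "((\<lambda>s. exp (a * s)) has_real_derivative a) (at 0)"
    by (auto intro!: derivative_eq_intros)
  then have "((\<lambda>s. (exp (a * s) - 1) / s) \<longlongrightarrow> a) (at 0)"
    by (simp add: DERIV_def)
  then have 2: "((\<lambda>s. (exp (a * s) - 1) / s) \<longlongrightarrow> a) (at_right 0)"
    by (rule filterlim_mono) (auto intro: at_le)
  have "((\<lambda>s. - ((exp (a * s) - 1) / s) * ip u v + exp (a * s) *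
      ((\<integral>t. indicator {0<..s} t * (exp (- a * t) * ip f (T t v)) \<partial>lborel) / s)) \<longlongrightarrow> - a * ip u v + 1 * l) (at_right 0)"
    by (intro tendsto_add tendsto_mult tendsto_minus 1 2 e tendsto_const)
  then have "((\<lambda>s. ip (\<lambda>x. u x - T s u x) v / s) \<longlongrightarrow> - a * ip u v + 1 * l) (at_right 0)"
  proof (rule Lim_transform_eventually)
    show "\<forall>\<^sub>F s in at_right 0. - ((exp (a * s) - 1) / s) * ip u v + exp (a * s) *
      ((\<integral>t. indicator {0<..s} t * (exp (- a * t) * ip f (T t v)) \<partial>lborel) / s) = ip (\<lambda>x. u x - T s u x) v / s"
      using eventually_at_right_less[of 0]
    proof eventually_elim
      case (elim s)
      then show ?case
        using weak_increment[OF a f u elim v] by (simp add: field_simps)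
    qed
  qed
  then show ?thesis by (simp add: algebra_simps)
qed

abbreviation \<E>K :: "('a \<Rightarrow> real) \<Rightarrow> ('a \<Rightarrow> real) \<Rightarrow> real" where
  "\<E>K \<equiv> semigroup_form M T"

abbreviation DK :: "('a \<Rightarrow> real) set" where
  "DK \<equiv> semigroup_dom M T"

lemma semigroup_form_ip: "\<E>K u v = Lim (at_right 0) (\<lambda>t. ip (\<lambda>x. u x - T t u x) v / t)"
  by (simp add: semigroup_form_def ip_def)

lemma semigroup_dom_ip: "DK = {u \<in> L2 M. \<exists>c. ((\<lambda>t. ip (\<lambda>x. u x - T t u x) u / t) \<longlongrightarrow> c) (at_right 0)}"
  by (simp add: semigroup_dom_def ip_def)

text \<open>No strong continuity at \<open>0\<close> is assumed; on the domain of the form it is automatic.\<close>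

lemma dom_tendsto:
  assumes v: "v \<in> DK" and f: "f \<in> L2 M"
  shows "((\<lambda>t. ip f (T t v)) \<longlongrightarrow> ip f v) (at_right 0)"
proof -
  have vL: "v \<in> L2 M" using v by (simp add: semigroup_dom_ip)
  obtain c where "((\<lambda>t. ip (\<lambda>x. v x - T t v x) v / t) \<longlongrightarrow> c) (at_right 0)"
    using v by (auto simp: semigroup_dom_ip)
  then have "((\<lambda>t. ip (\<lambda>x. v x - T t v x) v / t * t) \<longlongrightarrow> c * 0) (at_right 0)"
    by (intro tendsto_mult) auto
  then have "((\<lambda>t. ip v v - ip v (T t v)) \<longlongrightarrow> c * 0) (at_right 0)"
  proof (rule Lim_transform_eventually)
    show "\<forall>\<^sub>F t in at_right 0. ip (\<lambda>x. v x - T t v x) v / t * t = ip v v - ip v (T t v)"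
      using eventually_at_right_less[of 0]
      by eventually_elim (simp add: ip_diff_left vL T_L2 T_symmetric)
  qed
  then have "((\<lambda>t. ip v v - (ip v v - ip v (T t v))) \<longlongrightarrow> ip v v - c * 0) (at_right 0)"
    by (intro tendsto_diff tendsto_const)
  then have 1: "((\<lambda>t. ip v (T t v)) \<longlongrightarrow> ip v v) (at_right 0)" by simp
  moreover have "filterlim (\<lambda>t::real. t + t) (at_right 0) (at_right 0)"
  proof (rule filterlim_at_withinI)
    have "((\<lambda>t::real. t + t) \<longlongrightarrow> 0 + 0) (at_right 0)"
      by (intro tendsto_intros)
    then show "((\<lambda>t::real. t + t) \<longlongrightarrow> 0) (at_right 0)" by simp
    show "\<forall>\<^sub>F t in at_right (0::real). t + t \<in> {0<..} - {0}"
      using eventually_at_right_less[of "0::real"] by eventually_elim simp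
  qed
  ultimately have 2: "((\<lambda>t. ip v (T (t + t) v)) \<longlongrightarrow> ip v v) (at_right 0)"
    by (rule filterlim_compose)
  let ?w = "\<lambda>t x. v x - T t v x"
  have "((\<lambda>t. ip v v - 2 * ip v (T t v) + ip v (T (t + t) v)) \<longlongrightarrow> ip v v - 2 * ip v v + ip v v) (at_right 0)"
    by (intro tendsto_intros 1 2)
  \<comment> \<open>Strong continuity at v: the squared norm of v - T_t v is <v, v> - 2 <v, T_t v> +
    <v, T_(2t) v>, and all three pairings have the same limit.\<close>
  have "((\<lambda>t. ip (?w t) (?w t)) \<longlongrightarrow> ip v v - 2 * ip v v + ip v v) (at_right 0)"
  proof (rule Lim_transform_eventually)
    show "((\<lambda>t. ip v v - 2 * ip v (T t v) + ip v (T (t + t) v)) \<longlongrightarrow> ip v v - 2 * ip v v + ip v v) (at_right 0)"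
      by fact
    show "\<forall>\<^sub>F t in at_right 0. ip v v - 2 * ip v (T t v) + ip v (T (t + t) v) = ip (?w t) (?w t)"
      using eventually_at_right_less[of 0]
    proof eventually_elim
      case (elim t)
      have L: "T t v \<in> L2 M" by (rule T_L2[OF elim vL])
      have "ip (?w t) (?w t) = ip v (?w t) - ip (T t v) (?w t)"
        by (intro ip_diff_left vL L L2_diff)
      also have "\<dots> = ip v v - ip v (T t v) - (ip (T t v) v - ip (T t v) (T t v))"
        by (simp only: ip_diff_right[OF vL L vL] ip_diff_right[OF vL L L])
      finally show ?case
        by (simp add: ip_T_split[OF elim elim vL vL, simplified] T_symmetric[OF elim vL vL])
    qed
  qed
  then have w: "((\<lambda>t. ip (?w t) (?w t)) \<longlongrightarrow> 0) (at_right 0)" by simp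
  obtain l where l: "((\<lambda>t. ip f (T t v)) \<longlongrightarrow> l) (at_right 0)"
    using ip_T_convergent[OF f vL] by auto
  let ?d = "ip f v - l"
  \<comment> \<open>The squared norm of f + c (v - T_t v) is nonnegative and its quadratic term in c
    vanishes in the limit. An affine function of c that is bounded below has slope 0, whence ?d =
    0.\<close>
  have pos: "0 \<le> ip f f + 2 * c * ?d" for c
  proof (rule tendsto_lowerbound)
    have "((\<lambda>t. ip f f + 2 * c * (ip f v - ip f (T t v)) + c * c * ip (?w t) (?w t)) \<longlongrightarrow> ip f f + 2 * c * ?d + c * c * 0) (at_right 0)"
      by (intro tendsto_intros l w)
    then show "((\<lambda>t. ip f f + 2 * c * (ip f v - ip f (T t v)) + c * c * ip (?w t) (?w t)) \<longlongrightarrow> ip f f + 2 * c * ?d) (at_right 0)"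
      by simp
    show "\<forall>\<^sub>F t in at_right 0. 0 \<le> ip f f + 2 * c * (ip f v - ip f (T t v)) + c * c * ip (?w t) (?w t)"
      using eventually_at_right_less[of 0]
    proof eventually_elim
      case (elim t)
      have wL: "?w t \<in> L2 M" using vL T_L2[OF elim vL] by (rule L2_diff)
      have "(\<lambda>x. (f x + c * ?w t x) * (f x + c * ?w t x)) = (\<lambda>x. f x * f x + 2 * c * (f x * ?w t x) + c * c * (?w t x * ?w t x))"
        by (auto simp: algebra_simps)
      then have "ip (\<lambda>x. f x + c * ?w t x) (\<lambda>x. f x + c * ?w t x) = ip f f + 2 * c * ip f (?w t) + c * c * ip (?w t) (?w t)"
        unfolding ip_def using L2_integrable_mult[OF f f] L2_integrable_mult[OF f wL] L2_integrable_mult[OF wL wL] by simp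
      moreover have "ip f (?w t) = ip f v - ip f (T t v)"
        using f vL T_L2[OF elim vL] by (simp add: ip_diff_right)
      ultimately show ?case
        using ip_self_nonneg[of "\<lambda>x. f x + c * ?w t x"] by simp
    qed
  qed simp
  have "?d = 0"
  proof (rule ccontr)
    assume d: "?d \<noteq> 0"
    \<comment> \<open>This value of c makes the affine function equal to -1.\<close>
    then have "2 * (- (ip f f + 1) / (2 * ?d)) * ?d = - (ip f f + 1)"
      by (simp add: field_simps)
    then show False using pos[of "- (ip f f + 1) / (2 * ?d)"] by simp
  qed
  then show ?thesis using l by simp
qed

text \<open>The increment is tested with u itself; \<open>ip_T_convergent\<close> supplies the limit
  l without its value being known.\<close>

lemma weak_resolvent_dom:
  assumes c: "0 < c" and f: "f \<in> L2 M" and u: "weak_resolvent c f u"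
  shows "u \<in> DK"
proof -
  have uL: "u \<in> L2 M" using u by (simp add: weak_resolvent_def)
  obtain l where "((\<lambda>t. ip f (T t u)) \<longlongrightarrow> l) (at_right 0)"
    using ip_T_convergent[OF f uL] by auto
  then have "((\<lambda>s. ip (\<lambda>x. u x - T s u x) u / s) \<longlongrightarrow> l - c * ip u u) (at_right 0)"
    by (rule weak_increment_tendsto[OF c f u uL])
  then show ?thesis using uL by (auto simp: semigroup_dom_ip)
qed

lemma weak_resolvent_form:
  assumes c: "0 < c" and f: "f \<in> L2 M" and u: "weak_resolvent c f u"
  shows "form_resolvent M \<E>K DK c f u"
  unfolding form_resolvent_def
proof (intro conjI ballI weak_resolvent_dom[OF assms])
  fix v assume v: "v \<in> DK"
  then have vL: "v \<in> L2 M" by (simp add: semigroup_dom_ip)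
  have "\<E>K u v = ip f v - c * ip u v"
    unfolding semigroup_form_ip
    by (intro tendsto_Lim weak_increment_tendsto[OF c f u vL] dom_tendsto v f) simp
  then show "\<E>K u v + c * (\<integral>x. u x * v x \<partial>M) = (\<integral>x. f x * v x \<partial>M)"
    by (simp add: ip_def)
qed

text \<open>The form at (u, v) is computed twice: from the increments of v, moved over by symmetry
  of T_s, and from the equation satisfied by u. Comparison gives <u, h> = <f, v>, and v represents
  the Laplace transform of h.\<close>

lemma form_resolvent_ip:
  assumes c: "0 < c" and f: "f \<in> L2 M" and u: "form_resolvent M \<E>K DK c f u"
    and h: "h \<in> L2 M" and v: "weak_resolvent c h v"
  shows "ip u h = J c f h"
proof -
  have uD: "u \<in> DK" using u by (simp add: form_resolvent_def)
  then have uL: "u \<in> L2 M" by (simp add: semigroup_dom_ip)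
  have vD: "v \<in> DK" using weak_resolvent_dom[OF c h v] .
  then have vL: "v \<in> L2 M" by (simp add: semigroup_dom_ip)
  have "((\<lambda>s. ip (\<lambda>x. v x - T s v x) u / s) \<longlongrightarrow> ip h u - c * ip v u) (at_right 0)"
    by (intro weak_increment_tendsto[OF c h v uL] dom_tendsto uD h)
  then have "((\<lambda>s. ip (\<lambda>x. u x - T s u x) v / s) \<longlongrightarrow> ip h u - c * ip v u) (at_right 0)"
  proof (rule Lim_transform_eventually)
    show "\<forall>\<^sub>F s in at_right 0. ip (\<lambda>x. v x - T s v x) u / s = ip (\<lambda>x. u x - T s u x) v / s"
      using eventually_at_right_less[of 0]
    proof eventually_elim
      case (elim s)
      have "ip (\<lambda>x. v x - T s v x) u = ip v u - ip v (T s u)"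
        using T_L2[OF elim vL] T_symmetric[OF elim vL uL] uL vL by (simp add: ip_diff_left)
      also have "\<dots> = ip (\<lambda>x. u x - T s u x) v"
        using T_L2[OF elim uL] uL vL by (simp add: ip_diff_left ip_commute[of v u] ip_commute[of v "T s u"])
      finally show ?case by simp
    qed
  qed
  then have "\<E>K u v = ip h u - c * ip v u"
    unfolding semigroup_form_ip by (intro tendsto_Lim) auto
  moreover have "\<E>K u v + c * ip u v = ip f v"
    using u vD by (auto simp: form_resolvent_def ip_def)
  ultimately have "ip u h = ip v f"
    by (simp add: ip_commute)
  also have "\<dots> = J c h f" using v f by (simp add: weak_resolvent_def)
  finally show ?thesis using J_sym[OF f h] by simp
qed

end

section \<open>Densities of potentials as resolvents of the form\<close>

context symmetric_semigroup
begin

lemma nn_integral_exp_minus: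
  assumes "0 < c"
  shows "(\<integral>\<^sup>+t. ennreal (exp (- c * t)) * indicator {0<..} t \<partial>lborel) = ennreal (1 / c)"
proof -
  interpret prob_space "density lborel (exponential_density c)"
    by (rule prob_space_exponential_density[OF assms])
  have "(\<integral>\<^sup>+t. ennreal (exponential_density c t) \<partial>lborel) = 1"
    using emeasure_space_1 by (simp add: emeasure_density)
  moreover have "AE t in lborel. t \<noteq> (0::real)" by (rule AE_lborel_singleton)
  then have "AE t in lborel. ennreal (exponential_density c t) = ennreal c * (ennreal (exp (- c * t)) * indicator {0<..} t)"
    by eventually_elim
       (use assms in \<open>auto simp: exponential_density_def indicator_def ennreal_mult[symmetric] ac_simps\<close>)
  then have "(\<integral>\<^sup>+t. ennreal (exponential_density c t) \<partial>lborel) = ennreal c * (\<integral>\<^sup>+t. ennreal (exp (- c * t)) * indicator {0<..} t \<partial>lborel)"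
    by (subst nn_integral_cmult[symmetric]) (auto intro!: nn_integral_cong_AE)
  ultimately have *: "ennreal c * (\<integral>\<^sup>+t. ennreal (exp (- c * t)) * indicator {0<..} t \<partial>lborel) = 1" by simp
  have "ennreal (1 / c) = ennreal (1 / c) * (ennreal c * (\<integral>\<^sup>+t. ennreal (exp (- c * t)) * indicator {0<..} t \<partial>lborel))"
    unfolding * by simp
  also have "\<dots> = (ennreal (1 / c) * ennreal c) * (\<integral>\<^sup>+t. ennreal (exp (- c * t)) * indicator {0<..} t \<partial>lborel)"
    by (simp only: mult.assoc)
  also have "ennreal (1 / c) * ennreal c = 1"
    using assms by (simp add: ennreal_mult[symmetric])
  finally show ?thesis by simp
qed

lemma U_bound:
  assumes c: "0 < c" and fg: "f \<in> BM" "g \<in> BM"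
    and "(\<integral>\<^sup>+x. (f x)\<^sup>2 \<partial>M) \<le> ennreal a" "(\<integral>\<^sup>+x. (g x)\<^sup>2 \<partial>M) \<le> ennreal b" "0 \<le> a" "0 \<le> b"
  shows "U c f g \<le> ennreal ((a + b) / (2 * c))"
proof -
  have "U c f g \<le> (\<integral>\<^sup>+t. ennreal ((a + b) / 2) * (ennreal (exp (- c * t)) * indicator {0<..} t) \<partial>lborel)"
    unfolding U_def
  proof (intro nn_integral_mono)
    fix t
    show "ennreal (exp (- c * t)) * (indicator {0<..} t * bil t f g) \<le> ennreal ((a + b) / 2) * (ennreal (exp (- c * t)) * indicator {0<..} t)"
      using bil_bound[OF _ assms(2-7), of t]
      by (cases "0 < t") (auto simp: mult.commute[of _ "bil t f g"] mult.left_commute[of _ "bil t f g"] intro!: mult_right_mono)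
  qed
  also have "\<dots> = ennreal ((a + b) / 2) * ennreal (1 / c)"
    by (subst nn_integral_cmult) (simp_all add: nn_integral_exp_minus[OF c, simplified])
  also have "\<dots> = ennreal ((a + b) / (2 * c))"
    using assms by (subst ennreal_mult[symmetric]) auto
  finally show ?thesis .
qed

text \<open>Square integrability is obtained by absorption: square integrable minorants u k of
  \<open>R c f\<close> have norms bounded in terms of f and c only, and monotone convergence
  transfers the bound.\<close>

lemma R_L2:
  assumes c: "0 < c" and f[measurable]: "f \<in> BM" and f2: "(\<integral>\<^sup>+x. (f x)\<^sup>2 \<partial>M) < \<infinity>"
  shows "(\<integral>\<^sup>+x. (R c f x)\<^sup>2 \<partial>M) < \<infinity>"
proof -
  have [measurable]: "R c f \<in> BM" using R_measurable[OF f] .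
  obtain a where a: "(\<integral>\<^sup>+x. (f x)\<^sup>2 \<partial>M) = ennreal a" "0 \<le> a"
    using f2 by (cases "\<integral>\<^sup>+x. (f x)\<^sup>2 \<partial>M") auto
  obtain u where u: "\<And>k. u k \<in> L2 M" "\<And>k x. 0 \<le> u k x" "incseq (\<lambda>k x. ennreal (u k x))"
     "\<And>x. x \<in> space M \<Longrightarrow> R c f x = (SUP k::nat. ennreal (u k x))"
    using ex_L2_approx[OF R_measurable[OF f]] by metis
  have [measurable]: "u k \<in> BM" for k using u(1) by auto
  have bound: "(\<integral>\<^sup>+x. (ennreal (u k x))\<^sup>2 \<partial>M) \<le> ennreal (a / c\<^sup>2)" for k
  proof -
    let ?N = "ip (u k) (u k)"
    have N: "(\<integral>\<^sup>+x. (ennreal (u k x))\<^sup>2 \<partial>M) = ennreal ?N"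
    proof -
      have "(\<integral>\<^sup>+x. (ennreal (- u k x))\<^sup>2 \<partial>M) = 0"
        using u(2) by (simp add: ennreal_neg)
      then show ?thesis using nn_integral_square_eq_ip(3)[OF u(1), of k] by simp
    qed
    have N0: "0 \<le> ?N" by (rule ip_self_nonneg)
    \<comment> \<open>Testing with c times u k balances the two terms of \<open>U_bound\<close>: c N
      \<le> (a + c^2 N) / (2 c) gives c^2 N \<le> a, where N is finite beforehand.\<close>
    have "ennreal c * ennreal ?N = (\<integral>\<^sup>+x. ennreal (u k x) * (ennreal c * ennreal (u k x)) \<partial>M)"
      unfolding N[symmetric]
      by (subst nn_integral_cmult[symmetric]) (auto simp: power2_eq_square ac_simps)
    also have "\<dots> \<le> (\<integral>\<^sup>+x. R c f x * (ennreal c * ennreal (u k x)) \<partial>M)"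
      by (intro nn_integral_mono mult_right_mono) (auto simp: u(4) intro: SUP_upper)
    also have "\<dots> = U c f (\<lambda>x. ennreal c * ennreal (u k x))"
      by (intro nn_integral_R) auto
    also have "\<dots> \<le> ennreal ((a + c\<^sup>2 * ?N) / (2 * c))"
    proof (intro U_bound c f)
      have "(\<integral>\<^sup>+x. (ennreal c * ennreal (u k x))\<^sup>2 \<partial>M) = (ennreal c)\<^sup>2 * (\<integral>\<^sup>+x. (ennreal (u k x))\<^sup>2 \<partial>M)"
        by (subst nn_integral_cmult[symmetric]) (auto simp: power_mult_distrib)
      also have "\<dots> = ennreal (c\<^sup>2 * ?N)"
        unfolding N using c N0 by (simp add: ennreal_power ennreal_mult)
      finally show "(\<integral>\<^sup>+x. (ennreal c * ennreal (u k x))\<^sup>2 \<partial>M) \<le> ennreal (c\<^sup>2 * ?N)" by simp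
    qed (use a N0 in auto)
    finally have "ennreal (c * ?N) \<le> ennreal ((a + c\<^sup>2 * ?N) / (2 * c))"
      using c N0 by (simp add: ennreal_mult)
    then have "c * ?N \<le> (a + c\<^sup>2 * ?N) / (2 * c)"
      using a(2) c N0 by (subst (asm) ennreal_le_iff) auto
    then have "c\<^sup>2 * ?N \<le> a"
      using c by (simp add: field_simps power2_eq_square)
    then have "?N \<le> a / c\<^sup>2"
      using c by (simp add: field_simps)
    then show ?thesis unfolding N by (rule ennreal_leI)
  qed
  have "(\<integral>\<^sup>+x. (R c f x)\<^sup>2 \<partial>M) = (\<integral>\<^sup>+x. (SUP k. (ennreal (u k x))\<^sup>2) \<partial>M)"
  proof (intro nn_integral_cong)
    fix x assume x: "x \<in> space M"
    have "incseq (\<lambda>k. ennreal (u k x))" using u(3) by (auto simp: incseq_def le_fun_def)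
    then have "(\<lambda>k. ennreal (u k x)) \<longlonglongrightarrow> R c f x"
      unfolding u(4)[OF x] by (rule LIMSEQ_SUP)
    from this this have "(\<lambda>k. (ennreal (u k x))\<^sup>2) \<longlonglongrightarrow> (R c f x)\<^sup>2"
      unfolding power2_eq_square by (rule tendsto_mult_ennreal) auto
    moreover have "(\<lambda>k. (ennreal (u k x))\<^sup>2) \<longlonglongrightarrow> (SUP k. (ennreal (u k x))\<^sup>2)"
      using \<open>incseq (\<lambda>k. ennreal (u k x))\<close> by (intro LIMSEQ_SUP) (auto simp: incseq_def intro: power_mono)
    ultimately show "(R c f x)\<^sup>2 = (SUP k. (ennreal (u k x))\<^sup>2)"
      by (rule LIMSEQ_unique)
  qed
  also have "\<dots> = (SUP k. \<integral>\<^sup>+x. (ennreal (u k x))\<^sup>2 \<partial>M)"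
    using u(3) by (intro nn_integral_monotone_convergence_SUP) (auto simp: incseq_def le_fun_def intro: power_mono)
  also have "\<dots> \<le> ennreal (a / c\<^sup>2)"
    using bound by (rule SUP_least)
  finally show ?thesis by (simp add: order.strict_trans1)
qed

lemma R_weak:
  assumes c: "0 < c" and f[measurable]: "f \<in> BM" and f2: "(\<integral>\<^sup>+x. (f x)\<^sup>2 \<partial>M) < \<infinity>"
  shows "weak_resolvent c (\<lambda>x. enn2real (f x)) (\<lambda>x. enn2real (R c f x))"
proof -
  let ?h = "\<lambda>x. enn2real (f x)" and ?u = "\<lambda>x. enn2real (R c f x)"
  have Rm[measurable]: "R c f \<in> BM" using R_measurable[OF f] .
  have \<phi>L: "?h \<in> L2 M" and ffin: "AE x in M. f x < \<infinity>" using L2_enn2real[OF f f2] by auto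
  have uL: "?u \<in> L2 M" and Rfin: "AE x in M. R c f x < \<infinity>"
    using L2_enn2real[OF Rm R_L2[OF assms]] by auto
  have pos: "ip ?u v = J c ?h v" if v: "v \<in> L2 M" "\<And>x. 0 \<le> v x" for v
  proof -
    have [measurable]: "v \<in> BM" using v by auto
    have "ip ?u v = enn2real (\<integral>\<^sup>+x. ennreal (?u x * v x) \<partial>M)"
      unfolding ip_def using v(2) by (intro integral_eq_nn_integral) auto
    also have "(\<integral>\<^sup>+x. ennreal (?u x * v x) \<partial>M) = (\<integral>\<^sup>+x. R c f x * ennreal (v x) \<partial>M)"
      using Rfin v(2) by (intro nn_integral_cong_AE) (auto simp: ennreal_mult)
    also have "\<dots> = U c f (\<lambda>x. ennreal (v x))"
      by (intro nn_integral_R) auto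
    also have "\<dots> = (\<integral>\<^sup>+t. ennreal (indicator {0<..} t * (exp (- c * t) * ip ?h (T t v))) \<partial>lborel)"
      unfolding U_def
    proof (intro nn_integral_cong)
      fix t
      show "ennreal (exp (- c * t)) * (indicator {0<..} t * bil t f (\<lambda>x. ennreal (v x)))
         = ennreal (indicator {0<..} t * (exp (- c * t) * ip ?h (T t v)))"
      proof (cases "0 < t")
        case True
        have "bil t f (\<lambda>x. ennreal (v x)) = bil t (\<lambda>x. ennreal (?h x)) (\<lambda>x. ennreal (v x))"
          using True ffin by (intro bil_cong) (auto simp: less_top)
        also have "\<dots> = ennreal (ip ?h (T t v))"
          using True v \<phi>L by (intro bil_ennreal) auto
        finally show ?thesis using True by (simp add: ennreal_mult')
      qed simp
    qed
    also have "enn2real \<dots> = J c ?h v"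
      unfolding J_def
    proof (rule integral_eq_nn_integral[symmetric])
      show "(\<lambda>t. indicator {0<..} t * (exp (- c * t) * ip ?h (T t v))) \<in> borel_measurable lborel"
        using J_integrable[OF c \<phi>L v(1)] by (rule borel_measurable_integrable)
      show "AE t in lborel. 0 \<le> indicator {0<..} t * (exp (- c * t) * ip ?h (T t v))"
        using ip_T_nonneg[OF _ \<phi>L _ v(1)] v(2) by (intro always_eventually allI) (auto simp: indicator_def)
    qed
    finally show ?thesis .
  qed
  have "ip ?u v = J c ?h v" if v: "v \<in> L2 M" for v
  proof -
    have [measurable]: "v \<in> BM" using v by auto
    let ?p = "\<lambda>x. max (v x) 0" and ?n = "\<lambda>x. max (- v x) 0"
    have p: "?p \<in> L2 M" "?n \<in> L2 M"
    proof -
      have "?p = (\<lambda>x. enn2real (ennreal (v x)))" "?n = (\<lambda>x. enn2real (ennreal (- v x)))"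
        by (auto simp: fun_eq_iff max_def ennreal_neg)
      then show "?p \<in> L2 M" "?n \<in> L2 M"
        using L2_enn2real(1)[OF _ nn_integral_square_pos_part[OF v]]
          L2_enn2real(1)[OF _ nn_integral_square_pos_part[OF L2_uminus[OF v]]] by auto
    qed
    have "v = (\<lambda>x. ?p x - ?n x)" by (auto simp: fun_eq_iff max_def)
    then have "ip ?u v = ip ?u (\<lambda>x. ?p x - ?n x)" "J c ?h v = J c ?h (\<lambda>x. ?p x - ?n x)" by auto
    then show ?thesis
      using pos[OF p(1)] pos[OF p(2)] p uL \<phi>L by (simp add: ip_diff_right J_diff_right[OF c])
  qed
  then show ?thesis using uL by (simp add: weak_resolvent_def)
qed

lemma AE_zero_of_ip:
  assumes d: "d \<in> L2 M" and z: "\<And>h. h \<in> L2 M \<Longrightarrow> (\<And>x. 0 \<le> h x) \<Longrightarrow> ip d h = 0"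
  shows "AE x in M. d x = 0"
proof -
  have [measurable]: "d \<in> BM" using d by auto
  have *: "AE x in M. e x \<le> 0" if e: "e \<in> L2 M" "\<And>h. h \<in> L2 M \<Longrightarrow> (\<And>x. 0 \<le> h x) \<Longrightarrow> ip e h = 0" for e
  proof -
    have [measurable]: "e \<in> BM" using e by auto
    let ?p = "\<lambda>x. enn2real (ennreal (e x))"
    have p: "?p \<in> L2 M"
      using L2_enn2real(1)[OF _ nn_integral_square_pos_part[OF e(1)]] by auto
    have "(\<integral>x. e x * ?p x \<partial>M) = 0" using e(2)[OF p] by (simp add: ip_def)
    moreover have "0 \<le> e x * ?p x" for x by (cases "0 \<le> e x") (auto simp: ennreal_neg)
    ultimately have "AE x in M. e x * ?p x = 0"
      by (subst (asm) integral_nonneg_eq_0_iff_AE) (auto intro: L2_integrable_mult e p simp del: mult_eq_0_iff)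
    then show ?thesis
      by eventually_elim (auto simp: ennreal_eq_0_iff enn2real_eq_0_iff)
  qed
  have "AE x in M. - d x \<le> 0"
  proof (intro * L2_uminus d)
    fix h assume "h \<in> L2 M" "\<And>x. 0 \<le> h x"
    from z[OF this] show "ip (\<lambda>x. - d x) h = 0" by (simp add: ip_def)
  qed
  moreover have "AE x in M. d x \<le> 0" by (intro * d z)
  ultimately show ?thesis by eventually_elim auto
qed

text \<open>Existence comes from \<open>R_weak\<close>. Uniqueness follows by pairing with
  nonnegative p, each of which has a weak resolvent and is therefore accessible to
  \<open>form_resolvent_ip\<close>.\<close>

lemma form_resolvent_iff:
  assumes c: "0 < c" and h: "h \<in> L2 M" and \<phi>0: "AE x in M. 0 \<le> h x"
  shows "form_resolvent M \<E>K DK c h u \<longleftrightarrow>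
    u \<in> BM \<and> (AE x in M. u x = enn2real (R c (\<lambda>x. ennreal (h x)) x))"
proof -
  have [measurable]: "h \<in> BM" using h by auto
  let ?f = "\<lambda>x. ennreal (h x)"
  let ?r = "\<lambda>x. enn2real (R c ?f x)"
  have Rm[measurable]: "R c ?f \<in> BM" by (rule R_measurable) auto
  have "weak_resolvent c (\<lambda>x. enn2real (?f x)) ?r"
    by (intro R_weak c nn_integral_square_pos_part h) auto
  moreover have "J c (\<lambda>x. enn2real (?f x)) v = J c h v" if "v \<in> L2 M" for v
  proof -
    have [measurable]: "v \<in> BM" using that by auto
    have "ip (\<lambda>x. enn2real (?f x)) (T t v) = ip h (T t v)" if "0 < t" for t
      using \<phi>0 that by (intro ip_cong) auto
    then show ?thesis
      unfolding J_def by (intro Bochner_Integration.integral_cong) (auto simp: indicator_def simp del: enn2real_ennreal)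
  qed
  ultimately have r: "weak_resolvent c h ?r" by (simp add: weak_resolvent_def)
  then have rL: "?r \<in> L2 M" by (simp add: weak_resolvent_def)
  show ?thesis
  proof safe
    assume u: "form_resolvent M \<E>K DK c h u"
    then have uL: "u \<in> L2 M" by (simp add: form_resolvent_def semigroup_dom_ip)
    then show "u \<in> BM" by auto
    have "AE x in M. u x - ?r x = 0"
    proof (intro AE_zero_of_ip L2_diff uL rL)
      fix p assume p: "p \<in> L2 M" "\<And>x. 0 \<le> p x"
      have [measurable]: "p \<in> BM" using p by auto
      have "weak_resolvent c (\<lambda>x. enn2real (ennreal (p x))) (\<lambda>x. enn2real (R c (\<lambda>x. ennreal (p x)) x))"
        by (intro R_weak c nn_integral_square_pos_part p) auto
      then have w: "weak_resolvent c p (\<lambda>x. enn2real (R c (\<lambda>x. ennreal (p x)) x))"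
        using p(2) by simp
      have "ip u p = J c h p"
        by (rule form_resolvent_ip[OF c h u p(1) w])
      moreover have "ip ?r p = J c h p" using r p by (simp add: weak_resolvent_def)
      ultimately show "ip (\<lambda>x. u x - ?r x) p = 0"
        using uL rL p by (simp add: ip_diff_left)
    qed
    then show "AE x in M. u x = ?r x" by eventually_elim simp
  next
    assume [measurable]: "u \<in> BM" and eq: "AE x in M. u x = ?r x"
    have "u \<in> L2 M" using eq by (intro L2_cong_AE[OF rL]) auto
    moreover have "ip u v = ip ?r v" if "v \<in> L2 M" for v
      using eq that by (intro ip_cong) auto
    ultimately have "weak_resolvent c h u" using r by (simp add: weak_resolvent_def)
    then show "form_resolvent M \<E>K DK c h u" by (rule weak_resolvent_form[OF c h])
  qed
qed

lemma DK_cong: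
  assumes u: "u \<in> DK" and [measurable]: "u' \<in> BM" and eq: "AE x in M. u x = u' x"
  shows "u' \<in> DK"
proof -
  have uL: "u \<in> L2 M" using u by (simp add: semigroup_dom_ip)
  have [measurable]: "u \<in> BM" using uL by auto
  have u'L: "u' \<in> L2 M" by (rule L2_cong_AE[OF uL _ eq]) simp
  have "ip (\<lambda>x. u x - T t u x) u = ip (\<lambda>x. u' x - T t u' x) u'" if t: "0 < t" for t
  proof -
    have "AE x in M. T t u x = T t u' x" using t eq by (intro T_cong) auto
    then have "AE x in M. u x - T t u x = u' x - T t u' x" using eq by eventually_elim simp
    then have "ip (\<lambda>x. u x - T t u x) u = ip (\<lambda>x. u' x - T t u' x) u" using t by (intro ip_cong) auto
    also have "\<dots> = ip (\<lambda>x. u' x - T t u' x) u'" using t eq by (intro ip_cong) auto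
    finally show ?thesis .
  qed
  then have *: "\<forall>\<^sub>F t in at_right 0. ip (\<lambda>x. u x - T t u x) u / t = ip (\<lambda>x. u' x - T t u' x) u' / t"
    using eventually_at_right_less[of 0] by (auto elim!: eventually_mono)
  obtain c where "((\<lambda>t. ip (\<lambda>x. u x - T t u x) u / t) \<longlongrightarrow> c) (at_right 0)"
    using u by (auto simp: semigroup_dom_ip)
  then have "((\<lambda>t. ip (\<lambda>x. u' x - T t u' x) u' / t) \<longlongrightarrow> c) (at_right 0)"
    by (rule Lim_transform_eventually[OF _ *])
  then show ?thesis using u'L by (auto simp: semigroup_dom_ip)
qed

lemma \<E>K_cong_right:
  assumes u: "u \<in> BM" and v: "v \<in> BM" "v' \<in> BM"
    and eq: "AE x in M. v x = v' x"
  shows "\<E>K u v = \<E>K u v'"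
proof -
  have "ip (\<lambda>x. u x - T t u x) v / t = ip (\<lambda>x. u x - T t u x) v' / t" if t: "0 < t" for t
    using t ip_cong(2)[OF v _ eq, of "\<lambda>x. u x - T t u x"] u by simp
  then have *: "\<forall>\<^sub>F t in at_right 0. ip (\<lambda>x. u x - T t u x) v / t = ip (\<lambda>x. u x - T t u x) v' / t"
    using eventually_at_right_less[of 0] by (auto elim!: eventually_mono)
  show ?thesis
    unfolding semigroup_form_ip Topological_Spaces.Lim_def using tendsto_cong[OF *] by simp
qed

end

section \<open>Potentials of order zero\<close>

context symmetric_semigroup
begin

lemma R_cong:
  assumes "f \<in> BM" "g \<in> BM" "AE x in M. f x = g x"
  shows "AE x in M. R c f x = R c g x"
proof (rule R_eqI)
  fix q :: "'a \<Rightarrow> ennreal" assume q: "q \<in> BM"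
  have "(\<integral>\<^sup>+x. R c f x * q x \<partial>M) = U c f q" by (intro nn_integral_R assms q)
  also have "\<dots> = U c g q" using assms q by (intro U_cong_bil bil_cong) auto
  finally show "(\<integral>\<^sup>+x. R c f x * q x \<partial>M) = U c g q" .
qed (use assms in \<open>auto intro: R_measurable\<close>)

lemma U_mono_left: "AE x in M. f x \<le> f' x \<Longrightarrow> U c f g \<le> U c f' g"
  by (intro U_mono_bil bil_mono_left)

lemma R_mono_fun:
  assumes "f \<in> BM" "f' \<in> BM" "AE x in M. f x \<le> f' x"
  shows "AE x in M. R c f x \<le> R c f' x"
  using assms by (intro R_mono U_mono_left)

lemma R_SUP:
  assumes [measurable]: "\<And>i::nat. g i \<in> BM" and g: "incseq g"
  shows "AE x in M. R c (\<lambda>x. SUP i. g i x) x = (SUP i. R c (g i) x)"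
proof -
  have [measurable]: "R c (g i) \<in> BM" for i by (rule R_measurable) auto
  have inc: "AE x in M. \<forall>i. R c (g i) x \<le> R c (g (Suc i)) x"
    using g by (subst AE_all_countable, intro allI R_mono_fun) (auto simp: incseq_Suc_iff le_fun_def)
  have "AE x in M. (SUP i. R c (g i) x) = R c (\<lambda>x. SUP i. g i x) x"
  proof (rule R_eqI)
    fix q :: "'a \<Rightarrow> ennreal" assume [measurable]: "q \<in> BM"
    have "(\<integral>\<^sup>+x. (SUP i. R c (g i) x) * q x \<partial>M) = (\<integral>\<^sup>+x. (SUP i. R c (g i) x * q x) \<partial>M)"
      by (simp add: SUP_mult_right_ennreal)
    also have "\<dots> = (SUP i. \<integral>\<^sup>+x. R c (g i) x * q x \<partial>M)"
      using inc by (intro nn_integral_monotone_convergence_SUP_AE) (auto elim!: eventually_mono intro: mult_right_mono)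
    also have "\<dots> = U c (\<lambda>x. SUP i. g i x) q"
      using g by (simp add: nn_integral_R U_SUP_left)
    finally show "(\<integral>\<^sup>+x. (SUP i. R c (g i) x) * q x \<partial>M) = U c (\<lambda>x. SUP i. g i x) q" .
  qed auto
  then show ?thesis by eventually_elim simp
qed

lemma exp_inverse_Suc_mono:
  "0 < t \<Longrightarrow> ennreal (exp (- (1 / real (Suc i)) * t)) \<le> ennreal (exp (- (1 / real (Suc (Suc i))) * t))"
  by (rule ennreal_leI) (simp add: frac_le)

text \<open>Monotone convergence as the rate decreases to 0; the rates 1 / Suc n are those in
  \<open>form_potential\<close>.\<close>

lemma R_potential:
  assumes [measurable]: "g \<in> BM"
  shows "AE x in M. R 0 g x = (SUP n. R (1 / real (Suc n)) g x)"
proof -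
  have [measurable]: "R c g \<in> BM" for c by (rule R_measurable) auto
  have mono: "U (1 / real (Suc i)) g q \<le> U (1 / real (Suc (Suc i))) g q" for i q
    unfolding U_def
    by (intro nn_integral_mono) (use exp_inverse_Suc_mono[of _ i] in \<open>auto simp del: of_nat_Suc simp: indicator_def intro!: mult_right_mono\<close>)
  have inc: "AE x in M. \<forall>i. R (1 / real (Suc i)) g x \<le> R (1 / real (Suc (Suc i))) g x"
    by (subst AE_all_countable) (intro allI R_mono mono, auto)
  have "AE x in M. (SUP i. R (1 / real (Suc i)) g x) = R 0 g x"
  proof (rule R_eqI)
    fix q :: "'a \<Rightarrow> ennreal" assume [measurable]: "q \<in> BM"
    have [measurable]: "(\<lambda>t. indicator {0<..} t * bil t g q) \<in> borel_measurable borel"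
      by (intro bil_measurable) auto
    have "(\<integral>\<^sup>+x. (SUP i. R (1 / real (Suc i)) g x) * q x \<partial>M) = (\<integral>\<^sup>+x. (SUP i. R (1 / real (Suc i)) g x * q x) \<partial>M)"
      by (simp only: SUP_mult_right_ennreal)
    also have "\<dots> = (SUP i. \<integral>\<^sup>+x. R (1 / real (Suc i)) g x * q x \<partial>M)"
      using inc by (intro nn_integral_monotone_convergence_SUP_AE) (auto elim!: eventually_mono intro: mult_right_mono)
    also have "\<dots> = (SUP i. U (1 / real (Suc i)) g q)"
      by (simp add: nn_integral_R)
    also have "\<dots> = (\<integral>\<^sup>+t. (SUP i. ennreal (exp (- (1 / real (Suc i)) * t)) * (indicator {0<..} t * bil t g q)) \<partial>lborel)"
      unfolding U_def
    proof (rule nn_integral_monotone_convergence_SUP[symmetric])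
      show "incseq (\<lambda>i t. ennreal (exp (- (1 / real (Suc i)) * t)) * (indicator {0<..} t * bil t g q))"
        by (intro incseq_SucI le_funI) (use exp_inverse_Suc_mono in \<open>auto simp del: of_nat_Suc simp: indicator_def intro!: mult_right_mono\<close>)
    qed measurable
    also have "\<dots> = U 0 g q"
      unfolding U_def
    proof (intro nn_integral_cong)
      fix t :: real
      show "(SUP i. ennreal (exp (- (1 / real (Suc i)) * t)) * (indicator {0<..} t * bil t g q)) =
        ennreal (exp (- 0 * t)) * (indicator {0<..} t * bil t g q)"
      proof (cases "0 < t")
        case True
        have "(\<lambda>i. - (1 / real (Suc i)) * t) \<longlonglongrightarrow> - 0 * t"
          using LIMSEQ_inverse_real_of_nat by (intro tendsto_intros) (simp add: inverse_eq_divide)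
        then have "(\<lambda>i. ennreal (exp (- (1 / real (Suc i)) * t))) \<longlonglongrightarrow> ennreal (exp (- 0 * t))"
          by (intro tendsto_ennrealI tendsto_exp)
        moreover have "(\<lambda>i. ennreal (exp (- (1 / real (Suc i)) * t))) \<longlonglongrightarrow> (SUP i. ennreal (exp (- (1 / real (Suc i)) * t)))"
          by (intro LIMSEQ_SUP incseq_SucI exp_inverse_Suc_mono True)
        ultimately have "(SUP i. ennreal (exp (- (1 / real (Suc i)) * t))) = ennreal (exp (- 0 * t))"
          by (rule LIMSEQ_unique[rotated])
        then show ?thesis by (simp only: SUP_mult_right_ennreal[symmetric])
      qed simp
    qed
    finally show "(\<integral>\<^sup>+x. (SUP i. R (1 / real (Suc i)) g x) * q x \<partial>M) = U 0 g q" .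
  qed auto
  then show ?thesis by eventually_elim simp
qed

section \<open>Resolvents, potentials and global properties of the transformed forms\<close>

abbreviation h_resolvent :: "('a \<Rightarrow> ennreal) \<Rightarrow> real \<Rightarrow> ('a \<Rightarrow> real) \<Rightarrow> ('a \<Rightarrow> real) \<Rightarrow> bool" where
  "h_resolvent h \<equiv> form_resolvent (h_measure M h) (h_form \<E>K h) (h_dom DK h)"

abbreviation h_potential :: "('a \<Rightarrow> ennreal) \<Rightarrow> ('a \<Rightarrow> real) \<Rightarrow> ('a \<Rightarrow> ennreal) \<Rightarrow> bool" where
  "h_potential h \<equiv> form_potential (h_measure M h) (h_form \<E>K h) (h_dom DK h)"

text \<open>Multiplication by h is an isometry from L2 of \<open>h_measure M h\<close> to L2 of M
  that carries the transformed form to the original one. As h is positive and finite only almost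
  everywhere, the way back by division is taken up to null sets.\<close>

lemma h_form_resolvent_iff:
  assumes h[measurable]: "h \<in> BM" and h0: "AE x in M. 0 < h x \<and> h x < \<infinity>"
    and c: "0 < c" and g[measurable]: "g \<in> BM" and g0: "AE x in M. 0 \<le> g x"
    and gL: "(\<lambda>x. g x * enn2real (h x)) \<in> L2 M"
  shows "h_resolvent h c g u \<longleftrightarrow>
     (\<lambda>x. u x * enn2real (h x)) \<in> BM \<and>
     (AE x in M. u x * enn2real (h x) = enn2real (R c (\<lambda>x. ennreal (g x) * h x) x))"
proof -
  let ?h = "\<lambda>x. enn2real (h x)"
  have hpos: "AE x in M. 0 < ?h x"
    using h0 by eventually_elim (auto simp: enn2real_positive_iff)
  have meas: "v \<in> BM" if "(\<lambda>x. v x * ?h x) \<in> BM" for v :: "'a \<Rightarrow> real"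
  proof (rule borel_measurable_AE_cong)
    show "(\<lambda>x. v x * ?h x / ?h x) \<in> BM" using that by measurable
    show "AE x in M. v x * ?h x / ?h x = v x" using hpos by eventually_elim auto
  qed
  have int: "(\<integral>x. a x * b x \<partial>h_measure M h) = (\<integral>x. (a x * ?h x) * (b x * ?h x) \<partial>M)"
    if [measurable]: "a \<in> BM" "b \<in> BM" for a b :: "'a \<Rightarrow> real"
  proof -
    have "h_measure M h = density M (\<lambda>x. ennreal ((?h x)\<^sup>2))"
      unfolding h_measure_def using h0
      by (intro density_cong) (auto simp: ennreal_power[symmetric] less_top)
    then have "(\<integral>x. a x * b x \<partial>h_measure M h) = (\<integral>x. (?h x)\<^sup>2 * (a x * b x) \<partial>M)"
      by (simp add: integral_density)
    then show ?thesis by (simp add: power2_eq_square ac_simps)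
  qed
  have DKm: "v \<in> BM" if "v \<in> DK" for v using that by (auto simp: semigroup_dom_ip)
  have "h_resolvent h c g u \<longleftrightarrow>
    form_resolvent M \<E>K DK c (\<lambda>x. g x * ?h x) (\<lambda>x. u x * ?h x)" (is "?L = ?R")
  proof
    assume L: ?L
    then have uD: "(\<lambda>x. u x * ?h x) \<in> DK" by (simp add: form_resolvent_def h_dom_def)
    then have [measurable]: "u \<in> BM" by (rule meas[OF DKm])
    show ?R unfolding form_resolvent_def
    proof (intro conjI uD ballI)
      fix v assume v: "v \<in> DK"
      then have vm[measurable]: "v \<in> BM" by (rule DKm)
      \<comment> \<open>The inverse of the isometry: every test function v of the original form is,
        almost everywhere, h times this one.\<close>
      let ?v = "\<lambda>x. v x / ?h x"
      have veq: "AE x in M. v x = ?v x * ?h x" using hpos by eventually_elim auto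
      have vD: "?v \<in> h_dom DK h"
        unfolding h_dom_def using veq v by (auto intro!: DK_cong[of v])
      have um: "u \<in> BM" and v'm: "?v \<in> BM" by measurable
      have "\<E>K (\<lambda>x. u x * ?h x) (\<lambda>x. ?v x * ?h x) + c * (\<integral>x. (u x * ?h x) * (?v x * ?h x) \<partial>M) = (\<integral>x. (g x * ?h x) * (?v x * ?h x) \<partial>M)"
        using bspec[OF conjunct2[OF L[unfolded form_resolvent_def h_form_def]] vD] unfolding int[OF um v'm] int[OF g v'm] .
      moreover have "\<E>K (\<lambda>x. u x * ?h x) (\<lambda>x. ?v x * ?h x) = \<E>K (\<lambda>x. u x * ?h x) v"
        using veq by (intro \<E>K_cong_right) auto
      moreover have "(\<integral>x. (u x * ?h x) * (?v x * ?h x) \<partial>M) = (\<integral>x. (u x * ?h x) * v x \<partial>M)"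
        "(\<integral>x. (g x * ?h x) * (?v x * ?h x) \<partial>M) = (\<integral>x. (g x * ?h x) * v x \<partial>M)"
        using veq by (auto intro!: integral_cong_AE)
      ultimately show "\<E>K (\<lambda>x. u x * ?h x) v + c * (\<integral>x. u x * ?h x * v x \<partial>M) = (\<integral>x. g x * ?h x * v x \<partial>M)"
        by simp
    qed
  next
    assume R: ?R
    then have uD: "(\<lambda>x. u x * ?h x) \<in> DK" by (simp add: form_resolvent_def)
    then have [measurable]: "u \<in> BM" by (rule meas[OF DKm])
    show ?L unfolding form_resolvent_def
    proof (intro conjI ballI)
      show "u \<in> h_dom DK h" using uD by (simp add: h_dom_def)
      fix v assume "v \<in> h_dom DK h"
      then have v: "(\<lambda>x. v x * ?h x) \<in> DK" by (simp add: h_dom_def)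
      then have [measurable]: "v \<in> BM" by (rule meas[OF DKm])
      show "h_form \<E>K h u v + c * (\<integral>x. u x * v x \<partial>h_measure M h) = (\<integral>x. g x * v x \<partial>h_measure M h)"
        using R v by (simp add: int h_form_def form_resolvent_def)
    qed
  qed
  also have "\<dots> \<longleftrightarrow> (\<lambda>x. u x * ?h x) \<in> BM \<and>
     (AE x in M. u x * ?h x = enn2real (R c (\<lambda>x. ennreal (g x * ?h x)) x))"
  proof (intro form_resolvent_iff c gL)
    show "AE x in M. 0 \<le> g x * ?h x" using g0 by eventually_elim simp
  qed
  also have "(AE x in M. u x * ?h x = enn2real (R c (\<lambda>x. ennreal (g x * ?h x)) x)) \<longleftrightarrow>
     (AE x in M. u x * ?h x = enn2real (R c (\<lambda>x. ennreal (g x) * h x) x))"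
  proof -
    have "AE x in M. R c (\<lambda>x. ennreal (g x * ?h x)) x = R c (\<lambda>x. ennreal (g x) * h x) x"
    proof (rule R_cong)
      show "AE x in M. ennreal (g x * ?h x) = ennreal (g x) * h x"
        using g0 h0 by eventually_elim (auto simp: ennreal_mult less_top)
    qed auto
    then have "AE x in M. (u x * ?h x = enn2real (R c (\<lambda>x. ennreal (g x * ?h x)) x)) =
       (u x * ?h x = enn2real (R c (\<lambda>x. ennreal (g x) * h x) x))"
      by eventually_elim simp
    then show ?thesis by (rule eventually_subst)
  qed
  finally show ?thesis .
qed

lemma integrable_h_measureD:
  assumes h[measurable]: "h \<in> BM" and f: "integrable (h_measure M h) f"
  shows "f \<in> BM" "(\<integral>\<^sup>+x. ennreal \<bar>f x\<bar> * (h x)\<^sup>2 \<partial>M) < \<infinity>"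
proof -
  show fm[measurable]: "f \<in> BM"
    using borel_measurable_integrable[OF f] by (simp add: h_measure_def)
  have "(\<integral>\<^sup>+x. ennreal \<bar>f x\<bar> \<partial>h_measure M h) < \<infinity>"
    using f by (simp add: integrable_iff_bounded)
  then show "(\<integral>\<^sup>+x. ennreal \<bar>f x\<bar> * (h x)\<^sup>2 \<partial>M) < \<infinity>"
    by (simp add: h_measure_def nn_integral_density mult.commute)
qed

lemma AE_h_measure:
  assumes [measurable]: "h \<in> BM" and h0: "AE x in M. 0 < h x \<and> h x < \<infinity>"
  shows "(AE x in h_measure M h. P x) \<longleftrightarrow> (AE x in M. P x)"
proof -
  have "(AE x in h_measure M h. P x) \<longleftrightarrow> (AE x in M. 0 < (h x)\<^sup>2 \<longrightarrow> P x)"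
    unfolding h_measure_def by (rule AE_density) auto
  also have "\<dots> \<longleftrightarrow> (AE x in M. P x)"
  proof (rule eventually_subst)
    show "AE x in M. (0 < (h x)\<^sup>2 \<longrightarrow> P x) = P x"
      using h0 by eventually_elim (simp add: power2_eq_square ennreal_zero_less_mult_iff)
  qed
  finally show ?thesis .
qed

lemma divide_times_cancel:
  assumes "0 < c" "c < (\<infinity> :: ennreal)"
  shows "a / c * c = a"
  using assms by (metis ennreal_divide_times ennreal_divide_self infinity_ennreal_def mult.right_neutral not_gr_zero)

text \<open>The equation is kept multiplied by h, so that infinite values cause no trouble. The
  truncations of f times h lie in L2 of M; monotone limits in the truncation level and then in the
  rate produce \<open>R 0\<close>.\<close>

lemma h_form_potential_iff:
  assumes h[measurable]: "h \<in> BM" and h0: "AE x in M. 0 < h x \<and> h x < \<infinity>"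
    and f: "integrable (h_measure M h) f" and f0: "AE x in M. 0 \<le> f x"
  shows "h_potential h f w \<longleftrightarrow>
     (AE x in M. w x * h x = R 0 (\<lambda>x. ennreal (f x) * h x) x)"
proof -
  let ?h = "\<lambda>x. enn2real (h x)"
  let ?r = "\<lambda>n. 1 / real (Suc n)"
  have [measurable]: "f \<in> BM" by (rule integrable_h_measureD[OF h f])
  define g where "g k x = min (f x) (real k)" for k :: nat and x
  have [measurable]: "g k \<in> BM" for k unfolding g_def by measurable
  have g0: "AE x in M. 0 \<le> g k x" for k using f0 by eventually_elim (auto simp: g_def)
  have gL: "(\<lambda>x. g k x * ?h x) \<in> L2 M" for k
    unfolding L2_iff_nn_integral
  proof
    have "(\<integral>\<^sup>+x. ennreal ((g k x * ?h x)\<^sup>2) \<partial>M) \<le> (\<integral>\<^sup>+x. of_nat k * (ennreal \<bar>f x\<bar> * (h x)\<^sup>2) \<partial>M)"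
    proof (intro nn_integral_mono_AE, use f0 h0 in eventually_elim)
      fix x assume x: "0 \<le> f x" "0 < h x \<and> h x < \<infinity>"
      then obtain a where a: "h x = ennreal a" "0 < a" by (cases "h x") auto
      \<comment> \<open>This is how integrability of f becomes square integrability of its
        truncations: one factor is bounded by k, the other by f.\<close>
      have "(g k x)\<^sup>2 \<le> real k * f x"
        unfolding power2_eq_square g_def using x(1) by (intro mult_mono) auto
      then have "(g k x * a)\<^sup>2 \<le> real k * (f x * a\<^sup>2)"
        unfolding power_mult_distrib by (metis mult.assoc mult_right_mono zero_le_power2)
      then have "ennreal ((g k x * a)\<^sup>2) \<le> ennreal (real k * (f x * a\<^sup>2))" by (rule ennreal_leI)
      also have "\<dots> = of_nat k * (ennreal \<bar>f x\<bar> * (h x)\<^sup>2)"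
        using x(1) a by (simp add: ennreal_mult ennreal_power ennreal_of_nat_eq_real_of_nat)
      finally show "ennreal ((g k x * ?h x)\<^sup>2) \<le> of_nat k * (ennreal \<bar>f x\<bar> * (h x)\<^sup>2)"
        using a by simp
    qed
    also have "\<dots> = of_nat k * (\<integral>\<^sup>+x. ennreal \<bar>f x\<bar> * (h x)\<^sup>2 \<partial>M)"
      by (rule nn_integral_cmult) auto
    also have "\<dots> < \<infinity>"
      using integrable_h_measureD(2)[OF h f] by (simp add: ennreal_mult_less_top of_nat_less_top)
    finally show "(\<integral>\<^sup>+x. ennreal ((g k x * ?h x)\<^sup>2) \<partial>M) < \<infinity>" .
  qed measurable
  define G where "G k x = ennreal (g k x) * h x" for k x
  have [measurable]: "G k \<in> BM" for k unfolding G_def by measurable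
  have RGm[measurable]: "R \<alpha> (G k) \<in> BM" for \<alpha> k by (rule R_measurable) auto
  have G2: "(\<integral>\<^sup>+x. (G k x)\<^sup>2 \<partial>M) < \<infinity>" for k
  proof -
    have "(\<integral>\<^sup>+x. (G k x)\<^sup>2 \<partial>M) = (\<integral>\<^sup>+x. (ennreal (g k x * ?h x))\<^sup>2 \<partial>M)"
    proof (intro nn_integral_cong_AE)
      show "AE x in M. (G k x)\<^sup>2 = (ennreal (g k x * ?h x))\<^sup>2"
        using g0[of k] h0 by eventually_elim (simp add: G_def ennreal_mult less_top)
    qed
    then show ?thesis using nn_integral_square_pos_part[OF gL[of k]] by simp
  qed
  have RGfin: "AE x in M. \<forall>n k. R (?r n) (G k) x < \<infinity>"
    unfolding AE_all_countable by (intro allI L2_enn2real(2)[OF RGm R_L2] G2) auto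
  have res: "h_resolvent h (?r n) (\<lambda>x. min (f x) (real k)) u \<longleftrightarrow>
     (\<lambda>x. u x * ?h x) \<in> BM \<and> (AE x in M. u x * ?h x = enn2real (R (?r n) (G k) x))" for n k u
    using h_form_resolvent_iff[OF h h0 _ _ g0 gL, of "?r n" k u] unfolding G_def[abs_def] g_def by simp
  have incG: "incseq G"
  proof (rule incseq_SucI, rule le_funI)
    fix k x show "G k x \<le> G (Suc k) x"
      unfolding G_def g_def by (intro mult_right_mono ennreal_leI min.mono) auto
  qed
  have GSUP: "AE x in M. (SUP k. G k x) = ennreal (f x) * h x"
  proof -
    have "(SUP k. ennreal (g k x)) = ennreal (f x)" for x
    proof (rule antisym)
      show "(SUP k. ennreal (g k x)) \<le> ennreal (f x)"
        by (rule SUP_least) (auto simp: g_def intro!: ennreal_leI)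
      obtain k where "f x \<le> real k" using real_arch_simple by blast
      then show "ennreal (f x) \<le> (SUP k. ennreal (g k x))"
        by (intro SUP_upper2[of k]) (auto simp: g_def)
    qed
    then show ?thesis unfolding G_def by (simp add: SUP_mult_right_ennreal[symmetric])
  qed
  have lim: "AE x in M. R 0 (\<lambda>x. ennreal (f x) * h x) x = (SUP n. SUP k. R (?r n) (G k) x)"
  proof -
    have "AE x in M. R 0 (\<lambda>x. ennreal (f x) * h x) x = R 0 (\<lambda>x. SUP k. G k x) x"
      using GSUP by (intro R_cong) (auto elim: eventually_mono)
    moreover have "AE x in M. R 0 (\<lambda>x. SUP k. G k x) x = (SUP n. R (?r n) (\<lambda>x. SUP k. G k x) x)"
      by (intro R_potential) auto
    moreover have "AE x in M. \<forall>n. R (?r n) (\<lambda>x. SUP k. G k x) x = (SUP k. R (?r n) (G k) x)"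
      unfolding AE_all_countable by (intro allI R_SUP incG) auto
    ultimately show ?thesis by eventually_elim simp
  qed
  \<comment> \<open>At a point where h is positive and finite, multiplication by h is injective on
    [0,\<infinity>] and commutes with suprema.\<close>
  have key: "(w x = (SUP n. SUP k. ennreal (u n k x))) \<longleftrightarrow> w x * h x = (SUP n. SUP k. R (?r n) (G k) x)"
    if x: "0 < h x \<and> h x < \<infinity>" "\<forall>n k. R (?r n) (G k) x < \<infinity>"
      "\<forall>n k. u n k x * ?h x = enn2real (R (?r n) (G k) x)" for x u
  proof -
    have "ennreal (u n k x) * h x = R (?r n) (G k) x" for n k
    proof -
      obtain a where a: "h x = ennreal a" "0 < a" using x(1) by (cases "h x") auto
      have "u n k x * a = enn2real (R (?r n) (G k) x)" using x(3) a by simp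
      moreover then have "0 \<le> u n k x"
        using a by (metis enn2real_nonneg zero_le_mult_iff less_le_not_le)
      ultimately show ?thesis
        using a x(2) by (simp add: ennreal_mult[symmetric] less_top)
    qed
    then have "(SUP n. SUP k. R (?r n) (G k) x) = (SUP n. SUP k. ennreal (u n k x)) * h x"
      by (simp add: SUP_mult_right_ennreal)
    moreover have "a * h x = b * h x \<longleftrightarrow> a = b" for a b
    proof -
      obtain c where "h x = ennreal c" "0 < c" using x(1) by (cases "h x") auto
      then show ?thesis
        by (cases a; cases b) (auto simp: ennreal_mult[symmetric] ennreal_top_mult)
    qed
    ultimately show ?thesis by simp
  qed
  show ?thesis
  proof
    assume "h_potential h f w"
    then obtain u where u: "\<And>n k. h_resolvent h (?r n) (\<lambda>x. min (f x) (real k)) (u n k)"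
      and w: "AE x in M. w x = (SUP n. SUP k. ennreal (u n k x))"
      unfolding form_potential_def AE_h_measure[OF h h0] by blast
    have "AE x in M. \<forall>n k. u n k x * ?h x = enn2real (R (?r n) (G k) x)"
      using u unfolding res AE_all_countable by blast
    with w RGfin h0 lim show "AE x in M. w x * h x = R 0 (\<lambda>x. ennreal (f x) * h x) x"
    proof eventually_elim
      case (elim x)
      show ?case using key[of x u, OF elim(3,2,5)] elim(1,4) by simp
    qed
  next
    assume w: "AE x in M. w x * h x = R 0 (\<lambda>x. ennreal (f x) * h x) x"
    define u where "u n k x = enn2real (R (?r n) (G k) x) / ?h x" for n k x
    have eq: "AE x in M. \<forall>n k. u n k x * ?h x = enn2real (R (?r n) (G k) x)"
      using h0 by eventually_elim (auto simp: u_def enn2real_eq_0_iff)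
    have "AE x in M. w x = (SUP n. SUP k. ennreal (u n k x))"
      using w RGfin h0 lim eq
    proof eventually_elim
      case (elim x)
      show ?case using key[of x u, OF elim(3,2,5)] elim(1,4) by simp
    qed
    moreover have "h_resolvent h (?r n) (\<lambda>x. min (f x) (real k)) (u n k)" for n k
      unfolding res
    proof
      show "(\<lambda>x. u n k x * ?h x) \<in> BM" unfolding u_def by measurable
      show "AE x in M. u n k x * ?h x = enn2real (R (?r n) (G k) x)"
        using eq by eventually_elim simp
    qed
    ultimately show "h_potential h f w"
      unfolding form_potential_def AE_h_measure[OF h h0] by blast
  qed
qed

lemma ex_pos_integrable: "\<exists>p\<in>BM. (\<forall>x. 0 < p x \<and> p x < \<infinity>) \<and> (\<integral>\<^sup>+x. p x \<partial>M) < \<infinity>"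
proof -
  obtain p where p[measurable]: "p \<in> BM" and "integral\<^sup>N M p \<noteq> \<infinity>" "\<forall>x\<in>space M. 0 < p x \<and> p x < \<infinity>"
    using Ex_finite_integrable_function by blast
  then have "(\<integral>\<^sup>+x. (if x \<in> space M then p x else 1) \<partial>M) < \<infinity>"
    by (simp add: less_top cong: nn_integral_cong)
  then show ?thesis
    using \<open>\<forall>x\<in>space M. _ x\<close>
    by (intro bexI[of _ "\<lambda>x. if x \<in> space M then p x else 1"]) (auto cong: measurable_cong)
qed

lemma integrable_h_measureI:
  assumes [measurable]: "h \<in> BM" "q \<in> BM" "p \<in> BM"
    and p: "(\<integral>\<^sup>+x. p x \<partial>M) < \<infinity>" and le: "AE x in M. q x * (h x)\<^sup>2 \<le> c * p x" and c: "c < \<infinity>"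
  shows "integrable (h_measure M h) (\<lambda>x. enn2real (q x))"
proof (rule integrableI_nonneg)
  show "(\<lambda>x. enn2real (q x)) \<in> borel_measurable (h_measure M h)"
    by (simp add: h_measure_def)
  have "(\<integral>\<^sup>+x. ennreal (enn2real (q x)) \<partial>h_measure M h) = (\<integral>\<^sup>+x. (h x)\<^sup>2 * ennreal (enn2real (q x)) \<partial>M)"
    unfolding h_measure_def by (rule nn_integral_density) auto
  also have "\<dots> \<le> (\<integral>\<^sup>+x. c * p x \<partial>M)"
  proof (rule nn_integral_mono_AE, use le in eventually_elim)
    fix x assume x: "q x * (h x)\<^sup>2 \<le> c * p x"
    have "ennreal (enn2real (q x)) \<le> q x" by (cases "q x") auto
    then have "(h x)\<^sup>2 * ennreal (enn2real (q x)) \<le> (h x)\<^sup>2 * q x" by (rule mult_left_mono) simp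
    with x show "(h x)\<^sup>2 * ennreal (enn2real (q x)) \<le> c * p x" by (simp add: mult.commute)
  qed
  also have "\<dots> = c * (\<integral>\<^sup>+x. p x \<partial>M)" by (rule nn_integral_cmult) auto
  also have "\<dots> < \<infinity>" using p c by (simp add: ennreal_mult_less_top)
  finally show "(\<integral>\<^sup>+x. ennreal (enn2real (q x)) \<partial>h_measure M h) < \<infinity>" .
qed simp

text \<open>An arbitrary g is exhausted by functions f h with f integrable for h^2 M. Having only
  the values 0 and \<infinity> survives increasing suprema and multiplication or division by
  h.\<close>

lemma recurrent_h_form_iff:
  assumes h[measurable]: "h \<in> BM" and h0: "AE x in M. 0 < h x \<and> h x < \<infinity>"
  shows "recurrent_form (h_measure M h) (h_form \<E>K h) (h_dom DK h) \<longleftrightarrow>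
    (\<forall>g\<in>BM. AE x in M. R 0 g x = 0 \<or> R 0 g x = \<infinity>)"
proof
  assume rec: "recurrent_form (h_measure M h) (h_form \<E>K h) (h_dom DK h)"
  show "\<forall>g\<in>BM. AE x in M. R 0 g x = 0 \<or> R 0 g x = \<infinity>"
  proof
    fix g :: "'a \<Rightarrow> ennreal" assume [measurable]: "g \<in> BM"
    obtain p where [measurable]: "p \<in> BM" and p: "\<And>x. 0 < p x \<and> p x < \<infinity>" "(\<integral>\<^sup>+x. p x \<partial>M) < \<infinity>"
      using ex_pos_integrable by auto
    \<comment> \<open>The bound k p / h makes (G k / h) h^2 \<le> k p integrable; since p / h is
      positive it increases to \<infinity>, so that G k increases to g almost everywhere.\<close>
    define G where "G k x = min (g x) (of_nat k * (p x / h x))" for k :: nat and x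
    have [measurable]: "G k \<in> BM" for k unfolding G_def by measurable
    have inc: "incseq G"
    proof (rule incseq_SucI, rule le_funI)
      fix k x show "G k x \<le> G (Suc k) x"
        unfolding G_def by (intro min.mono mult_right_mono) auto
    qed
    have GSUP: "AE x in M. g x = (SUP k. G k x)"
      using h0
    proof eventually_elim
      case (elim x)
      obtain a where a: "h x = ennreal a" "0 < a" using elim by (cases "h x") auto
      obtain b where b: "p x = ennreal b" "0 < b" using p(1)[of x] by (cases "p x") auto
      have "0 < p x / h x"
        using a b by (simp add: divide_ennreal)
      then have top: "(SUP k. of_nat k * (p x / h x)) = \<top>"
      proof -
        have "(SUP k. of_nat k * (p x / h x)) = (SUP k::nat. of_nat k) * (p x / h x)"
          by (rule SUP_mult_right_ennreal[symmetric])
        then show ?thesis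
          using \<open>0 < p x / h x\<close> by (simp only: ennreal_SUP_of_nat_eq_top) (simp add: ennreal_top_mult zero_less_iff_neq_zero del: ennreal_divide_eq_0_iff)
      qed
      show "g x = (SUP k. G k x)"
      proof (rule antisym)
        show "g x \<le> (SUP k. G k x)"
        proof (cases "g x = \<top>")
          case True
          then have "(\<lambda>k. G k x) = (\<lambda>k. of_nat k * (p x / h x))" by (simp add: G_def)
          then have "(SUP k. G k x) = \<top>" using top by (simp only:)
          then show ?thesis by (simp only: top_greatest)
        next
          case False
          then have "g x < (SUP k. of_nat k * (p x / h x))" unfolding top by (simp add: less_top)
          then obtain k where "g x < of_nat k * (p x / h x)" by (auto simp: less_SUP_iff)
          then show ?thesis by (intro SUP_upper2[of k]) (auto simp: G_def)
        qed
        show "(SUP k. G k x) \<le> g x" by (rule SUP_least) (simp add: G_def)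
      qed
    qed
    have one: "AE x in M. R 0 (G k) x = 0 \<or> R 0 (G k) x = \<infinity>" for k
    proof -
      let ?f = "\<lambda>x. enn2real (G k x / h x)"
      have int: "integrable (h_measure M h) ?f"
      proof (rule integrable_h_measureI[where p=p and c="of_nat k"])
        show "AE x in M. G k x / h x * (h x)\<^sup>2 \<le> of_nat k * p x"
          using h0
        proof eventually_elim
          case (elim x)
          obtain a where a: "h x = ennreal a" "0 < a" using elim by (cases "h x") auto
          have "G k x / h x * (h x)\<^sup>2 \<le> (of_nat k * (p x / h x)) / h x * (h x)\<^sup>2"
            by (intro mult_right_mono divide_right_mono_ennreal) (auto simp: G_def)
          also have "\<dots> = of_nat k * p x"
            using a p(1)[of x] by (cases "p x") (auto simp: divide_ennreal ennreal_mult[symmetric] ennreal_power ennreal_of_nat_eq_real_of_nat power2_eq_square)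
          finally show ?case .
        qed
      qed (use p in \<open>auto simp: of_nat_less_top\<close>)
      obtain w where w: "h_potential h ?f w"
        "AE x in h_measure M h. w x = 0 \<or> w x = \<infinity>"
        using rec[unfolded recurrent_form_def, rule_format, of ?f] int by auto
      have 1: "AE x in M. w x * h x = R 0 (\<lambda>x. ennreal (?f x) * h x) x"
        using w(1) by (subst (asm) h_form_potential_iff[OF h h0 int]) auto
      have 2: "AE x in M. w x = 0 \<or> w x = \<infinity>"
        using w(2) by (simp add: AE_h_measure[OF h h0])
      have 3: "AE x in M. R 0 (\<lambda>x. ennreal (?f x) * h x) x = R 0 (G k) x"
      proof (rule R_cong)
        show "AE x in M. ennreal (?f x) * h x = G k x"
          using h0
        proof eventually_elim
          case (elim x)
          obtain a where a: "h x = ennreal a" "0 < a" using elim by (cases "h x") auto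
          obtain b where b: "p x = ennreal b" "0 < b" using p(1)[of x] by (cases "p x") auto
          have "G k x \<le> of_nat k * (p x / h x)" by (simp add: G_def)
          also have "\<dots> < \<infinity>" using a b by (simp add: divide_ennreal ennreal_mult_less_top of_nat_less_top)
          finally obtain c where "G k x = ennreal c" "0 \<le> c" by (cases "G k x") auto
          then show ?case using a by (simp add: divide_ennreal ennreal_mult[symmetric])
        qed
      qed auto
      from 1 2 3 h0 show ?thesis
      proof eventually_elim
        case (elim x)
        have "R 0 (G k) x = w x * h x" by (simp only: elim(1,3))
        moreover have "\<top> * h x = \<top>" using elim(4) by (auto simp: ennreal_top_mult)
        ultimately show ?case using elim(2) by (metis infinity_ennreal_def mult_zero_left)
      qed
    qed
    have "AE x in M. R 0 g x = R 0 (\<lambda>x. SUP k. G k x) x"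
      using GSUP by (intro R_cong) auto
    moreover have "AE x in M. R 0 (\<lambda>x. SUP k. G k x) x = (SUP k. R 0 (G k) x)"
      by (intro R_SUP inc) auto
    moreover have "AE x in M. \<forall>k. R 0 (G k) x = 0 \<or> R 0 (G k) x = \<infinity>"
      unfolding AE_all_countable using one by auto
    ultimately show "AE x in M. R 0 g x = 0 \<or> R 0 g x = \<infinity>"
    proof eventually_elim
      case (elim x)
      show ?case
      proof (cases "\<exists>k. R 0 (G k) x = \<infinity>")
        case True
        then show ?thesis using elim(1,2) by (metis SUP_upper UNIV_I infinity_ennreal_def top.extremum_unique)
      next
        case False
        then have "\<And>k. R 0 (G k) x = 0" using elim(3) by auto
        then show ?thesis using elim(1,2) by simp
      qed
    qed
  qed
next
  assume rec: "\<forall>g\<in>BM. AE x in M. R 0 g x = 0 \<or> R 0 g x = \<infinity>"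
  show "recurrent_form (h_measure M h) (h_form \<E>K h) (h_dom DK h)"
    unfolding recurrent_form_def AE_h_measure[OF h h0]
  proof (intro allI impI, elim conjE)
    fix f :: "'a \<Rightarrow> real" assume f: "integrable (h_measure M h) f" and f0: "AE x in M. 0 \<le> f x"
    have [measurable]: "f \<in> BM" by (rule integrable_h_measureD[OF h f])
    let ?W = "R 0 (\<lambda>x. ennreal (f x) * h x)"
    have "AE x in M. ?W x = 0 \<or> ?W x = \<infinity>" using rec by auto
    moreover have "AE x in M. ?W x / h x * h x = ?W x"
      using h0 by eventually_elim (rule divide_times_cancel; simp)
    moreover then have "h_potential h f (\<lambda>x. ?W x / h x)"
      by (subst h_form_potential_iff[OF h h0 f f0]) auto
    ultimately show "\<exists>w. h_potential h f w \<and> (AE x in M. w x = 0 \<or> w x = \<infinity>)"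
    proof (intro exI[of _ "\<lambda>x. ?W x / h x"] conjI)
      assume "AE x in M. ?W x = 0 \<or> ?W x = \<infinity>"
      then show "AE x in M. ?W x / h x = 0 \<or> ?W x / h x = \<infinity>"
        using h0
      proof eventually_elim
        case (elim x)
        then obtain a where "h x = ennreal a" by (cases "h x") auto
        then show ?case using elim(1) by (auto simp: ennreal_top_divide)
      qed
    qed
  qed
qed

text \<open>A strictly positive g with finite potential may fail to give an integrable function for
  h^2 M; but lowering g keeps its potential finite, so g can be cut down until it does.\<close>

lemma transient_h_form_iff:
  assumes h[measurable]: "h \<in> BM" and h0: "AE x in M. 0 < h x \<and> h x < \<infinity>"
  shows "transient_form (h_measure M h) (h_form \<E>K h) (h_dom DK h) \<longleftrightarrow>
    (\<exists>g\<in>BM. (AE x in M. 0 < g x) \<and> (AE x in M. R 0 g x < \<infinity>))"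
proof
  assume "transient_form (h_measure M h) (h_form \<E>K h) (h_dom DK h)"
  then obtain f w where f: "integrable (h_measure M h) f" and fpos: "AE x in M. 0 < f x"
    and w: "h_potential h f w" "AE x in M. w x < \<infinity>"
    unfolding transient_form_def AE_h_measure[OF h h0] by auto
  have [measurable]: "f \<in> BM" by (rule integrable_h_measureD[OF h f])
  have "AE x in M. 0 \<le> f x" using fpos by eventually_elim simp
  from w(1)[unfolded h_form_potential_iff[OF h h0 f this]]
  have eq: "AE x in M. w x * h x = R 0 (\<lambda>x. ennreal (f x) * h x) x" .
  show "\<exists>g\<in>BM. (AE x in M. 0 < g x) \<and> (AE x in M. R 0 g x < \<infinity>)"
  proof (intro bexI[of _ "\<lambda>x. ennreal (f x) * h x"] conjI)
    show "AE x in M. 0 < ennreal (f x) * h x"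
      using fpos h0 by eventually_elim (simp add: ennreal_zero_less_mult_iff)
    show "AE x in M. R 0 (\<lambda>x. ennreal (f x) * h x) x < \<infinity>"
      using eq w(2) h0
    proof eventually_elim
      case (elim x)
      from elim(2,3) have "w x * h x < \<top>" by (simp add: ennreal_mult_less_top)
      then show ?case unfolding elim(1) by simp
    qed
  qed measurable
next
  assume "\<exists>g\<in>BM. (AE x in M. 0 < g x) \<and> (AE x in M. R 0 g x < \<infinity>)"
  then obtain g where [measurable]: "g \<in> BM" and g0: "AE x in M. 0 < g x" and Rg: "AE x in M. R 0 g x < \<infinity>"
    by auto
  obtain p where [measurable]: "p \<in> BM" and p: "\<And>x. 0 < p x \<and> p x < \<infinity>" "(\<integral>\<^sup>+x. p x \<partial>M) < \<infinity>"
    using ex_pos_integrable by auto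
  \<comment> \<open>The first bound gives q h \<le> g and keeps the potential below that of g; the
    second gives q h^2 \<le> p and hence integrability. Both bounds are positive almost
    everywhere.\<close>
  define q where "q x = min (g x / h x) (p x / (h x)\<^sup>2)" for x
  have [measurable]: "q \<in> BM" unfolding q_def by measurable
  let ?f = "\<lambda>x. enn2real (q x)"
  have q: "AE x in M. 0 < q x \<and> q x < \<infinity> \<and> q x * h x \<le> g x \<and> q x * (h x)\<^sup>2 \<le> 1 * p x"
    using h0 g0
  proof eventually_elim
    case (elim x)
    obtain a where a: "h x = ennreal a" "0 < a" using elim by (cases "h x") auto
    obtain b where b: "p x = ennreal b" "0 < b" using p(1)[of x] by (cases "p x") auto
    have 1: "0 < g x / h x" using elim(2) a by (cases "g x") (auto simp: divide_ennreal ennreal_top_divide)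
    have 2: "p x / (h x)\<^sup>2 = ennreal (b / a\<^sup>2)" using a b by (simp add: divide_ennreal ennreal_power)
    have "q x * h x \<le> g x / h x * h x" by (intro mult_right_mono) (auto simp: q_def)
    also have "\<dots> = g x" using elim(1) by (intro divide_times_cancel) auto
    finally have 3: "q x * h x \<le> g x" .
    have "q x * (h x)\<^sup>2 \<le> p x / (h x)\<^sup>2 * (h x)\<^sup>2" by (intro mult_right_mono) (auto simp: q_def)
    also have "\<dots> = p x" unfolding 2 using a b by (simp add: ennreal_mult[symmetric] ennreal_power)
    finally have 4: "q x * (h x)\<^sup>2 \<le> 1 * p x" by simp
    have "0 < p x / (h x)\<^sup>2" "p x / (h x)\<^sup>2 < \<infinity>" unfolding 2 using a b by auto
    then show ?case using 1 3 4 by (auto simp: q_def min_less_iff_disj)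
  qed
  have int: "integrable (h_measure M h) ?f"
    using q p by (intro integrable_h_measureI[where p=p and c=1]) (auto elim: eventually_mono)
  let ?W = "R 0 (\<lambda>x. ennreal (?f x) * h x)"
  have "AE x in M. ?W x \<le> R 0 g x"
  proof (intro R_mono_fun)
    show "AE x in M. ennreal (?f x) * h x \<le> g x"
      using q by eventually_elim (simp add: less_top)
  qed auto
  with Rg have Wfin: "AE x in M. ?W x < \<infinity>" by eventually_elim auto
  have pot: "h_potential h ?f (\<lambda>x. ?W x / h x)"
  proof (subst h_form_potential_iff[OF h h0 int])
    show "AE x in M. ?W x / h x * h x = ?W x"
      using h0 by eventually_elim (rule divide_times_cancel; simp)
  qed simp
  show "transient_form (h_measure M h) (h_form \<E>K h) (h_dom DK h)"
    unfolding transient_form_def AE_h_measure[OF h h0]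
  proof (intro exI[of _ ?f] conjI exI[of _ "\<lambda>x. ?W x / h x"] int pot)
    show "AE x in M. 0 < ?f x" using q by eventually_elim (simp add: enn2real_positive_iff)
    show "AE x in M. ?W x / h x < \<infinity>"
      using h0 Wfin
    proof eventually_elim
      case (elim x)
      obtain a where a: "h x = ennreal a" "0 < a" using elim by (cases "h x") auto
      then show ?case using elim(2) by (cases "?W x") (auto simp: divide_ennreal)
    qed
  qed
qed

end

section \<open>The Markov property\<close>

abbreviation Borel :: "('a::topological_space \<Rightarrow> 'b::topological_space) set" where
  "Borel \<equiv> borel_measurable borel"

lemma space_cemetery_borel[simp]: "space cemetery_borel = UNIV"
  by (simp add: cemetery_borel_def)

lemma sets_cemetery_borel: "sets cemetery_borel = sigma_sets UNIV ((`) Some ` sets borel)"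
  by (simp add: cemetery_borel_def)

lemma Some_image_cemetery_borel: "B \<in> sets borel \<Longrightarrow> Some ` B \<in> sets cemetery_borel"
  by (auto simp: sets_cemetery_borel)

lemma None_cemetery_borel[measurable]: "{None} \<in> sets cemetery_borel"
proof -
  have "space cemetery_borel - Some ` UNIV \<in> sets (cemetery_borel :: 'a::topological_space option measure)"
    by (intro sets.Diff sets.top Some_image_cemetery_borel) auto
  also have "space cemetery_borel - Some ` UNIV = {None :: 'a option}"
    by (auto simp: image_iff)
  finally show ?thesis .
qed

lemma measurable_Some[measurable]: "Some \<in> borel \<rightarrow>\<^sub>M cemetery_borel"
  unfolding cemetery_borel_def
  by (rule measurable_measure_of) (auto simp: inj_vimage_image_eq)

lemma measurable_cemeteryI:
  assumes f: "(\<lambda>x. f (Some x)) \<in> borel \<rightarrow>\<^sub>M N" and None: "f None \<in> space N"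
  shows "f \<in> cemetery_borel \<rightarrow>\<^sub>M N"
proof (rule measurableI)
  fix z show "f z \<in> space N"
    using measurable_space[OF f] None by (cases z) auto
next
  fix A assume A: "A \<in> sets N"
  have "f -` A \<inter> space cemetery_borel = Some ` ((\<lambda>x. f (Some x)) -` A) \<union> (if f None \<in> A then {None} else {})"
  proof (safe, goal_cases)
    case (1 z) then show ?case by (cases z) auto
  qed (auto split: if_splits)
  also have "\<dots> \<in> sets cemetery_borel"
  proof -
    have S: "Some ` ((\<lambda>x. f (Some x)) -` A) \<in> sets cemetery_borel"
      using measurable_sets[OF f A] by (intro Some_image_cemetery_borel) simp
    show ?thesis
      by (cases "f None \<in> A") (use S sets.Un[OF S None_cemetery_borel] in simp_all)
  qed
  finally show "f -` A \<inter> space cemetery_borel \<in> sets cemetery_borel" .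
qed

lemma measurable_the[measurable]: "the \<in> cemetery_borel \<rightarrow>\<^sub>M borel"
  by (rule measurable_cemeteryI) auto

lemma measurable_ext0: "f \<in> Borel \<Longrightarrow> ext0 f \<in> borel_measurable cemetery_borel"
  by (rule measurable_cemeteryI) (auto simp: ext0_def)

lemma measurable_ext0'[measurable (raw)]:
  "f \<in> Borel \<Longrightarrow> g \<in> M \<rightarrow>\<^sub>M cemetery_borel \<Longrightarrow> (\<lambda>x. ext0 f (g x)) \<in> borel_measurable M"
  by (rule measurable_compose[OF _ measurable_ext0])

lemma ext0_simps[simp]: "ext0 f None = 0" "ext0 f (Some x) = f x"
  by (auto simp: ext0_def)

locale borel_right_process =
  fixes P :: "'a::t2_space option \<Rightarrow> 'w measure"
    and X :: "ennreal \<Rightarrow> 'w \<Rightarrow> 'a option"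
    and \<theta> :: "ennreal \<Rightarrow> 'w \<Rightarrow> 'w"
  assumes right_process: "right_process P X \<theta>"
begin

abbreviation \<F> :: "ennreal \<Rightarrow> 'w measure" where
  "\<F> \<equiv> nat_filtration X"

abbreviation XX :: "real \<Rightarrow> 'w \<Rightarrow> 'a option" where
  "XX t \<equiv> X (ennreal t)"

abbreviation alive :: "real \<Rightarrow> 'w \<Rightarrow> bool" where
  "alive t w \<equiv> XX t w \<noteq> None"

abbreviation BF :: "('w \<Rightarrow> 'b::topological_space) set" where
  "BF \<equiv> borel_measurable (\<F> \<top>)"

abbreviation EE :: "('w \<Rightarrow> ennreal) \<Rightarrow> 'a \<Rightarrow> ennreal" where
  "EE \<Phi> x \<equiv> (\<integral>\<^sup>+w. \<Phi> w \<partial>P (Some x))"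

lemmas right_processD = right_process[unfolded right_process_def]

lemma P_measurable[measurable]: "P \<in> cemetery_borel \<rightarrow>\<^sub>M prob_algebra (\<F> \<top>)"
  by (rule right_processD[THEN conjunct1])

lemma X_zero: "AE w in P z. X 0 w = z"
  by (rule right_processD[THEN conjunct2, THEN conjunct1, rule_format])

lemma X_top: "X \<top> w = None"
  by (rule right_processD[THEN conjunct2, THEN conjunct2, THEN conjunct1, rule_format])

lemma X_dead: "s \<le> t \<Longrightarrow> X s w = None \<Longrightarrow> X t w = None"
  using right_processD[THEN conjunct2, THEN conjunct2, THEN conjunct2, THEN conjunct1] by blast

lemma X_shift: "s < \<top> \<Longrightarrow> X t (\<theta> s w) = X (s + t) w"
  using right_processD[THEN conjunct2, THEN conjunct2, THEN conjunct2, THEN conjunct2, THEN conjunct1] by blast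

lemma X_right_continuous:
  "t < \<top> \<Longrightarrow> X t w = Some y \<Longrightarrow> open U \<Longrightarrow> y \<in> U \<Longrightarrow> (\<forall>\<^sub>F r in at_right t. X r w \<in> Some ` U)"
  using right_processD[THEN conjunct2, THEN conjunct2, THEN conjunct2, THEN conjunct2, THEN conjunct2, THEN conjunct1] by blast

lemma strong_Markov: "stopping_time (right_filtration X) T \<Longrightarrow> L \<in> sets (filtration.pre_sigma UNIV (right_filtration X) T) \<Longrightarrow>
    B \<in> sets cemetery_borel \<Longrightarrow> emeasure (P z) {w\<in>L. X (T w + s) w \<in> B}
       = (\<integral>\<^sup>+w\<in>L. emeasure (P (X (T w) w)) {w'. X s w' \<in> B} \<partial>P z)"
  using right_processD[THEN conjunct2, THEN conjunct2, THEN conjunct2, THEN conjunct2, THEN conjunct2, THEN conjunct2] by simp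

lemma space_\<F>[simp]: "space (\<F> t) = UNIV"
  by (simp add: nat_filtration_def)

lemma sets_\<F>: "sets (\<F> t) = sigma_sets UNIV {X s -` B | s B. s \<le> t \<and> B \<in> sets cemetery_borel}"
  by (simp add: nat_filtration_def)

lemma sets_\<F>_mono: "s \<le> t \<Longrightarrow> sets (\<F> s) \<subseteq> sets (\<F> t)"
  unfolding sets_\<F> by (rule sigma_sets_mono') (force intro: order_trans)

lemma measurable_\<F>_mono: "s \<le> t \<Longrightarrow> f \<in> \<F> s \<rightarrow>\<^sub>M N \<Longrightarrow> f \<in> \<F> t \<rightarrow>\<^sub>M N"
  using sets_\<F>_mono[of s t] by (auto simp: measurable_def)

lemma X_measurable: "s \<le> t \<Longrightarrow> X s \<in> \<F> t \<rightarrow>\<^sub>M cemetery_borel"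
  by (rule measurableI) (auto simp: sets_\<F>)

lemma X_measurable_top[measurable]: "X s \<in> \<F> \<top> \<rightarrow>\<^sub>M cemetery_borel"
  by (rule X_measurable) simp

lemma sets_P[measurable_cong, simp]: "sets (P z) = sets (\<F> \<top>)"
  using measurable_space[OF P_measurable, of z] by (simp add: space_prob_algebra)

lemma space_P[simp]: "space (P z) = UNIV"
  using sets_eq_imp_space_eq[OF sets_P] by simp

lemma prob_space_P: "prob_space (P z)"
  using measurable_space[OF P_measurable, of z] by (simp add: space_prob_algebra)

lemma emeasure_P_space[simp]: "emeasure (P z) UNIV = 1"
  using prob_space.emeasure_space_1[OF prob_space_P, of z] by simp

lemma P_subprob[measurable]: "P \<in> cemetery_borel \<rightarrow>\<^sub>M subprob_algebra (\<F> \<top>)"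
  by (rule measurable_prob_algebraD) (rule P_measurable)

lemma nn_integral_P_measurable[measurable]:
  "f \<in> BF \<Longrightarrow> (\<lambda>z. \<integral>\<^sup>+w. f w \<partial>P z) \<in> borel_measurable cemetery_borel"
  by (rule measurable_compose[OF P_subprob]) (rule nn_integral_measurable_subprob_algebra)

lemma filtration_right: "filtration UNIV (right_filtration X)"
proof
  show "space (right_filtration X i) = UNIV" for i
    by (simp add: right_filtration_def)
  fix i j :: ennreal assume ij: "i \<le> j"
  have sub: "(\<Inter>s\<in>{i<..}. sets (\<F> s)) \<subseteq> Pow UNIV" for i by simp
  show "sets (right_filtration X i) \<subseteq> sets (right_filtration X j)"
  proof (cases "j = \<top>")
    case True
    show ?thesis
    proof (cases "i = \<top>")
      case False
      then have "\<top> \<in> {i<..}" by (simp add: less_top)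
      then have "(\<Inter>s\<in>{i<..}. sets (\<F> s)) \<subseteq> sets (\<F> \<top>)" by blast
      then have "sigma_sets UNIV (\<Inter>s\<in>{i<..}. sets (\<F> s)) \<subseteq> sets (\<F> \<top>)"
        using sets.sigma_sets_subset[of _ "\<F> \<top>"] by simp
      then show ?thesis using True False by (simp add: right_filtration_def)
    qed (use True in simp)
  next
    case False
    then have "i \<noteq> \<top>" using ij by (auto simp: top_unique)
    have "(\<Inter>s\<in>{i<..}. sets (\<F> s)) \<subseteq> (\<Inter>s\<in>{j<..}. sets (\<F> s))" using ij by force
    then show ?thesis using False \<open>i \<noteq> \<top>\<close> by (simp add: right_filtration_def sigma_sets_mono')
  qed
qed

lemma sets_\<F>_right: "t < \<top> \<Longrightarrow> sets (\<F> t) \<subseteq> sets (right_filtration X t)"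
proof
  fix A assume "t < \<top>" "A \<in> sets (\<F> t)"
  then have "A \<in> (\<Inter>s\<in>{t<..}. sets (\<F> s))" using sets_\<F>_mono[of t] by (auto dest: less_imp_le)
  then show "A \<in> sets (right_filtration X t)"
    using \<open>t < \<top>\<close> by (auto simp: right_filtration_def)
qed

text \<open>The strong Markov property at the constant stopping time s; events of
  \<open>\<F> s\<close> belong to the corresponding pre-sigma-algebra because \<open>\<F> s\<close>
  is contained in the right filtration.\<close>

lemma simple_Markov_set:
  assumes s: "s < \<top>" and L: "L \<in> sets (\<F> s)" and B: "B \<in> sets cemetery_borel"
  shows "emeasure (P z) {w\<in>L. X (s + r) w \<in> B} = (\<integral>\<^sup>+w\<in>L. emeasure (P (X s w)) {w'. X r w' \<in> B} \<partial>P z)"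
proof -
  interpret filtration UNIV "right_filtration X" by (rule filtration_right)
  have st: "stopping_time (right_filtration X) (\<lambda>_. s)" by (rule stopping_time_const)
  have "L \<in> sets (pre_sigma (\<lambda>_. s))"
  proof (rule sets_pre_sigmaI[OF st])
    fix t show "{w \<in> L. s \<le> t} \<in> sets (right_filtration X t)"
      using L sets_\<F>_right[OF s] sets_F_mono[of s t] by (cases "s \<le> t") auto
  qed
  from strong_Markov[OF st this B] show ?thesis .
qed

lemma simple_Markov:
  assumes s: "s < \<top>" and V: "V \<in> borel_measurable (\<F> s)" and f[measurable]: "f \<in> borel_measurable cemetery_borel"
  shows "(\<integral>\<^sup>+w. V w * f (X (s + r) w) \<partial>P z) = (\<integral>\<^sup>+w. V w * (\<integral>\<^sup>+w'. f (X r w') \<partial>P (X s w)) \<partial>P z)"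
proof -
  let ?g = "\<lambda>w. \<integral>\<^sup>+w'. f (X r w') \<partial>P (X s w)"
  have ind: "(\<integral>\<^sup>+w. indicator L w * f (X (s + r) w) \<partial>P z) = (\<integral>\<^sup>+w. indicator L w * ?g w \<partial>P z)"
    if L: "L \<in> sets (\<F> s)" for L
  proof -
    have \<Lambda>t[measurable]: "L \<in> sets (\<F> \<top>)" using L sets_\<F>_mono[of s \<top>] by auto
    let ?D = "density (P z) (indicator L)" and ?k = "\<lambda>w. distr (P (X s w)) cemetery_borel (X r)"
    have "?k \<in> \<F> \<top> \<rightarrow>\<^sub>M subprob_algebra cemetery_borel"
      by (rule measurable_compose[OF measurable_compose[OF X_measurable_top P_subprob] measurable_distr[OF X_measurable_top]])
    then have k: "?k \<in> ?D \<rightarrow>\<^sub>M subprob_algebra cemetery_borel"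
      by (subst measurable_cong_sets[of ?D "\<F> \<top>", OF _ refl]) simp_all
    have D: "distr ?D cemetery_borel (X (s + r)) = ?D \<bind> ?k"
    proof (rule measure_eqI)
      show "sets (distr ?D cemetery_borel (X (s + r))) = sets (?D \<bind> ?k)"
        by (subst sets_bind[where N=cemetery_borel]) auto
      fix B assume "B \<in> sets (distr ?D cemetery_borel (X (s + r)))"
      then have B[measurable]: "B \<in> sets cemetery_borel" by simp
      have vimage: "{w. X u w \<in> B} \<in> sets (\<F> \<top>)" for u
        using measurable_sets[OF X_measurable_top B, of u] by (simp add: vimage_def)
      have "emeasure (distr ?D cemetery_borel (X (s + r))) B = emeasure (P z) {w\<in>L. X (s + r) w \<in> B}"
        using vimage[of "s + r"] \<Lambda>t
        by (simp add: emeasure_distr vimage_def emeasure_density indicator_inter_arith[symmetric] Collect_conj_eq)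
      also have "\<dots> = (\<integral>\<^sup>+w\<in>L. emeasure (P (X s w)) {w'. X r w' \<in> B} \<partial>P z)"
        by (rule simple_Markov_set[OF s L B])
      also have "\<dots> = (\<integral>\<^sup>+w. emeasure (?k w) B \<partial>?D)"
        using vimage[of r] by (subst nn_integral_density) (auto simp: emeasure_distr vimage_def mult.commute)
      also have "\<dots> = emeasure (?D \<bind> ?k) B"
        by (rule emeasure_bind[OF _ k B, symmetric]) simp
      finally show "emeasure (distr ?D cemetery_borel (X (s + r))) B = emeasure (?D \<bind> ?k) B" .
    qed
    have "(\<integral>\<^sup>+w. indicator L w * f (X (s + r) w) \<partial>P z) = (\<integral>\<^sup>+y. f y \<partial>distr ?D cemetery_borel (X (s + r)))"
      by (subst nn_integral_distr, measurable, subst nn_integral_density) auto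
    also have "\<dots> = (\<integral>\<^sup>+w. (\<integral>\<^sup>+y. f y \<partial>?k w) \<partial>?D)"
      unfolding D by (rule nn_integral_bind[OF f k])
    also have "\<dots> = (\<integral>\<^sup>+w. indicator L w * ?g w \<partial>P z)"
      by (subst nn_integral_density) (auto simp: nn_integral_distr)
    finally show ?thesis .
  qed
  \<comment> \<open>The measure with density g, restricted to \<open>\<F> s\<close>. For the two
    choices of g these measures agree on events, hence also when integrated against V.\<close>
  define Q where "Q g = distr (density (P z) g) (\<F> s) (\<lambda>w. w)" for g
  have id: "(\<lambda>w. w) \<in> density (P z) g \<rightarrow>\<^sub>M \<F> s" for g
    using measurable_\<F>_mono[of s \<top> "\<lambda>w. w" "\<F> s"] by (simp add: measurable_cong_sets[OF sets_P refl])
  have Q: "(\<integral>\<^sup>+w. W w \<partial>Q g) = (\<integral>\<^sup>+w. W w * g w \<partial>P z)"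
    if W: "W \<in> borel_measurable (\<F> s)" and [measurable]: "g \<in> BF" for W g
  proof -
    have [measurable]: "W \<in> BF" using measurable_\<F>_mono[OF _ W] by simp
    show ?thesis unfolding Q_def
      by (subst nn_integral_distr[OF id], simp add: W, subst nn_integral_density) (auto simp: mult.commute)
  qed
  have "Q (\<lambda>w. f (X (s + r) w)) = Q ?g"
  proof (rule measure_eqI)
    fix A assume "A \<in> sets (Q (\<lambda>w. f (X (s + r) w)))"
    then have A: "A \<in> sets (\<F> s)" by (simp add: Q_def)
    have "emeasure (Q g) A = (\<integral>\<^sup>+w. indicator A w * g w \<partial>P z)" if "g \<in> BF" for g
      using Q[OF borel_measurable_indicator[OF A] that] A by (simp add: Q_def)
    then show "emeasure (Q (\<lambda>w. f (X (s + r) w))) A = emeasure (Q ?g) A" using ind[OF A] by simp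
  qed (simp add: Q_def)
  then show ?thesis using Q[OF V, of "\<lambda>w. f (X (s + r) w)"] Q[OF V, of ?g] by simp
qed

text \<open>An entry of the list is a waiting time together with a function of the position reached
  after it. With waiting times instead of absolute times, a shift changes the starting time only,
  and one step of the recursion is one use of the Markov property.\<close>

primrec path_prod :: "ennreal \<Rightarrow> (ennreal \<times> ('a option \<Rightarrow> ennreal)) list \<Rightarrow> 'w \<Rightarrow> ennreal" where
  "path_prod s [] \<omega> = 1"
| "path_prod s (p # l) \<omega> = snd p (X (s + fst p) \<omega>) * path_prod (s + fst p) l \<omega>"

primrec chain_prod :: "(ennreal \<times> ('a option \<Rightarrow> ennreal)) list \<Rightarrow> 'a option \<Rightarrow> ennreal" where
  "chain_prod [] z = 1"
| "chain_prod (p # l) z = (\<integral>\<^sup>+\<omega>. snd p (X (fst p) \<omega>) * chain_prod l (X (fst p) \<omega>) \<partial>P z)"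

definition valid_chain :: "(ennreal \<times> ('a option \<Rightarrow> ennreal)) list \<Rightarrow> bool" where
  "valid_chain l \<longleftrightarrow> (\<forall>p\<in>set l. fst p < \<top> \<and> snd p \<in> borel_measurable cemetery_borel)"

lemma chain_prod_measurable: "valid_chain l \<Longrightarrow> chain_prod l \<in> borel_measurable cemetery_borel"
proof (induction l)
  case (Cons p l)
  then have [measurable]: "chain_prod l \<in> borel_measurable cemetery_borel" "snd p \<in> borel_measurable cemetery_borel"
    by (auto simp: valid_chain_def)
  show ?case by (simp only: chain_prod.simps[abs_def]) measurable
qed (simp only: chain_prod.simps[abs_def] borel_measurable_const)

lemma path_prod_measurable: "valid_chain l \<Longrightarrow> path_prod s l \<in> BF"
proof (induction l arbitrary: s)
  case (Cons p l)
  then have [measurable]: "path_prod (s + fst p) l \<in> BF" "snd p \<in> borel_measurable cemetery_borel"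
    by (auto simp: valid_chain_def)
  show ?case by (simp only: path_prod.simps[abs_def]) measurable
qed (simp only: path_prod.simps[abs_def] borel_measurable_const)

text \<open>The first factor is known at the time s + fst p and is absorbed into V before the
  induction hypothesis is applied.\<close>

lemma nn_integral_path_prod:
  assumes "s < \<top>" "V \<in> borel_measurable (\<F> s)" "valid_chain l"
  shows "(\<integral>\<^sup>+w. V w * path_prod s l w \<partial>P z) = (\<integral>\<^sup>+w. V w * chain_prod l (X s w) \<partial>P z)"
  using assms
proof (induction l arbitrary: s V)
  case (Cons p l)
  then have p: "fst p < \<top>" "snd p \<in> borel_measurable cemetery_borel" and l: "valid_chain l"
    by (auto simp: valid_chain_def)
  note [measurable] = p(2) chain_prod_measurable[OF l]
  let ?s = "s + fst p"
  have V: "V \<in> borel_measurable (\<F> ?s)"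
    using measurable_\<F>_mono[OF _ Cons.prems(2)] by simp
  have "(\<integral>\<^sup>+w. V w * path_prod s (p # l) w \<partial>P z) = (\<integral>\<^sup>+w. (V w * snd p (X ?s w)) * path_prod ?s l w \<partial>P z)"
    by (simp add: mult.assoc)
  also have "\<dots> = (\<integral>\<^sup>+w. (V w * snd p (X ?s w)) * chain_prod l (X ?s w) \<partial>P z)"
  proof (rule Cons.IH[OF _ _ l])
    show "?s < \<top>" using Cons.prems(1) p(1) by simp
    have "X ?s \<in> \<F> ?s \<rightarrow>\<^sub>M cemetery_borel" by (rule X_measurable) simp
    then show "(\<lambda>w. V w * snd p (X ?s w)) \<in> borel_measurable (\<F> ?s)"
      using V by measurable
  qed
  also have "\<dots> = (\<integral>\<^sup>+w. V w * (\<lambda>y. snd p y * chain_prod l y) (X (s + fst p) w) \<partial>P z)"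
    by (simp add: mult.assoc)
  also have "\<dots> = (\<integral>\<^sup>+w. V w * (\<integral>\<^sup>+w'. (\<lambda>y. snd p y * chain_prod l y) (X (fst p) w') \<partial>P (X s w)) \<partial>P z)"
    by (rule simple_Markov[OF Cons.prems(1,2)]) measurable
  finally show ?case by simp
qed simp

lemma nn_integral_path_prod_0:
  assumes "valid_chain l"
  shows "(\<integral>\<^sup>+w. path_prod 0 l w \<partial>P z) = chain_prod l z"
proof -
  note [measurable] = chain_prod_measurable[OF assms]
  have "(\<integral>\<^sup>+w. path_prod 0 l w \<partial>P z) = (\<integral>\<^sup>+w. chain_prod l (X 0 w) \<partial>P z)"
    using nn_integral_path_prod[of 0 "\<lambda>_. 1" l z] assms by simp
  also have "\<dots> = (\<integral>\<^sup>+w. chain_prod l z \<partial>P z)"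
  proof (rule nn_integral_cong_AE)
    show "AE w in P z. chain_prod l (X 0 w) = chain_prod l z"
      using X_zero[of z] by eventually_elim simp
  qed
  finally show ?thesis by simp
qed

lemma path_prod_shift: "s < \<top> \<Longrightarrow> path_prod r l (\<theta> s w) = path_prod (s + r) l w"
  by (induction l arbitrary: r) (auto simp: X_shift add.assoc)

text \<open>Times are taken below \<top>, where finite waiting times lead; nothing is lost, since X
  \<top> is constant.\<close>

definition cylinders :: "'w set set" where
  "cylinders = {{\<omega>. \<forall>r\<in>J. X r \<omega> \<in> B r} | J B. finite J \<and> J \<subseteq> {..<\<top>} \<and> (\<forall>r. B r \<in> sets cemetery_borel)}"

lemma cylindersI: "finite J \<Longrightarrow> J \<subseteq> {..<\<top>} \<Longrightarrow> (\<And>r. B r \<in> sets cemetery_borel) \<Longrightarrow> {w. \<forall>r\<in>J. X r w \<in> B r} \<in> cylinders"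
  unfolding cylinders_def by blast

lemma Int_stable_cylinders: "Int_stable cylinders"
proof (rule Int_stableI)
  fix a b assume "a \<in> cylinders" "b \<in> cylinders"
  then obtain J B J' B' where a: "a = {w. \<forall>r\<in>J. X r w \<in> B r}" "finite J" "J \<subseteq> {..<\<top>}" "\<And>r. B r \<in> sets cemetery_borel"
    and b: "b = {w. \<forall>r\<in>J'. X r w \<in> B' r}" "finite J'" "J' \<subseteq> {..<\<top>}" "\<And>r. B' r \<in> sets cemetery_borel"
    unfolding cylinders_def by blast
  have "a \<inter> b = {w. \<forall>r\<in>J\<union>J'. X r w \<in> (if r \<in> J then B r else UNIV) \<inter> (if r \<in> J' then B' r else UNIV)}"
    unfolding a b by auto
  also have "\<dots> \<in> cylinders"
  proof (rule cylindersI)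
    have U: "UNIV \<in> sets (cemetery_borel :: 'a option measure)" using sets.top[of cemetery_borel] by simp
    show "(if r \<in> J then B r else UNIV) \<inter> (if r \<in> J' then B' r else UNIV) \<in> sets cemetery_borel" for r
      using a(4)[of r] b(4)[of r] U by (intro sets.Int) auto
  qed (use a b in auto)
  finally show "a \<inter> b \<in> cylinders" .
qed

lemma sets_\<F>_cylinders: "sets (\<F> \<top>) = sigma_sets UNIV cylinders"
proof
  show "sets (\<F> \<top>) \<subseteq> sigma_sets UNIV cylinders"
    unfolding sets_\<F>
  proof (rule sigma_sets_mono, safe)
    fix s and B :: "'a option set" assume B: "B \<in> sets cemetery_borel"
    show "X s -` B \<in> sigma_sets UNIV cylinders"
    proof (cases "s < \<top>")
      case True
      have "{w. \<forall>r\<in>{s}. X r w \<in> B} \<in> cylinders"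
        using True B by (intro cylindersI) auto
      then show ?thesis by (auto simp: vimage_def)
    next
      case False
      then have "s = \<top>" by (simp add: less_top[symmetric])
      then have "X s -` B = (if None \<in> B then UNIV else {})" by (auto simp: X_top)
      then show ?thesis by (simp add: sigma_sets_top sigma_sets.Empty)
    qed
  qed
  have "cylinders \<subseteq> sets (\<F> \<top>)"
  proof
    fix a assume "a \<in> cylinders"
    then obtain J B where a: "a = {w. \<forall>r\<in>J. X r w \<in> B r}" "finite J" "\<And>r. B r \<in> sets cemetery_borel"
      unfolding cylinders_def by blast
    have "a = {w\<in>space (\<F> \<top>). \<forall>r\<in>J. X r w \<in> B r}" using a(1) by simp
    also have "\<dots> \<in> sets (\<F> \<top>)"
      using measurable_sets[OF X_measurable_top a(3)] a(2)
      by (intro sets.sets_Collect_finite_All) (auto simp: vimage_def)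
    finally show "a \<in> sets (\<F> \<top>)" .
  qed
  then show "sigma_sets UNIV cylinders \<subseteq> sets (\<F> \<top>)"
    using sets.sigma_sets_subset[of cylinders "\<F> \<top>"] by simp
qed

lemma shift_measurable: 
  assumes "s < \<top>"
  shows "\<theta> s \<in> \<F> \<top> \<rightarrow>\<^sub>M \<F> \<top>"
  unfolding nat_filtration_def[of X \<top>]
proof (rule measurable_measure_of)
  fix A assume "A \<in> {X s -` B | s B. s \<le> \<top> \<and> B \<in> sets cemetery_borel}"
  then obtain r B where A: "A = X r -` B" "B \<in> sets cemetery_borel" by auto
  have "\<theta> s -` A = X (s + r) -` B" using A X_shift[OF assms] by auto
  then show "\<theta> s -` A \<inter> space (sigma UNIV {X s -` B |s B. s \<le> \<top> \<and> B \<in> sets cemetery_borel}) \<in> sigma UNIV {X s -` B |s B. s \<le> \<top> \<and> B \<in> sets cemetery_borel}"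
    using A(2) by auto
qed auto

lemma shift_measurable_\<F>:
  assumes s: "s < \<top>" and G: "G \<in> \<F> r \<rightarrow>\<^sub>M N"
  shows "(\<lambda>w. G (\<theta> s w)) \<in> \<F> (s + r) \<rightarrow>\<^sub>M N"
proof (rule measurable_compose[OF _ G])
  show "\<theta> s \<in> \<F> (s + r) \<rightarrow>\<^sub>M \<F> r"
    unfolding nat_filtration_def[of X r]
  proof (rule measurable_measure_of)
    fix A assume "A \<in> {X s -` B | s B. s \<le> r \<and> B \<in> sets cemetery_borel}"
    then obtain r' B where A: "A = X r' -` B" "r' \<le> r" "B \<in> sets cemetery_borel" by auto
    have "\<theta> s -` A = X (s + r') -` B \<inter> space (\<F> (s + r))" using A X_shift[OF s] by auto
    then show "\<theta> s -` A \<inter> space (\<F> (s + r)) \<in> \<F> (s + r)"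
      using measurable_sets[OF X_measurable[of "s + r'" "s + r"] A(3)] A(2) by (simp add: add_left_mono)
  qed auto
qed

text \<open>Removing the least time first turns absolute times into waiting times.\<close>

lemma ex_path_prod:
  assumes "finite J" "\<forall>a\<in>J. s \<le> a \<and> a < \<top>" "\<And>r. B r \<in> sets cemetery_borel"
  shows "\<exists>l. valid_chain l \<and> (\<forall>w. path_prod s l w = indicator {w. \<forall>r\<in>J. X r w \<in> B r} w)"
  using assms
proof (induction J arbitrary: s rule: finite_linorder_min_induct)
  case empty
  then show ?case by (intro exI[of _ "[]"]) (auto simp: valid_chain_def)
next
  case (insert b A)
  have "\<exists>l. valid_chain l \<and> (\<forall>w. path_prod b l w = indicator {w. \<forall>r\<in>A. X r w \<in> B r} w)"
    by (rule insert.IH) (use insert.hyps insert.prems in \<open>auto intro: less_imp_le\<close>)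
  then obtain l where l: "valid_chain l" "\<And>w. path_prod b l w = indicator {w. \<forall>r\<in>A. X r w \<in> B r} w"
    by blast
  have sb: "s + (b - s) = b" using insert.prems(1) by (simp add: add_diff_inverse_ennreal)
  have "b - s < \<top>" using insert.prems(1) by (auto intro: le_less_trans[OF diff_le_self_ennreal])
  then have "valid_chain ((b - s, indicator (B b)) # l)"
    using l(1) insert.prems(2) by (auto simp: valid_chain_def)
  moreover have "path_prod s ((b - s, indicator (B b)) # l) w = indicator {w. \<forall>r\<in>insert b A. X r w \<in> B r} w" for w
    by (auto simp: sb l(2) indicator_def)
  ultimately show ?case by blast
qed

text \<open>For an event L, two laws are compared: that of the shifted path and the mixture of the
  laws P (X s). They agree on cylinders, whose indicators are products along the path, hence
  everywhere; V is then built up from indicators.\<close>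

lemma Markov:
  assumes s: "s < \<top>" and V: "V \<in> borel_measurable (\<F> s)" and G: "G \<in> BF"
  shows "(\<integral>\<^sup>+w. V w * G (\<theta> s w) \<partial>P z) = (\<integral>\<^sup>+w. V w * (\<integral>\<^sup>+w'. G w' \<partial>P (X s w)) \<partial>P z)"
proof -
  note [measurable] = shift_measurable[OF s] G
  have top: "g \<in> BF" if "g \<in> borel_measurable (\<F> s)" for g :: "'w \<Rightarrow> ennreal"
    using measurable_\<F>_mono[OF _ that] by simp
  have ind: "(\<integral>\<^sup>+w. indicator L w * G (\<theta> s w) \<partial>P z) = (\<integral>\<^sup>+w. indicator L w * (\<integral>\<^sup>+w'. G w' \<partial>P (X s w)) \<partial>P z)"
    if L: "L \<in> sets (\<F> s)" for L
  proof -
    have \<Lambda>m[measurable]: "L \<in> sets (\<F> \<top>)" using L sets_\<F>_mono[of s \<top>] by auto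
    let ?D = "density (P z) (indicator L)"
    let ?N1 = "distr ?D (\<F> \<top>) (\<theta> s)" and ?N2 = "?D \<bind> (\<lambda>w. P (X s w))"
    have K[measurable]: "(\<lambda>w. P (X s w)) \<in> ?D \<rightarrow>\<^sub>M subprob_algebra (\<F> \<top>)"
      by measurable
    have n1: "(\<integral>\<^sup>+w. f w \<partial>?N1) = (\<integral>\<^sup>+w. indicator L w * f (\<theta> s w) \<partial>P z)"
      if [measurable]: "f \<in> BF" for f
      by (subst nn_integral_distr) (auto simp: nn_integral_density)
    have n2: "(\<integral>\<^sup>+w. f w \<partial>?N2) = (\<integral>\<^sup>+w. indicator L w * (\<integral>\<^sup>+w'. f w' \<partial>P (X s w)) \<partial>P z)"
      if [measurable]: "f \<in> BF" for f
    proof -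
      have [measurable]: "(\<lambda>w. \<integral>\<^sup>+w'. f w' \<partial>P (X s w)) \<in> BF" by measurable
      have "(\<integral>\<^sup>+w. f w \<partial>?N2) = (\<integral>\<^sup>+w. (\<integral>\<^sup>+w'. f w' \<partial>P (X s w)) \<partial>?D)"
        by (rule nn_integral_bind[OF that K])
      then show ?thesis by (simp add: nn_integral_density)
    qed
    have sets_N2: "sets ?N2 = sets (\<F> \<top>)"
      by (rule sets_bind[where N="\<F> \<top>"]) (auto simp: space_density)
    have "?N1 = ?N2"
    proof (rule measure_eqI_generator_eq[OF Int_stable_cylinders, where \<Omega>=UNIV and A="\<lambda>_. UNIV"])
      show "sets ?N1 = sigma_sets UNIV cylinders" by (simp add: sets_\<F>_cylinders)
      show "sets ?N2 = sigma_sets UNIV cylinders" by (simp add: sets_N2 sets_\<F>_cylinders)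
      show "range (\<lambda>_::nat. UNIV) \<subseteq> cylinders"
        using cylindersI[of "{}" "\<lambda>_. {}"] by auto
      show "emeasure ?N1 UNIV \<noteq> \<infinity>" for i :: nat
      proof -
        have "emeasure ?N1 UNIV = emeasure (P z) L"
          using sets.top[of "\<F> \<top>"] by (subst emeasure_distr) (auto simp: emeasure_density)
        also have "\<dots> \<le> 1" using prob_space.emeasure_le_1[OF prob_space_P] .
        finally show ?thesis by (auto simp: top_unique)
      qed
      fix C assume C: "C \<in> cylinders"
      then obtain J B where JB: "C = {w. \<forall>r\<in>J. X r w \<in> B r}" "finite J" "J \<subseteq> {..<\<top>}" "\<And>r. B r \<in> sets cemetery_borel"
        unfolding cylinders_def by blast
      obtain l where l: "valid_chain l" "\<And>w. path_prod 0 l w = indicator C w"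
        using ex_path_prod[of J 0 B] JB by auto
      note [measurable] = path_prod_measurable[OF l(1)]
      have Cm: "C \<in> sets (\<F> \<top>)" using C by (auto simp: sets_\<F>_cylinders)
      have i: "indicator C = path_prod 0 l" using l(2) by (simp add: fun_eq_iff)
      have "emeasure ?N1 C = (\<integral>\<^sup>+w. path_prod 0 l w \<partial>?N1)"
        using Cm by (simp add: i[symmetric])
      also have "\<dots> = (\<integral>\<^sup>+w. indicator L w * path_prod s l w \<partial>P z)"
        by (subst n1) (auto simp: path_prod_shift[OF s] path_prod_measurable l)
      also have "\<dots> = (\<integral>\<^sup>+w. indicator L w * chain_prod l (X s w) \<partial>P z)"
        using L by (intro nn_integral_path_prod s l) auto
      also have "\<dots> = (\<integral>\<^sup>+w. path_prod 0 l w \<partial>?N2)"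
        by (subst n2) (auto simp: nn_integral_path_prod_0 path_prod_measurable l)
      also have "\<dots> = emeasure ?N2 C"
        using Cm by (simp add: i[symmetric] sets_N2)
      finally show "emeasure ?N1 C = emeasure ?N2 C" .
    qed auto
    then show ?thesis using n1[OF G] n2[OF G] by simp
  qed
  have [measurable]: "(\<lambda>w. \<integral>\<^sup>+w'. G w' \<partial>P (X s w)) \<in> BF" by measurable
  have [measurable]: "(\<lambda>w. G (\<theta> s w)) \<in> BF" by measurable
  show ?thesis using V
  proof (induction rule: borel_measurable_induct)
    case (cong f g)
    then show ?case by simp
  next
    case (set A)
    then show ?case by (rule ind)
  next
    case (mult u c)
    then have [measurable]: "u \<in> BF" by (intro top)
    show ?case
      using mult.IH by (simp add: nn_integral_cmult mult.assoc)
  next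
    case (add u v)
    then have [measurable]: "u \<in> BF" "v \<in> BF" by (auto intro!: top)
    show ?case
      using add.IH by (simp add: nn_integral_add distrib_right)
  next
    case (seq U)
    then have [measurable]: "U i \<in> BF" for i by (auto intro!: top)
    have "(\<integral>\<^sup>+w. (SUP i. U i w) * g w \<partial>P z) = (SUP i. \<integral>\<^sup>+w. U i w * g w \<partial>P z)"
      if [measurable]: "g \<in> BF" for g
      unfolding SUP_mult_right_ennreal using seq(3)
      by (intro nn_integral_monotone_convergence_SUP) (auto simp: incseq_def le_fun_def intro: mult_right_mono)
    then show ?case
      using seq.IH by (simp add: image_comp comp_def)
  qed
qed

end

section \<open>Symmetric processes and time reversal\<close>

text \<open>Fractions of the time interval. They are countable, closed under q -> 1 - q, and every
  finite set of them lies on one equidistant grid, where reversal only concerns powers of one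
  symmetric operator interlaced with multiplications.\<close>

definition dyadics :: "real set" where
  "dyadics = {real k / 2 ^ n | k n. k \<le> 2 ^ n}"

lemma dyadicsI: "k \<le> 2 ^ n \<Longrightarrow> real k / 2 ^ n \<in> dyadics"
  by (auto simp: dyadics_def)

lemma dyadics_bounds: "q \<in> dyadics \<Longrightarrow> 0 \<le> q" "q \<in> dyadics \<Longrightarrow> q \<le> 1"
  by (auto simp: dyadics_def divide_le_eq_1 of_nat_le_iff[of _ "2 ^ _", where 'a=real, simplified])

lemma dyadics_0_1[simp]: "0 \<in> dyadics" "1 \<in> dyadics"
  using dyadicsI[of 0 0] dyadicsI[of 1 0] by auto

lemma dyadics_reverse: "q \<in> dyadics \<Longrightarrow> 1 - q \<in> dyadics"
proof -
  assume "q \<in> dyadics"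
  then obtain k n where q: "q = real k / 2 ^ n" "k \<le> 2 ^ n" by (auto simp: dyadics_def)
  then have "1 - q = real (2 ^ n - k) / 2 ^ n" by (simp add: of_nat_diff diff_divide_distrib)
  then show ?thesis using dyadicsI[of "2 ^ n - k" n] by simp
qed

lemma countable_dyadics: "countable dyadics"
proof -
  have "dyadics \<subseteq> (\<lambda>(k, n). real k / 2 ^ n) ` (UNIV :: (nat \<times> nat) set)"
    by (auto simp: dyadics_def)
  then show ?thesis by (rule countable_subset) auto
qed

lemma finite_dyadics_level:
  assumes "finite J" "J \<subseteq> dyadics"
  shows "\<exists>n. \<forall>q\<in>J. \<exists>k\<le>2 ^ n. q = real k / 2 ^ n"
  using assms
proof (induction J rule: finite_induct)
  case (insert q J)
  then obtain n where n: "\<And>r. r \<in> J \<Longrightarrow> \<exists>k\<le>2 ^ n. r = real k / 2 ^ n" by auto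
  obtain k' n' where q: "q = real k' / 2 ^ n'" "k' \<le> 2 ^ n'" using insert by (auto simp: dyadics_def)
  have lift: "\<exists>k\<le>2 ^ (a + b). r = real k / 2 ^ (a + b)" if "\<exists>k\<le>2 ^ a. r = real k / 2 ^ a" for r and a b :: nat
  proof -
    obtain k where k: "k \<le> 2 ^ a" "r = real k / 2 ^ a" using \<open>\<exists>k\<le>2 ^ a. r = real k / 2 ^ a\<close> by blast
    then have "k * 2 ^ b \<le> 2 ^ (a + b)" "r = real (k * 2 ^ b) / 2 ^ (a + b)"
      by (auto simp: power_add)
    then show ?thesis by blast
  qed
  have "\<exists>k\<le>2 ^ (n' + n). q = real k / 2 ^ (n' + n)" using q by (intro lift) auto
  moreover have "\<exists>k\<le>2 ^ (n' + n). r = real k / 2 ^ (n' + n)" if "r \<in> J" for r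
    using lift[OF n[OF that], of n'] by (simp add: add.commute)
  ultimately show ?case by (intro exI[of _ "n' + n"]) auto
qed simp

definition reverse_path :: "(real \<Rightarrow> 'a) \<Rightarrow> real \<Rightarrow> 'a" where
  "reverse_path y = (\<lambda>q\<in>dyadics. y (1 - q))"

lemma reverse_path_measurable[measurable]:
  "reverse_path \<in> (\<Pi>\<^sub>M q\<in>dyadics. N) \<rightarrow>\<^sub>M (\<Pi>\<^sub>M q\<in>dyadics. N)"
  unfolding reverse_path_def
  by (rule measurable_restrict) (auto intro: measurable_component_singleton dyadics_reverse)

lemma reverse_path_apply[simp]: "q \<in> dyadics \<Longrightarrow> reverse_path y q = y (1 - q)"
  by (simp add: reverse_path_def)

locale symmetric_right_process = borel_right_process P X \<theta>
  for P :: "'a::t2_space option \<Rightarrow> 'w measure"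
    and X :: "ennreal \<Rightarrow> 'w \<Rightarrow> 'a option"
    and \<theta> :: "ennreal \<Rightarrow> 'w \<Rightarrow> 'w" +
  fixes m :: "'a measure"
  assumes sets_m[measurable_cong, simp]: "sets m = sets borel"
    and sigma_finite_m: "sigma_finite_measure m"
    and m_nonzero: "emeasure m UNIV \<noteq> 0"
    and symmetric: "symmetric_process m (\<lambda>x. P (Some x)) X"
begin

lemma space_m[simp]: "space m = UNIV"
  using sets_eq_imp_space_eq[OF sets_m] by simp

definition S :: "real \<Rightarrow> ('a \<Rightarrow> ennreal) \<Rightarrow> 'a \<Rightarrow> ennreal" where
  "S t f x = EE (\<lambda>\<omega>. ext0 f (XX t \<omega>)) x"

lemma S_eq: "process_semigroup (\<lambda>x. P (Some x)) X t f x = S t f x"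
  by (simp add: process_semigroup_def S_def nn_integral_completion)

lemma kernel_measurable[measurable]: "(\<lambda>x. P (Some x)) \<in> borel \<rightarrow>\<^sub>M subprob_algebra (\<F> \<top>)"
  by measurable

lemma nn_integral_kernel_measurable[measurable]:
  "G \<in> BF \<Longrightarrow> (\<lambda>x. \<integral>\<^sup>+w. G w \<partial>P (Some x)) \<in> Borel"
  by (rule measurable_compose[OF measurable_Some nn_integral_P_measurable])

lemma S_measurable[measurable (raw)]: "f \<in> Borel \<Longrightarrow> S t f \<in> Borel"
  unfolding S_def[abs_def] by (rule nn_integral_kernel_measurable, rule measurable_compose[OF X_measurable_top measurable_ext0])

lemma S_symmetric:
  "0 < t \<Longrightarrow> f \<in> Borel \<Longrightarrow> g \<in> Borel \<Longrightarrow>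
    (\<integral>\<^sup>+x. f x * S t g x \<partial>m) = (\<integral>\<^sup>+x. S t f x * g x \<partial>m)"
  using symmetric unfolding symmetric_process_def S_eq by blast

lemma P_None: "AE w in P None. X s w = None"
  using X_zero[of None] by eventually_elim (rule X_dead[OF zero_le])

lemma alive_mono: "s \<le> t \<Longrightarrow> X t w \<noteq> None \<Longrightarrow> X s w \<noteq> None"
  using X_dead[of s t w] by (cases "X s w") auto

primrec S_chain :: "real \<Rightarrow> ('a \<Rightarrow> ennreal) list \<Rightarrow> ('a \<Rightarrow> ennreal) \<Rightarrow> 'a \<Rightarrow> ennreal" where
  "S_chain t [] \<phi> = S t \<phi>"
| "S_chain t (a # l) \<phi> = S t (\<lambda>x. a x * S_chain t l \<phi> x)"

lemma S_chain_measurable[measurable (raw)]: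
  "set l \<subseteq> Borel \<Longrightarrow> f \<in> Borel \<Longrightarrow> S_chain t l f \<in> Borel"
  by (induction l) auto

lemma S_chain_append: "S_chain t (l @ [a]) f = S_chain t l (\<lambda>x. a x * S t f x)"
  by (induction l) auto

text \<open>The operators are moved to the other factor one after the other, which reverses the
  order of the functions between them.\<close>

lemma S_chain_symmetric:
  assumes t: "0 < t" and "set l \<subseteq> Borel" "f \<in> Borel" "h \<in> Borel"
  shows "(\<integral>\<^sup>+x. h x * S_chain t l f x \<partial>m) = (\<integral>\<^sup>+x. f x * S_chain t (rev l) h x \<partial>m)"
  using assms(2-)
proof (induction l arbitrary: h)
  case Nil
  then show ?case using S_symmetric[OF t, of h f] by (simp add: mult.commute)
next
  case (Cons a l)
  then have l: "set l \<subseteq> Borel" and [measurable]: "a \<in> Borel" "f \<in> Borel" "h \<in> Borel"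
    by auto
  note [measurable] = S_chain_measurable[OF l]
  have "(\<integral>\<^sup>+x. h x * S_chain t (a # l) f x \<partial>m) = (\<integral>\<^sup>+x. S t h x * (a x * S_chain t l f x) \<partial>m)"
    unfolding S_chain.simps by (rule S_symmetric[OF t]) measurable
  also have "\<dots> = (\<integral>\<^sup>+x. (a x * S t h x) * S_chain t l f x \<partial>m)"
    by (simp add: ac_simps)
  also have "\<dots> = (\<integral>\<^sup>+x. f x * S_chain t (rev l) (\<lambda>x. a x * S t h x) x \<partial>m)"
    by (rule Cons.IH[OF l]) measurable
  finally show ?case by (simp add: S_chain_append)
qed

lemma path_prod_equispaced:
  "path_prod s (map (\<lambda>a. (d, a)) l) w = (\<Prod>i<length l. (l ! i) (X (s + of_nat (Suc i) * d) w))"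
proof (induction l arbitrary: s)
  case (Cons a l)
  have "s + d + of_nat (Suc i) * d = s + of_nat (Suc (Suc i)) * d" for i
    by (simp add: distrib_right add.assoc)
  note eq = this
  have "path_prod s (map (\<lambda>a. (d, a)) (a # l)) w = a (X (s + d) w) * (\<Prod>i<length l. (l ! i) (X (s + d + of_nat (Suc i) * d) w))"
    by (simp add: Cons.IH del: of_nat_Suc)
  also have "\<dots> = a (X (s + d) w) * (\<Prod>i<length l. (l ! i) (X (s + of_nat (Suc (Suc i)) * d) w))"
    by (simp only: eq)
  also have "\<dots> = (\<Prod>i<length (a # l). ((a # l) ! i) (X (s + of_nat (Suc i) * d) w))"
    by (simp only: length_Cons prod.lessThan_Suc_shift nth_Cons_0 nth_Cons_Suc) simp
  finally show ?case .
qed simp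

text \<open>The value 0 at the cemetery belongs to the induction: the remaining chain has to be an
  \<open>ext0\<close> function, also on dead paths.\<close>

lemma chain_prod_S_chain:
  assumes d: "0 < d" and "set l \<subseteq> Borel" "f \<in> Borel"
  shows "chain_prod (map (\<lambda>a. (ennreal d, ext0 a)) (l @ [f])) (Some x) = S_chain d l f x
    \<and> chain_prod (map (\<lambda>a. (ennreal d, ext0 a)) (l @ [f])) None = 0"
  using assms(2-)
proof (induction l arbitrary: x)
  case Nil
  have "(\<integral>\<^sup>+w. ext0 f (XX d w) \<partial>P None) = (\<integral>\<^sup>+w. 0 \<partial>P None)"
    by (rule nn_integral_cong_AE) (use P_None[of "ennreal d"] in eventually_elim, simp)
  then show ?case by (simp add: S_def)
next
  case (Cons a l)
  let ?c = "chain_prod (map (\<lambda>a. (ennreal d, ext0 a)) (l @ [f]))"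
  have IH: "?c (Some y) = S_chain d l f y" "?c None = 0" for y
    using Cons by auto
  have "ext0 a z * ?c z = ext0 (\<lambda>y. a y * S_chain d l f y) z" for z
    by (cases z) (simp_all only: IH ext0_simps mult_zero_left)
  moreover have "(\<integral>\<^sup>+w. ext0 (\<lambda>y. a y * S_chain d l f y) (XX d w) \<partial>P None) = (\<integral>\<^sup>+w. 0 \<partial>P None)"
    by (rule nn_integral_cong_AE) (use P_None[of "ennreal d"] in eventually_elim, simp)
  ultimately show ?case by (simp add: S_def del: map_append)
qed

definition path :: "real \<Rightarrow> 'w \<Rightarrow> real \<Rightarrow> 'a" where
  "path t \<omega> = (\<lambda>q\<in>dyadics. the (XX (t * q) \<omega>))"

abbreviation path_space :: "(real \<Rightarrow> 'a) measure" where
  "path_space \<equiv> \<Pi>\<^sub>M q\<in>dyadics. borel"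

abbreviation BP :: "((real \<Rightarrow> 'a) \<Rightarrow> 'b::topological_space) set" where
  "BP \<equiv> borel_measurable path_space"

lemma path_measurable[measurable]: "path t \<in> \<F> \<top> \<rightarrow>\<^sub>M path_space"
  unfolding path_def by (rule measurable_restrict) measurable

lemma path_measurable_\<F>: "0 \<le> t \<Longrightarrow> path t \<in> \<F> (ennreal t) \<rightarrow>\<^sub>M path_space"
  unfolding path_def
proof (rule measurable_restrict)
  fix q assume "0 \<le> t" "q \<in> dyadics"
  then have "ennreal (t * q) \<le> ennreal t"
    using dyadics_bounds(2)[of q] by (intro ennreal_leI) (auto intro: mult_left_le)
  then show "(\<lambda>w. the (XX (t * q) w)) \<in> borel_measurable (\<F> (ennreal t))"
    by (intro measurable_compose[OF X_measurable measurable_the])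
qed

text \<open>With equal steps d = t / N a single operator S_d occurs. The indicator at time 0 joins
  f, that at time t joins g, and the inner ones are reversed by
  \<open>S_chain_symmetric\<close>.\<close>

lemma reversal_grid:
  fixes B :: "nat \<Rightarrow> 'a set" and n N :: nat
  assumes t: "0 < t" and [measurable]: "f \<in> Borel" "g \<in> Borel" "\<And>k. B k \<in> sets borel"
  defines "N \<equiv> 2 ^ n"
  shows "(\<integral>\<^sup>+x. f x * EE (\<lambda>w. ext0 g (XX t w) * indicator {w. \<forall>k\<le>N. the (XX (t * (real k / N)) w) \<in> B k} w) x \<partial>m)
    = (\<integral>\<^sup>+x. g x * EE (\<lambda>w. ext0 f (XX t w) * indicator {w. \<forall>k\<le>N. the (XX (t * (real k / N)) w) \<in> B (N - k)} w) x \<partial>m)"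
proof -
  define d where "d = t / N"
  have N: "0 < N" unfolding N_def by simp
  have d: "0 < d" using t N by (simp add: d_def)
  have one: "EE (\<lambda>w. ext0 g (XX t w) * indicator {w. \<forall>k\<le>N. the (XX (t * (real k / N)) w) \<in> C k} w) x
     = indicator (C 0) x * S_chain d (map (\<lambda>k. indicator (C k)) [1..<N]) (\<lambda>x. g x * indicator (C N) x) x"
    if [measurable]: "\<And>k. C k \<in> sets borel" "g \<in> Borel" for C g x
  proof -
    \<comment> \<open>Entry i sits at grid time Suc i. Time 0 is deterministic and stays outside the
      list; the last entry carries g.\<close>
    let ?l = "map (\<lambda>k. indicator (C k)) [1..<N] @ [\<lambda>x. g x * indicator (C N) x]"
    let ?p = "map (\<lambda>a. (ennreal d, ext0 a)) ?l"
    have len: "length ?l = N" using N by simp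
    have "set ?l \<subseteq> Borel" by auto
    then have vc: "valid_chain ?p" by (auto simp: valid_chain_def intro!: measurable_ext0)
    have nth: "?l ! i = (if Suc i < N then indicator (C (Suc i)) else (\<lambda>x. g x * indicator (C N) x))" if "i < N" for i
      using that N by (auto simp: nth_append)
    have pp: "path_prod 0 ?p w = (\<Prod>i<N. ext0 (?l ! i) (XX (t * (real (Suc i) / N)) w))" for w
    proof -
      have "?p = map (\<lambda>a. (ennreal d, a)) (map ext0 ?l)" by simp
      then have "path_prod 0 ?p w = (\<Prod>i<N. (map ext0 ?l ! i) (X (0 + of_nat (Suc i) * ennreal d) w))"
        by (simp only: path_prod_equispaced length_map len)
      also have "\<dots> = (\<Prod>i<N. ext0 (?l ! i) (XX (t * (real (Suc i) / N)) w))"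
      proof (rule prod.cong[OF refl])
        fix i assume "i \<in> {..<N}"
        then have "i < length ?l" using len by simp
        moreover have "of_nat (Suc i) * ennreal d = ennreal (t * (real (Suc i) / N))"
          using d by (simp add: d_def ennreal_of_nat_eq_real_of_nat ennreal_mult[symmetric] mult.commute del: of_nat_Suc)
        ultimately show "(map ext0 ?l ! i) (X (0 + of_nat (Suc i) * ennreal d) w) = ext0 (?l ! i) (XX (t * (real (Suc i) / N)) w)"
          by (simp only: nth_map add_0)
      qed
      finally show ?thesis .
    qed
    have "EE (\<lambda>w. ext0 g (XX t w) * indicator {w. \<forall>k\<le>N. the (XX (t * (real k / N)) w) \<in> C k} w) x
      = EE (\<lambda>w. indicator (C 0) x * path_prod 0 ?p w) x"
    proof (rule nn_integral_cong_AE, use X_zero[of "Some x"] in eventually_elim)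
      fix w assume X0: "X 0 w = Some x"
      show "ext0 g (XX t w) * indicator {w. \<forall>k\<le>N. the (XX (t * (real k / N)) w) \<in> C k} w = indicator (C 0) x * path_prod 0 ?p w"
      proof (cases "XX t w")
        case None
        \<comment> \<open>The factor with index N - 1 sits at time t, where the path is
          dead.\<close>
        have "path_prod 0 ?p w = 0"
          unfolding pp using N None by (intro prod_zero bexI[of _ "N - 1"]) auto
        then show ?thesis using None by simp
      next
        case (Some y)
        have alive: "XX (t * (real k / N)) w \<noteq> None" if "k \<le> N" for k
        proof (rule alive_mono[of _ "ennreal t"])
          have "t * (real k / N) \<le> t * 1" using that N t by (intro mult_left_mono) auto
          then show "ennreal (t * (real k / N)) \<le> ennreal t" by (intro ennreal_leI) simp
        qed (simp add: Some)
        let ?i = "\<lambda>k. indicator (C k) (the (XX (t * (real k / N)) w)) :: ennreal"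
        have "path_prod 0 ?p w = (\<Prod>i<N. (if Suc i = N then g y else 1) * ?i (Suc i))"
          unfolding pp
        proof (rule prod.cong[OF refl])
          fix i assume "i \<in> {..<N}"
          then have i: "i < N" "Suc i \<le> N" by auto
          obtain z where z: "XX (t * (real (Suc i) / N)) w = Some z" using alive[OF i(2)] by auto
          show "ext0 (?l ! i) (XX (t * (real (Suc i) / N)) w) = (if Suc i = N then g y else 1) * ?i (Suc i)"
          proof (cases "Suc i = N")
            case True
            then have y: "XX (t * (real (Suc i) / N)) w = Some y" using Some N by simp
            show ?thesis unfolding nth[OF i(1)] y using True by simp
          next
            case False
            then show ?thesis unfolding nth[OF i(1)] z using i by simp
          qed
        qed
        also have "\<dots> = g y * (\<Prod>i<N. ?i (Suc i))"
        proof -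
          obtain M where M: "N = Suc M" using N by (cases N) auto
          have "(\<Prod>i<N. if Suc i = N then g y else 1) = g y"
            unfolding M by (simp add: prod.neutral)
          then show ?thesis by (simp add: prod.distrib del: of_nat_Suc)
        qed
        finally have "indicator (C 0) x * path_prod 0 ?p w = g y * (?i 0 * (\<Prod>i<N. ?i (Suc i)))"
          using X0 by (simp add: ac_simps)
        also have "?i 0 * (\<Prod>i<N. ?i (Suc i)) = (\<Prod>k\<le>N. ?i k)"
          by (rule prod.atMost_shift[symmetric])
        also have "\<dots> = indicator {w. \<forall>k\<le>N. the (XX (t * (real k / N)) w) \<in> C k} w"
          by (auto simp: indicator_def prod_zero_iff)
        finally show ?thesis using Some by simp
      qed
    qed
    also have "\<dots> = indicator (C 0) x * EE (\<lambda>w. path_prod 0 ?p w) x"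
      using path_prod_measurable[OF vc, of 0] by (intro nn_integral_cmult) (simp cong: measurable_cong_sets)
    also have "EE (\<lambda>w. path_prod 0 ?p w) x = chain_prod ?p (Some x)"
      by (rule nn_integral_path_prod_0[OF vc])
    also have "\<dots> = S_chain d (map (\<lambda>k. indicator (C k)) [1..<N]) (\<lambda>x. g x * indicator (C N) x) x"
      by (rule conjunct1[OF chain_prod_S_chain[OF d]]) auto
    finally show ?thesis .
  qed
  let ?l = "map (\<lambda>k. indicator (B k)) [1..<N] :: ('a \<Rightarrow> ennreal) list"
  have rev: "rev ?l = map (\<lambda>k. indicator (B (N - k))) [1..<N]"
    by (rule nth_equalityI) (auto simp: rev_nth Suc_diff_Suc)
  have "(\<integral>\<^sup>+x. f x * (indicator (B 0) x * S_chain d ?l (\<lambda>x. g x * indicator (B N) x) x) \<partial>m)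
    = (\<integral>\<^sup>+x. (f x * indicator (B 0) x) * S_chain d ?l (\<lambda>x. g x * indicator (B N) x) x \<partial>m)"
    by (simp add: mult.assoc)
  also have "\<dots> = (\<integral>\<^sup>+x. (g x * indicator (B N) x) * S_chain d (map (\<lambda>k. indicator (B (N - k))) [1..<N]) (\<lambda>x. f x * indicator (B 0) x) x \<partial>m)"
    unfolding rev[symmetric] by (rule S_chain_symmetric[OF d]) auto
  finally show ?thesis
    using one[of B g] one[of "\<lambda>k. B (N - k)" f] by (simp add: mult.assoc)
qed

text \<open>Both sides integrate G over laws on path space. Integrability of f and the bound on g
  make the first law finite, so that agreement on finite-dimensional sets, given by
  \<open>reversal_grid\<close>, is enough.\<close>

lemma reversal_bounded:
  assumes t: "0 < t" and f[measurable]: "f \<in> Borel" "g \<in> Borel"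
    and fin: "(\<integral>\<^sup>+x. f x \<partial>m) < \<infinity>" and gb: "\<And>x. g x \<le> of_nat c"
    and G[measurable]: "G \<in> BP"
  shows "(\<integral>\<^sup>+x. f x * EE (\<lambda>w. ext0 g (XX t w) * G (path t w)) x \<partial>m)
    = (\<integral>\<^sup>+x. g x * EE (\<lambda>w. ext0 f (XX t w) * G (reverse_path (path t w))) x \<partial>m)"
proof -
  define M where "M f g h = distr (density (density m f \<bind> (\<lambda>x. P (Some x))) (\<lambda>w. ext0 g (XX t w))) path_space (\<lambda>w. h (path t w))"
    for f g :: "'a \<Rightarrow> ennreal" and h :: "(real \<Rightarrow> 'a) \<Rightarrow> real \<Rightarrow> 'a"
  have M: "(\<integral>\<^sup>+y. G y \<partial>M f g h) = (\<integral>\<^sup>+x. f x * EE (\<lambda>w. ext0 g (XX t w) * G (h (path t w))) x \<partial>m)"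
    if [measurable]: "f \<in> Borel" "g \<in> Borel" "h \<in> path_space \<rightarrow>\<^sub>M path_space" "G \<in> BP"
    for f g h G
  proof -
    let ?B = "density m f \<bind> (\<lambda>x. P (Some x))"
    have K: "(\<lambda>x. P (Some x)) \<in> density m f \<rightarrow>\<^sub>M subprob_algebra (\<F> \<top>)" by measurable
    have [measurable_cong]: "sets ?B = sets (\<F> \<top>)"
      by (rule sets_bind_measurable[OF K]) simp
    have "(\<integral>\<^sup>+y. G y \<partial>M f g h) = (\<integral>\<^sup>+w. ext0 g (XX t w) * G (h (path t w)) \<partial>?B)"
      unfolding M_def by (subst nn_integral_distr, measurable, subst nn_integral_density) measurable
    also have "\<dots> = (\<integral>\<^sup>+x. (EE (\<lambda>w. ext0 g (XX t w) * G (h (path t w))) x) \<partial>density m f)"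
      by (rule nn_integral_bind[OF _ K]) measurable
    also have "\<dots> = (\<integral>\<^sup>+x. f x * EE (\<lambda>w. ext0 g (XX t w) * G (h (path t w))) x \<partial>m)"
      by (rule nn_integral_density) measurable
    finally show ?thesis .
  qed
  have em: "emeasure (M f g h) C = (\<integral>\<^sup>+x. f x * EE (\<lambda>w. ext0 g (XX t w) * indicator C (h (path t w))) x \<partial>m)"
    if "f \<in> Borel" "g \<in> Borel" "h \<in> path_space \<rightarrow>\<^sub>M path_space" "C \<in> sets path_space" for f g h C
    using M[OF that(1-3), of "indicator C"] that(4) by (simp add: M_def)
  have "M f g (\<lambda>y. y) = M g f reverse_path"
  proof (rule measure_eqI_PiM_infinite)
    show "sets (M f g (\<lambda>y. y)) = sets path_space" "sets (M g f reverse_path) = sets path_space"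
      by (auto simp: M_def)
    show "finite_measure (M f g (\<lambda>y. y))"
    proof
      have "emeasure (M f g (\<lambda>y. y)) (space path_space) = (\<integral>\<^sup>+x. f x * EE (\<lambda>w. ext0 g (XX t w) * indicator (space path_space) (path t w)) x \<partial>m)"
        by (rule em) auto
      also have "\<dots> \<le> (\<integral>\<^sup>+x. f x * EE (\<lambda>w. of_nat c) x \<partial>m)"
      proof (intro nn_integral_mono mult_left_mono)
        fix w show "ext0 g (XX t w) * indicator (space path_space) (path t w) \<le> of_nat c"
          using gb by (cases "XX t w") (auto simp: indicator_def)
      qed auto
      also have "\<dots> = of_nat c * (\<integral>\<^sup>+x. f x \<partial>m)"
        by (simp add: nn_integral_cmult mult.commute)
      also have "\<dots> < \<infinity>" using fin by (simp add: ennreal_mult_less_top of_nat_less_top)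
      finally show "emeasure (M f g (\<lambda>y. y)) (space (M f g (\<lambda>y. y))) \<noteq> \<infinity>" by (simp add: M_def)
    qed
    fix A :: "real \<Rightarrow> 'a set" and J assume J: "finite J" "J \<subseteq> dyadics" and A: "\<And>i. i \<in> J \<Longrightarrow> A i \<in> sets borel"
    let ?C = "prod_emb dyadics (\<lambda>_. borel) J (Pi\<^sub>E J A)"
    have C: "?C \<in> sets path_space" using J A by (intro sets_PiM_I) auto
    obtain n where n: "\<And>q. q \<in> J \<Longrightarrow> \<exists>k\<le>2 ^ n. q = real k / 2 ^ n"
      using finite_dyadics_level[OF J] by blast
    let ?N = "2 ^ n :: nat"
    \<comment> \<open>Constraints are given at the times in J only; the other points of the common
      grid get the trivial one.\<close>
    define B where "B k = (if real k / ?N \<in> J then A (real k / ?N) else UNIV)" for k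
    have Bm: "B k \<in> sets borel" for k using A by (auto simp: B_def)
    have mem: "y \<in> ?C \<longleftrightarrow> (\<forall>k\<le>?N. y (real k / ?N) \<in> B k)" if "y \<in> extensional dyadics" for y
      using that J(2) n by (fastforce simp: prod_emb_iff PiE_iff B_def)
    have 1: "indicator ?C (path t w) = (indicator {w. \<forall>k\<le>?N. the (XX (t * (real k / ?N)) w) \<in> B k} w :: ennreal)" for w
    proof -
      have "path t w \<in> extensional dyadics" by (simp add: path_def)
      moreover have "path t w (real k / ?N) = the (XX (t * (real k / ?N)) w)" if "k \<le> ?N" for k
        using dyadicsI[OF that] by (simp add: path_def)
      ultimately show ?thesis by (auto simp: indicator_def mem)
    qed
    have 2: "indicator ?C (reverse_path (path t w)) = (indicator {w. \<forall>k\<le>?N. the (XX (t * (real k / ?N)) w) \<in> B (?N - k)} w :: ennreal)" for w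
    proof -
      have "reverse_path (path t w) \<in> extensional dyadics" by (simp add: reverse_path_def)
      moreover have "reverse_path (path t w) (real k / ?N) = the (XX (t * (real (?N - k) / ?N)) w)" if k: "k \<le> ?N" for k
      proof -
        have "1 - real k / ?N = real (?N - k) / ?N" using k by (simp add: of_nat_diff diff_divide_distrib)
        then show ?thesis using dyadicsI[OF k] dyadicsI[of "?N - k" n] by (simp add: path_def)
      qed
      ultimately have "reverse_path (path t w) \<in> ?C \<longleftrightarrow> (\<forall>k\<le>?N. the (XX (t * (real (?N - k) / ?N)) w) \<in> B k)"
        by (auto simp: mem)
      also have "\<dots> \<longleftrightarrow> (\<forall>k\<le>?N. the (XX (t * (real k / ?N)) w) \<in> B (?N - k))"
        by (metis diff_diff_cancel diff_le_self)
      finally show ?thesis by (auto simp: indicator_def)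
    qed
    have "emeasure (M f g (\<lambda>y. y)) ?C = (\<integral>\<^sup>+x. f x * EE (\<lambda>w. ext0 g (XX t w) * indicator ?C (path t w)) x \<partial>m)"
      by (rule em) (auto simp: C)
    also have "\<dots> = (\<integral>\<^sup>+x. g x * EE (\<lambda>w. ext0 f (XX t w) * indicator ?C (reverse_path (path t w))) x \<partial>m)"
      unfolding 1 2 by (rule reversal_grid[OF t f Bm])
    also have "\<dots> = emeasure (M g f reverse_path) ?C"
      by (rule em[symmetric]) (auto simp: C)
    finally show "emeasure (M f g (\<lambda>y. y)) ?C = emeasure (M g f reverse_path) ?C" .
  qed
  then show ?thesis
    using M[OF f, of "\<lambda>y. y" G] M[OF f(2,1), of reverse_path G] by simp
qed

text \<open>The initial and the final position are functions of the path, so that \<open>f\<close> and \<open>g\<close> can be replaced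
  by a bounded integrable function.\<close>

theorem reversal:
  assumes t: "0 < t" and [measurable]: "f \<in> Borel" "g \<in> Borel"
    and [measurable]: "G \<in> BP"
  shows "(\<integral>\<^sup>+x. f x * EE (\<lambda>w. ext0 g (XX t w) * G (path t w)) x \<partial>m)
    = (\<integral>\<^sup>+x. g x * EE (\<lambda>w. ext0 f (XX t w) * G (reverse_path (path t w))) x \<partial>m)"
proof -
  obtain u :: "'a \<Rightarrow> real" where "u \<in> borel_measurable m" and u: "\<And>x. 0 < u x" "\<And>x. u x \<le> 1" "integrable m u"
    using sigma_finite_measure.obtain_positive_integrable_function[OF sigma_finite_m] by metis
  then have [measurable]: "u \<in> Borel" by (simp add: measurable_cong_sets[OF sets_m refl])
  define p where "p x = ennreal (u x)" for x
  have [measurable]: "p \<in> Borel" unfolding p_def[abs_def] by measurable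
  have pinv: "p x * inverse (p x) = 1" for x
    using u(1)[of x] by (simp add: p_def divide_ennreal_def[symmetric])
  have fin: "(\<integral>\<^sup>+x. p x \<partial>m) < \<infinity>"
    using u(3) by (simp add: p_def nn_integral_eq_integral less_imp_le[OF u(1)])
  \<comment> \<open>Besides f and g, H contains the inverse weights at the two end points, which are
    the coordinates 0 and 1 of the path; they cancel the factors p introduced for
    finiteness.\<close>
  define H where "H y = f (y 0) * g (y 1) * (inverse (p (y 0)) * inverse (p (y 1)) * G y)" for y
  have [measurable]: "(\<lambda>y. y 0) \<in> path_space \<rightarrow>\<^sub>M borel" "(\<lambda>y. y 1) \<in> path_space \<rightarrow>\<^sub>M borel" by measurable
  have [measurable]: "H \<in> BP" unfolding H_def[abs_def] by measurable
  have *: "p x * EE (\<lambda>w. ext0 p (XX t w) * T' w) x = a x * EE (\<lambda>w. ext0 b (XX t w) * T w) x"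
    if T': "\<And>w y. X 0 w = Some x \<Longrightarrow> XX t w = Some y \<Longrightarrow> T' w = a x * b y * (inverse (p x) * inverse (p y) * T w)"
      and [measurable]: "b \<in> Borel" "T \<in> BF" for a b T T' x
  proof -
    have "EE (\<lambda>w. ext0 p (XX t w) * T' w) x
      = EE (\<lambda>w. a x * inverse (p x) * (ext0 b (XX t w) * T w)) x"
    proof (rule nn_integral_cong_AE)
      show "AE w in P (Some x). ext0 p (XX t w) * T' w = a x * inverse (p x) * (ext0 b (XX t w) * T w)"
        using X_zero[of "Some x"]
      proof eventually_elim
        case (elim w)
        show ?case
        proof (cases "XX t w")
          case (Some y)
          have "p y * (a x * b y * (inverse (p x) * inverse (p y) * T w)) = p y * inverse (p y) * (a x * inverse (p x) * (b y * T w))"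
            by (simp only: mult_ac)
          then show ?thesis using T'[OF elim Some] Some by (simp add: pinv)
        qed simp
      qed
    qed
    also have "\<dots> = a x * inverse (p x) * EE (\<lambda>w. ext0 b (XX t w) * T w) x"
      by (rule nn_integral_cmult) measurable
    also have "p x * \<dots> = p x * inverse (p x) * (a x * EE (\<lambda>w. ext0 b (XX t w) * T w) x)"
      by (simp only: mult_ac)
    finally show ?thesis by (simp add: pinv)
  qed
  have "(\<integral>\<^sup>+x. p x * EE (\<lambda>w. ext0 p (XX t w) * H (path t w)) x \<partial>m)
    = (\<integral>\<^sup>+x. p x * EE (\<lambda>w. ext0 p (XX t w) * H (reverse_path (path t w))) x \<partial>m)"
    by (rule reversal_bounded[OF t, where c=1]) (use u(2) fin in \<open>auto simp: p_def\<close>)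
  moreover have "p x * EE (\<lambda>w. ext0 p (XX t w) * H (path t w)) x = f x * EE (\<lambda>w. ext0 g (XX t w) * G (path t w)) x" for x
    by (rule *) (auto simp: H_def path_def)
  moreover have "p x * EE (\<lambda>w. ext0 p (XX t w) * H (reverse_path (path t w))) x = g x * EE (\<lambda>w. ext0 f (XX t w) * G (reverse_path (path t w))) x" for x
    by (rule *) (auto simp: H_def path_def mult_ac)
  ultimately show ?thesis by simp
qed

end

section \<open>A reference law equivalent to starting from m\<close>

context symmetric_right_process
begin

lemma ex_density: "\<exists>g\<in>Borel. (\<forall>x. 0 < g x \<and> g x < \<infinity>) \<and> (\<integral>\<^sup>+x. g x \<partial>m) = 1"
proof -
  interpret sigma_finite_measure m by (rule sigma_finite_m)
  obtain p where p[measurable]: "p \<in> borel_measurable m" and fin: "(\<integral>\<^sup>+x. p x \<partial>m) \<noteq> \<infinity>" and pos: "\<And>x. 0 < p x \<and> p x < \<infinity>"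
    using Ex_finite_integrable_function by auto
  have "(\<integral>\<^sup>+x. p x \<partial>m) \<noteq> 0"
  proof
    assume "(\<integral>\<^sup>+x. p x \<partial>m) = 0"
    then have "AE x in m. p x = 0" by (subst (asm) nn_integral_0_iff_AE) auto
    then have "AE x in m. False" by eventually_elim (use pos in \<open>auto simp: less_le\<close>)
    then have "UNIV \<in> null_sets m"
      by (subst (asm) AE_iff_null) auto
    then show False using m_nonzero by auto
  qed
  with fin obtain c where c: "(\<integral>\<^sup>+x. p x \<partial>m) = ennreal c" "0 < c"
    by (cases "\<integral>\<^sup>+x. p x \<partial>m") (auto simp: less_le)
  show ?thesis
  proof (intro bexI[of _ "\<lambda>x. p x / ennreal c"] conjI allI)
    show "0 < p x / ennreal c" "p x / ennreal c < \<infinity>" for x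
      using pos[of x] c(2) by (cases "p x"; auto simp: divide_ennreal)+
    have "(\<integral>\<^sup>+x. p x / ennreal c \<partial>m) = ennreal c / ennreal c"
      by (simp add: nn_integral_divide c)
    then show "(\<integral>\<^sup>+x. p x / ennreal c \<partial>m) = 1" using c(2) by (simp add: divide_ennreal)
  qed measurable
qed

definition g\<^sub>0 :: "'a \<Rightarrow> ennreal" where
  "g\<^sub>0 = (SOME g. g \<in> Borel \<and> (\<forall>x. 0 < g x \<and> g x < \<infinity>) \<and> (\<integral>\<^sup>+x. g x \<partial>m) = 1)"

lemma g\<^sub>0: "g\<^sub>0 \<in> Borel \<and> (\<forall>x. 0 < g\<^sub>0 x \<and> g\<^sub>0 x < \<infinity>) \<and> (\<integral>\<^sup>+x. g\<^sub>0 x \<partial>m) = 1"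
proof -
  have "\<exists>g. g \<in> Borel \<and> (\<forall>x. 0 < g x \<and> g x < \<infinity>) \<and> (\<integral>\<^sup>+x. g x \<partial>m) = 1"
    using ex_density by blast
  from someI_ex[OF this] show ?thesis unfolding g\<^sub>0_def[symmetric] .
qed

lemma g\<^sub>0_measurable[measurable]: "g\<^sub>0 \<in> Borel"
  and g\<^sub>0_pos: "0 < g\<^sub>0 x" and nn_integral_g\<^sub>0: "(\<integral>\<^sup>+x. g\<^sub>0 x \<partial>m) = 1"
  using g\<^sub>0 by auto

definition \<nu> :: "'a measure" where
  "\<nu> = density m g\<^sub>0"

text \<open>A single probability law whose initial distribution has the same null sets as m:
  statements that hold almost surely from almost every starting point become statements about one
  measure.\<close>

definition PP :: "'w measure" where
  "PP = \<nu> \<bind> (\<lambda>x. P (Some x))"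

lemma sets_\<nu>[measurable_cong, simp]: "sets \<nu> = sets borel"
  by (simp add: \<nu>_def)

lemma prob_space_\<nu>: "prob_space \<nu>"
  by rule (simp add: \<nu>_def emeasure_density nn_integral_g\<^sub>0)

lemma kernel_\<nu>: "(\<lambda>x. P (Some x)) \<in> \<nu> \<rightarrow>\<^sub>M subprob_algebra (\<F> \<top>)"
  by measurable

lemma sets_PP[measurable_cong, simp]: "sets PP = sets (\<F> \<top>)"
  unfolding PP_def by (rule sets_bind_measurable[OF kernel_\<nu>]) (simp add: \<nu>_def)

lemma space_PP[simp]: "space PP = UNIV"
  using sets_eq_imp_space_eq[OF sets_PP] by simp

lemma nn_integral_PP:
  assumes [measurable]: "G \<in> BF"
  shows "(\<integral>\<^sup>+w. G w \<partial>PP) = (\<integral>\<^sup>+x. g\<^sub>0 x * EE (\<lambda>w. G w) x \<partial>m)"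
  unfolding PP_def by (subst nn_integral_bind[OF assms kernel_\<nu>]) (auto simp: \<nu>_def nn_integral_density)

lemma prob_space_PP: "prob_space PP"
proof
  have "(\<integral>\<^sup>+w. 1 \<partial>PP) = (\<integral>\<^sup>+x. g\<^sub>0 x \<partial>m)"
    by (subst nn_integral_PP) auto
  then show "emeasure PP (space PP) = 1" by (simp add: nn_integral_g\<^sub>0)
qed

lemma AE_\<nu>: "(AE x in \<nu>. f x) \<longleftrightarrow> (AE x in m. f x)"
  unfolding \<nu>_def by (subst AE_density) (auto simp: g\<^sub>0_pos)

lemma AE_PP_iff:
  assumes "Measurable.pred (\<F> \<top>) f"
  shows "(AE w in PP. f w) \<longleftrightarrow> (AE x in m. AE w in P (Some x). f w)"
  unfolding PP_def using AE_bind[OF kernel_\<nu> assms] by (simp add: AE_\<nu>)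

text \<open>Intended for predicates of additive functionals, which are not
  \<open>\<F> \<top>\<close>-measurable: the exceptional set is first enlarged to a measurable null
  set.\<close>

lemma AE_PP_D:
  assumes "AE w in PP. f w"
  shows "AE x in m. AE w in P (Some x). f w"
proof -
  from assms obtain N where N: "N \<in> null_sets PP" "{w\<in>space PP. \<not> f w} \<subseteq> N"
    by (auto simp: eventually_ae_filter)
  have [measurable]: "N \<in> sets (\<F> \<top>)" using N(1) by auto
  have "AE w in PP. w \<notin> N" by (rule AE_not_in[OF N(1)])
  then have "AE x in m. AE w in P (Some x). w \<notin> N"
    by (subst (asm) AE_PP_iff) measurable
  then show ?thesis
  proof eventually_elim
    case (elim x)
    then show ?case by eventually_elim (use N(2) in auto)
  qed
qed

lemma Markov_PP:
  assumes s: "s < \<top>" and V: "V \<in> borel_measurable (\<F> s)" and G[measurable]: "G \<in> BF"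
  shows "(\<integral>\<^sup>+w. V w * G (\<theta> s w) \<partial>PP) = (\<integral>\<^sup>+w. V w * (\<integral>\<^sup>+w'. G w' \<partial>P (X s w)) \<partial>PP)"
proof -
  have [measurable]: "V \<in> BF" using measurable_\<F>_mono[OF _ V] by simp
  note [measurable] = shift_measurable[OF s]
  have [measurable]: "(\<lambda>w. \<integral>\<^sup>+w'. G w' \<partial>P (X s w)) \<in> BF" by measurable
  show ?thesis
    by (simp add: nn_integral_PP Markov[OF s V G])
qed

text \<open>By symmetry the m-mass carried into a null set N at time s > 0 is the integral of S_s 1
  over N, which is zero.\<close>

lemma AE_PP_law:
  assumes f: "AE x in m. f x" and s: "0 \<le> s"
  shows "AE w in PP. \<forall>x. XX s w = Some x \<longrightarrow> f x"
proof -
  from f obtain N where N: "N \<in> null_sets m" "{x\<in>space m. \<not> f x} \<subseteq> N"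
    by (auto simp: eventually_ae_filter)
  have [measurable]: "N \<in> sets borel" using N(1) by auto
  have "AE x in m. AE w in P (Some x). ext0 (indicator N) (XX s w) = (0::ennreal)"
  proof (cases "s = 0")
    case True
    show ?thesis using AE_not_in[OF N(1)]
    proof eventually_elim
      case (elim x)
      show ?case using X_zero[of "Some x"] by eventually_elim (use True elim in simp)
    qed
  next
    case False
    then have s: "0 < s" using s by simp
    have "(\<integral>\<^sup>+x. 1 * S s (indicator N) x \<partial>m) = (\<integral>\<^sup>+x. S s (\<lambda>_. 1) x * indicator N x \<partial>m)"
      by (rule S_symmetric[OF s]) auto
    also have "\<dots> = (\<integral>\<^sup>+x. 0 \<partial>m)"
      by (rule nn_integral_cong_AE) (use AE_not_in[OF N(1)] in eventually_elim, simp)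
    finally have "(\<integral>\<^sup>+x. S s (indicator N) x \<partial>m) = 0" by simp
    then have "AE x in m. S s (indicator N) x = 0"
      by (subst (asm) nn_integral_0_iff_AE) auto
    then show ?thesis
    proof eventually_elim
      case (elim x)
      then show ?case unfolding S_def
        by (subst (asm) nn_integral_0_iff_AE) (auto cong: measurable_cong_sets)
    qed
  qed
  then have "AE w in PP. ext0 (indicator N) (XX s w) = (0::ennreal)"
    by (subst AE_PP_iff) measurable
  then show ?thesis
    by eventually_elim (use N(2) in \<open>auto simp: indicator_def split: if_splits\<close>)
qed

text \<open>By the Markov property the path after s has the law P (X s), and by
  \<open>AE_PP_law\<close> X s avoids the null set of bad starting points while alive.\<close>

lemma AE_PP_shift:
  assumes f: "AE w in PP. f w" and s: "0 \<le> s"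
  shows "AE w in PP. alive s w \<longrightarrow> f (\<theta> (ennreal s) w)"
proof -
  from f obtain N where N: "N \<in> null_sets PP" "{w\<in>space PP. \<not> f w} \<subseteq> N"
    by (auto simp: eventually_ae_filter)
  have [measurable]: "N \<in> sets (\<F> \<top>)" using N(1) by auto
  have s': "ennreal s < \<top>" by simp
  note [measurable] = shift_measurable[OF s']
  let ?V = "\<lambda>w. indicator (- {None}) (XX s w) :: ennreal"
  have [measurable]: "- {None} \<in> sets (cemetery_borel :: 'a option measure)"
    using sets.compl_sets[OF None_cemetery_borel] by (simp add: Compl_eq_Diff_UNIV)
  have V: "?V \<in> borel_measurable (\<F> (ennreal s))"
    by (rule measurable_compose[OF X_measurable]) auto
  have "AE x in m. AE w in P (Some x). w \<notin> N"
    by (rule AE_PP_D) (rule AE_not_in[OF N(1)])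
  from AE_PP_law[OF this s]
  have *: "AE w in PP. ?V w * (\<integral>\<^sup>+w'. indicator N w' \<partial>P (XX s w)) = 0"
  proof eventually_elim
    case (elim w)
    show ?case
    proof (cases "XX s w")
      case (Some x)
      then have "AE w' in P (Some x). w' \<notin> N" using elim by simp
      then have "AE w' in P (Some x). indicator N w' = (0::ennreal)" by eventually_elim simp
      then have "EE (\<lambda>w'. indicator N w') x = EE (\<lambda>w'. 0) x"
        by (rule nn_integral_cong_AE)
      then show ?thesis using Some by simp
    qed simp
  qed
  have "(\<integral>\<^sup>+w. ?V w * indicator N (\<theta> (ennreal s) w) \<partial>PP) = (\<integral>\<^sup>+w. ?V w * (\<integral>\<^sup>+w'. indicator N w' \<partial>P (XX s w)) \<partial>PP)"
    by (rule Markov_PP[OF s' V]) simp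
  also have "\<dots> = (\<integral>\<^sup>+w. 0 \<partial>PP)"
    by (rule nn_integral_cong_AE) (rule *)
  finally have "(\<integral>\<^sup>+w. ?V w * indicator N (\<theta> (ennreal s) w) \<partial>PP) = 0" by simp
  then have "AE w in PP. ?V w * indicator N (\<theta> (ennreal s) w) = 0"
    by (subst (asm) nn_integral_0_iff_AE) auto
  then show ?thesis
    by eventually_elim (use N(2) in \<open>auto simp: indicator_def split: if_splits\<close>)
qed

subsection \<open>Functionals of the path and of the reversed path\<close>

text \<open>The same Borel function must serve the path and the reversed path, so that
  \<open>\<eta>'\<close> is \<open>\<eta>\<close> read backwards in time. The case
  \<open>\<eta>' = \<eta>\<close> is invariance under reversal; different pairs are needed for
  jumps, whose end points are interchanged.\<close>

definition reversible :: "real \<Rightarrow> ('w \<Rightarrow> ennreal) \<Rightarrow> ('w \<Rightarrow> ennreal) \<Rightarrow> bool" where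
  "reversible t \<eta> \<eta>' \<longleftrightarrow> (\<exists>\<psi>\<in>BP. AE \<omega> in PP. alive t \<omega> \<longrightarrow>
     \<eta> \<omega> = \<psi> (path t \<omega>) \<and> \<eta>' \<omega> = \<psi> (reverse_path (path t \<omega>)))"

text \<open>In \<open>reversal\<close> the weight \<open>g\<^sub>0\<close> at the start is exchanged
  with the weight 1 at the end. Both are strictly positive, so that vanishing of either integral
  means vanishing almost surely on surviving paths.\<close>

lemma reversal_null:
  assumes t: "0 < t" and [measurable]: "h \<in> BP"
    and null: "AE w in PP. alive t w \<longrightarrow> h (reverse_path (path t w)) = (0::ennreal)"
  shows "AE w in PP. alive t w \<longrightarrow> h (path t w) = 0"
proof -
  have "(\<integral>\<^sup>+w. ext0 (\<lambda>_. 1) (XX t w) * h (path t w) \<partial>PP)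
     = (\<integral>\<^sup>+x. g\<^sub>0 x * EE (\<lambda>w. ext0 (\<lambda>_. 1) (XX t w) * h (path t w)) x \<partial>m)"
    by (rule nn_integral_PP) measurable
  also have "\<dots> = (\<integral>\<^sup>+x. 1 * EE (\<lambda>w. ext0 g\<^sub>0 (XX t w) * h (reverse_path (path t w))) x \<partial>m)"
    by (rule reversal[OF t]) auto
  also have "\<dots> = (\<integral>\<^sup>+x. 0 \<partial>m)"
  proof (rule nn_integral_cong_AE, use AE_PP_D[OF null] in eventually_elim)
    fix x assume x: "AE w in P (Some x). alive t w \<longrightarrow> h (reverse_path (path t w)) = 0"
    have "EE (\<lambda>w. ext0 g\<^sub>0 (XX t w) * h (reverse_path (path t w))) x = EE (\<lambda>w. 0) x"
    proof (rule nn_integral_cong_AE, use x in eventually_elim)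
      fix w assume "alive t w \<longrightarrow> h (reverse_path (path t w)) = 0"
      then show "ext0 g\<^sub>0 (XX t w) * h (reverse_path (path t w)) = 0"
        by (cases "XX t w") auto
    qed
    then show "1 * EE (\<lambda>w. ext0 g\<^sub>0 (XX t w) * h (reverse_path (path t w))) x = 0" by simp
  qed
  finally have "(\<integral>\<^sup>+w. ext0 (\<lambda>_. 1) (XX t w) * h (path t w) \<partial>PP) = 0" by simp
  then have "AE w in PP. ext0 (\<lambda>_. 1) (XX t w) * h (path t w) = 0"
    by (subst (asm) nn_integral_0_iff_AE) auto
  then show ?thesis by eventually_elim auto
qed

lemma reversible_null:
  assumes t: "0 < t" and r: "reversible t e e'" and null: "AE w in PP. alive t w \<longrightarrow> e' w = 0"
  shows "AE w in PP. alive t w \<longrightarrow> e w = 0"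
proof -
  obtain h where [measurable]: "h \<in> BP" and h: "AE w in PP. alive t w \<longrightarrow>
     e w = h (path t w) \<and> e' w = h (reverse_path (path t w))"
    using r by (auto simp: reversible_def)
  have "AE w in PP. alive t w \<longrightarrow> h (reverse_path (path t w)) = 0"
    using h null by eventually_elim auto
  from reversal_null[OF t _ this] have "AE w in PP. alive t w \<longrightarrow> h (path t w) = 0" by simp
  with h show ?thesis by eventually_elim auto
qed

subsection \<open>Versions of augmented random variables\<close>

text \<open>Exhibits \<open>PP\<close> as the law belonging to one of the initial distributions over
  which \<open>aug_filtration\<close> quantifies.\<close>

lemma PP_bind: "distr \<nu> cemetery_borel Some \<bind> P = PP"
  unfolding PP_def by (subst bind_distr[OF _ P_subprob]) (auto simp: \<nu>_def)

text \<open>The sets that agree \<open>PP\<close>-almost surely with a set of \<open>\<F> s\<close>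
  are closed under complements and countable unions, so only the generators have to be treated, with
  the initial law of \<open>PP\<close>.\<close>

lemma aug_filtration_version:
  assumes L: "L \<in> sets (aug_filtration P X s)"
  shows "\<exists>\<Lambda>0\<in>sets (\<F> s). AE w in PP. w \<in> L \<longleftrightarrow> w \<in> \<Lambda>0"
proof -
  interpret \<nu>: prob_space \<nu> by (rule prob_space_\<nu>)
  have "distr \<nu> cemetery_borel Some \<in> space (prob_algebra cemetery_borel)"
    by (auto simp: space_prob_algebra intro!: \<nu>.prob_space_distr)
  then have base: "\<exists>\<Lambda>0\<in>sets (\<F> s). (L - \<Lambda>0) \<union> (\<Lambda>0 - L) \<in> null_sets (completion PP)"
    if "\<forall>\<mu>\<in>space (prob_algebra cemetery_borel). \<exists>\<Lambda>0\<in>sets (\<F> s). (L - \<Lambda>0) \<union> (\<Lambda>0 - L) \<in> null_sets (completion (\<mu> \<bind> P))" for L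
    using that by (metis PP_bind)
  have "L \<in> sigma_sets UNIV {L. \<forall>\<mu>\<in>space (prob_algebra cemetery_borel). \<exists>\<Lambda>0\<in>sets (\<F> s).
           (L - \<Lambda>0) \<union> (\<Lambda>0 - L) \<in> null_sets (completion (\<mu> \<bind> P))}"
    using L by (simp add: aug_filtration_def)
  then show ?thesis
  proof (induction rule: sigma_sets.induct)
    case (Basic a)
    then obtain \<Lambda>0 where \<Lambda>0: "\<Lambda>0 \<in> sets (\<F> s)" "(a - \<Lambda>0) \<union> (\<Lambda>0 - a) \<in> null_sets (completion PP)"
      using base by blast
    have "AE w in PP. w \<notin> (a - \<Lambda>0) \<union> (\<Lambda>0 - a)"
      using AE_not_in[OF \<Lambda>0(2)] by (simp only: AE_completion_iff)
    then have "AE w in PP. w \<in> a \<longleftrightarrow> w \<in> \<Lambda>0" by eventually_elim auto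
    then show ?case using \<Lambda>0(1) by blast
  next
    case Empty
    then show ?case by (intro bexI[of _ "{}"]) auto
  next
    case (Compl a)
    then obtain \<Lambda>0 where \<Lambda>0: "\<Lambda>0 \<in> sets (\<F> s)" "AE w in PP. w \<in> a \<longleftrightarrow> w \<in> \<Lambda>0" by blast
    have "space (\<F> s) - \<Lambda>0 \<in> sets (\<F> s)" using \<Lambda>0(1) by (rule sets.compl_sets)
    moreover have "AE w in PP. w \<in> UNIV - a \<longleftrightarrow> w \<in> space (\<F> s) - \<Lambda>0"
      using \<Lambda>0(2) by eventually_elim auto
    ultimately show ?case by blast
  next
    case (Union a)
    then obtain B where B: "\<And>i. B i \<in> sets (\<F> s)" "\<And>i. AE w in PP. w \<in> a i \<longleftrightarrow> w \<in> B i" by metis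
    have "AE w in PP. \<forall>i. w \<in> a i \<longleftrightarrow> w \<in> B i" using B(2) by (simp add: AE_all_countable)
    then have "AE w in PP. w \<in> (\<Union>i. a i) \<longleftrightarrow> w \<in> (\<Union>i. B i)" by eventually_elim auto
    moreover have "(\<Union>i. B i) \<in> sets (\<F> s)" using B(1) by auto
    ultimately show ?case by blast
  qed
qed

lemma aug_filtration_measurable_version:
  fixes e :: "'w \<Rightarrow> ennreal"
  assumes "e \<in> borel_measurable (aug_filtration P X s)"
  shows "\<exists>e'\<in>borel_measurable (\<F> s). AE w in PP. e w = e' w"
  using assms
proof (induction rule: borel_measurable_induct)
  case (cong f g)
  have "f = g" using cong(3) by (auto simp: aug_filtration_def)
  then show ?case using cong by simp
next
  case (set A)
  then obtain B where B: "B \<in> sets (\<F> s)" "AE w in PP. w \<in> A \<longleftrightarrow> w \<in> B"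
    using aug_filtration_version by blast
  have "AE w in PP. indicator A w = (indicator B w :: ennreal)"
    using B(2) by eventually_elim (simp add: indicator_def)
  then show ?case using B(1) by (intro bexI[of _ "indicator B"]) auto
next
  case (mult u c)
  then obtain u' where u': "u' \<in> borel_measurable (\<F> s)" "AE w in PP. u w = u' w" by blast
  have "AE w in PP. c * u w = c * u' w" using u'(2) by eventually_elim simp
  then show ?case using u'(1) by (intro bexI[of _ "\<lambda>w. c * u' w"]) auto
next
  case (add u v)
  then obtain u' v' where u': "u' \<in> borel_measurable (\<F> s)" "AE w in PP. u w = u' w"
    and v': "v' \<in> borel_measurable (\<F> s)" "AE w in PP. v w = v' w" by blast
  have "AE w in PP. v w + u w = v' w + u' w" using u'(2) v'(2) by eventually_elim simp
  then show ?case using u'(1) v'(1) by (intro bexI[of _ "\<lambda>w. v' w + u' w"]) auto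
next
  case (seq U)
  then obtain U' where U': "\<And>i. U' i \<in> borel_measurable (\<F> s)" "\<And>i. AE w in PP. U i w = U' i w" by metis
  have "AE w in PP. \<forall>i. U i w = U' i w" using U'(2) by (simp add: AE_all_countable)
  then have "AE w in PP. (SUP i. U i) w = (SUP i. U' i w)" by eventually_elim (simp add: image_comp comp_def)
  then show ?case using U'(1) by (intro bexI[of _ "\<lambda>w. SUP i. U' i w"]) auto
qed

lemma Markov_expectation:
  fixes V e :: "'w \<Rightarrow> real"
  assumes s: "s < \<top>" and V: "V \<in> borel_measurable (\<F> s)" and Vb: "\<And>w. \<bar>V w\<bar> \<le> c"
    and e[measurable]: "e \<in> BF" and \<eta>b: "\<And>w. 0 \<le> e w \<and> e w \<le> 1"
  shows "(\<integral>w. V w * e (\<theta> s w) \<partial>PP) = (\<integral>w. V w * enn2real (\<integral>\<^sup>+w'. ennreal (e w') \<partial>P (X s w)) \<partial>PP)"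
proof -
  interpret prob_space PP by (rule prob_space_PP)
  note [measurable] = shift_measurable[OF s]
  have Vm[measurable]: "V \<in> BF" using measurable_\<F>_mono[OF _ V] by simp
  let ?b = "\<lambda>w. \<integral>\<^sup>+w'. ennreal (e w') \<partial>P (X s w)"
  have bm[measurable]: "?b \<in> BF" by measurable
  have b1: "?b w \<le> 1" for w
  proof -
    have "?b w \<le> (\<integral>\<^sup>+w'. 1 \<partial>P (X s w))" using \<eta>b by (intro nn_integral_mono) auto
    then show ?thesis by simp
  qed
  then have bfin: "ennreal (enn2real (?b w)) = ?b w" for w
    using order.strict_trans1[OF b1[of w] ennreal_one_less_top] by simp
  have b1': "enn2real (?b w) \<le> 1" for w using b1[of w] by (intro enn2real_leI) auto
  have c: "0 \<le> c" using Vb[of undefined] by linarith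
  have *: "(\<integral>w. U w * e (\<theta> s w) \<partial>PP) = (\<integral>w. U w * enn2real (?b w) \<partial>PP)"
    if U: "U \<in> borel_measurable (\<F> s)" "\<And>w. 0 \<le> U w" for U :: "'w \<Rightarrow> real"
  proof -
    have [measurable]: "U \<in> BF" using measurable_\<F>_mono[OF _ U(1)] by simp
    have "(\<integral>w. U w * e (\<theta> s w) \<partial>PP) = enn2real (\<integral>\<^sup>+w. ennreal (U w * e (\<theta> s w)) \<partial>PP)"
      using U \<eta>b by (intro integral_eq_nn_integral) auto
    also have "(\<integral>\<^sup>+w. ennreal (U w * e (\<theta> s w)) \<partial>PP) = (\<integral>\<^sup>+w. ennreal (U w) * ennreal (e (\<theta> s w)) \<partial>PP)"
      using U \<eta>b by (simp add: ennreal_mult)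
    also have "\<dots> = (\<integral>\<^sup>+w. ennreal (U w) * ?b w \<partial>PP)"
      using U by (intro Markov_PP[OF s]) auto
    also have "\<dots> = (\<integral>\<^sup>+w. ennreal (U w * enn2real (?b w)) \<partial>PP)"
      using U by (simp add: ennreal_mult bfin)
    also have "enn2real \<dots> = (\<integral>w. U w * enn2real (?b w) \<partial>PP)"
      using U by (intro integral_eq_nn_integral[symmetric]) auto
    finally show ?thesis .
  qed
  have i: "integrable PP (\<lambda>w. U w * f w)" if "U \<in> BF" "f \<in> BF" "\<And>w. \<bar>U w\<bar> \<le> c" "\<And>w. 0 \<le> f w \<and> f w \<le> 1" for U f
  proof (rule integrable_const_bound[where B=c])
    show "AE w in PP. norm (U w * f w) \<le> c"
    proof (rule AE_I2)
      fix w
      have "\<bar>U w\<bar> * \<bar>f w\<bar> \<le> c * 1" using that(3)[of w] that(4)[of w] c by (intro mult_mono) auto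
      then show "norm (U w * f w) \<le> c" by (simp add: abs_mult)
    qed
  qed (use that in measurable)
  have m1: "(\<lambda>w. e (\<theta> s w)) \<in> BF" "(\<lambda>w. enn2real (?b w)) \<in> BF" by measurable
  \<comment> \<open>Adding the constant c makes the factor nonnegative; the contribution of c alone
    is subtracted afterwards.\<close>
  have "(\<integral>w. (V w + c) * e (\<theta> s w) \<partial>PP) = (\<integral>w. (V w + c) * enn2real (?b w) \<partial>PP)"
  proof (rule *)
    show "0 \<le> V w + c" for w using Vb[of w] by linarith
  qed (use V in measurable)
  moreover have "(\<integral>w. c * e (\<theta> s w) \<partial>PP) = (\<integral>w. c * enn2real (?b w) \<partial>PP)"
    by (rule *) (use c in auto)
  moreover have "(\<integral>w. (V w + c) * f w \<partial>PP) = (\<integral>w. V w * f w \<partial>PP) + (\<integral>w. c * f w \<partial>PP)"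
    if f: "f \<in> BF" "\<And>w. 0 \<le> f w \<and> f w \<le> 1" for f
    unfolding distrib_right using i[OF Vm f(1) Vb f(2)] i[OF _ f(1) _ f(2), of "\<lambda>_. c"] c
    by (intro Bochner_Integration.integral_add) auto
  ultimately show ?thesis
    using m1 \<eta>b b1' by (cases "c = 0") auto
qed

text \<open>The summands are orthogonal: \<beta> k is the conditional expectation of x k at time k
  d, when V k and all earlier summands are known. Subtracting a conditional expectation does not
  increase the second moment.\<close>

lemma compensator_L2:
  fixes e :: "'w \<Rightarrow> real" and V :: "nat \<Rightarrow> 'w \<Rightarrow> real" and d :: real
  assumes d: "0 \<le> d" and e: "e \<in> borel_measurable (\<F> (ennreal d))" and \<eta>b: "\<And>w. 0 \<le> e w \<and> e w \<le> 1"
    and V: "\<And>k. V k \<in> borel_measurable (\<F> (ennreal (k * d)))" and Vb: "\<And>k w. V k w = 0 \<or> V k w = 1"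
  defines "x \<equiv> \<lambda>k w. e (\<theta> (ennreal (real k * d)) w)"
    and "\<beta> \<equiv> \<lambda>k w. enn2real (\<integral>\<^sup>+w'. ennreal (e w') \<partial>P (XX (real k * d) w))"
  shows "(\<integral>w. (\<Sum>k<n. V k w * (x k w - \<beta> k w))\<^sup>2 \<partial>PP) \<le> (\<integral>w. (\<Sum>k<n. V k w * (x k w)\<^sup>2) \<partial>PP)"
proof -
  interpret prob_space PP by (rule prob_space_PP)
  have \<eta>m[measurable]: "e \<in> BF" using measurable_\<F>_mono[OF _ e] by simp
  have \<xi>m: "x k \<in> borel_measurable (\<F> (ennreal (real j * d)))" if "k < j" for k j
  proof -
    have "x k \<in> borel_measurable (\<F> (ennreal (real k * d) + ennreal d))"
      unfolding x_def by (rule shift_measurable_\<F>[OF _ e]) simp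
    moreover have "ennreal (real k * d) + ennreal d \<le> ennreal (real j * d)"
    proof -
      have "real k * d + d = real (Suc k) * d" by (simp add: algebra_simps)
      also have "\<dots> \<le> real j * d" using that d by (intro mult_right_mono) auto
      finally show ?thesis using d by (simp add: ennreal_plus[symmetric] ennreal_leI del: ennreal_plus)
    qed
    ultimately show ?thesis by (rule measurable_\<F>_mono[rotated])
  qed
  have \<beta>m: "\<beta> k \<in> borel_measurable (\<F> (ennreal (real j * d)))" if "k \<le> j" for k j
  proof -
    have "(\<lambda>z. enn2real (\<integral>\<^sup>+w'. ennreal (e w') \<partial>P z)) \<in> borel_measurable cemetery_borel" by measurable
    moreover have "XX (real k * d) \<in> \<F> (ennreal (real j * d)) \<rightarrow>\<^sub>M cemetery_borel"
      using that d by (intro X_measurable ennreal_leI mult_right_mono) auto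
    ultimately show ?thesis unfolding \<beta>_def by (rule measurable_compose[rotated])
  qed
  have Vm: "V k \<in> borel_measurable (\<F> (ennreal (real j * d)))" if "k \<le> j" for k j
    by (rule measurable_\<F>_mono[OF _ V[of k]]) (use that d in \<open>auto intro!: ennreal_leI mult_right_mono\<close>)
  have \<xi>b: "0 \<le> x k w \<and> x k w \<le> 1" for k w using \<eta>b by (simp add: x_def)
  have \<beta>b: "0 \<le> \<beta> k w \<and> \<beta> k w \<le> 1" for k w
  proof -
    have "(\<integral>\<^sup>+w'. ennreal (e w') \<partial>P (XX (real k * d) w)) \<le> (\<integral>\<^sup>+w'. 1 \<partial>P (XX (real k * d) w))"
      using \<eta>b by (intro nn_integral_mono) auto
    then show ?thesis unfolding \<beta>_def by (auto intro!: enn2real_leI)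
  qed
  have top: "f \<in> BF" if "f \<in> borel_measurable (\<F> s)" for f :: "'w \<Rightarrow> real" and s
    using measurable_\<F>_mono[OF _ that] by simp
  note [measurable] = top[OF \<xi>m[OF lessI]] top[OF \<beta>m[OF order_refl]] top[OF Vm[OF order_refl]]
  define D where "D n w = (\<Sum>k<n. V k w * (x k w - \<beta> k w))" for n w
  have Dm: "D n \<in> borel_measurable (\<F> (ennreal (real n * d)))" for n
    unfolding D_def by (intro borel_measurable_sum borel_measurable_times borel_measurable_diff Vm \<xi>m \<beta>m) auto
  have Db: "\<bar>D n w\<bar> \<le> real n" for n w
  proof -
    have "\<bar>D n w\<bar> \<le> (\<Sum>k<n. \<bar>V k w * (x k w - \<beta> k w)\<bar>)" unfolding D_def by (rule sum_abs)
    also have "\<dots> \<le> (\<Sum>k<n. 1)"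
    proof (rule sum_mono)
      fix k show "\<bar>V k w * (x k w - \<beta> k w)\<bar> \<le> 1"
        using Vb[of k w] \<xi>b[of k w] \<beta>b[of k w] by auto
    qed
    finally show ?thesis by simp
  qed
  note [measurable] = top[OF Dm]
  have int: "integrable PP f" if "f \<in> BF" "\<And>w. \<bar>f w\<bar> \<le> C" for f :: "'w \<Rightarrow> real" and C
    using that by (intro integrable_const_bound[where B=C]) auto
  have "(\<integral>w. (D n w)\<^sup>2 \<partial>PP) \<le> (\<integral>w. (\<Sum>k<n. V k w * (x k w)\<^sup>2) \<partial>PP)"
  proof (induction n)
    case 0
    then show ?case by (simp add: D_def)
  next
    case (Suc n)
    let ?s = "ennreal (real n * d)"
    have Markov: "(\<integral>w. U w * x n w \<partial>PP) = (\<integral>w. U w * \<beta> n w \<partial>PP)"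
      if "U \<in> borel_measurable (\<F> ?s)" "\<And>w. \<bar>U w\<bar> \<le> c" for U c
      unfolding x_def \<beta>_def using that by (intro Markov_expectation \<eta>m \<eta>b) auto
    \<comment> \<open>Uses that V is its own square.\<close>
    have sq: "(D (Suc n) w)\<^sup>2 = (D n w)\<^sup>2 + 2 * (D n w * V n w * x n w - D n w * V n w * \<beta> n w)
        + (V n w * (x n w)\<^sup>2 - 2 * (V n w * \<beta> n w * x n w) + V n w * \<beta> n w * \<beta> n w)" for w
      using Vb[of n w] by (auto simp: D_def power2_eq_square algebra_simps)
    have DVb: "\<bar>D n w * V n w\<bar> \<le> real n" for w using Db[of n w] Vb[of n w] by auto
    have V\<beta>b: "\<bar>V n w * \<beta> n w\<bar> \<le> 1" for w using \<beta>b[of n w] Vb[of n w] by auto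
    have i1: "integrable PP (\<lambda>w. (D n w)\<^sup>2)"
      using Db[of n] by (intro int[of _ "(real n)\<^sup>2"]) (auto simp: power2_le_iff_abs_le)
    have prod_le: "\<bar>a * b\<bar> \<le> C" if "\<bar>a\<bar> \<le> C" "0 \<le> b \<and> b \<le> 1" for a b C :: real
    proof -
      have "\<bar>a\<bar> * \<bar>b\<bar> \<le> C * 1" using that by (intro mult_mono) auto
      then show ?thesis by (simp add: abs_mult)
    qed
    have i2: "integrable PP (\<lambda>w. D n w * V n w * x n w)" "integrable PP (\<lambda>w. D n w * V n w * \<beta> n w)"
      using prod_le[OF DVb \<xi>b] prod_le[OF DVb \<beta>b] by (auto intro!: int[of _ "real n"])
    have i3: "integrable PP (\<lambda>w. V n w * \<beta> n w * x n w)" "integrable PP (\<lambda>w. V n w * \<beta> n w * \<beta> n w)"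
      using prod_le[OF V\<beta>b \<xi>b] prod_le[OF V\<beta>b \<beta>b] by (auto intro!: int[of _ 1])
    have V\<xi>: "\<bar>V k w * (x k w)\<^sup>2\<bar> \<le> 1" for k w
      using Vb[of k w] \<xi>b[of k w] by (auto simp: power_le_one)
    have i4: "integrable PP (\<lambda>w. V k w * (x k w)\<^sup>2)" for k
      using V\<xi>[of k] by (intro int[of _ 1]) auto
    have e1: "(\<integral>w. D n w * V n w * x n w \<partial>PP) = (\<integral>w. D n w * V n w * \<beta> n w \<partial>PP)"
      by (rule Markov[OF _ DVb]) (intro borel_measurable_times Dm Vm order_refl)
    have e2: "(\<integral>w. V n w * \<beta> n w * x n w \<partial>PP) = (\<integral>w. V n w * \<beta> n w * \<beta> n w \<partial>PP)"
      by (rule Markov[OF _ V\<beta>b]) (intro borel_measurable_times \<beta>m Vm order_refl)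
    have "(\<integral>w. (D (Suc n) w)\<^sup>2 \<partial>PP) = (\<integral>w. (D n w)\<^sup>2 \<partial>PP) + (\<integral>w. V n w * (x n w)\<^sup>2 \<partial>PP) - (\<integral>w. V n w * \<beta> n w * \<beta> n w \<partial>PP)"
      unfolding sq using i1 i2 i3 i4[of n] by (simp add: e1 e2)
    also have "\<dots> \<le> (\<integral>w. (D n w)\<^sup>2 \<partial>PP) + (\<integral>w. V n w * (x n w)\<^sup>2 \<partial>PP)"
    proof -
      have "0 \<le> (\<integral>w. V n w * \<beta> n w * \<beta> n w \<partial>PP)"
        by (rule Bochner_Integration.integral_nonneg) (use Vb[of n] \<beta>b[of n] in \<open>metis mult_nonneg_nonneg mult_zero_left mult_1 order_refl\<close>)
      then show ?thesis by simp
    qed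
    also have "\<dots> \<le> (\<integral>w. (\<Sum>k<n. V k w * (x k w)\<^sup>2) \<partial>PP) + (\<integral>w. V n w * (x n w)\<^sup>2 \<partial>PP)"
      using Suc by simp
    also have "\<dots> = (\<integral>w. (\<Sum>k<Suc n. V k w * (x k w)\<^sup>2) \<partial>PP)"
      using i4 by simp
    finally show ?case .
  qed
  then show ?thesis by (simp add: D_def)
qed

end

section \<open>Continuous additive functionals under time reversal\<close>

text \<open>exp (-a), with the value 0 at \<infinity>. It is bounded, decreasing and continuous on
  all of [0,\<infinity>], so that a functional that may explode at the lifetime can be handled by
  its bounded transform.\<close>

definition nexp :: "ennreal \<Rightarrow> real" where
  "nexp a = (if a = \<top> then 0 else exp (- enn2real a))"

lemma nexp_measurable[measurable]: "nexp \<in> Borel"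
  unfolding nexp_def by measurable

lemma nexp_bounds: "0 \<le> nexp a" "nexp a \<le> 1"
  by (auto simp: nexp_def)

lemma nexp_0[simp]: "nexp 0 = 1"
  by (simp add: nexp_def)

lemma nexp_add: "nexp (a + b) = nexp a * nexp b"
  by (cases a; cases b) (auto simp: nexp_def ennreal_plus[symmetric] exp_add[symmetric] simp del: ennreal_plus)

lemma nexp_antimono: "a \<le> b \<Longrightarrow> nexp b \<le> nexp a"
  by (cases a; cases b) (auto simp: nexp_def top_unique)

lemma tendsto_nexp:
  assumes f: "(f \<longlongrightarrow> l) F"
  shows "((\<lambda>x. nexp (f x)) \<longlongrightarrow> nexp l) F"
proof (cases "l = \<top>")
  case True
  show ?thesis
  proof (rule tendstoI)
    fix e :: real assume e: "0 < e"
    define c where "c = max 0 (- ln e)"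
    have "\<forall>\<^sub>F x in F. ennreal (c + 1) < f x"
      using f True by (intro order_tendstoD(1)[OF f]) auto
    then show "\<forall>\<^sub>F x in F. dist (nexp (f x)) (nexp l) < e"
    proof eventually_elim
      case (elim x)
      have "nexp (f x) \<le> nexp (ennreal (c + 1))" using elim by (intro nexp_antimono) auto
      also have "\<dots> = exp (- (c + 1))" 
      proof -
        have "0 \<le> c + 1" by (simp add: c_def)
        then show ?thesis by (simp add: nexp_def del: ennreal_plus)
      qed
      also have "\<dots> < exp (ln e)" unfolding exp_less_cancel_iff by (simp add: c_def)
      finally show ?case using e True nexp_bounds(1)[of "f x"] by (simp add: dist_real_def nexp_def)
    qed
  qed
next
  case False
  then obtain r where r: "l = ennreal r" "0 \<le> r" by (cases l) auto
  have fin: "\<forall>\<^sub>F x in F. f x < \<top>"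
    using False by (intro order_tendstoD(2)[OF f]) (auto simp: less_top)
  have "((\<lambda>x. enn2real (f x)) \<longlongrightarrow> r) F"
    by (rule tendsto_enn2real[OF f[unfolded r(1)] r(2)])
  then have "((\<lambda>x. exp (- enn2real (f x))) \<longlongrightarrow> exp (- r)) F"
    by (intro tendsto_exp tendsto_minus)
  moreover have "\<forall>\<^sub>F x in F. exp (- enn2real (f x)) = nexp (f x)"
    using fin by eventually_elim (auto simp: nexp_def)
  ultimately have "((\<lambda>x. nexp (f x)) \<longlongrightarrow> exp (- r)) F"
    by (rule Lim_transform_eventually)
  then show ?thesis using r by (simp add: nexp_def)
qed

text \<open>The generous term d^2, instead of d^2 / 2, reduces the lower bound to the identity (1 -
  d + d^2) (1 + d) = 1 + d^3.\<close>

lemma one_minus_exp_bounds: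
  fixes d :: real
  assumes "0 \<le> d"
  shows "d - d\<^sup>2 \<le> 1 - exp (- d)" "1 - exp (- d) \<le> d"
proof -
  show "1 - exp (- d) \<le> d" using exp_ge_add_one_self[of "- d"] by simp
  have "1 + d \<le> exp d" by (rule exp_ge_add_one_self)
  then have "exp (- d) \<le> 1 / (1 + d)" using assms by (simp add: exp_minus inverse_eq_divide frac_le)
  moreover have "1 / (1 + d) \<le> 1 - (d - d\<^sup>2)"
  proof -
    have "1 \<le> (1 - (d - d\<^sup>2)) * (1 + d)"
    proof -
      have "(1 - (d - d\<^sup>2)) * (1 + d) = 1 + d ^ 3" by (simp add: power2_eq_square power3_eq_cube algebra_simps)
      then show ?thesis using assms by simp
    qed
    then show ?thesis using assms by (simp add: divide_le_eq)
  qed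
  ultimately show "d - d\<^sup>2 \<le> 1 - exp (- d)" by linarith
qed

text \<open>A continuous monotone function has no quadratic variation: the largest increment tends
  to 0 by uniform continuity, and the sum of the increments telescopes.\<close>

lemma grid_squares_tendsto_0:
  fixes g :: "real \<Rightarrow> real"
  assumes t: "0 < t" and c: "continuous_on {0..t} g" and mono: "\<And>s u. 0 \<le> s \<Longrightarrow> s \<le> u \<Longrightarrow> u \<le> t \<Longrightarrow> g s \<le> g u"
  shows "(\<lambda>n. \<Sum>k<2^n. (g (real (Suc k) * (t / 2^n)) - g (real k * (t / 2^n)))\<^sup>2) \<longlonglongrightarrow> 0"
proof (rule LIMSEQ_I)
  fix e :: real assume e: "0 < e"
  \<comment> \<open>The summand 1 keeps the denominator positive when g is constant.\<close>
  define e' where "e' = e / (g t - g 0 + 1)"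
  have gpos: "0 \<le> g t - g 0" using mono[of 0 t] t by simp
  then have e': "0 < e'" using e by (simp add: e'_def)
  have "uniformly_continuous_on {0..t} g" by (rule compact_uniformly_continuous[OF c]) simp
  then obtain r where r: "0 < r" "\<And>s u. s \<in> {0..t} \<Longrightarrow> u \<in> {0..t} \<Longrightarrow> dist u s < r \<Longrightarrow> dist (g u) (g s) < e'"
    unfolding uniformly_continuous_on_def using e' by metis
  have "(\<lambda>n. t * (1 / 2) ^ n) \<longlonglongrightarrow> t * 0" by (intro tendsto_intros) auto
  then have "\<forall>\<^sub>F n in sequentially. t * (1 / 2) ^ n < r"
    using r(1) by (intro order_tendstoD) auto
  then obtain n0 where n0: "\<And>n. n0 \<le> n \<Longrightarrow> t * (1 / 2) ^ n < r" by (auto simp: eventually_sequentially)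
  show "\<exists>no. \<forall>n\<ge>no. norm ((\<Sum>k<2^n. (g (real (Suc k) * (t / 2^n)) - g (real k * (t / 2^n)))\<^sup>2) - 0) < e"
  proof (intro exI[of _ n0] allI impI)
    fix n assume n: "n0 \<le> n"
    let ?d = "t / 2^n"
    have d: "0 < ?d" "?d < r" using t n0[OF n] by (auto simp: power_divide)
    have le: "real k * ?d \<le> t" if "k \<le> 2^n" for k
    proof -
      have "real k \<le> real (2 ^ n)" using that by (subst of_nat_le_iff)
      then have "real k * ?d \<le> real (2 ^ n) * ?d" using d by (intro mult_right_mono) auto
      then show ?thesis by simp
    qed
    have tm: "(g (real (Suc k) * ?d) - g (real k * ?d))\<^sup>2 \<le> e' * (g (real (Suc k) * ?d) - g (real k * ?d))" if k: "k < 2^n" for k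
    proof -
      have m1: "0 \<le> g (real (Suc k) * ?d) - g (real k * ?d)"
      proof -
        have "real k * ?d \<le> real (Suc k) * ?d" using d by (intro mult_right_mono) auto
        then have "g (real k * ?d) \<le> g (real (Suc k) * ?d)" using le[of "Suc k"] k d by (intro mono mult_nonneg_nonneg) auto
        then show ?thesis by simp
      qed
      have "real (Suc k) * ?d = real k * ?d + ?d" by (simp only: of_nat_Suc distrib_right mult_1_left add.commute)
      then have "dist (real (Suc k) * ?d) (real k * ?d) = ?d" using d by (simp only: dist_real_def)
      then have "dist (g (real (Suc k) * ?d)) (g (real k * ?d)) < e'"
        using le[of "Suc k"] le[of k] k d t by (intro r(2)) auto
      then show ?thesis using m1 by (simp add: power2_eq_square dist_real_def mult_right_mono)
    qed
    have "(\<Sum>k<2^n. (g (real (Suc k) * ?d) - g (real k * ?d))\<^sup>2) \<le> (\<Sum>k<2^n. e' * (g (real (Suc k) * ?d) - g (real k * ?d)))"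
      by (rule sum_mono) (use tm in auto)
    also have "\<dots> = e' * (g (real (2^n) * ?d) - g (real 0 * ?d))"
      unfolding sum_distrib_left[symmetric] by (subst sum_lessThan_telescope) simp
    also have "\<dots> = e' * (g t - g 0)" by simp
    also have "\<dots> < e" using e gpos by (simp add: e'_def field_simps)
    finally show "norm ((\<Sum>k<2^n. (g (real (Suc k) * ?d) - g (real k * ?d))\<^sup>2) - 0) < e"
      by (simp add: sum_nonneg)
  qed
qed

text \<open>The sum of the squares has finite expectation, hence is almost surely finite.\<close>

lemma AE_tendsto_0_of_summable:
  fixes D :: "nat \<Rightarrow> 'a \<Rightarrow> real"
  assumes [measurable]: "\<And>j. D j \<in> borel_measurable M"
    and le: "\<And>j. (\<integral>\<^sup>+x. ennreal ((D j x)\<^sup>2) \<partial>M) \<le> ennreal ((1/2)^j)"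
  shows "AE x in M. (\<lambda>j. D j x) \<longlonglongrightarrow> 0"
proof -
  have "(\<integral>\<^sup>+x. (\<Sum>j. ennreal ((D j x)\<^sup>2)) \<partial>M) = (\<Sum>j. \<integral>\<^sup>+x. ennreal ((D j x)\<^sup>2) \<partial>M)"
    by (rule nn_integral_suminf) measurable
  also have "\<dots> \<le> (\<Sum>j. ennreal ((1/2)^j))"
    by (intro suminf_le le) auto
  also have "\<dots> < \<infinity>"
    by (subst suminf_ennreal2) (auto intro: summable_geometric)
  finally have "(\<integral>\<^sup>+x. (\<Sum>j. ennreal ((D j x)\<^sup>2)) \<partial>M) \<noteq> \<infinity>" by simp
  then have "AE x in M. (\<Sum>j. ennreal ((D j x)\<^sup>2)) \<noteq> \<infinity>"
    by (intro nn_integral_noteq_infinite) measurable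
  then show ?thesis
  proof eventually_elim
    case (elim x)
    then have "summable (\<lambda>j. (D j x)\<^sup>2)" by (intro summable_suminf_not_top) auto
    then have "(\<lambda>j. sqrt ((D j x)\<^sup>2)) \<longlonglongrightarrow> sqrt 0"
      by (intro tendsto_real_sqrt summable_LIMSEQ_zero)
    then show ?case by (simp add: tendsto_rabs_zero_iff)
  qed
qed

context symmetric_right_process
begin

text \<open>By right continuity a path alive at t stays alive for some time after t, which separates
  t from the infimum defining the lifetime.\<close>

lemma less_lifetime:
  assumes "alive t w"
  shows "ennreal t < lifetime X w"
proof (rule ccontr)
  assume "\<not> ?thesis"
  then have le: "lifetime X w \<le> ennreal t" by simp
  obtain y where "XX t w = Some y" using assms by auto
  from X_right_continuous[OF _ this open_UNIV] have "\<forall>\<^sub>F r in at_right (ennreal t). X r w \<in> Some ` UNIV" by simp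
  then obtain b where b: "ennreal t < b" "\<And>r. ennreal t < r \<Longrightarrow> r < b \<Longrightarrow> X r w \<in> Some ` UNIV"
    by (subst (asm) eventually_at_right[where y=\<top>]) auto
  have "Inf {s. X s w = None} < b" using le b(1) by (auto simp: lifetime_def)
  then obtain s where s: "X s w = None" "s < b" by (auto simp: Inf_less_iff)
  have "ennreal t < s"
  proof (rule ccontr)
    assume "\<not> ennreal t < s"
    then have "XX t w = None" using X_dead[OF _ s(1)] by (simp add: not_less)
    then show False using assms by simp
  qed
  then show False using b(2)[of s] s by auto
qed

text \<open>On the grid of mesh \<open>t / 2\<^sup>n\<close>, \<open>A\<^sub>t\<close> is approximated by the sum of \<open>1 - exp (- d)\<close> over its increments
  \<open>d\<close>.  The difference of this sum and its compensator tends to \<open>0\<close> in \<open>L\<^sup>2\<close> because \<open>A\<close> is continuous, and the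
  compensator is the sum of a function of the positions on the grid, hence invariant under reversal.\<close>

lemma pcaf_reversible:
  assumes pcaf: "pcaf_strict P X \<theta> A" and t: "0 < t"
  shows "\<exists>h\<in>BP. (\<forall>y. h (reverse_path y) = h y) \<and>
    (AE w in PP. alive t w \<longrightarrow> A (ennreal t) w = h (path t w))"
proof -
  interpret prob_space PP by (rule prob_space_PP)
  note d = pcaf[unfolded pcaf_strict_def]
  have Am: "\<And>t. t < \<top> \<Longrightarrow> A t \<in> borel_measurable (aug_filtration P X t)"
    using d[THEN conjunct1] by blast
  from d[THEN conjunct2] obtain L where \<Lambda>s: "L \<in> sets (aug_filtration P X \<top>)"
    and L': "(\<forall>x. AE w in P (Some x). w \<in> L)
      \<and> (\<forall>w\<in>L. (\<forall>t<\<top>. \<theta> t w \<in> L)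
           \<and> A 0 w = 0
           \<and> (\<forall>t<lifetime X w. A t w < \<top>)
           \<and> (\<forall>t\<ge>lifetime X w. A t w = A (lifetime X w) w)
           \<and> continuous_on {..<\<top>} (\<lambda>t. A t w)
           \<and> (\<forall>s<\<top>. \<forall>t<\<top>. A (s + t) w = A s w + A t (\<theta> s w)))"
    by (rule bexE)
  have \<Lambda>P: "\<And>x. AE w in P (Some x). w \<in> L" by (rule L'[THEN conjunct1, THEN spec])
  have L: "A 0 w = 0 \<and> (\<forall>t<lifetime X w. A t w < \<top>)
         \<and> continuous_on {..<\<top>} (\<lambda>t. A t w) \<and> (\<forall>s<\<top>. \<forall>t<\<top>. A (s + t) w = A s w + A t (\<theta> s w))"
    if "w \<in> L" for w
    using bspec[OF L'[THEN conjunct2] that] by (elim conjE) (intro conjI; assumption)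
  have \<Lambda>AE: "AE w in PP. w \<in> L"
  proof -
    obtain \<Lambda>0 where [measurable]: "\<Lambda>0 \<in> sets (\<F> \<top>)" and e: "AE w in PP. w \<in> L \<longleftrightarrow> w \<in> \<Lambda>0"
      using aug_filtration_version[OF \<Lambda>s] by blast
    have "AE x in m. AE w in P (Some x). w \<in> \<Lambda>0"
      using AE_PP_D[OF e]
    proof eventually_elim
      case (elim x)
      then show ?case using \<Lambda>P[of x] by eventually_elim simp
    qed
    then have "AE w in PP. w \<in> \<Lambda>0" by (subst AE_PP_iff) measurable
    then show ?thesis using e by eventually_elim simp
  qed
  \<comment> \<open>At each deterministic time A is replaced by a version measurable for the raw
    filtration; the grids use countably many of these times.\<close>
  have "\<exists>\<eta>'\<in>borel_measurable (\<F> (ennreal s)). AE w in PP. A (ennreal s) w = \<eta>' w" for s :: real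
    by (intro aug_filtration_measurable_version Am) simp
  then obtain A' where A'm: "\<And>s::real. A' s \<in> borel_measurable (\<F> (ennreal s))" and A': "\<And>s. AE w in PP. A (ennreal s) w = A' s w"
    by metis
  have A'top[measurable]: "A' s \<in> BF" for s
    using measurable_\<F>_mono[OF _ A'm[of s]] by simp

  \<comment> \<open>Increments, compensators and cut-offs on the dyadic grids\<close>
  define r where "r n = t / 2^n" for n :: nat
  have r: "0 < r n" for n using t by (simp add: r_def)
  define \<eta> where "\<eta> n w = 1 - nexp (A' (r n) w)" for n w
  have \<eta>m: "\<eta> n \<in> borel_measurable (\<F> (ennreal (r n)))" for n
    unfolding \<eta>_def using A'm by measurable
  have \<eta>m'[measurable]: "\<eta> n \<in> BF" for n
    unfolding \<eta>_def by measurable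
  have \<eta>b: "0 \<le> \<eta> n w \<and> \<eta> n w \<le> 1" for n w
    using nexp_bounds[of "A' (r n) w"] by (simp add: \<eta>_def)
  define b where "b n z = enn2real (\<integral>\<^sup>+w. ennreal (\<eta> n w) \<partial>P z)" for n z
  have bm[measurable]: "b n \<in> borel_measurable cemetery_borel" for n
    unfolding b_def by measurable
  \<comment> \<open>A cut-off known at the k-th grid time. It keeps \<open>nexp\<close> of the
    functional above exp (-j), so that the increments c can be estimated by the increments of
    \<open>nexp\<close>.\<close>
  define V where "V j n k w = (if alive (real k * r n) w \<and> A' (real k * r n) w \<le> of_nat j then 1 else 0 :: real)" for j n k w
  have [measurable]: "Measurable.pred cemetery_borel (\<lambda>z::'a option. z \<noteq> None)"
  proof -
    have "{z \<in> space cemetery_borel. z \<noteq> (None :: 'a option)} = space cemetery_borel - {None}" by auto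
    then show ?thesis unfolding pred_def by (simp only:) (intro sets.Diff None_cemetery_borel sets.top)
  qed
  have Vm: "V j n k \<in> borel_measurable (\<F> (ennreal (real k * r n)))" for j n k
  proof -
    note [measurable] = A'm X_measurable[OF order_refl]
    show ?thesis unfolding V_def by measurable
  qed
  define c where "c n k w = \<eta> n (\<theta> (ennreal (real k * r n)) w)" for n k w
  define \<beta> where "\<beta> n k w = b n (XX (real k * r n) w)" for n k w
  define D where "D j n w = (\<Sum>k<2^n. V j n k w * (c n k w - \<beta> n k w))" for j n w
  have Dm[measurable]: "D j n \<in> BF" for j n
  proof -
    have [measurable]: "V j n k \<in> BF" for k using measurable_\<F>_mono[OF _ Vm[of j n k]] by simp
    have [measurable]: "c n k \<in> BF" for k
      unfolding c_def by (rule measurable_compose[OF shift_measurable \<eta>m']) simp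
    show ?thesis unfolding D_def \<beta>_def by measurable
  qed
  \<comment> \<open>Quadratic variation of the bounded transform along the grid: at most 1 because
    the transform decreases within [0,1], and tending to 0 by continuity, so that its mean tends to
    0.\<close>
  define W where "W n w = (\<Sum>k<2^n. (nexp (A' (real (Suc k) * r n) w) - nexp (A' (real k * r n) w))\<^sup>2)" for n w
  have [measurable]: "W n \<in> BF" for n unfolding W_def by measurable
  \<comment> \<open>Countably many identities between A and its versions, at grid times and after
    shifts while alive, hold outside one null set. The pathwise arguments below take place
    there.\<close>
  have good: "AE w in PP. w \<in> L \<and> (\<forall>n k. A (ennreal (real k * r n)) w = A' (real k * r n) w)
     \<and> (\<forall>n k. alive (real k * r n) w \<longrightarrow> A (ennreal (r n)) (\<theta> (ennreal (real k * r n)) w) = A' (r n) (\<theta> (ennreal (real k * r n)) w))"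
  proof (intro AE_conjI \<Lambda>AE)
    show "AE w in PP. \<forall>n k. A (ennreal (real k * r n)) w = A' (real k * r n) w"
      by (simp add: AE_all_countable A')
    have "AE w in PP. alive (real k * r n) w \<longrightarrow> A (ennreal (r n)) (\<theta> (ennreal (real k * r n)) w) = A' (r n) (\<theta> (ennreal (real k * r n)) w)" for n k
      using AE_PP_shift[OF A'[of "r n"], of "real k * r n"] r[of n] by simp
    then show "AE w in PP. \<forall>n k. alive (real k * r n) w \<longrightarrow> A (ennreal (r n)) (\<theta> (ennreal (real k * r n)) w) = A' (r n) (\<theta> (ennreal (real k * r n)) w)"
      by (simp add: AE_all_countable)
  qed
  have grid: "ennreal (real k * r n) + ennreal (r n) = ennreal (real (Suc k) * r n)" for k n
    using r[of n] by (simp add: ennreal_plus[symmetric] algebra_simps del: ennreal_plus)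
  have gridle: "real k * r n \<le> t" if "k \<le> 2^n" for k n
  proof -
    have "real k \<le> real (2 ^ n)" using that by (subst of_nat_le_iff)
    then have "real k * r n \<le> real (2 ^ n) * r n" using r[of n] by (intro mult_right_mono) auto
    then show ?thesis by (simp add: r_def)
  qed
  have cont: "continuous_on {0..t} (\<lambda>s. A (ennreal s) w)" if "w \<in> L" for w
  proof (rule continuous_on_compose2[of "{..<\<top>}" "\<lambda>s. A s w"])
    show "continuous_on {0..t} ennreal" by (intro continuous_on_ennreal continuous_on_id)
  qed (use L[OF that] in auto)
  have mono: "A (ennreal s) w \<le> A (ennreal u) w" if "w \<in> L" "0 \<le> s" "s \<le> u" for w s u
  proof -
    have "A (ennreal s + ennreal (u - s)) w = A (ennreal s) w + A (ennreal (u - s)) (\<theta> (ennreal s) w)"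
      using L[OF that(1)] by simp
    then show ?thesis using that by (simp add: ennreal_plus[symmetric] del: ennreal_plus)
  qed
  have step: "A (ennreal (real (Suc k) * r n)) w = A (ennreal (real k * r n)) w + A (ennreal (r n)) (\<theta> (ennreal (real k * r n)) w)"
    if "w \<in> L" for w n k
    unfolding grid[symmetric] using L[OF that] by simp
  have W: "AE w in PP. (\<lambda>n. W n w) \<longlonglongrightarrow> 0" "\<And>n. AE w in PP. norm (W n w) \<le> 1"
  proof -
    show "AE w in PP. (\<lambda>n. W n w) \<longlonglongrightarrow> 0"
      using good
    proof eventually_elim
      case (elim w)
      let ?g = "\<lambda>s. - nexp (A (ennreal s) w)"
      have "(\<lambda>n. \<Sum>k<2^n. (?g (real (Suc k) * (t / 2^n)) - ?g (real k * (t / 2^n)))\<^sup>2) \<longlonglongrightarrow> 0"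
      proof (rule grid_squares_tendsto_0[OF t])
        show "continuous_on {0..t} ?g"
          using cont[of w] elim unfolding continuous_on_def by (intro ballI tendsto_minus tendsto_nexp) auto
        show "?g s \<le> ?g u" if "0 \<le> s" "s \<le> u" "u \<le> t" for s u
          using mono[of w s u] that elim by (auto intro: nexp_antimono)
      qed
      moreover have "W n w = (\<Sum>k<2^n. (?g (real (Suc k) * (t / 2^n)) - ?g (real k * (t / 2^n)))\<^sup>2)" for n
      proof -
        have "A (ennreal (real k * (t / 2^n))) w = A' (real k * r n) w" for k using elim by (simp add: r_def)
        then show ?thesis unfolding W_def by (intro sum.cong refl) (simp add: power2_commute del: of_nat_Suc)
      qed
      ultimately show ?case by simp
    qed
    show "AE w in PP. norm (W n w) \<le> 1" for n
      using good
    proof eventually_elim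
      case (elim w)
      let ?f = "\<lambda>k. nexp (A' (real k * r n) w)"
      have "W n w \<le> (\<Sum>k<2^n. ?f k - ?f (Suc k))"
        unfolding W_def
      proof (rule sum_mono)
        fix k
        have "A' (real k * r n) w \<le> A' (real (Suc k) * r n) w"
          using elim mono[of w "real k * r n" "real (Suc k) * r n"] r[of n] by (simp add: mult_right_mono del: of_nat_Suc)
        then have "0 \<le> ?f k - ?f (Suc k)" "?f k - ?f (Suc k) \<le> 1"
          using nexp_antimono nexp_bounds[of "A' (real k * r n) w"] nexp_bounds[of "A' (real (Suc k) * r n) w"] by auto
        then have "(?f k - ?f (Suc k)) * (?f k - ?f (Suc k)) \<le> (?f k - ?f (Suc k)) * 1" by (intro mult_left_mono)
        moreover have "(?f (Suc k) - ?f k)\<^sup>2 = (?f k - ?f (Suc k)) * (?f k - ?f (Suc k))"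
          by (simp add: power2_eq_square algebra_simps del: of_nat_Suc)
        ultimately show "(?f (Suc k) - ?f k)\<^sup>2 \<le> ?f k - ?f (Suc k)" by (simp only: mult_1_right)
      qed
      also have "\<dots> = ?f 0 - ?f (2^n)" by (rule sum_lessThan_telescope')
      also have "\<dots> \<le> 1" using nexp_bounds[of "A' (real 0 * r n) w"] nexp_bounds[of "A' (real (2^n) * r n) w"] by linarith
      finally show ?case by (simp add: W_def sum_nonneg)
    qed
  qed

  \<comment> \<open>Mean square convergence of the compensated sums\<close>
  have Wint: "integrable PP (W n)" for n
    by (rule integrable_const_bound[OF W(2)]) measurable
  have Wlim: "(\<lambda>n. \<integral>w. W n w \<partial>PP) \<longlonglongrightarrow> 0"
    using integral_dominated_convergence[of "\<lambda>_. 0" PP W "\<lambda>_. 1"] W by simp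
  \<comment> \<open>With f_k for \<open>nexp\<close> of the functional at the k-th grid time,
    multiplicativity gives c f_k = f_k - f_(k+1), and the cut-off gives f_k \<ge> exp (-j). This is
    the origin of the factor exp (j) squared.\<close>
  have DW: "(\<integral>w. (D j n w)\<^sup>2 \<partial>PP) \<le> (exp (real j))\<^sup>2 * (\<integral>w. W n w \<partial>PP)" for j n
  proof -
    have \<xi>V: "\<bar>V j n k w * (c n k w)\<^sup>2\<bar> \<le> 1" for k w
      using \<eta>b by (auto simp: V_def c_def power_le_one)
    have "(\<integral>w. (D j n w)\<^sup>2 \<partial>PP) \<le> (\<integral>w. (\<Sum>k<2^n. V j n k w * (c n k w)\<^sup>2) \<partial>PP)"
      unfolding D_def c_def \<beta>_def b_def
    proof (rule compensator_L2[OF less_imp_le[OF r] \<eta>m \<eta>b Vm])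
      show "V j n k w = 0 \<or> V j n k w = 1" for k w by (simp add: V_def)
    qed
    also have "\<dots> \<le> (\<integral>w. (exp (real j))\<^sup>2 * W n w \<partial>PP)"
    proof (rule integral_mono_AE)
      have [measurable]: "V j n k \<in> BF" for k using measurable_\<F>_mono[OF _ Vm[of j n k]] by simp
      have [measurable]: "c n k \<in> BF" for k
        unfolding c_def by (rule measurable_compose[OF shift_measurable \<eta>m']) simp
      show "integrable PP (\<lambda>w. \<Sum>k<2^n. V j n k w * (c n k w)\<^sup>2)"
        using \<xi>V by (intro Bochner_Integration.integrable_sum integrable_const_bound[where B=1]) auto
      show "integrable PP (\<lambda>w. (exp (real j))\<^sup>2 * W n w)" using Wint by simp
      show "AE w in PP. (\<Sum>k<2^n. V j n k w * (c n k w)\<^sup>2) \<le> (exp (real j))\<^sup>2 * W n w"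
        using good
      proof eventually_elim
        case (elim w)
        show ?case unfolding W_def sum_distrib_left
        proof (rule sum_mono)
          fix k
          let ?f = "\<lambda>k. nexp (A' (real k * r n) w)"
          show "V j n k w * (c n k w)\<^sup>2 \<le> (exp (real j))\<^sup>2 * (?f (Suc k) - ?f k)\<^sup>2"
          proof (cases "V j n k w = 0")
            case False
            then have alive: "alive (real k * r n) w" and le: "A' (real k * r n) w \<le> of_nat j" and V1: "V j n k w = 1"
              by (auto simp: V_def split: if_splits)
            have "A' (real (Suc k) * r n) w = A' (real k * r n) w + A' (r n) (\<theta> (ennreal (real k * r n)) w)"
              using step[of w k n] elim alive by metis
            then have "?f (Suc k) = ?f k * (1 - c n k w)" by (simp add: nexp_add c_def \<eta>_def)
            then have diff: "?f k * c n k w = ?f k - ?f (Suc k)" by (simp add: algebra_simps)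
            have "nexp (of_nat j) \<le> ?f k" by (rule nexp_antimono[OF le])
            then have fk: "exp (- real j) \<le> ?f k" by (simp add: nexp_def ennreal_of_nat_eq_real_of_nat)
            have "c n k w = exp (real j) * (exp (- real j) * c n k w)"
              by (simp add: exp_add[symmetric] mult.assoc[symmetric])
            also have "\<dots> \<le> exp (real j) * (?f k * c n k w)"
              using fk \<eta>b by (intro mult_left_mono mult_right_mono) (auto simp: c_def)
            finally have "c n k w \<le> exp (real j) * (?f k - ?f (Suc k))" unfolding diff .
            then have "(c n k w)\<^sup>2 \<le> (exp (real j) * (?f k - ?f (Suc k)))\<^sup>2"
              using \<eta>b by (intro power_mono) (auto simp: c_def)
            then show ?thesis by (simp add: V1 power_mult_distrib power2_commute[of "nexp (A' (real (Suc k) * r n) w)"] del: of_nat_Suc)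
          qed simp
        qed
      qed
    qed
    finally show ?thesis by simp
  qed
  \<comment> \<open>The level is coupled to the cut-off: as j is released, the mesh is refined fast
    enough for the second moments to be summable.\<close>
  have "\<exists>n\<ge>j. (\<integral>w. (D j n w)\<^sup>2 \<partial>PP) \<le> (1/2)^j" for j
  proof -
    have "(\<lambda>n. (exp (real j))\<^sup>2 * (\<integral>w. W n w \<partial>PP)) \<longlonglongrightarrow> (exp (real j))\<^sup>2 * 0"
      by (intro tendsto_intros Wlim)
    then have "\<forall>\<^sub>F n in sequentially. (exp (real j))\<^sup>2 * (\<integral>w. W n w \<partial>PP) < (1/2)^j"
      by (rule order_tendstoD) simp
    then obtain n0 where "\<And>n. n0 \<le> n \<Longrightarrow> (exp (real j))\<^sup>2 * (\<integral>w. W n w \<partial>PP) < (1/2)^j"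
      by (auto simp: eventually_sequentially)
    from this[of "max n0 j"] DW[of j "max n0 j"] show ?thesis by (intro exI[of _ "max n0 j"]) simp
  qed
  then obtain N where N: "\<And>j. j \<le> N j" "\<And>j. (\<integral>w. (D j (N j) w)\<^sup>2 \<partial>PP) \<le> (1/2)^j" by metis
  have \<beta>b: "0 \<le> b n z \<and> b n z \<le> 1" for n z
  proof -
    have "(\<integral>\<^sup>+w. ennreal (\<eta> n w) \<partial>P z) \<le> (\<integral>\<^sup>+w. 1 \<partial>P z)"
      using \<eta>b by (intro nn_integral_mono) auto
    then show ?thesis unfolding b_def by (auto intro!: enn2real_leI)
  qed
  have Dlim: "AE w in PP. (\<lambda>j. D j (N j) w) \<longlonglongrightarrow> 0"
  proof (rule AE_tendsto_0_of_summable)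
    fix j
    show "D j (N j) \<in> borel_measurable PP" by measurable
    have "\<bar>D j (N j) w\<bar> \<le> 2 ^ N j" for w
    proof -
      have "\<bar>D j (N j) w\<bar> \<le> (\<Sum>k<2^N j. \<bar>V j (N j) k w * (c (N j) k w - \<beta> (N j) k w)\<bar>)" unfolding D_def by (rule sum_abs)
      also have "\<dots> \<le> (\<Sum>k<(2::nat)^N j. 1)"
      proof (rule sum_mono)
        fix k show "\<bar>V j (N j) k w * (c (N j) k w - \<beta> (N j) k w)\<bar> \<le> 1"
          using \<eta>b[of "N j" "\<theta> (ennreal (real k * r (N j))) w"] \<beta>b[of "N j" "XX (real k * r (N j)) w"]
          by (auto simp: V_def c_def \<beta>_def)
      qed
      finally show ?thesis by simp
    qed
    then have "integrable PP (\<lambda>w. (D j (N j) w)\<^sup>2)"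
      by (intro integrable_const_bound[where B="(2 ^ N j)\<^sup>2"]) (auto simp: power2_le_iff_abs_le)
    then have "(\<integral>\<^sup>+w. ennreal ((D j (N j) w)\<^sup>2) \<partial>PP) = ennreal (\<integral>w. (D j (N j) w)\<^sup>2 \<partial>PP)"
      by (intro nn_integral_eq_integral) auto
    then show "(\<integral>\<^sup>+w. ennreal ((D j (N j) w)\<^sup>2) \<partial>PP) \<le> ennreal ((1/2)^j)"
      using N(2)[of j] by (simp add: ennreal_leI)
  qed
  have \<delta>lim: "r \<longlonglongrightarrow> 0"
  proof -
    have "(\<lambda>n. t * (1 / 2) ^ n) \<longlonglongrightarrow> t * 0" by (intro tendsto_intros) auto
    then show ?thesis by (simp add: r_def[abs_def] power_divide)
  qed
  \<comment> \<open>The compensator is a sum over k < 2^n and thus omits the final grid point, which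
    breaks the symmetry k -> 2^n - k. Adding the term at k = 2^n restores it, and by continuity of A
    at 0 this term is negligible.\<close>
  have blim: "AE x in m. (\<lambda>n. b n (Some x)) \<longlonglongrightarrow> 0"
    using AE_PP_D[OF good]
  proof eventually_elim
    case (elim x)
    have *: "AE w in P (Some x). (\<lambda>n. ennreal (\<eta> n w)) \<longlonglongrightarrow> 0"
      using elim
    proof eventually_elim
      case (elim w)
      have d: "r n \<in> {0..t}" for n using r[of n] gridle[of 1 n] by simp
      have "((\<lambda>s. A (ennreal s) w) \<longlongrightarrow> A (ennreal 0) w) (at 0 within {0..t})"
        using cont[of w, unfolded continuous_on_def, rule_format, of 0] elim t by simp
      then have "(\<lambda>n. A (ennreal (r n)) w) \<longlonglongrightarrow> A (ennreal 0) w"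
      proof (rule filterlim_compose)
        have "r n \<noteq> 0" for n using r[of n] by simp
        then show "filterlim r (at 0 within {0..t}) sequentially"
          unfolding filterlim_at using \<delta>lim d by simp
      qed
      then have "(\<lambda>n. nexp (A (ennreal (r n)) w)) \<longlonglongrightarrow> nexp 0"
        using L[of w] elim by (intro tendsto_nexp) auto
      moreover have "A (ennreal (r n)) w = A' (r n) w" for n
        using elim[THEN conjunct2, THEN conjunct1, rule_format, of 1 n] by simp
      ultimately have "(\<lambda>n. 1 - nexp (A' (r n) w)) \<longlonglongrightarrow> 1 - 1"
        by (intro tendsto_diff tendsto_const) simp
      then show ?case unfolding \<eta>_def using tendsto_ennrealI by fastforce
    qed
    have "(\<lambda>n. \<integral>\<^sup>+w. ennreal (\<eta> n w) \<partial>P (Some x)) \<longlonglongrightarrow> EE (\<lambda>w. 0) x"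
      by (rule nn_integral_dominated_convergence[where w="\<lambda>_. 1"]) (use * \<eta>b in \<open>auto cong: measurable_cong_sets\<close>)
    then have "(\<lambda>n. \<integral>\<^sup>+w. ennreal (\<eta> n w) \<partial>P (Some x)) \<longlonglongrightarrow> ennreal 0" by simp
    then show ?case unfolding b_def by (intro tendsto_enn2real) auto
  qed
  \<comment> \<open>The sum runs over all grid points including both ends, so it is exactly
    invariant under reversal. The lower limit is measurable on all of path space and equals the
    limit wherever that exists.\<close>
  define h where "h y = liminf (\<lambda>j. ennreal (\<Sum>k\<le>2^N j. b (N j) (Some (y (real k / 2^N j)))))" for y :: "real \<Rightarrow> 'a"
  show ?thesis
  proof (intro bexI[of _ h] conjI allI)
    have "(\<lambda>y. b n (Some (y (real k / 2^n)))) \<in> BP" if "k \<le> 2^n" for n k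
      using dyadicsI[OF that] by measurable
    then show "h \<in> BP"
      unfolding h_def[abs_def] by (intro borel_measurable_liminf measurable_compose[OF _ measurable_ennreal] borel_measurable_sum) auto
    show "h (reverse_path y) = h y" for y
    proof -
      have "(\<Sum>k\<le>2^n. b n (Some (reverse_path y (real k / 2^n)))) = (\<Sum>k\<le>2^n. b n (Some (y (real k / 2^n))))" for n
      proof -
        have "(\<Sum>k\<le>2^n. b n (Some (reverse_path y (real k / 2^n)))) = (\<Sum>k\<le>2^n. b n (Some (y (real (2^n - k) / 2^n))))"
        proof (intro sum.cong refl)
          fix k :: nat assume "k \<in> {..2^n}"
          then have k: "k \<le> 2^n" by simp
          have "1 - real k / 2^n = real (2^n - k) / 2^n" using k by (simp add: of_nat_diff diff_divide_distrib)
          then show "b n (Some (reverse_path y (real k / 2^n))) = b n (Some (y (real (2^n - k) / 2^n)))"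
            using dyadicsI[OF k] by simp
        qed
        also have "\<dots> = (\<Sum>k\<le>2^n. b n (Some (y (real k / 2^n))))"
          by (rule sum.reindex_bij_witness[of _ "\<lambda>k. 2^n - k" "\<lambda>k. 2^n - k"]) auto
        finally show ?thesis .
      qed
      then show ?thesis by (simp add: h_def)
    qed

    \<comment> \<open>Identification of the limit along a surviving path\<close>
    show "AE w in PP. alive t w \<longrightarrow> A (ennreal t) w = h (path t w)"
      using good Dlim AE_PP_law[OF blim less_imp_le[OF t]]
    proof eventually_elim
      case (elim w)
      show ?case
      proof
        assume alive: "alive t w"
        then obtain y where y: "XX t w = Some y" by auto
        have w: "w \<in> L" using elim by simp
        have alive_k: "alive (real k * r n) w" if "k \<le> 2^n" for k n
          by (rule alive_mono[OF _ alive]) (use gridle[OF that] in \<open>auto intro: ennreal_leI\<close>)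
        have fin: "A (ennreal t) w < \<top>" using L[OF w] less_lifetime[OF alive] by simp
        have fin': "A (ennreal s) w < \<top>" if "0 \<le> s" "s \<le> t" for s
          using mono[OF w that] fin by (rule le_less_trans)
        define a where "a s = enn2real (A (ennreal s) w)" for s
        have a: "A (ennreal s) w = ennreal (a s)" if "0 \<le> s" "s \<le> t" for s
          using fin'[OF that] by (simp add: a_def)
        have a0: "a 0 = 0" using L[OF w] by (simp add: a_def)
        have amono: "a s \<le> a u" if "0 \<le> s" "s \<le> u" "u \<le> t" for s u
          unfolding a_def using mono[OF w that(1,2)] fin'[of u] that by (intro enn2real_mono) auto
        have acont: "continuous_on {0..t} a"
          unfolding continuous_on_def a_def
        proof
          fix s assume s: "s \<in> {0..t}"
          show "((\<lambda>s. enn2real (A (ennreal s) w)) \<longlongrightarrow> enn2real (A (ennreal s) w)) (at s within {0..t})"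
            using cont[OF w] s fin'[of s] by (intro tendsto_enn2real) (auto simp: continuous_on_def)
        qed
        let ?d = "\<lambda>n k. a (real (Suc k) * r n) - a (real k * r n)"
        have \<xi>eq: "c n k w = 1 - exp (- ?d n k)" "0 \<le> ?d n k" if k: "k < 2^n" for n k
        proof -
          have s: "0 \<le> real k * r n" "real k * r n \<le> real (Suc k) * r n" "real (Suc k) * r n \<le> t"
            using r[of n] gridle[of "Suc k" n] k by (auto simp: mult_right_mono)
          show d0: "0 \<le> ?d n k" using amono[OF s] by simp
          have "alive (real k * r n) w" using alive_k k by simp
          then have "A (ennreal (r n)) (\<theta> (ennreal (real k * r n)) w) = A' (r n) (\<theta> (ennreal (real k * r n)) w)"
            using elim by blast
          then have "ennreal (a (real (Suc k) * r n)) = ennreal (a (real k * r n)) + A' (r n) (\<theta> (ennreal (real k * r n)) w)"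
            using step[OF w, of k n] a[of "real k * r n"] a[of "real (Suc k) * r n"] s by (metis order_trans)
          moreover have "ennreal (a (real (Suc k) * r n)) = ennreal (a (real k * r n)) + ennreal (?d n k)"
            using d0 by (subst ennreal_plus[symmetric]) (auto simp: a_def)
          ultimately have "A' (r n) (\<theta> (ennreal (real k * r n)) w) = ennreal (?d n k)" by simp
          then show "c n k w = 1 - exp (- ?d n k)"
            using d0 by (simp add: c_def \<eta>_def nexp_def)
        qed
        have tele: "(\<Sum>k<2^n. ?d n k) = a t" for n
        proof -
          have "(\<Sum>k<2^n. ?d n k) = a (real (2^n) * r n) - a (real 0 * r n)"
            by (rule sum_lessThan_telescope)
          then show ?thesis by (simp add: a0 r_def)
        qed
        have "(\<lambda>n. \<Sum>k<2^n. (?d n k)\<^sup>2) \<longlonglongrightarrow> 0"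
          unfolding r_def by (rule grid_squares_tendsto_0[OF t acont amono])
        then have "(\<lambda>n. a t - (\<Sum>k<2^n. (?d n k)\<^sup>2)) \<longlonglongrightarrow> a t - 0" by (intro tendsto_intros)
        then have lower: "(\<lambda>n. a t - (\<Sum>k<2^n. (?d n k)\<^sup>2)) \<longlonglongrightarrow> a t" by simp
        \<comment> \<open>The increments of a sum to a t, and replacing d by 1 - exp (-d) changes
          the sum by at most the sum of the squares, which vanishes.\<close>
        have "(\<lambda>n. \<Sum>k<2^n. c n k w) \<longlonglongrightarrow> a t"
        proof (rule real_tendsto_sandwich[OF _ _ lower tendsto_const])
          show "\<forall>\<^sub>F n in sequentially. a t - (\<Sum>k<2^n. (?d n k)\<^sup>2) \<le> (\<Sum>k<2^n. c n k w)"
          proof (intro always_eventually allI)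
            fix n
            have "a t - (\<Sum>k<2^n. (?d n k)\<^sup>2) = (\<Sum>k<2^n. ?d n k - (?d n k)\<^sup>2)"
              unfolding tele[of n, symmetric] by (rule sum_subtractf[symmetric])
            also have "\<dots> \<le> (\<Sum>k<2^n. c n k w)"
            proof (rule sum_mono)
              fix k :: nat assume "k \<in> {..<2^n}"
              then have k: "k < 2^n" by simp
              show "?d n k - (?d n k)\<^sup>2 \<le> c n k w"
                unfolding \<xi>eq(1)[OF k] by (rule one_minus_exp_bounds(1)[OF \<xi>eq(2)[OF k]])
            qed
            finally show "a t - (\<Sum>k<2^n. (?d n k)\<^sup>2) \<le> (\<Sum>k<2^n. c n k w)" .
          qed
          show "\<forall>\<^sub>F n in sequentially. (\<Sum>k<2^n. c n k w) \<le> a t"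
          proof (intro always_eventually allI)
            fix n show "(\<Sum>k<2^n. c n k w) \<le> a t"
              unfolding tele[of n, symmetric]
            proof (rule sum_mono)
              fix k :: nat assume "k \<in> {..<2^n}"
              then have k: "k < 2^n" by simp
              show "c n k w \<le> ?d n k"
                unfolding \<xi>eq(1)[OF k] by (rule one_minus_exp_bounds(2)[OF \<xi>eq(2)[OF k]])
            qed
          qed
        qed
        moreover have Nlim: "filterlim N sequentially sequentially"
          by (rule filterlim_at_top_mono[OF filterlim_ident]) (use N(1) in auto)
        ultimately have \<xi>lim: "(\<lambda>j. \<Sum>k<2^N j. c (N j) k w) \<longlonglongrightarrow> a t"
          by (rule filterlim_compose)
        \<comment> \<open>From j0 on the cut-off equals 1 at every grid point before t.\<close>
        obtain j0 :: nat where j0: "A (ennreal t) w \<le> of_nat j0"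
          using ennreal_Ex_less_of_nat[OF fin] by (auto intro: less_imp_le)
        have V1: "V j n k w = 1" if "j0 \<le> j" "k < 2^n" for j n k
        proof -
          have "A' (real k * r n) w = A (ennreal (real k * r n)) w" using elim by simp
          also have "\<dots> \<le> A (ennreal t) w" using that r[of n] gridle[of k n] by (intro mono w) auto
          also have "\<dots> \<le> of_nat j0" by (rule j0)
          also have "\<dots> \<le> of_nat j" using that by simp
          finally show ?thesis using alive_k[of k n] that by (simp add: V_def)
        qed
        have "(\<lambda>j. (\<Sum>k<2^N j. c (N j) k w) - D j (N j) w + b (N j) (XX t w)) \<longlonglongrightarrow> a t - 0 + 0"
        proof (intro tendsto_add tendsto_diff \<xi>lim)
          show "(\<lambda>j. D j (N j) w) \<longlonglongrightarrow> 0" using elim by simp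
          show "(\<lambda>j. b (N j) (XX t w)) \<longlonglongrightarrow> 0"
            unfolding y by (rule filterlim_compose[OF _ Nlim]) (use elim(3) y in simp)
        qed
        moreover have "(\<Sum>k<2^N j. c (N j) k w) - D j (N j) w + b (N j) (XX t w)
           = (\<Sum>k\<le>2^N j. b (N j) (Some (path t w (real k / 2^N j))))" if "j0 \<le> j" for j
        proof -
          have p: "Some (path t w (real k / 2^n)) = XX (real k * r n) w" if k: "k \<le> 2^n" for k n
          proof -
            have "t * (real k / 2^n) = real k * r n" by (simp add: r_def)
            then show ?thesis using alive_k[OF k] dyadicsI[OF k] by (simp add: path_def)
          qed
          have "D j (N j) w = (\<Sum>k<2^N j. c (N j) k w - \<beta> (N j) k w)"
            unfolding D_def using V1[OF that] by (intro sum.cong) auto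
          then have "(\<Sum>k<2^N j. c (N j) k w) - D j (N j) w = (\<Sum>k<2^N j. \<beta> (N j) k w)"
            by (simp add: sum_subtractf)
          also have "\<dots> = (\<Sum>k<2^N j. b (N j) (Some (path t w (real k / 2^N j))))"
            unfolding \<beta>_def using p by (intro sum.cong) auto
          finally have *: "(\<Sum>k<2^N j. c (N j) k w) - D j (N j) w = (\<Sum>k<2^N j. b (N j) (Some (path t w (real k / 2^N j))))" .
          have "XX t w = Some (path t w (real (2^N j) / 2^N j))"
            using p[of "2^N j" "N j"] by (simp add: r_def)
          moreover have "{..2^N j} = insert (2^N j) {..<2^N j :: nat}" by auto
          ultimately show ?thesis unfolding * by (simp add: add.commute)
        qed
        then have "\<forall>\<^sub>F j in sequentially. (\<Sum>k<2^N j. c (N j) k w) - D j (N j) w + b (N j) (XX t w)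
           = (\<Sum>k\<le>2^N j. b (N j) (Some (path t w (real k / 2^N j))))"
          unfolding eventually_sequentially by blast
        ultimately have "(\<lambda>j. \<Sum>k\<le>2^N j. b (N j) (Some (path t w (real k / 2^N j)))) \<longlonglongrightarrow> a t - 0 + 0"
          by (rule Lim_transform_eventually)
        then have "(\<lambda>j. ennreal (\<Sum>k\<le>2^N j. b (N j) (Some (path t w (real k / 2^N j))))) \<longlonglongrightarrow> ennreal (a t)"
          by (intro tendsto_ennrealI) simp
        then have "h (path t w) = ennreal (a t)"
          unfolding h_def by (intro lim_imp_Liminf) auto
        then show "A (ennreal t) w = h (path t w)" using a[of t] t by simp
      qed
    qed
  qed
qed

end

section \<open>Oscillations and jumps of right continuous paths\<close>

text \<open>Counts moves larger than e over successive nonoverlapping dyadic intervals, the last one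
  being split off first. The quantifiers are countable, which makes the property measurable in the
  path.\<close>

primrec oscillates :: "real \<Rightarrow> (real \<Rightarrow> 'b::metric_space) \<Rightarrow> nat \<Rightarrow> real \<Rightarrow> bool" where
  "oscillates e y 0 q \<longleftrightarrow> True"
| "oscillates e y (Suc n) q \<longleftrightarrow> (\<exists>r\<in>dyadics. \<exists>p\<in>dyadics. r < p \<and> p \<le> q \<and> oscillates e y n r \<and> e < dist (y r) (y p))"

lemma oscillates_mono: "oscillates e y n q \<Longrightarrow> q \<le> q' \<Longrightarrow> oscillates e y n q'"
  by (cases n) (auto intro: order_trans)

text \<open>The first time of infinite oscillation is approached from the left.  In contrast to the absence of
  left limits, this is a measurable condition on paths along the dyadic times.\<close>

definition left_explosion :: "real \<Rightarrow> (real \<Rightarrow> 'b::metric_space) \<Rightarrow> bool" where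
  "left_explosion e y \<longleftrightarrow> (\<forall>n. \<exists>q\<in>dyadics. oscillates e y n q \<and> (\<exists>k. \<not> oscillates e y k q))"

lemma dyadics_dense:
  assumes "0 \<le> a" "a < b" "b \<le> 1"
  shows "\<exists>q\<in>dyadics. a < q \<and> q < b"
proof -
  have "(\<lambda>n. (1/2)^n :: real) \<longlonglongrightarrow> 0" by (intro LIMSEQ_realpow_zero) auto
  then have "\<forall>\<^sub>F n in sequentially. (1/2)^n < (b - a) / 2"
    using assms by (intro order_tendstoD) auto
  then obtain n where n: "(1/2::real)^n < (b - a) / 2" by (auto simp: eventually_sequentially)
  define k where "k = nat \<lfloor>a * 2^n\<rfloor> + 1"
  have "0 \<le> a * 2^n" using assms by simp
  then have k: "a * 2^n < real k" "real k \<le> a * 2^n + 1"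
    unfolding k_def by linarith+
  have 1: "a < real k / 2^n" using k(1) by (simp add: pos_less_divide_eq)
  have "real k / 2^n \<le> (a * 2^n + 1) / 2^n" using k(2) by (intro divide_right_mono) auto
  also have "\<dots> = a + (1/2)^n" by (simp add: add_divide_distrib power_divide)
  also have "\<dots> < b" using n assms by simp
  finally have 2: "real k / 2^n < b" .
  have "real k / 2^n < 1" using 2 assms(3) by linarith
  then have "real k < 2^n" by (simp only: pos_divide_less_eq zero_less_power zero_less_numeral mult_1)
  then have "k \<le> 2^n" by (metis less_imp_le of_nat_le_iff of_nat_numeral of_nat_power)
  then show ?thesis using dyadicsI[of k n] 1 2 by auto
qed

text \<open>Without left explosion a single n bounds the count at all times of finite oscillation.
  Let s be their supremum. Right regularity carries finiteness beyond s if s < 1; if s = 1, only one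
  more move is possible up to time 1.\<close>

lemma finite_oscillation:
  assumes rl: "\<And>s. 0 \<le> s \<Longrightarrow> s < 1 \<Longrightarrow> \<exists>b>s. \<forall>r\<in>dyadics. \<forall>p\<in>dyadics. s < r \<and> r < p \<and> p < b \<longrightarrow> dist (y r) (y p) \<le> e"
    and ne: "\<not> left_explosion e y"
  shows "\<exists>k. \<not> oscillates e y k 1"
proof (rule ccontr)
  assume "\<not> ?thesis"
  then have inf1: "\<And>k. oscillates e y k 1" by auto
  define G where "G = {q\<in>dyadics. \<exists>k. \<not> oscillates e y k q}"
  obtain n where n: "\<And>q. q \<in> G \<Longrightarrow> \<not> oscillates e y n q"
    using ne unfolding left_explosion_def G_def by blast
  have "\<not> oscillates e y (Suc 0) 0" using dyadics_bounds(1) by fastforce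
  then have G0: "0 \<in> G" unfolding G_def by (metis (mono_tags, lifting) dyadics_0_1(1) mem_Collect_eq)
  have bdd: "bdd_above G" using dyadics_bounds(2) by (auto simp: G_def intro!: bdd_aboveI[of _ 1])
  define s where "s = Sup G"
  have s0: "0 \<le> s" unfolding s_def by (rule cSup_upper[OF G0 bdd])
  have s1: "s \<le> 1" unfolding s_def
  proof (rule cSup_least)
    show "x \<le> 1" if "x \<in> G" for x using that dyadics_bounds(2) by (simp add: G_def)
  qed (use G0 in blast)
  note s = s0 s1
  have below: "r \<in> G" if "r \<in> dyadics" "r < s" for r
  proof -
    have "r < Sup G" using that(2) by (simp only: s_def)
    then obtain g where g: "g \<in> G" "r < g" using less_cSup_iff[OF _ bdd, of r] G0 by blast
    then obtain k where "\<not> oscillates e y k g" by (auto simp: G_def)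
    then have "\<not> oscillates e y k r" using oscillates_mono[of e y k r g] g by auto
    then show ?thesis using that by (auto simp: G_def)
  qed
  have above: "q \<notin> G" if "s < q" for q
    using cSup_upper[OF _ bdd, of q] that by (auto simp: s_def)
  show False
  proof (cases "s < 1")
    case True
    obtain b where b: "s < b" "\<And>r p. r \<in> dyadics \<Longrightarrow> p \<in> dyadics \<Longrightarrow> s < r \<Longrightarrow> r < p \<Longrightarrow> p < b \<Longrightarrow> dist (y r) (y p) \<le> e"
      using rl[OF s(1) True] by blast
    obtain q where q: "q \<in> dyadics" "s < q" "q < min b 1" using dyadics_dense[of s "min b 1"] s b(1) True by auto
    \<comment> \<open>Two moves more than n: by right regularity the last one begins no later than
      s, so the one before it begins strictly before s, at a time in G with at least n
      moves.\<close>
    have "oscillates e y (Suc (Suc n)) q" using above[OF q(2)] q(1) by (auto simp: G_def simp del: oscillates.simps)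
    then obtain r p where rp: "r \<in> dyadics" "p \<in> dyadics" "r < p" "p \<le> q" "oscillates e y (Suc n) r" "e < dist (y r) (y p)"
      by auto
    have "r \<le> s" using b(2)[OF rp(1,2)] rp q by force
    obtain r' p' where rp': "r' \<in> dyadics" "r' < p'" "p' \<le> r" "oscillates e y n r'" using rp(5) by auto
    have "r' \<in> G" using rp' \<open>r \<le> s\<close> by (intro below) auto
    then show False using n rp'(4) by blast
  next
    case False
    then have s1: "s = 1" using s by simp
    obtain r p where rp: "r \<in> dyadics" "p \<in> dyadics" "r < p" "p \<le> 1" "oscillates e y n r"
      using inf1[of "Suc n"] by auto
    have "r \<in> G" using rp s1 by (intro below) auto
    then show False using n rp(5) by blast
  qed
qed

text \<open>The time is the supremum of the times with finite oscillation. It is not attained, and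
  as the counts are unbounded among these times, some move begins after any given one of them and
  ends before the supremum.\<close>

lemma left_explosionD:
  assumes le: "left_explosion e y"
  shows "\<exists>s. 0 < s \<and> s \<le> 1 \<and> (\<forall>b<s. \<exists>r\<in>dyadics. \<exists>p\<in>dyadics. b < r \<and> r < p \<and> p < s \<and> e < dist (y r) (y p))"
proof -
  define G where "G = {q\<in>dyadics. \<exists>k. \<not> oscillates e y k q}"
  have ex: "\<exists>q\<in>G. oscillates e y n q" for n
    using le unfolding left_explosion_def G_def by blast
  then have ne: "G \<noteq> {}" by blast
  have bdd: "bdd_above G" using dyadics_bounds(2) by (auto simp: G_def intro!: bdd_aboveI[of _ 1])
  define s where "s = Sup G"
  have s1: "s \<le> 1" unfolding s_def using ne dyadics_bounds(2) by (intro cSup_least) (auto simp: G_def)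
  have sG: "s \<notin> G"
  proof
    assume "s \<in> G"
    then obtain k where k: "\<not> oscillates e y k s" by (auto simp: G_def)
    obtain q where "q \<in> G" "oscillates e y k q" using ex by blast
    moreover then have "q \<le> s" unfolding s_def by (intro cSup_upper bdd)
    ultimately show False using oscillates_mono k by blast
  qed
  have lt: "q < s" if "q \<in> G" for q
    using cSup_upper[OF that bdd] sG that by (auto simp: s_def less_le)
  have s0: "0 < s" using ne lt dyadics_bounds(1) by (force simp: G_def)
  have "\<exists>r\<in>dyadics. \<exists>p\<in>dyadics. b < r \<and> r < p \<and> p < s \<and> e < dist (y r) (y p)" if "b < s" for b
  proof -
    have "b < Sup G" using that by (simp only: s_def)
    then obtain g where g: "g \<in> G" "b < g" using less_cSup_iff[OF ne bdd, of b] by blast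
    then obtain k where k: "\<not> oscillates e y k g" by (auto simp: G_def)
    obtain q where q: "q \<in> G" "oscillates e y (Suc k) q" using ex by blast
    then obtain r p where rp: "r \<in> dyadics" "p \<in> dyadics" "r < p" "p \<le> q" "oscillates e y k r" "e < dist (y r) (y p)"
      by auto
    have "g < r" using k rp(5) oscillates_mono[of e y k r g] by (auto simp: not_le[symmetric])
    then show ?thesis using rp g lt[OF q(1)] by (intro bexI[of _ r] bexI[of _ p]) auto
  qed
  then show ?thesis using s0 s1 by blast
qed

text \<open>Otherwise large moves before s could be strung together without end, each starting after
  the previous one.\<close>

lemma left_cauchy_of_finite_oscillation:
  assumes fin: "\<not> oscillates e y k 1" and s: "0 < s" "s \<le> 1"
  shows "\<exists>b<s. \<forall>r\<in>dyadics. \<forall>p\<in>dyadics. b < r \<and> r < p \<and> p < s \<longrightarrow> dist (y r) (y p) \<le> e"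
proof (rule ccontr)
  assume "\<not> ?thesis"
  then have ex: "\<exists>r\<in>dyadics. \<exists>p\<in>dyadics. b < r \<and> r < p \<and> p < s \<and> e < dist (y r) (y p)" if "b < s" for b
    using that by (meson not_le)
  have "\<exists>q<s. oscillates e y n q" for n
  proof (induction n)
    case 0
    then show ?case using s by auto
  next
    case (Suc n)
    then obtain q where q: "q < s" "oscillates e y n q" by auto
    obtain r p where rp: "r \<in> dyadics" "p \<in> dyadics" "q < r" "r < p" "p < s" "e < dist (y r) (y p)" using ex[OF q(1)] by blast
    have "oscillates e y n r" using oscillates_mono[OF q(2)] rp by simp
    then have "oscillates e y (Suc n) p" using rp by auto
    then show ?case using rp by blast
  qed
  then obtain q where "q < s" "oscillates e y k q" by blast
  then have "oscillates e y k 1" using oscillates_mono[of e y k q 1] s by auto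
  then show False using fin by simp
qed

definition cadlag_on :: "real \<Rightarrow> (real \<Rightarrow> 'b::metric_space) \<Rightarrow> bool" where
  "cadlag_on t z \<longleftrightarrow> (\<forall>s. 0 \<le> s \<and> s < t \<longrightarrow> (z \<longlongrightarrow> z s) (at_right s)) \<and> (\<forall>s. 0 < s \<and> s \<le> t \<longrightarrow> (\<exists>l. (z \<longlongrightarrow> l) (at_left s)))"

abbreviation left_lim :: "(real \<Rightarrow> 'b::metric_space) \<Rightarrow> real \<Rightarrow> 'b" where
  "left_lim z s \<equiv> Lim (at_left s) z"

lemma cadlag_left_lim: "cadlag_on t z \<Longrightarrow> 0 < s \<Longrightarrow> s \<le> t \<Longrightarrow> (z \<longlongrightarrow> left_lim z s) (at_left s)"
  unfolding cadlag_on_def using tendsto_Lim[of "at_left s" z] by (metis trivial_limit_at_left_real)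

text \<open>Finite oscillation makes the path Cauchy from the left along dyadic times, right
  continuity extends this to all times, and completeness provides the limit.\<close>

lemma cadlagI_finite_oscillation:
  fixes z :: "real \<Rightarrow> 'b::complete_space"
  assumes t: "0 < t" and right: "\<And>s. 0 \<le> s \<Longrightarrow> s < t \<Longrightarrow> (z \<longlongrightarrow> z s) (at_right s)"
    and y: "\<And>q. q \<in> dyadics \<Longrightarrow> y q = z (t * q)"
    and fin: "\<And>n. \<exists>k. \<not> oscillates (1 / real (Suc n)) y k 1"
  shows "cadlag_on t z"
  unfolding cadlag_on_def
proof (intro conjI allI impI)
  fix s assume s: "0 < s \<and> s \<le> t"
  have near: "\<exists>q\<in>dyadics. u < t * q \<and> t * q < v \<and> dist (z (t * q)) (z u) < d" if "0 \<le> u" "u < v" "v \<le> t" "0 < d" for u v d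
  proof -
    have "\<forall>\<^sub>F x in at_right u. dist (z x) (z u) < d" using right[of u] that by (intro tendstoD) auto
    then obtain b where b: "u < b" "\<And>x. u < x \<Longrightarrow> x < b \<Longrightarrow> dist (z x) (z u) < d"
      by (auto simp: eventually_at_right_field)
    have "0 \<le> u / t" "u / t < min b v / t" "min b v / t \<le> 1"
      using that b t by (auto simp: divide_strict_right_mono)
    then obtain q where q: "q \<in> dyadics" "u / t < q" "q < min b v / t" using dyadics_dense by blast
    then have "u < t * q" "t * q < min b v" using t by (auto simp: field_simps)
    then show ?thesis using q(1) b(2) by (intro bexI[of _ q]) auto
  qed
  have cauchy: "\<exists>b<s. 0 \<le> b \<and> (\<forall>u v. b < u \<and> u < v \<and> v < s \<longrightarrow> dist (z u) (z v) \<le> 1 / real (Suc n))" for n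
  proof -
    obtain k where "\<not> oscillates (1 / real (Suc n)) y k 1" using fin by blast
    from left_cauchy_of_finite_oscillation[OF this, of "s / t"] obtain b where b: "b < s / t"
      "\<And>r p. r \<in> dyadics \<Longrightarrow> p \<in> dyadics \<Longrightarrow> b < r \<Longrightarrow> r < p \<Longrightarrow> p < s / t \<Longrightarrow> dist (y r) (y p) \<le> 1 / real (Suc n)"
      using s t by auto
    show ?thesis
    proof (intro exI[of _ "max 0 (t * b)"] conjI allI impI)
      show "max 0 (t * b) < s" using s b(1) t by (auto simp: field_simps)
      fix u v assume uv: "max 0 (t * b) < u \<and> u < v \<and> v < s"
      show "dist (z u) (z v) \<le> 1 / real (Suc n)"
      proof (rule ccontr)
        assume "\<not> ?thesis"
        then have gt: "1 / real (Suc n) < dist (z u) (z v)" by simp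
        \<comment> \<open>Half of the excess: moving u and v to dyadic times on their right costs
          less than d each, so the total error stays below the excess.\<close>
        define d where "d = (dist (z u) (z v) - 1 / real (Suc n)) / 2"
        have d: "0 < d" using gt by (simp add: d_def)
        obtain q where q: "q \<in> dyadics" "u < t * q" "t * q < v" "dist (z (t * q)) (z u) < d"
          using near[of u v d] uv s d by auto
        obtain p where p: "p \<in> dyadics" "v < t * p" "t * p < s" "dist (z (t * p)) (z v) < d"
          using near[of v s d] uv s d by auto
        have "dist (y q) (y p) \<le> 1 / real (Suc n)"
        proof (rule b(2)[OF q(1) p(1)])
          have "t * b < t * q" using uv q by auto
          then show "b < q" using t by simp
          have "t * q < t * p" using q p by auto
          then show "q < p" using t by simp
          show "p < s / t" using p t by (simp add: field_simps)
        qed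
        moreover have "dist (z u) (z v) \<le> dist (z (t * q)) (z u) + dist (z (t * q)) (z (t * p)) + dist (z (t * p)) (z v)"
          by (metis dist_commute dist_triangle_le add_right_mono dist_triangle)
        ultimately show False using q p y by (simp add: d_def)
      qed
    qed simp
  qed
  \<comment> \<open>The summand 2 keeps w 0 = s / 2 positive.\<close>
  define w where "w n = s - s / (real n + 2)" for n :: nat
  have w: "0 < w n" "w n < s" for n
  proof -
    have "0 < s / (real n + 2)" using s by simp
    moreover have "s / (real n + 2) < s / 1" using s by (intro divide_strict_left_mono) auto
    ultimately show "0 < w n" "w n < s" by (simp_all add: w_def)
  qed
  have wlim: "w \<longlonglongrightarrow> s"
  proof -
    have "(\<lambda>n. s - s * inverse (real (Suc (Suc n)))) \<longlonglongrightarrow> s - s * 0"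
      by (intro tendsto_intros LIMSEQ_Suc[OF LIMSEQ_inverse_real_of_nat])
    then show ?thesis by (simp add: w_def[abs_def] divide_inverse add.commute)
  qed
  have close: "\<exists>b<s. \<forall>u v. b < u \<and> u < s \<and> b < v \<and> v < s \<longrightarrow> dist (z u) (z v) < e" if "0 < e" for e
  proof -
    obtain n where n: "1 / real (Suc n) < e" using \<open>0 < e\<close> by (rule nat_approx_posE)
    obtain b where b: "b < s" "\<And>u v. b < u \<Longrightarrow> u < v \<Longrightarrow> v < s \<Longrightarrow> dist (z u) (z v) \<le> 1 / real (Suc n)"
      using cauchy by blast
    have "dist (z u) (z v) < e" if "b < u" "u < s" "b < v" "v < s" for u v
      using b(2)[of u v] b(2)[of v u] that n \<open>0 < e\<close> by (cases u v rule: linorder_cases) (auto simp: dist_commute)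
    then show ?thesis using b(1) by blast
  qed
  have "Cauchy (\<lambda>n. z (w n))"
  proof (rule metric_CauchyI)
    fix e :: real assume "0 < e"
    then obtain b where b: "b < s" "\<And>u v. b < u \<Longrightarrow> u < s \<Longrightarrow> b < v \<Longrightarrow> v < s \<Longrightarrow> dist (z u) (z v) < e" using close by blast
    have "\<forall>\<^sub>F n in sequentially. b < w n" using wlim b(1) by (rule order_tendstoD)
    then obtain M where "\<And>n. M \<le> n \<Longrightarrow> b < w n" by (auto simp: eventually_sequentially)
    then show "\<exists>M. \<forall>m\<ge>M. \<forall>n\<ge>M. dist (z (w m)) (z (w n)) < e" using b(2) w by blast
  qed
  then obtain l where l: "(\<lambda>n. z (w n)) \<longlonglongrightarrow> l" using Cauchy_convergent convergent_def by blast
  show "\<exists>l. (z \<longlongrightarrow> l) (at_left s)"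
  proof (intro exI[of _ l] tendstoI)
    fix e :: real assume "0 < e"
    then obtain b where b: "b < s" "\<And>u v. b < u \<Longrightarrow> u < s \<Longrightarrow> b < v \<Longrightarrow> v < s \<Longrightarrow> dist (z u) (z v) < e / 2" using close[of "e / 2"] by auto
    have "\<forall>\<^sub>F n in sequentially. b < w n \<and> dist (z (w n)) l < e / 2"
      using order_tendstoD(1)[OF wlim b(1)] tendstoD[OF l, of "e / 2"] \<open>0 < e\<close> by (auto simp: eventually_conj_iff)
    then obtain n where n: "b < w n" "dist (z (w n)) l < e / 2" by (auto simp: eventually_sequentially)
    show "\<forall>\<^sub>F x in at_left s. dist (z x) l < e"
      unfolding eventually_at_left_field
    proof (intro exI[of _ b] conjI allI impI b(1))
      fix u assume "b < u" "u < s"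
      then have "dist (z u) (z (w n)) < e / 2" using b(2) n w by blast
      then show "dist (z u) l < e" using n(2) dist_triangle[of "z u" l "z (w n)"] by simp
    qed
  qed
qed (use right in auto)

text \<open>Bisection: near x the single division point x is enough, by the left limit on one side
  and right continuity on the other. When two intervals are joined, their common end point is
  added.\<close>

lemma cadlag_partition:
  assumes z: "cadlag_on t z" and t: "0 \<le> t" and e: "0 < e"
  shows "\<exists>T. finite T \<and> T \<subseteq> {0<..t} \<and> (\<forall>s u. 0 \<le> s \<and> s < u \<and> u \<le> t \<and> {s<..u} \<inter> T = {} \<longrightarrow> dist (z s) (z u) \<le> e)"
proof -
  define Q where "Q a b \<longleftrightarrow> (0 \<le> a \<and> b \<le> t \<longrightarrow> (\<exists>T. finite T \<and> T \<subseteq> {a<..b} \<and>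
    (\<forall>s u. a \<le> s \<and> s < u \<and> u \<le> b \<and> {s<..u} \<inter> T = {} \<longrightarrow> dist (z s) (z u) \<le> e)))" for a b
  have "Q 0 t"
    using t
  proof (induction rule: Bolzano)
    case (trans a b c)
    show ?case unfolding Q_def
    proof
      assume ac: "0 \<le> a \<and> c \<le> t"
      obtain T1 where T1: "finite T1" "T1 \<subseteq> {a<..b}" "\<And>s u. a \<le> s \<Longrightarrow> s < u \<Longrightarrow> u \<le> b \<Longrightarrow> {s<..u} \<inter> T1 = {} \<Longrightarrow> dist (z s) (z u) \<le> e"
        using trans ac unfolding Q_def by (meson order_trans)
      obtain T2 where T2: "finite T2" "T2 \<subseteq> {b<..c}" "\<And>s u. b \<le> s \<Longrightarrow> s < u \<Longrightarrow> u \<le> c \<Longrightarrow> {s<..u} \<inter> T2 = {} \<Longrightarrow> dist (z s) (z u) \<le> e"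
        using trans ac unfolding Q_def by (meson order_trans)
      show "\<exists>T. finite T \<and> T \<subseteq> {a<..c} \<and> (\<forall>s u. a \<le> s \<and> s < u \<and> u \<le> c \<and> {s<..u} \<inter> T = {} \<longrightarrow> dist (z s) (z u) \<le> e)"
      proof (intro exI[of _ "T1 \<union> T2 \<union> ({b} \<inter> {a<..c})"] conjI allI impI)
        show "T1 \<union> T2 \<union> ({b} \<inter> {a<..c}) \<subseteq> {a<..c}" using T1(2) T2(2) trans by auto
        fix s u assume su: "a \<le> s \<and> s < u \<and> u \<le> c \<and> {s<..u} \<inter> (T1 \<union> T2 \<union> ({b} \<inter> {a<..c})) = {}"
        consider "u \<le> b" | "b \<le> s" | "s < b" "b < u" by linarith
        then show "dist (z s) (z u) \<le> e"
        proof cases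
          case 1 then show ?thesis using su by (intro T1(3)) auto
        next
          case 2 then show ?thesis using su by (intro T2(3)) auto
        next
          case 3
          then have "b \<in> {s<..u} \<inter> (T1 \<union> T2 \<union> ({b} \<inter> {a<..c}))" using su by auto
          then show ?thesis using su by blast
        qed
      qed (use T1(1) T2(1) in auto)
    qed
  next
    case (local x)
    have "\<exists>d>0. (\<forall>s u. 0 \<le> s \<and> x - d < s \<and> s < u \<and> u < x \<longrightarrow> dist (z s) (z u) \<le> e) \<and> (\<forall>s u. x \<le> s \<and> s < u \<and> u < x + d \<and> u \<le> t \<longrightarrow> dist (z s) (z u) \<le> e)"
    proof -
      have "\<exists>d>0. \<forall>s u. 0 \<le> s \<and> x - d < s \<and> s < u \<and> u < x \<longrightarrow> dist (z s) (z u) \<le> e"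
      proof (cases "x = 0")
        case False
        then have x: "0 < x" using local by simp
        have "\<forall>\<^sub>F s in at_left x. dist (z s) (left_lim z x) < e / 2"
          using e by (intro tendstoD cadlag_left_lim[OF z x]) (use local in auto)
        then obtain b where b: "b < x" "\<And>s. b < s \<Longrightarrow> s < x \<Longrightarrow> dist (z s) (left_lim z x) < e / 2"
          by (auto simp: eventually_at_left_field)
        have "dist (z s) (z u) \<le> e" if "x - (x - b) < s" "s < u" "u < x" for s u
        proof -
          have "dist (z s) (left_lim z x) < e / 2" by (rule b(2)) (use that in auto)
          moreover have "dist (z u) (left_lim z x) < e / 2" by (rule b(2)) (use that in auto)
          ultimately show ?thesis using dist_triangle_half_l[of "z s" "left_lim z x" e "z u"] by (simp add: dist_commute less_imp_le)
        qed
        then show ?thesis using b(1) by (intro exI[of _ "x - b"]) auto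
      qed (intro exI[of _ 1], auto)
      then obtain d1 where d1: "0 < d1" "\<And>s u. 0 \<le> s \<Longrightarrow> x - d1 < s \<Longrightarrow> s < u \<Longrightarrow> u < x \<Longrightarrow> dist (z s) (z u) \<le> e" by blast
      have "\<exists>d>0. \<forall>s u. x \<le> s \<and> s < u \<and> u < x + d \<and> u \<le> t \<longrightarrow> dist (z s) (z u) \<le> e"
      proof (cases "x < t")
        case True
        then have "(z \<longlongrightarrow> z x) (at_right x)" using z local by (auto simp: cadlag_on_def)
        then have "\<forall>\<^sub>F s in at_right x. dist (z s) (z x) < e / 2" using e by (intro tendstoD) auto
        then obtain b where b: "x < b" "\<And>s. x < s \<Longrightarrow> s < b \<Longrightarrow> dist (z s) (z x) < e / 2"
          by (auto simp: eventually_at_right_field)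
        have "dist (z s) (z u) \<le> e" if "x \<le> s" "s < u" "u < x + (b - x)" for s u
        proof -
          have "dist (z s) (z x) < e / 2" using that b(2)[of s] e by (cases "s = x") auto
          moreover have "dist (z u) (z x) < e / 2" by (rule b(2)) (use that in auto)
          ultimately show ?thesis using dist_triangle_half_l[of "z s" "z x" e "z u"] by (simp add: dist_commute less_imp_le)
        qed
        then show ?thesis using b(1) by (intro exI[of _ "b - x"]) auto
      qed (intro exI[of _ 1], auto)
      then obtain d2 where d2: "0 < d2" "\<And>s u. x \<le> s \<Longrightarrow> s < u \<Longrightarrow> u < x + d2 \<Longrightarrow> u \<le> t \<Longrightarrow> dist (z s) (z u) \<le> e" by blast
      show ?thesis using d1 d2 by (intro exI[of _ "min d1 d2"]) auto
    qed
    then obtain d where d: "0 < d" "\<And>s u. 0 \<le> s \<Longrightarrow> x - d < s \<Longrightarrow> s < u \<Longrightarrow> u < x \<Longrightarrow> dist (z s) (z u) \<le> e"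
      "\<And>s u. x \<le> s \<Longrightarrow> s < u \<Longrightarrow> u < x + d \<Longrightarrow> u \<le> t \<Longrightarrow> dist (z s) (z u) \<le> e" by blast
    show ?case
    proof (intro exI[of _ d] conjI allI impI d(1))
      fix a b assume ab: "a \<le> x \<and> x \<le> b \<and> b - a < d"
      show "Q a b" unfolding Q_def
      proof
        assume ab': "0 \<le> a \<and> b \<le> t"
        show "\<exists>T. finite T \<and> T \<subseteq> {a<..b} \<and> (\<forall>s u. a \<le> s \<and> s < u \<and> u \<le> b \<and> {s<..u} \<inter> T = {} \<longrightarrow> dist (z s) (z u) \<le> e)"
        proof (intro exI[of _ "{x} \<inter> {a<..b}"] conjI allI impI)
          fix s u assume su: "a \<le> s \<and> s < u \<and> u \<le> b \<and> {s<..u} \<inter> ({x} \<inter> {a<..b}) = {}"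
          show "dist (z s) (z u) \<le> e"
          proof (cases "x \<le> s")
            case True
            then show ?thesis using su ab ab' by (intro d(3)) auto
          next
            case False
            then have "u < x" using su ab by (auto simp: not_le not_less[symmetric])
            then show ?thesis using su ab ab' by (intro d(2)) auto
          qed
        qed auto
      qed
    qed
  qed
  then show ?thesis using t by (simp add: Q_def)
qed

definition jumps :: "real \<Rightarrow> real \<Rightarrow> (real \<Rightarrow> 'b::metric_space) \<Rightarrow> real set" where
  "jumps t e z = {s. 0 < s \<and> s \<le> t \<and> e < dist (left_lim z s) (z s)}"

text \<open>If s is not a division point, the values just before s are within e of z s, and so is
  the left limit.\<close>

lemma jumps_subset_partition:
  assumes z: "cadlag_on t z" and T: "finite T"
    and part: "\<And>s u. 0 \<le> s \<Longrightarrow> s < u \<Longrightarrow> u \<le> t \<Longrightarrow> {s<..u} \<inter> T = {} \<Longrightarrow> dist (z s) (z u) \<le> e"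
  shows "jumps t e z \<subseteq> T"
proof
  fix s assume s: "s \<in> jumps t e z"
  then have s': "0 < s" "s \<le> t" by (auto simp: jumps_def)
  show "s \<in> T"
  proof (rule ccontr)
    assume "s \<notin> T"
    have "dist (left_lim z s) (z s) \<le> e"
    proof (rule tendsto_upperbound)
      show "((\<lambda>r. dist (z r) (z s)) \<longlongrightarrow> dist (left_lim z s) (z s)) (at_left s)"
        by (intro tendsto_dist tendsto_const cadlag_left_lim[OF z s'])
      define b where "b = Max (insert 0 (T \<inter> {..<s}))"
      have b: "b < s" "0 \<le> b" "\<And>x. x \<in> T \<Longrightarrow> x < s \<Longrightarrow> x \<le> b"
        using T s' by (auto simp: b_def Max_less_iff)
      show "\<forall>\<^sub>F r in at_left s. dist (z r) (z s) \<le> e"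
        unfolding eventually_at_left_field
      proof (intro exI[of _ b] conjI allI impI b(1))
        fix r assume r: "b < r" "r < s"
        have "{r<..s} \<inter> T = {}" using b(3) r \<open>s \<notin> T\<close> by (force simp: le_less)
        then show "dist (z r) (z s) \<le> e" using r b(2) s' by (intro part) auto
      qed
    qed simp
    then show False using s by (simp add: jumps_def)
  qed
qed

lemma finite_jumps: "cadlag_on t z \<Longrightarrow> 0 \<le> t \<Longrightarrow> 0 < e \<Longrightarrow> finite (jumps t e z)"
  using cadlag_partition[of t z e] jumps_subset_partition[of t z _ e] by (meson finite_subset)

text \<open>Grid intervals without a division point contribute nothing, as G vanishes on moves of
  size at most e. On fine grids every division point has an interval of its own, whose end point
  values tend to the left limit and to the value.\<close>

lemma jump_Riemann_sum:
  fixes G :: "'b::metric_space \<times> 'b \<Rightarrow> real"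
  assumes t: "0 < t" and z: "cadlag_on t z" and e: "0 < e" and cont: "continuous_on UNIV G"
    and zero: "\<And>p. dist (fst p) (snd p) \<le> e \<Longrightarrow> G p = 0"
  shows "(\<lambda>n. \<Sum>k<2^n. G (z (real k * (t / 2^n)), z (real (Suc k) * (t / 2^n)))) \<longlonglongrightarrow> (\<Sum>s\<in>jumps t e z. G (left_lim z s, z s))"
proof -
  from cadlag_partition[OF z less_imp_le[OF t] e] obtain T where T: "finite T" "T \<subseteq> {0<..t}"
    and part': "\<forall>s u. 0 \<le> s \<and> s < u \<and> u \<le> t \<and> {s<..u} \<inter> T = {} \<longrightarrow> dist (z s) (z u) \<le> e" by (elim exE conjE)
  have part: "\<And>s u. 0 \<le> s \<Longrightarrow> s < u \<Longrightarrow> u \<le> t \<Longrightarrow> {s<..u} \<inter> T = {} \<Longrightarrow> dist (z s) (z u) \<le> e"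
    by (rule part'[rule_format]) (intro conjI)
  have DT: "jumps t e z \<subseteq> T" by (rule jumps_subset_partition[OF z T(1) part])
  define d where "d n = t / 2^n" for n :: nat
  have d: "0 < d n" for n using t by (simp add: d_def)
  have \<delta>lim: "d \<longlonglongrightarrow> 0"
  proof -
    have "(\<lambda>n. t * (1 / 2) ^ n) \<longlonglongrightarrow> t * 0" by (intro tendsto_intros) auto
    then show ?thesis by (simp add: d_def[abs_def] power_divide)
  qed
  \<comment> \<open>Index of the grid interval (k d, (k + 1) d] containing s; the intervals are
    closed on the right, hence the ceiling minus 1.\<close>
  define K where "K n s = nat (\<lceil>s / d n\<rceil> - 1)" for n s
  have K: "real (K n s) * d n < s" "s \<le> real (Suc (K n s)) * d n" if "0 < s" for n s
  proof -
    have "0 < s / d n" using that d by simp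
    then have "1 \<le> \<lceil>s / d n\<rceil>" by linarith
    then have "real (K n s) = of_int \<lceil>s / d n\<rceil> - 1" by (simp add: K_def)
    then have "real (K n s) < s / d n" "s / d n \<le> real (Suc (K n s))" by linarith+
    then show "real (K n s) * d n < s" "s \<le> real (Suc (K n s)) * d n"
      using d[of n] by (auto simp: pos_less_divide_eq pos_divide_le_eq)
  qed
  have Klt: "K n s < 2^n" if "0 < s" "s \<le> t" for n s
  proof -
    have "real (K n s) * d n < real (2^n) * d n" using K(1)[OF that(1), of n] that(2) by (simp add: d_def)
    then have "real (K n s) < real (2^n)" using d[of n] by (metis mult_less_cancel_right_pos)
    then show ?thesis by (simp only: of_nat_less_iff)
  qed
  have Kuniq: "k = K n s" if "real k * d n < s" "s \<le> real (Suc k) * d n" "0 < s" for n k s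
  proof -
    have "real k * d n < real (Suc (K n s)) * d n" "real (K n s) * d n < real (Suc k) * d n"
      using that K[OF that(3), of n] by linarith+
    then have "real k < real (Suc (K n s))" "real (K n s) < real (Suc k)"
      using d[of n] by (metis mult_less_cancel_right_pos)+
    then show ?thesis by linarith
  qed
  have gridle: "real k * d n \<le> t" if "k \<le> 2^n" for k n
  proof -
    have "real k \<le> real (2 ^ n)" using that by (subst of_nat_le_iff)
    then have "real k * d n \<le> real (2 ^ n) * d n" using d[of n] by (intro mult_right_mono) auto
    then show ?thesis by (simp add: d_def)
  qed
  have zero': "G (z (real k * d n), z (real (Suc k) * d n)) = 0" if "k < 2^n" "k \<notin> K n ` T" for k n
  proof -
    have "s \<notin> {real k * d n<..real (Suc k) * d n}" if "s \<in> T" for s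
    proof
      assume "s \<in> {real k * d n<..real (Suc k) * d n}"
      then have "k = K n s" using T(2) that by (intro Kuniq) (auto simp del: of_nat_Suc)
      then show False using that \<open>k \<notin> K n ` T\<close> by blast
    qed
    then have "{real k * d n<..real (Suc k) * d n} \<inter> T = {}" by blast
    moreover have "real k * d n < real (Suc k) * d n" using d[of n] by (intro mult_strict_right_mono) auto
    moreover have "0 \<le> real k * d n" using d[of n] by simp
    moreover have "real (Suc k) * d n \<le> t" using that(1) by (intro gridle) auto
    ultimately show ?thesis by (intro zero) (simp add: part del: of_nat_Suc)
  qed
  have inj: "\<forall>\<^sub>F n in sequentially. inj_on (K n) T"
  proof -
    have "\<forall>\<^sub>F n in sequentially. \<forall>s\<in>T. \<forall>u\<in>T. s < u \<longrightarrow> d n < u - s"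
    proof (intro eventually_ball_finite T(1) ballI)
      fix s u assume "s \<in> T" "u \<in> T"
      show "\<forall>\<^sub>F n in sequentially. s < u \<longrightarrow> d n < u - s"
      proof (cases "s < u")
        case True
        then have "0 < u - s" by simp
        from order_tendstoD(2)[OF \<delta>lim this] show ?thesis by eventually_elim simp
      qed simp
    qed
    then show ?thesis
    proof eventually_elim
      case (elim n)
      have ne: "K n s \<noteq> K n u" if "s \<in> T" "u \<in> T" "s < u" for s u
      proof
        assume eq: "K n s = K n u"
        have "0 < s" "0 < u" using that T(2) by auto
        then have "u - s < d n" using K[of u n] K[of s n] eq by (simp add: algebra_simps)
        then show False using elim that by fastforce
      qed
      show ?case
      proof (rule inj_onI)
        fix s u assume "s \<in> T" "u \<in> T" "K n s = K n u"
        then show "s = u" using ne[of s u] ne[of u s] by (cases s u rule: linorder_cases) auto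
      qed
    qed
  qed
  have "(\<lambda>n. \<Sum>s\<in>T. G (z (real (K n s) * d n), z (real (Suc (K n s)) * d n))) \<longlonglongrightarrow> (\<Sum>s\<in>T. G (left_lim z s, z s))"
  proof (rule tendsto_sum)
    fix s assume "s \<in> T"
    then have s: "0 < s" "s \<le> t" using T(2) by auto
    have l1: "s - d n \<le> real (K n s) * d n" for n using K(2)[OF s(1), of n] by (simp add: algebra_simps)
    have l2: "real (Suc (K n s)) * d n \<le> s + d n" for n using K(1)[OF s(1), of n] by (simp add: algebra_simps)
    have "(\<lambda>n. s - d n) \<longlonglongrightarrow> s - 0" by (intro tendsto_intros \<delta>lim)
    then have lo: "(\<lambda>n. s - d n) \<longlonglongrightarrow> s" by (simp only: diff_zero)
    have left: "(\<lambda>n. real (K n s) * d n) \<longlonglongrightarrow> s"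
      by (rule real_tendsto_sandwich[OF always_eventually always_eventually lo tendsto_const])
        (rule allI, rule l1, rule allI, rule less_imp_le, rule K(1)[OF s(1)])
    have "(\<lambda>n. s + d n) \<longlonglongrightarrow> s + 0" by (intro tendsto_intros \<delta>lim)
    then have hi: "(\<lambda>n. s + d n) \<longlonglongrightarrow> s" by (simp only: add_0_right)
    have right: "(\<lambda>n. real (Suc (K n s)) * d n) \<longlonglongrightarrow> s"
      by (rule real_tendsto_sandwich[OF always_eventually always_eventually tendsto_const hi])
        (rule allI, rule K(2)[OF s(1)], rule allI, rule l2)
    have "filterlim (\<lambda>n. real (K n s) * d n) (at_left s) sequentially"
      unfolding filterlim_at using left K(1)[OF s(1)] by (simp add: always_eventually less_imp_neq)
    then have zl: "(\<lambda>n. z (real (K n s) * d n)) \<longlonglongrightarrow> left_lim z s"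
      by (rule filterlim_compose[OF cadlag_left_lim[OF z s]])
    have zr: "(\<lambda>n. z (real (Suc (K n s)) * d n)) \<longlonglongrightarrow> z s"
    proof (cases "s < t")
      case True
      then have "(z \<longlongrightarrow> z s) (at_right s)" using z s by (auto simp: cadlag_on_def)
      then have zr: "\<forall>\<^sub>F u in at_right s. dist (z u) (z s) < r" if "0 < r" for r
        using that by (rule tendstoD)
      show ?thesis
      proof (rule tendstoI)
        fix r :: real assume "0 < r"
        from zr[OF this] obtain b where b: "s < b" "\<And>u. s < u \<Longrightarrow> u < b \<Longrightarrow> dist (z u) (z s) < r"
          by (auto simp: eventually_at_right_field)
        have "\<forall>\<^sub>F n in sequentially. real (Suc (K n s)) * d n < b" using right b(1) by (rule order_tendstoD(2))
        then show "\<forall>\<^sub>F n in sequentially. dist (z (real (Suc (K n s)) * d n)) (z s) < r"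
        proof eventually_elim
          case (elim n)
          show ?case
          proof (cases "real (Suc (K n s)) * d n = s")
            case True
            show ?thesis unfolding True using \<open>0 < r\<close> by simp
          next
            case False
            then show ?thesis using K(2)[OF s(1), of n] elim by (intro b(2)) simp_all
          qed
        qed
      qed
    next
      \<comment> \<open>No right continuity is available at t; but t is itself a grid point, so the
        right end of its interval equals t.\<close>
      case False
      then have "s = t" using s by simp
      have "real (Suc (K n s)) * d n = s" for n
        using K(2)[OF s(1), of n] gridle[of "Suc (K n s)" n] Klt[OF s, of n] \<open>s = t\<close> by (simp del: of_nat_Suc)
      then show ?thesis by (simp del: of_nat_Suc)
    qed
    have "isCont G (left_lim z s, z s)" using cont by (simp add: continuous_on_eq_continuous_at)
    then show "(\<lambda>n. G (z (real (K n s) * d n), z (real (Suc (K n s)) * d n))) \<longlonglongrightarrow> G (left_lim z s, z s)"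
      by (rule isCont_tendsto_compose[OF _ tendsto_Pair[OF zl zr]])
  qed
  moreover have "(\<Sum>s\<in>T. G (left_lim z s, z s)) = (\<Sum>s\<in>jumps t e z. G (left_lim z s, z s))"
  proof (rule sum.mono_neutral_right[OF T(1) DT], rule ballI)
    fix s assume s: "s \<in> T - jumps t e z"
    then have "dist (left_lim z s) (z s) \<le> e" using T(2) by (auto simp: jumps_def)
    then show "G (left_lim z s, z s) = 0" by (intro zero) simp
  qed
  moreover have "\<forall>\<^sub>F n in sequentially. (\<Sum>s\<in>T. G (z (real (K n s) * d n), z (real (Suc (K n s)) * d n)))
      = (\<Sum>k<2^n. G (z (real k * (t / 2^n)), z (real (Suc k) * (t / 2^n))))"
    using inj
  proof eventually_elim
    case (elim n)
    have "(\<Sum>s\<in>T. G (z (real (K n s) * d n), z (real (Suc (K n s)) * d n))) = (\<Sum>k\<in>K n ` T. G (z (real k * d n), z (real (Suc k) * d n)))"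
      using elim by (simp add: sum.reindex comp_def)
    also have "\<dots> = (\<Sum>k<2^n. G (z (real k * d n), z (real (Suc k) * d n)))"
      using Klt T(2) zero' by (intro sum.mono_neutral_left) (auto simp del: of_nat_Suc)
    finally show ?case by (simp add: d_def)
  qed
  ultimately show ?thesis using Lim_transform_eventually by fastforce
qed

section \<open>Embedding of a Lusin space\<close>

text \<open>The coordinates are the distances to a countable dense set, assembled from finite nets
  of radius 1 / Suc n.\<close>

lemma compact_metric_embedding:
  fixes K :: "'k metric"
  assumes "compact_space (mtopology_of K)"
  shows "\<exists>f :: 'k \<Rightarrow> nat \<Rightarrow> real. continuous_map (mtopology_of K) euclidean f \<and> inj_on f (mspace K)"
proof -
  interpret K: Metric_space "mspace K" "mdist K" by (rule Metric_space_mspace_mdist)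
  have "K.mtotally_bounded (mspace K)"
    using assms K.compactin_imp_mtotally_bounded[of "mspace K"] by (simp add: mtopology_of_def compact_space_def)
  then have "\<exists>C. finite C \<and> C \<subseteq> mspace K \<and> mspace K \<subseteq> (\<Union>x\<in>C. K.mball x (1 / real (Suc n)))" for n
    unfolding K.mtotally_bounded_def by (simp del: of_nat_Suc)
  then obtain C where C: "\<And>n. finite (C n)" "\<And>n. C n \<subseteq> mspace K" "\<And>n. mspace K \<subseteq> (\<Union>x\<in>C n. K.mball x (1 / real (Suc n)))"
    by metis
  define D where "D = (\<Union>n. C n)"
  have "countable D" unfolding D_def using C(1) by (simp add: countable_finite)
  show ?thesis
  proof (cases "mspace K = {}")
    case True
    then show ?thesis by (intro exI[of _ "\<lambda>_ _. 0"]) simp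
  next
    case False
    then have "D \<noteq> {}" using C(3)[of 0] unfolding D_def by blast
    define a where "a = from_nat_into D"
    have a: "a i \<in> mspace K" for i
      using from_nat_into[OF \<open>D \<noteq> {}\<close>, of i] C(2) by (auto simp: a_def D_def)
    have ra: "range a = D" unfolding a_def using \<open>countable D\<close> \<open>D \<noteq> {}\<close> by (rule range_from_nat_into[rotated])
    define f where "f x i = mdist K x (a i)" for x i
    have "continuous_map (mtopology_of K) euclidean f"
    proof -
      have "continuous_map (mtopology_of K) euclidean (\<lambda>x. f x i)" for i
      proof -
        have "Lipschitz_continuous_map K K (\<lambda>x. a i)"
          unfolding Lipschitz_continuous_map_const using a by blast
        then have "Lipschitz_continuous_map K euclidean_metric (\<lambda>x. mdist K x (a i))"
          by (rule Lipschitz_continuous_map_mdist[OF Lipschitz_continuous_map_id])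
        then have "continuous_map (mtopology_of K) (mtopology_of euclidean_metric) (\<lambda>x. mdist K x (a i))"
          by (rule Lipschitz_continuous_imp_continuous_map)
        then show ?thesis by (simp add: f_def)
      qed
      then have "continuous_map (mtopology_of K) (product_topology (\<lambda>i. euclidean) UNIV) f"
        by (simp add: continuous_map_componentwise_UNIV)
      then show ?thesis by (simp add: euclidean_product_topology)
    qed
    moreover have "inj_on f (mspace K)"
    proof (rule inj_onI, rule ccontr)
      fix x y assume xy: "x \<in> mspace K" "y \<in> mspace K" "f x = f y" "x \<noteq> y"
      then have "0 < mdist K x y / 2" by simp
      then obtain n where n: "1 / real (Suc n) < mdist K x y / 2" by (rule nat_approx_posE)
      obtain c where "c \<in> C n" "x \<in> K.mball c (1 / real (Suc n))" using C(3)[of n] xy(1) by blast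
      then have "c \<in> range a" and c: "mdist K c x < 1 / real (Suc n)"
        unfolding ra unfolding D_def K.mball_def by blast+
      then obtain i where i: "a i = c" by blast
      have "mdist K x c = mdist K y c" using fun_cong[OF xy(3), of i] i by (simp add: f_def)
      then have "mdist K x y \<le> 2 * mdist K c x"
        using K.triangle[of x c y] xy a[of i] i by (simp add: K.commute)
      then show False using c n by linarith
    qed
    ultimately show ?thesis by blast
  qed
qed

text \<open>A continuous map from a compact space to a Hausdorff space is closed. Injectivity turns
  images of complements into relative complements, so that the induction over the sigma-algebra goes
  through.\<close>

lemma compact_metric_image_borel:
  fixes K :: "'k metric" and f :: "'k \<Rightarrow> 'b::metric_space"
  assumes K: "compact_space (mtopology_of K)" and f: "continuous_map (mtopology_of K) euclidean f" "inj_on f (mspace K)"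
    and B: "B \<in> sigma_sets (mspace K) {U. openin (mtopology_of K) U}"
  shows "f ` B \<in> sets borel"
proof -
  have cl: "closed_map (mtopology_of K) euclidean f"
    using K f(1) by (intro continuous_imp_closed_map_gen) (auto intro: Hausdorff_imp_kc_space Hausdorff_space_euclidean)
  have sub: "B \<subseteq> mspace K" if "B \<in> sigma_sets (mspace K) {U. openin (mtopology_of K) U}" for B
    using that sigma_sets_into_sp[of "{U. openin (mtopology_of K) U}" "mspace K" B] openin_subset[of "mtopology_of K"] by auto
  have top: "f ` mspace K \<in> sets borel"
    using cl closedin_topspace[of "mtopology_of K"] by (simp add: closed_map_def borel_closed)
  have diff: "f ` (mspace K - A) = f ` mspace K - f ` A" if "A \<subseteq> mspace K" for A
    by (rule inj_on_image_set_diff[OF f(2)]) (use that in auto)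
  show ?thesis
    using B
  proof (induction rule: sigma_sets.induct)
    case (Basic U)
    then have U: "U \<subseteq> mspace K" "closedin (mtopology_of K) (mspace K - U)"
      using openin_subset[of "mtopology_of K" U] closedin_diff[OF closedin_topspace[of "mtopology_of K"], of U] by auto
    have "f ` (mspace K - U) \<in> sets borel" using cl U(2) by (simp add: closed_map_def borel_closed)
    then have "f ` mspace K - (f ` mspace K - f ` U) \<in> sets borel" using top diff[OF U(1)] by simp
    moreover have "f ` mspace K - (f ` mspace K - f ` U) = f ` U" using U(1) by blast
    ultimately show ?case by simp
  next
    case (Compl A)
    then show ?case using diff[OF sub[OF Compl(1)]] top by simp
  next
    case (Union A)
    then show ?case by (simp add: image_UN)
  qed simp
qed

text \<open>The target is complete, so embedded paths may have left limits outside the image. Borel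
  images make the range measurable, by which this is excluded later, and make the inverse a Borel
  map.\<close>

definition borel_embedding :: "('a::topological_space \<Rightarrow> nat \<Rightarrow> real) \<Rightarrow> bool" where
  "borel_embedding e \<longleftrightarrow> continuous_on UNIV e \<and> inj e \<and> continuous_on (range e) (inv e) \<and> (\<forall>A\<in>sets borel. e ` A \<in> sets borel)"

lemma lusin_space_embedding:
  assumes "lusin_space (euclidean :: 'a::t2_space topology)"
  shows "\<exists>e :: 'a \<Rightarrow> nat \<Rightarrow> real. borel_embedding e"
proof -
  obtain K :: "real metric" and B where K: "compact_space (mtopology_of K)"
    and B: "B \<in> sigma_sets (mspace K) {U. openin (mtopology_of K) U}"
    and hom: "(euclidean :: 'a topology) homeomorphic_space (subtopology (mtopology_of K) B)"
    using assms by (auto simp: lusin_space_def)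
  have BK: "B \<subseteq> mspace K"
    using sigma_sets_into_sp[of "{U. openin (mtopology_of K) U}" "mspace K" B] openin_subset[of "mtopology_of K"] B by auto
  obtain f where f: "homeomorphic_map (euclidean :: 'a topology) (subtopology (mtopology_of K) B) f"
    using hom homeomorphic_space by blast
  obtain h :: "real \<Rightarrow> nat \<Rightarrow> real" where h: "continuous_map (mtopology_of K) euclidean h" "inj_on h (mspace K)"
    using compact_metric_embedding[OF K] by blast
  define e where "e x = h (f x)" for x
  have finj: "inj f" and fr: "range f = B"
    using homeomorphic_imp_injective_map[OF f] homeomorphic_imp_surjective_map[OF f] BK by (auto simp: Int_absorb1)
  have inj: "inj e"
  proof (rule injI)
    fix x y assume "e x = e y"
    moreover have "f x \<in> mspace K" "f y \<in> mspace K" using fr BK by auto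
    ultimately have "f x = f y" using h(2) by (auto simp: e_def dest: inj_onD)
    then show "x = y" using finj by (simp add: inj_eq)
  qed
  have cont: "continuous_on UNIV e"
  proof -
    have "continuous_map (subtopology (mtopology_of K) B) euclidean h" using h(1) by (rule continuous_map_from_subtopology)
    from continuous_map_compose[OF homeomorphic_imp_continuous_map[OF f] this]
    show ?thesis by (simp add: e_def[abs_def] comp_def)
  qed
  have cl: "closed_map (mtopology_of K) euclidean h"
    using K h(1) by (intro continuous_imp_closed_map_gen) (auto intro: Hausdorff_imp_kc_space Hausdorff_space_euclidean)
  \<comment> \<open>Continuity of the inverse in terms of closed sets: images of closed sets are
    traces of closed sets on the range, which itself is only Borel.\<close>
  have closed_image: "\<exists>C. closed C \<and> e ` A = C \<inter> range e" if "closed A" for A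
  proof -
    have "closedin (subtopology (mtopology_of K) B) (f ` A)"
      using homeomorphic_imp_closed_map[OF f] that by (simp add: closed_map_def)
    then obtain C where C: "closedin (mtopology_of K) C" "f ` A = C \<inter> B" by (auto simp: closedin_subtopology)
    have "C \<subseteq> mspace K" using closedin_subset[OF C(1)] by simp
    then have "h ` (C \<inter> B) = h ` C \<inter> h ` B" using h(2) BK by (intro inj_on_image_Int) auto
    moreover have "e ` A = h ` (f ` A)" "range e = h ` B" using fr by (auto simp: e_def)
    moreover have "closed (h ` C)" using cl C(1) by (simp add: closed_map_def)
    ultimately show ?thesis using C(2) by auto
  qed
  have "continuous_on (range e) (inv e)"
    unfolding continuous_on_closed_invariant
  proof (intro allI impI)
    fix A :: "'a set" assume "closed A"
    from closed_image[OF this] obtain C where "closed C" "e ` A = C \<inter> range e" by (elim exE conjE)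
    moreover have "inv e -` A \<inter> range e = e ` A" using inj by auto
    ultimately show "\<exists>C. closed C \<and> C \<inter> range e = inv e -` A \<inter> range e" by auto
  qed
  moreover have "e ` A \<in> sets borel" if "A \<in> sets borel" for A
  proof -
    have "range e = h ` range f" unfolding e_def by (rule image_image[symmetric])
    then have re: "range e \<in> sets borel"
      using compact_metric_image_borel[OF K h B] fr by simp
    have "sets (borel :: 'a measure) = sigma_sets UNIV (Collect closed)" by (simp add: borel_eq_closed)
    then have "A \<in> sigma_sets UNIV (Collect closed)" using that by blast
    then show ?thesis
    proof (induction rule: sigma_sets.induct)
      case (Basic A)
      then have "closed A" by simp
      from closed_image[OF this] obtain C where "closed C" "e ` A = C \<inter> range e" by (elim exE conjE)
      then show ?case using re by (simp add: borel_closed sets.Int)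
    next
      case (Compl A)
      have "e ` (UNIV - A) = range e - e ` A" using inj by (intro image_set_diff)
      then show ?case using Compl re by simp
    next
      case (Union A)
      then show ?case by (simp add: image_UN)
    qed simp
  qed
  ultimately show ?thesis using cont inj by (auto simp: borel_embedding_def)
qed

section \<open>Embedded paths and their left limits\<close>

locale lusin_symmetric_process = symmetric_right_process P X \<theta> m
  for P :: "'a::t2_space option \<Rightarrow> 'w measure"
    and X :: "ennreal \<Rightarrow> 'w \<Rightarrow> 'a option"
    and \<theta> :: "ennreal \<Rightarrow> 'w \<Rightarrow> 'w"
    and m :: "'a measure" +
  fixes emb :: "'a \<Rightarrow> nat \<Rightarrow> real"
  assumes emb: "borel_embedding emb"
begin

lemma continuous_emb: "continuous_on UNIV emb"
  and inj_emb: "inj emb"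
  and continuous_inv_emb: "continuous_on (range emb) (inv emb)"
  and image_emb: "A \<in> sets borel \<Longrightarrow> emb ` A \<in> sets borel"
  using emb by (auto simp: borel_embedding_def)

lemma emb_measurable[measurable]: "emb \<in> Borel"
  using continuous_emb by (rule borel_measurable_continuous_onI)

lemma inv_emb_measurable[measurable]: "inv emb \<in> Borel"
proof (rule measurableI)
  fix A :: "'a set" assume A: "A \<in> sets borel"
  have "inv emb -` A = emb ` A \<union> ((- range emb) \<inter> inv emb -` A)" using inj_emb by (auto simp: image_iff)
  \<comment> \<open>Outside the range the inverse is a choice from the empty predicate, hence one
    constant.\<close>
  moreover have "inv emb y = (SOME x. False)" if "y \<notin> range emb" for y
  proof -
    have "(\<lambda>x. x \<in> UNIV \<and> emb x = y) = (\<lambda>x. False)" using that by auto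
    then show ?thesis by (simp only: inv_into_def)
  qed
  then obtain c where "\<And>y. y \<notin> range emb \<Longrightarrow> inv emb y = c" by blast
  then have "(- range emb) \<inter> inv emb -` A = (if c \<in> A then - range emb else {})" by auto
  ultimately have "inv emb -` A = emb ` A \<union> (if c \<in> A then - range emb else {})" by simp
  moreover have "\<dots> \<in> sets borel" using image_emb[OF A] image_emb[of UNIV] by auto
  ultimately show "inv emb -` A \<inter> space borel \<in> sets borel" by simp
qed simp

definition zpath :: "'w \<Rightarrow> real \<Rightarrow> nat \<Rightarrow> real" where
  "zpath \<omega> s = emb (the (XX s \<omega>))"

lemma zpath_right:
  assumes "alive s w" "0 \<le> s"
  shows "(zpath w \<longlongrightarrow> zpath w s) (at_right s)"
proof (rule topological_tendstoI)
  fix V assume V: "open V" "zpath w s \<in> V"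
  obtain x where x: "XX s w = Some x" using assms(1) by blast
  have U: "open (emb -` V)" using continuous_emb V(1) by (simp add: continuous_on_open_vimage)
  have ev: "\<forall>\<^sub>F r in at_right (ennreal s). X r w \<in> Some ` (emb -` V)"
    by (rule X_right_continuous[OF _ x U]) (use V(2) x in \<open>simp_all add: zpath_def\<close>)
  have "filterlim ennreal (at_right (ennreal s)) (at_right s)"
    unfolding filterlim_at
  proof (intro conjI tendsto_ennrealI tendsto_ident_at)
    show "\<forall>\<^sub>F x in at_right s. ennreal x \<in> {ennreal s<..} \<and> ennreal x \<noteq> ennreal s"
      using eventually_at_right_less[of s] by eventually_elim (use assms(2) in \<open>simp add: ennreal_less_iff\<close>)
  qed
  from eventually_compose_filterlim[OF ev this]
  show "\<forall>\<^sub>F r in at_right s. zpath w r \<in> V" by eventually_elim (auto simp: zpath_def)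
qed

lemma zpath_path: "q \<in> dyadics \<Longrightarrow> emb (path t w q) = zpath w (t * q)"
  by (simp add: path_def zpath_def)

lemma right_osc:
  assumes "alive s w" "0 \<le> s" "0 < e"
  shows "\<exists>b>s. \<forall>u v. s \<le> u \<and> u < b \<and> s \<le> v \<and> v < b \<longrightarrow> dist (zpath w u) (zpath w v) \<le> e"
proof -
  have "\<forall>\<^sub>F u in at_right s. dist (zpath w u) (zpath w s) < e / 2"
    using assms by (intro tendstoD zpath_right) auto
  then obtain b where b: "s < b" "\<And>u. s < u \<Longrightarrow> u < b \<Longrightarrow> dist (zpath w u) (zpath w s) < e / 2"
    by (auto simp: eventually_at_right_field)
  have near: "dist (zpath w u) (zpath w s) < e / 2" if "s \<le> u" "u < b" for u
    using b(2)[of u] that assms(3) by (cases "u = s") auto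
  show ?thesis
  proof (intro exI[of _ b] conjI allI impI b(1))
    fix u v assume "s \<le> u \<and> u < b \<and> s \<le> v \<and> v < b"
    then have "dist (zpath w u) (zpath w s) < e / 2" "dist (zpath w v) (zpath w s) < e / 2" by (simp_all only: near)
    then show "dist (zpath w u) (zpath w v) \<le> e"
      using dist_triangle_half_l[of "zpath w u" "zpath w s" e "zpath w v"] by (simp add: dist_commute less_imp_le)
  qed
qed

lemma pred_Bex_countable:
  assumes "countable D" "\<And>r. r \<in> D \<Longrightarrow> Measurable.pred M (R r)"
  shows "Measurable.pred M (\<lambda>x. \<exists>r\<in>D. R r x)"
proof -
  have "{x \<in> space M. \<exists>r\<in>D. R r x} = (\<Union>r\<in>D. {x \<in> space M. R r x})" by auto
  then show ?thesis unfolding pred_def using assms by (auto simp: pred_def intro!: sets.countable_UN')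
qed

lemma oscillates_measurable: "Measurable.pred path_space (\<lambda>y. oscillates e (\<lambda>r. emb (y r)) n q)"
proof (induction n arbitrary: q)
  case (Suc n)
  have [measurable]: "Measurable.pred path_space (\<lambda>y. e < dist (emb (y r)) (emb (y p)))" if "r \<in> dyadics" "p \<in> dyadics" for r p
  proof -
    have [measurable]: "(\<lambda>y. y r) \<in> path_space \<rightarrow>\<^sub>M borel" "(\<lambda>y. y p) \<in> path_space \<rightarrow>\<^sub>M borel"
      using that by (auto intro: measurable_component_singleton)
    show ?thesis by measurable
  qed
  note [measurable] = Suc
  show ?case
    unfolding oscillates.simps
    by (intro pred_Bex_countable countable_dyadics) measurable
qed simp

lemma left_explosion_measurable: "Measurable.pred path_space (\<lambda>y. left_explosion e (\<lambda>r. emb (y r)))"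
proof -
  note [measurable] = oscillates_measurable
  show ?thesis unfolding left_explosion_def
    by (intro pred_intros_countable(1) pred_Bex_countable countable_dyadics) measurable
qed

text \<open>Reversing time turns a left explosion into an oscillation immediately after a time, which right continuity forbids.\<close>

lemma AE_no_left_explosion:
  assumes t: "0 < t" and e: "0 < e"
  shows "AE w in PP. alive t w \<longrightarrow> \<not> left_explosion e (\<lambda>r. emb (path t w r))"
proof -
  define L where "L = {y \<in> space path_space. left_explosion e (\<lambda>r. emb (y r))}"
  have L: "L \<in> sets path_space"
    unfolding L_def using left_explosion_measurable by (rule predE)
  have "indicator L (reverse_path (path t w)) = (0::ennreal)" if alive: "alive t w" for w
  proof (rule ccontr)
    assume "\<not> ?thesis"
    then have "left_explosion e (\<lambda>r. emb (reverse_path (path t w) r))" by (auto simp: L_def indicator_def split: if_splits)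
    from left_explosionD[OF this] obtain s where s: "0 < s" "s \<le> 1"
      and osc: "\<And>b. b < s \<Longrightarrow> \<exists>r\<in>dyadics. \<exists>p\<in>dyadics. b < r \<and> r < p \<and> p < s
        \<and> e < dist (emb (reverse_path (path t w) r)) (emb (reverse_path (path t w) p))" by blast
    \<comment> \<open>The explosion time in the original orientation: moves just before s on the
      reversed path are moves just after u on the path itself.\<close>
    define u where "u = t * (1 - s)"
    have u: "0 \<le> u" "u < t" using s t by (simp_all add: u_def)
    have "alive u w" using alive_mono[OF _ alive, of "ennreal u"] u by (simp add: ennreal_leI)
    from right_osc[OF this u(1) e] obtain b where b: "u < b"
      "\<And>x y. u \<le> x \<Longrightarrow> x < b \<Longrightarrow> u \<le> y \<Longrightarrow> y < b \<Longrightarrow> dist (zpath w x) (zpath w y) \<le> e" by blast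
    have "1 - b / t < s" using b(1) t by (simp add: u_def field_simps)
    from osc[OF this] obtain r p where rp: "r \<in> dyadics" "p \<in> dyadics" "1 - b / t < r" "r < p" "p < s"
      "e < dist (emb (reverse_path (path t w) r)) (emb (reverse_path (path t w) p))" by blast
    have range: "u \<le> t * (1 - x) \<and> t * (1 - x) < b" if "1 - b / t < x" "x < s" for x
      using that t by (auto simp: u_def field_simps)
    have "dist (zpath w (t * (1 - r))) (zpath w (t * (1 - p))) \<le> e"
      using range[of r] range[of p] rp by (intro b(2)) auto
    then show False using rp by (simp add: zpath_path dyadics_reverse)
  qed
  then have "AE w in PP. alive t w \<longrightarrow> indicator L (reverse_path (path t w)) = (0::ennreal)"
    by (intro AE_I2 impI)
  then have "AE w in PP. alive t w \<longrightarrow> indicator L (path t w) = (0::ennreal)"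
    by (rule reversal_null[OF t borel_measurable_indicator[OF L]])
  then show ?thesis
  proof eventually_elim
    case (elim w)
    have "path t w \<in> space path_space" by (simp add: path_def space_PiM)
    then show ?case using elim by (auto simp: L_def indicator_def split: if_splits)
  qed
qed

text \<open>Left explosions are excluded almost surely at each of the levels 1 / Suc n, and right
  continuity is the right regularity asked for by \<open>finite_oscillation\<close>.\<close>

lemma AE_cadlag:
  assumes t: "0 < t"
  shows "AE w in PP. alive t w \<longrightarrow> cadlag_on t (zpath w)"
proof -
  have "AE w in PP. \<forall>n. alive t w \<longrightarrow> \<not> left_explosion (1 / real (Suc n)) (\<lambda>r. emb (path t w r))"
    unfolding AE_all_countable by (intro allI AE_no_left_explosion t) simp
  then show ?thesis
  proof (eventually_elim, intro impI)
    fix w assume elim: "\<forall>n. alive t w \<longrightarrow> \<not> left_explosion (1 / real (Suc n)) (\<lambda>r. emb (path t w r))"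
      and alive: "alive t w"
    have al: "alive s w" if "s \<le> t" for s
      using alive_mono[OF _ alive, of "ennreal s"] that by (simp add: ennreal_leI)
    show "cadlag_on t (zpath w)"
    proof (rule cadlagI_finite_oscillation[OF t])
      show "(zpath w \<longlongrightarrow> zpath w s) (at_right s)" if "0 \<le> s" "s < t" for s
        using that by (intro zpath_right al) auto
      show "emb (path t w q) = zpath w (t * q)" if "q \<in> dyadics" for q using that by (rule zpath_path)
      show "\<exists>k. \<not> oscillates (1 / real (Suc n)) (\<lambda>r. emb (path t w r)) k 1" for n
      proof (rule finite_oscillation)
        show "\<not> left_explosion (1 / real (Suc n)) (\<lambda>r. emb (path t w r))" using elim alive by blast
        fix s :: real assume s: "0 \<le> s" "s < 1"
        have ts: "0 \<le> t * s" "t * s \<le> t" using s t by (simp_all add: mult_le_cancel_left1)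
        obtain b where b: "t * s < b" "\<And>x y. t * s \<le> x \<Longrightarrow> x < b \<Longrightarrow> t * s \<le> y \<Longrightarrow> y < b \<Longrightarrow> dist (zpath w x) (zpath w y) \<le> 1 / real (Suc n)"
          using right_osc[OF al[OF ts(2)] ts(1), of "1 / real (Suc n)"] by (auto simp del: of_nat_Suc)
        show "\<exists>b>s. \<forall>r\<in>dyadics. \<forall>p\<in>dyadics. s < r \<and> r < p \<and> p < b \<longrightarrow> dist (emb (path t w r)) (emb (path t w p)) \<le> 1 / real (Suc n)"
        proof (intro exI[of _ "b / t"] conjI ballI impI)
          show "s < b / t" using b(1) t by (simp add: pos_less_divide_eq mult.commute)
          fix r p assume rp: "r \<in> dyadics" "p \<in> dyadics" "s < r \<and> r < p \<and> p < b / t"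
          have lt: "t * s \<le> t * x \<and> t * x < b" if "s < x" "x < b / t" for x
            using that t by (simp add: pos_less_divide_eq mult.commute)
          show "dist (emb (path t w r)) (emb (path t w p)) \<le> 1 / real (Suc n)"
            unfolding zpath_path[OF rp(1)] zpath_path[OF rp(2)] using lt[of r] lt[of p] rp(3) by (intro b(2)) auto
        qed
      qed
    qed
  qed
qed

end

subsection \<open>Reversibility of jump functionals\<close>

context symmetric_right_process
begin

lemma reversible_cong:
  assumes "reversible t e e'"
    and "AE w in PP. alive t w \<longrightarrow> x w = e w \<and> x' w = e' w"
  shows "reversible t x x'"
proof -
  obtain h where "h \<in> BP"
    and h: "AE w in PP. alive t w \<longrightarrow> e w = h (path t w) \<and> e' w = h (reverse_path (path t w))"
    using assms(1) unfolding reversible_def by blast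
  from h assms(2) have "AE w in PP. alive t w \<longrightarrow> x w = h (path t w) \<and> x' w = h (reverse_path (path t w))"
    by eventually_elim simp
  then show ?thesis unfolding reversible_def using \<open>h \<in> _\<close> by blast
qed

lemma reversible_comp2:
  assumes "reversible t \<eta>1 \<eta>1'" "reversible t \<eta>2 \<eta>2'"
    and G[measurable]: "(\<lambda>(a, b). G a b) \<in> borel \<Otimes>\<^sub>M borel \<rightarrow>\<^sub>M borel"
  shows "reversible t (\<lambda>w. G (\<eta>1 w) (\<eta>2 w)) (\<lambda>w. G (\<eta>1' w) (\<eta>2' w))"
proof -
  obtain \<psi>1 where [measurable]: "\<psi>1 \<in> BP"
    and \<psi>1: "AE w in PP. alive t w \<longrightarrow> \<eta>1 w = \<psi>1 (path t w) \<and> \<eta>1' w = \<psi>1 (reverse_path (path t w))"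
    using assms(1) unfolding reversible_def by blast
  obtain \<psi>2 where [measurable]: "\<psi>2 \<in> BP"
    and \<psi>2: "AE w in PP. alive t w \<longrightarrow> \<eta>2 w = \<psi>2 (path t w) \<and> \<eta>2' w = \<psi>2 (reverse_path (path t w))"
    using assms(2) unfolding reversible_def by blast
  show ?thesis
    unfolding reversible_def
  proof
    have "(\<lambda>y. (\<lambda>(a, b). G a b) (\<psi>1 y, \<psi>2 y)) \<in> BP" by measurable
    then show "(\<lambda>y. G (\<psi>1 y) (\<psi>2 y)) \<in> BP" by simp
    from \<psi>1 \<psi>2 show "AE w in PP. alive t w \<longrightarrow> G (\<eta>1 w) (\<eta>2 w) = G (\<psi>1 (path t w)) (\<psi>2 (path t w))
      \<and> G (\<eta>1' w) (\<eta>2' w) = G (\<psi>1 (reverse_path (path t w))) (\<psi>2 (reverse_path (path t w)))"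
      by eventually_elim simp
  qed
qed

lemma reversible_SUP:
  assumes "\<And>n::nat. reversible t (e n) (e' n)"
  shows "reversible t (\<lambda>w. SUP n. e n w) (\<lambda>w. SUP n. e' n w)"
proof -
  have "\<exists>h. \<forall>n. h n \<in> BP \<and> (AE w in PP. alive t w \<longrightarrow>
     e n w = h n (path t w) \<and> e' n w = h n (reverse_path (path t w)))"
    by (rule choice, rule allI) (use assms in \<open>auto simp: reversible_def\<close>)
  then obtain h where [measurable]: "\<And>n. h n \<in> BP"
    and h: "\<And>n. AE w in PP. alive t w \<longrightarrow> e n w = h n (path t w) \<and> e' n w = h n (reverse_path (path t w))"
    by blast
  show ?thesis
    unfolding reversible_def
  proof
    show "(\<lambda>y. SUP n. h n y) \<in> BP" by measurable
    have "AE w in PP. \<forall>n. alive t w \<longrightarrow> e n w = h n (path t w) \<and> e' n w = h n (reverse_path (path t w))"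
      unfolding AE_all_countable using h by blast
    then show "AE w in PP. alive t w \<longrightarrow> (SUP n. e n w) = (SUP n. h n (path t w))
      \<and> (SUP n. e' n w) = (SUP n. h n (reverse_path (path t w)))"
      by eventually_elim simp
  qed
qed

lemma reversible_add: "reversible t \<eta>1 \<eta>1' \<Longrightarrow> reversible t \<eta>2 \<eta>2' \<Longrightarrow> reversible t (\<lambda>w. \<eta>1 w + \<eta>2 w) (\<lambda>w. \<eta>1' w + \<eta>2' w)"
  by (rule reversible_comp2) measurable

lemma reversible_diff: "reversible t \<eta>1 \<eta>1' \<Longrightarrow> reversible t \<eta>2 \<eta>2' \<Longrightarrow> reversible t (\<lambda>w. \<eta>1 w - \<eta>2 w) (\<lambda>w. \<eta>1' w - \<eta>2' w)"
  by (rule reversible_comp2) measurable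

lemma reversible_cmult: "reversible t \<eta>1 \<eta>1' \<Longrightarrow> reversible t (\<lambda>w. c * \<eta>1 w) (\<lambda>w. c * \<eta>1' w)"
  by (rule reversible_comp2[where G="\<lambda>a b. c * a"]) (assumption, assumption, measurable)

lemma reversible_0: "reversible t (\<lambda>_. 0) (\<lambda>_. 0)"
  unfolding reversible_def by (intro bexI[of _ "\<lambda>_. 0"]) auto

lemma pcaf_reversible': 
  assumes "pcaf_strict P X \<theta> A" "0 < t"
  shows "reversible t (A (ennreal t)) (A (ennreal t))"
proof -
  obtain h where "h \<in> BP" and h: "\<And>y. h (reverse_path y) = h y"
    "AE w in PP. alive t w \<longrightarrow> A (ennreal t) w = h (path t w)"
    using pcaf_reversible[OF assms] by blast
  from h(2) have "AE w in PP. alive t w \<longrightarrow> A (ennreal t) w = h (path t w) \<and> A (ennreal t) w = h (reverse_path (path t w))"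
    by eventually_elim (simp add: h(1))
  then show ?thesis unfolding reversible_def using \<open>h \<in> _\<close> by blast
qed

end

context lusin_symmetric_process
begin

text \<open>Jumps are measured in the embedding, and only those larger than e are taken: on a path
  with left limits there are finitely many, and they can be reached by grid sums.\<close>

definition big_jump_sum :: "real \<Rightarrow> real \<Rightarrow> ((nat \<Rightarrow> real) \<times> (nat \<Rightarrow> real) \<Rightarrow> ennreal) \<Rightarrow> 'w \<Rightarrow> ennreal" where
  "big_jump_sum t e \<Phi> \<omega> = (\<Sum>s\<in>jumps t e (zpath \<omega>). \<Phi> (left_lim (zpath \<omega>) s, zpath \<omega> s))"

text \<open>Reversal turns a jump from a to b into a jump from b to a, hence the interchanged
  arguments on the reversed side.\<close>

definition rev_jumps :: "real \<Rightarrow> real \<Rightarrow> ((nat \<Rightarrow> real) \<times> (nat \<Rightarrow> real) \<Rightarrow> ennreal) \<Rightarrow> bool" where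
  "rev_jumps t e \<Phi> \<longleftrightarrow> reversible t (big_jump_sum t e \<Phi>) (big_jump_sum t e (\<Phi> \<circ> prod.swap))"

text \<open>For continuous G vanishing near the diagonal the jump sum is a limit of sums over grid
  intervals, which depend on the dyadic path only; along the reversed path the same sums have
  interchanged arguments.\<close>

lemma rev_jumps_continuous:
  assumes t: "0 < t" and e: "0 < e" and c: "continuous_on UNIV G"
    and \<Phi>0: "\<And>p. 0 \<le> G p" and zero: "\<And>p. dist (fst p) (snd p) \<le> e \<Longrightarrow> G p = 0"
  shows "rev_jumps t e (\<lambda>p. ennreal (G p))"
proof -
  have [measurable]: "G \<in> Borel" using c by (rule borel_measurable_continuous_onI)
  define s where "s n y = ennreal (\<Sum>k<2^n. G (emb (y (real k / 2^n)), emb (y (real (Suc k) / 2^n))))" for n :: nat and y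
  define h where "h y = liminf (\<lambda>n. s n y)" for y
  have [measurable]: "s n \<in> BP" for n
    unfolding s_def
  proof (intro measurable_compose[OF _ measurable_ennreal] borel_measurable_sum)
    fix k :: nat assume "k \<in> {..<2^n}"
    then have "real k / 2^n \<in> dyadics" "real (Suc k) / 2^n \<in> dyadics" by (auto intro!: dyadicsI simp del: of_nat_Suc)
    then have [measurable]: "(\<lambda>y. y (real k / 2^n)) \<in> path_space \<rightarrow>\<^sub>M borel" "(\<lambda>y. y (real (Suc k) / 2^n)) \<in> path_space \<rightarrow>\<^sub>M borel"
      by (auto intro: measurable_component_singleton)
    show "(\<lambda>y. G (emb (y (real k / 2^n)), emb (y (real (Suc k) / 2^n)))) \<in> BP"
      by measurable
  qed
  have [measurable]: "h \<in> BP" unfolding h_def by measurable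
  have lim: "(\<lambda>n. ennreal (\<Sum>k<2^n. W (zpath w (real k * (t / 2^n)), zpath w (real (Suc k) * (t / 2^n)))))
      \<longlonglongrightarrow> big_jump_sum t e (\<lambda>p. ennreal (W p)) w"
    if "cadlag_on t (zpath w)" "continuous_on UNIV W" "\<And>p. 0 \<le> W p" "\<And>p. dist (fst p) (snd p) \<le> e \<Longrightarrow> W p = 0" for W w
    using tendsto_ennrealI[OF jump_Riemann_sum[OF t that(1) e that(2,4)]] that(3)
    by (simp add: big_jump_sum_def sum_ennreal)
  have grid: "emb (path t w (real k / 2^n)) = zpath w (real k * (t / 2^n))" if "k \<le> 2^n" for k n w
    using zpath_path[OF dyadicsI[OF that], of t w] by (simp add: mult.commute)
  have grid': "emb (reverse_path (path t w) (real k / 2^n)) = zpath w (real (2^n - k) * (t / 2^n))" if "k \<le> 2^n" for k n w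
  proof -
    have "1 - real k / 2^n = real (2^n - k) / 2^n" using that by (simp add: of_nat_diff diff_divide_distrib)
    then show ?thesis using grid[of "2^n - k" n w] dyadicsI[OF that] by simp
  qed
  have "h (path t w) = big_jump_sum t e (\<lambda>p. ennreal (G p)) w" if "cadlag_on t (zpath w)" for w
  proof -
    have "s n (path t w) = ennreal (\<Sum>k<2^n. G (zpath w (real k * (t / 2^n)), zpath w (real (Suc k) * (t / 2^n))))" for n
      unfolding s_def by (intro arg_cong[where f=ennreal] sum.cong refl) (simp add: grid del: of_nat_Suc)
    then have "(\<lambda>n. s n (path t w)) \<longlonglongrightarrow> big_jump_sum t e (\<lambda>p. ennreal (G p)) w"
      using lim[OF that c \<Phi>0 zero] by (simp only:)
    then show ?thesis unfolding h_def by (intro lim_imp_Liminf) auto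
  qed
  moreover have "h (reverse_path (path t w)) = big_jump_sum t e ((\<lambda>p. ennreal (G p)) \<circ> prod.swap) w" if cad: "cadlag_on t (zpath w)" for w
  proof -
    have "s n (reverse_path (path t w)) = ennreal (\<Sum>k<2^n. (G \<circ> prod.swap) (zpath w (real k * (t / 2^n)), zpath w (real (Suc k) * (t / 2^n))))" for n
    proof -
      define g where "g k = (G \<circ> prod.swap) (zpath w (real k * (t / 2^n)), zpath w (real (Suc k) * (t / 2^n)))" for k
      \<comment> \<open>Interval k of the reversed grid is interval 2^n - Suc k of the original one,
        traversed backwards.\<close>
      have "(\<Sum>k<2^n. G (emb (reverse_path (path t w) (real k / 2^n)), emb (reverse_path (path t w) (real (Suc k) / 2^n)))) = (\<Sum>k<2^n. g (2^n - Suc k))"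
      proof (intro sum.cong refl)
        fix k assume "k \<in> {..<(2::nat)^n}"
        then have k: "k \<le> 2^n" "Suc k \<le> 2^n" "Suc (2^n - Suc k) = 2^n - k" by auto
        show "G (emb (reverse_path (path t w) (real k / 2^n)), emb (reverse_path (path t w) (real (Suc k) / 2^n))) = g (2^n - Suc k)"
          unfolding g_def k(3) grid'[OF k(1)] grid'[OF k(2)] by simp
      qed
      also have "\<dots> = (\<Sum>k<2^n. g k)" by (rule sum.nat_diff_reindex)
      finally show ?thesis unfolding s_def g_def by (rule arg_cong)
    qed
    moreover have "continuous_on UNIV (G \<circ> prod.swap)"
      by (rule continuous_on_compose2[OF c continuous_on_swap, unfolded comp_def[symmetric]]) auto
    ultimately have "(\<lambda>n. s n (reverse_path (path t w))) \<longlonglongrightarrow> big_jump_sum t e (\<lambda>p. ennreal ((G \<circ> prod.swap) p)) w"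
      using lim[OF cad, of "G \<circ> prod.swap"] \<Phi>0 zero by (simp add: dist_commute)
    then show ?thesis unfolding h_def by (subst lim_imp_Liminf) (auto simp: comp_def)
  qed
  ultimately have eq: "cadlag_on t (zpath w) \<Longrightarrow> big_jump_sum t e (\<lambda>p. ennreal (G p)) w = h (path t w)
      \<and> big_jump_sum t e ((\<lambda>p. ennreal (G p)) \<circ> prod.swap) w = h (reverse_path (path t w))" for w by simp
  have "AE w in PP. alive t w \<longrightarrow> big_jump_sum t e (\<lambda>p. ennreal (G p)) w = h (path t w)
      \<and> big_jump_sum t e ((\<lambda>p. ennreal (G p)) \<circ> prod.swap) w = h (reverse_path (path t w))"
    using AE_cadlag[OF t] by eventually_elim (use eq in blast)
  then show ?thesis unfolding rev_jumps_def reversible_def using \<open>h \<in> _\<close> by blast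
qed

lemma big_jump_sum_SUP:
  assumes "\<And>p. incseq (\<lambda>n. U n p)"
  shows "big_jump_sum t e (\<lambda>p. SUP n. U n p) w = (SUP n. big_jump_sum t e (U n) w)"
  unfolding big_jump_sum_def
  by (rule ennreal_SUP_sum[symmetric]) (rule assms)

lemma rev_jumps_SUP:
  assumes "\<And>n::nat. rev_jumps t e (U n)" "\<And>p. incseq (\<lambda>n. U n p)"
  shows "rev_jumps t e (\<lambda>p. SUP n. U n p)"
proof -
  have "reversible t (\<lambda>w. SUP n. big_jump_sum t e (U n) w) (\<lambda>w. SUP n. big_jump_sum t e (U n \<circ> prod.swap) w)"
    using assms(1) unfolding rev_jumps_def by (rule reversible_SUP)
  moreover have "big_jump_sum t e (\<lambda>p. SUP n. U n p) = (\<lambda>w. SUP n. big_jump_sum t e (U n) w)"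
    by (intro ext big_jump_sum_SUP assms)
  moreover have "big_jump_sum t e ((\<lambda>p. SUP n. U n p) \<circ> prod.swap) = (\<lambda>w. SUP n. big_jump_sum t e (U n \<circ> prod.swap) w)"
    using big_jump_sum_SUP[of "\<lambda>n. U n \<circ> prod.swap"] assms(2) by (auto simp: comp_def)
  ultimately show ?thesis unfolding rev_jumps_def by simp
qed

lemma big_jump_sum_add: "big_jump_sum t e (\<lambda>p. U p + V p) w = big_jump_sum t e U w + big_jump_sum t e V w"
  by (simp add: big_jump_sum_def sum.distrib)

lemma big_jump_sum_cmult: "big_jump_sum t e (\<lambda>p. c * U p) w = c * big_jump_sum t e U w"
  by (simp add: big_jump_sum_def sum_distrib_left)

lemma rev_jumps_add: "rev_jumps t e U \<Longrightarrow> rev_jumps t e V \<Longrightarrow> rev_jumps t e (\<lambda>p. U p + V p)"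
  unfolding rev_jumps_def using reversible_add[of t "big_jump_sum t e U" "big_jump_sum t e (U \<circ> prod.swap)" "big_jump_sum t e V"]
  by (simp add: comp_def big_jump_sum_add[abs_def])

lemma rev_jumps_cmult: "rev_jumps t e U \<Longrightarrow> rev_jumps t e (\<lambda>p. c * U p)"
  unfolding rev_jumps_def using reversible_cmult[of t "big_jump_sum t e U" "big_jump_sum t e (U \<circ> prod.swap)"]
  by (simp add: comp_def big_jump_sum_cmult[abs_def])

text \<open>A counted jump has size larger than e, so only the values of the function on such pairs
  are ever evaluated.\<close>

lemma rev_jumps_off_diagonal:
  assumes "\<And>p. e < dist (fst p) (snd p) \<Longrightarrow> U p = V p"
  shows "rev_jumps t e U \<longleftrightarrow> rev_jumps t e V"
proof -
  have "big_jump_sum t e U w = big_jump_sum t e V w" "big_jump_sum t e (U \<circ> prod.swap) w = big_jump_sum t e (V \<circ> prod.swap) w" for w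
    unfolding big_jump_sum_def by (intro sum.cong refl; simp add: jumps_def assms dist_commute)+
  then have "big_jump_sum t e U = big_jump_sum t e V" "big_jump_sum t e (U \<circ> prod.swap) = big_jump_sum t e (V \<circ> prod.swap)" by auto
  then show ?thesis by (simp add: rev_jumps_def)
qed

text \<open>Pairs at distance at most e are removed first. Truncated multiples of the distance to
  the complement are then continuous, vanish near the diagonal and increase to the
  indicator.\<close>

lemma rev_jumps_open:
  assumes t: "0 < t" and e: "0 < e" and O: "open U"
  shows "rev_jumps t e (indicator U)"
proof -
  define V where "V = U \<inter> {p. e < dist (fst p) (snd p)}"
  have oV: "open V" unfolding V_def using O by (intro open_Int open_Collect_less continuous_intros)
  \<comment> \<open>The complement has to be nonempty, because \<open>infdist\<close> to the empty
    set is 0.\<close>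
  have "(undefined, undefined) \<in> - V" using e by (simp add: V_def)
  then have ne: "- V \<noteq> {}" by blast
  define G where "G j p = min 1 (real j * infdist p (- V))" for j :: nat and p
  have "rev_jumps t e (\<lambda>p. ennreal (G j p))" for j
  proof (rule rev_jumps_continuous[OF t e])
    show "continuous_on UNIV (G j)" unfolding G_def by (intro continuous_intros)
    show "0 \<le> G j p" for p by (simp add: G_def infdist_nonneg)
    show "G j p = 0" if "dist (fst p) (snd p) \<le> e" for p
    proof -
      have "p \<in> - V" using that by (simp add: V_def)
      then show ?thesis by (simp add: G_def)
    qed
  qed
  moreover have inc: "incseq (\<lambda>j. ennreal (G j p))" for p
    by (intro incseq_SucI ennreal_leI) (simp add: G_def algebra_simps infdist_nonneg min_le_iff_disj min.coboundedI2)
  ultimately have "rev_jumps t e (\<lambda>p. SUP j. ennreal (G j p))" by (rule rev_jumps_SUP)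
  moreover have "(SUP j. ennreal (G j p)) = indicator V p" for p
  proof (cases "p \<in> V")
    case True
    have pos: "0 < infdist p (- V)"
      using infdist_pos_not_in_closed[of "- V" p] oV ne True by (simp add: closed_Compl)
    then obtain j where "1 < real j * infdist p (- V)" using reals_Archimedean3 by blast
    then have "1 \<le> (SUP j. ennreal (G j p))" by (intro SUP_upper2[of j]) (simp_all add: G_def)
    moreover have "(SUP j. ennreal (G j p)) \<le> 1" by (intro SUP_least) (simp add: G_def ennreal_le_1)
    ultimately show ?thesis using True by simp
  next
    case False
    then show ?thesis by (simp add: G_def)
  qed
  ultimately have "rev_jumps t e (indicator V)" by simp
  moreover have "indicator V p = (indicator U p :: ennreal)" if "e < dist (fst p) (snd p)" for p
    using that by (simp add: V_def indicator_def)
  ultimately show ?thesis using rev_jumps_off_diagonal[of e "indicator V" "indicator U"] by blast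
qed

text \<open>Open sets are stable under intersection, so complements and disjoint unions suffice;
  there reversibility is kept by differences and by increasing suprema.\<close>

lemma rev_jumps_Borel:
  assumes t: "0 < t" and e: "0 < e" and C: "C \<in> sets borel"
  shows "rev_jumps t e (indicator C)"
proof -
  \<comment> \<open>Subtraction in [0,\<infinity>] needs finite subtrahends. A sum over an infinite
    set is 0 by convention, so this holds on every path.\<close>
  have fin: "big_jump_sum t e (indicator A) w \<noteq> \<top>" "big_jump_sum t e (indicator A \<circ> prod.swap) w \<noteq> \<top>" for A w
  proof -
    have *: "sum f J \<noteq> \<top>" if "\<And>s. f s \<noteq> \<top>" for f :: "real \<Rightarrow> ennreal" and J
      by (cases "finite J") (simp_all add: that)
    show "big_jump_sum t e (indicator A) w \<noteq> \<top>" "big_jump_sum t e (indicator A \<circ> prod.swap) w \<noteq> \<top>"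
      unfolding big_jump_sum_def by (rule *, simp add: indicator_def)+
  qed
  have stable: "Int_stable {S :: ((nat \<Rightarrow> real) \<times> (nat \<Rightarrow> real)) set. open S}" by (auto simp: Int_stable_def)
  have sub: "{S :: ((nat \<Rightarrow> real) \<times> (nat \<Rightarrow> real)) set. open S} \<subseteq> Pow UNIV" by simp
  have "C \<in> sigma_sets UNIV {S. open S}" using C by (simp add: borel_def)
  then show ?thesis
  proof (induction rule: sigma_sets_induct_disjoint[OF stable sub, consumes 1, case_names basic empty compl union])
    case (basic A)
    then show ?case using rev_jumps_open[OF t e] by simp
  next
    case empty
    have "big_jump_sum t e (indicator {}) = (\<lambda>_. 0)" "big_jump_sum t e (indicator {} \<circ> prod.swap) = (\<lambda>_. 0)"
      by (auto simp: big_jump_sum_def)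
    then show ?case unfolding rev_jumps_def using reversible_0[of t] by simp
  next
    case (compl A)
    have 1: "rev_jumps t e (\<lambda>_. 1)" using rev_jumps_open[OF t e, of UNIV] by simp
    have "big_jump_sum t e (\<lambda>_. 1) w = big_jump_sum t e (indicator (UNIV - A)) w + big_jump_sum t e (indicator A) w" for w
      unfolding big_jump_sum_add[symmetric] by (rule arg_cong2[where f="big_jump_sum t e"]) (auto simp: indicator_def)
    then have d1: "big_jump_sum t e (indicator (UNIV - A)) w = big_jump_sum t e (\<lambda>_. 1) w - big_jump_sum t e (indicator A) w" for w
      using fin(1)[of A w] by simp
    have "big_jump_sum t e ((\<lambda>_. 1) \<circ> prod.swap) w = big_jump_sum t e (indicator (UNIV - A) \<circ> prod.swap) w + big_jump_sum t e (indicator A \<circ> prod.swap) w" for w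
      unfolding big_jump_sum_add[symmetric] by (rule arg_cong2[where f="big_jump_sum t e"]) (auto simp: indicator_def)
    then have d2: "big_jump_sum t e (indicator (UNIV - A) \<circ> prod.swap) w = big_jump_sum t e ((\<lambda>_. 1) \<circ> prod.swap) w - big_jump_sum t e (indicator A \<circ> prod.swap) w" for w
      using fin(2)[of A w] by simp
    have "big_jump_sum t e (indicator (UNIV - A)) = (\<lambda>w. big_jump_sum t e (\<lambda>_. 1) w - big_jump_sum t e (indicator A) w)"
      and "big_jump_sum t e (indicator (UNIV - A) \<circ> prod.swap) = (\<lambda>w. big_jump_sum t e ((\<lambda>_. 1) \<circ> prod.swap) w - big_jump_sum t e (indicator A \<circ> prod.swap) w)"
      using d1 d2 by auto
    then show ?case
      using reversible_diff[OF 1[unfolded rev_jumps_def] compl(2)[unfolded rev_jumps_def]] unfolding rev_jumps_def by simp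
  next
    case (union A)
    have sum: "rev_jumps t e (\<lambda>p. \<Sum>i<n. indicator (A i) p)" for n
    proof (induction n)
      case 0
      have "big_jump_sum t e (\<lambda>p. 0) = (\<lambda>_. 0)" by (auto simp: big_jump_sum_def)
      then show ?case unfolding rev_jumps_def using reversible_0[of t] by (simp add: comp_def)
    next
      case (Suc n)
      then show ?case using rev_jumps_add[OF Suc union(3)[of n]] by simp
    qed
    have "rev_jumps t e (\<lambda>p. SUP n. \<Sum>i<n. indicator (A i) p)"
      by (rule rev_jumps_SUP[OF sum]) (auto intro!: incseq_SucI)
    moreover have "(SUP n. \<Sum>i<n. indicator (A i) p) = (indicator (\<Union>i. A i) p :: ennreal)" for p
      using suminf_indicator[OF union(1), of p] by (simp add: suminf_eq_SUP)
    ultimately show ?case by simp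
  qed
qed

lemma rev_jumps_measurable:
  assumes t: "0 < t" and e: "0 < e" and G: "G \<in> Borel"
  shows "rev_jumps t e G"
  using G
proof (induction rule: borel_measurable_induct)
  case (cong f g)
  then have "f = g" by auto
  then show ?case using cong by simp
next
  case (set A)
  then show ?case by (rule rev_jumps_Borel[OF t e])
next
  case (mult u c)
  then show ?case using rev_jumps_cmult by simp
next
  case (add u v)
  then show ?case using rev_jumps_add by simp
next
  case (seq U)
  have "rev_jumps t e (\<lambda>p. SUP n. U n p)" by (rule rev_jumps_SUP) (use seq in \<open>auto simp: incseq_def le_fun_def\<close>)
  moreover have "(SUP n. U n) = (\<lambda>p. SUP n. U n p)" by (auto simp: image_comp)
  ultimately show ?case by simp
qed

text \<open>A jump that leaves a limit outside the range becomes, after reversal, a jump that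
  arrives outside the range; but paths take their values in the range. Where there is no jump, the
  left limit is such a value.\<close>

lemma AE_left_lim_range:
  assumes t: "0 < t"
  shows "AE w in PP. alive t w \<longrightarrow> (\<forall>s. 0 < s \<and> s \<le> t \<longrightarrow> left_lim (zpath w) s \<in> range emb)"
proof -
  define C where "C = {p :: (nat \<Rightarrow> real) \<times> (nat \<Rightarrow> real). fst p \<notin> range emb}"
  have [measurable]: "range emb \<in> sets borel" using image_emb[of UNIV] by simp
  have "{p :: (nat \<Rightarrow> real) \<times> (nat \<Rightarrow> real) \<in> space (borel \<Otimes>\<^sub>M borel). fst p \<notin> range emb} \<in> sets (borel \<Otimes>\<^sub>M borel)" by measurable
  then have "{p \<in> space borel. fst p \<notin> range emb} \<in> sets (borel :: ((nat \<Rightarrow> real) \<times> (nat \<Rightarrow> real)) measure)"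
    unfolding borel_prod .
  then have C: "C \<in> sets borel" by (simp add: C_def)
  have "AE w in PP. alive t w \<longrightarrow> big_jump_sum t (1 / real (Suc n)) (indicator C) w = 0" for n
  proof (rule reversible_null[OF t])
    show "reversible t (big_jump_sum t (1 / real (Suc n)) (indicator C)) (big_jump_sum t (1 / real (Suc n)) (indicator C \<circ> prod.swap))"
      using rev_jumps_Borel[OF t _ C, of "1 / real (Suc n)"] by (simp add: rev_jumps_def del: of_nat_Suc)
    have "big_jump_sum t (1 / real (Suc n)) (indicator C \<circ> prod.swap) w = 0" for w
      unfolding big_jump_sum_def by (intro sum.neutral) (auto simp: C_def zpath_def)
    then show "AE w in PP. alive t w \<longrightarrow> big_jump_sum t (1 / real (Suc n)) (indicator C \<circ> prod.swap) w = 0" by simp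
  qed
  then have "AE w in PP. \<forall>n. alive t w \<longrightarrow> big_jump_sum t (1 / real (Suc n)) (indicator C) w = 0"
    by (simp only: AE_all_countable) blast
  then show ?thesis
    using AE_cadlag[OF t]
  proof (eventually_elim, intro impI allI)
    fix w s
    assume 0: "\<forall>n. alive t w \<longrightarrow> big_jump_sum t (1 / real (Suc n)) (indicator C) w = 0"
      and cad: "alive t w \<longrightarrow> cadlag_on t (zpath w)" and alive: "alive t w" and s: "0 < s \<and> s \<le> t"
    show "left_lim (zpath w) s \<in> range emb"
    proof (cases "left_lim (zpath w) s = zpath w s")
      case True
      then show ?thesis by (simp add: zpath_def)
    next
      case False
      then have "0 < dist (left_lim (zpath w) s) (zpath w s)" by simp
      then obtain n where n: "1 / real (Suc n) < dist (left_lim (zpath w) s) (zpath w s)" by (rule nat_approx_posE)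
      have fin: "finite (jumps t (1 / real (Suc n)) (zpath w))"
        using cad alive t by (intro finite_jumps) auto
      have "s \<in> jumps t (1 / real (Suc n)) (zpath w)" using n s by (simp add: jumps_def)
      moreover have "big_jump_sum t (1 / real (Suc n)) (indicator C) w = 0" using 0 alive by blast
      ultimately have "indicator C (left_lim (zpath w) s, zpath w s) = (0::ennreal)"
        using fin unfolding big_jump_sum_def by (simp only: sum_nonneg_eq_0_iff zero_le)
      then show ?thesis by (simp add: C_def indicator_def split: if_splits)
    qed
  qed
qed

lemma left_limit_zpath:
  assumes cad: "cadlag_on t (zpath w)" and range: "left_lim (zpath w) s \<in> range emb" and s: "0 < s" "s \<le> t"
  shows "left_limit X s w = inv emb (left_lim (zpath w) s)"
  unfolding left_limit_def
proof (rule tendsto_Lim)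
  have "(zpath w \<longlongrightarrow> left_lim (zpath w) s) (at_left s)" using cadlag_left_lim[OF cad s] .
  then have "((\<lambda>r. inv emb (zpath w r)) \<longlongrightarrow> inv emb (left_lim (zpath w) s)) (at_left s)"
    by (rule continuous_on_tendsto_compose[OF continuous_inv_emb _ range]) (simp add: zpath_def)
  moreover have "inv emb (zpath w r) = the (XX r w)" for r by (simp add: zpath_def inj_emb)
  ultimately show "((\<lambda>r. the (XX r w)) \<longlongrightarrow> inv emb (left_lim (zpath w) s)) (at_left s)" by simp
qed simp

text \<open>The jump times are the increasing union of the finite sets of jumps larger than 1 / Suc
  n, and these are cofinal among the finite sets over which the infinite sum is taken.\<close>

lemma jump_sum_eq:
  assumes t: "0 < t" and cad: "cadlag_on t (zpath w)" and alive: "alive t w"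
    and range: "\<And>s. 0 < s \<Longrightarrow> s \<le> t \<Longrightarrow> left_lim (zpath w) s \<in> range emb"
  shows "jump_sum X G (ennreal t) w = (SUP n. big_jump_sum t (1 / real (Suc n)) (\<lambda>p. if fst p = snd p then 0 else G (inv emb (fst p)) (inv emb (snd p))) w)"
proof -
  let ?J = "\<lambda>n. jumps t (1 / real (Suc n)) (zpath w)"
  define S where "S = {s. 0 < s \<and> ennreal s \<le> ennreal t \<and> alive s w \<and> left_limit X s w \<noteq> the (XX s w)}"
  define f where "f s = G (left_limit X s w) (the (XX s w))" for s
  have inv: "inv emb (zpath w s) = the (XX s w)" for s by (simp add: zpath_def inj_emb)
  have alive': "alive s w" if "s \<le> t" for s
    using alive_mono[OF _ alive, of "ennreal s"] that by (simp add: ennreal_leI)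
  have eq_iff: "left_limit X s w = the (XX s w) \<longleftrightarrow> left_lim (zpath w) s = zpath w s" if "0 < s" "s \<le> t" for s
  proof -
    have "left_lim (zpath w) s \<in> range emb" by (rule range[OF that])
    then obtain x where x: "left_lim (zpath w) s = emb x" by blast
    show ?thesis unfolding left_limit_zpath[OF cad range[OF that] that] x zpath_def by (simp add: inj_emb inj_eq)
  qed
  have S: "S = (\<Union>n. ?J n)"
  proof (intro set_eqI iffI)
    fix s assume "s \<in> S"
    then have s: "0 < s" "s \<le> t" "left_limit X s w \<noteq> the (XX s w)" using t by (auto simp: S_def)
    then have "0 < dist (left_lim (zpath w) s) (zpath w s)" using eq_iff by simp
    then obtain n where "1 / real (Suc n) < dist (left_lim (zpath w) s) (zpath w s)" by (rule nat_approx_posE)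
    then show "s \<in> (\<Union>n. ?J n)" using s by (intro UN_I[of n]) (simp_all add: jumps_def)
  next
    fix s assume "s \<in> (\<Union>n. ?J n)"
    then obtain n where s: "0 < s" "s \<le> t" "1 / real (Suc n) < dist (left_lim (zpath w) s) (zpath w s)" by (auto simp: jumps_def)
    have "0 < 1 / real (Suc n)" by simp
    then have "0 < dist (left_lim (zpath w) s) (zpath w s)" using s(3) by (rule less_trans)
    then have "left_lim (zpath w) s \<noteq> zpath w s" by simp
    then show "s \<in> S" using s eq_iff[OF s(1,2)] alive'[OF s(2)] by (simp add: S_def ennreal_leI)
  qed
  have fin: "finite (?J n)" for n using cad t by (intro finite_jumps) auto
  have inc: "?J i \<subseteq> ?J j" if "i \<le> j" for i j
  proof -
    have "1 / real (Suc j) \<le> 1 / real (Suc i)" using that by (intro divide_left_mono) auto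
    then show ?thesis by (auto simp: jumps_def)
  qed
  have big: "big_jump_sum t (1 / real (Suc n)) (\<lambda>p. if fst p = snd p then 0 else G (inv emb (fst p)) (inv emb (snd p))) w = sum f (?J n)" for n
    unfolding big_jump_sum_def
  proof (intro sum.cong refl)
    fix s assume s: "s \<in> ?J n"
    then have s': "0 < s" "s \<le> t" by (auto simp: jumps_def)
    have "s \<in> S" using s S by blast
    then have "left_lim (zpath w) s \<noteq> zpath w s" using eq_iff[OF s'] by (simp add: S_def)
    then show "(if fst (left_lim (zpath w) s, zpath w s) = snd (left_lim (zpath w) s, zpath w s) then 0
       else G (inv emb (fst (left_lim (zpath w) s, zpath w s))) (inv emb (snd (left_lim (zpath w) s, zpath w s)))) = f s"
      using left_limit_zpath[OF cad range[OF s'] s'] by (simp add: f_def inv)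
  qed
  have "jump_sum X G (ennreal t) w = infsum f S" unfolding jump_sum_def S_def f_def ..
  also have "\<dots> = (SUP F\<in>{F. finite F \<and> F \<subseteq> S}. sum f F)" by (rule nonneg_infsum_complete) simp
  also have "\<dots> = (SUP n. sum f (?J n))"
  proof (rule SUP_eq)
    fix F assume "F \<in> {F. finite F \<and> F \<subseteq> S}"
    then have F: "finite F" "F \<subseteq> (\<Union>n. ?J n)" using S by auto
    have "\<exists>n. F \<subseteq> ?J n"
      using F
    proof (induction F rule: finite_induct)
      case (insert s F)
      then obtain n k where "F \<subseteq> ?J n" "s \<in> ?J k" by blast
      then have "insert s F \<subseteq> ?J (max n k)" using inc[of n "max n k"] inc[of k "max n k"] by auto
      then show ?case by blast
    qed simp
    then obtain n where "F \<subseteq> ?J n" by blast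
    then have "sum f F \<le> sum f (?J n)" by (intro sum_mono2 fin) auto
    then show "\<exists>n\<in>UNIV. sum f F \<le> sum f (?J n)" by blast
  next
    fix n :: nat
    show "\<exists>F\<in>{F. finite F \<and> F \<subseteq> S}. sum f (?J n) \<le> sum f F"
      by (intro bexI[of _ "?J n"] order_refl) (use fin S in blast)
  qed
  finally show ?thesis by (simp only: big)
qed

theorem jump_sum_reversible:
  assumes t: "0 < t" and G: "(\<lambda>(x, y). if x = y then 0 else G x y) \<in> borel_measurable (borel \<Otimes>\<^sub>M borel)"
    and sym: "\<And>x y. x \<noteq> y \<Longrightarrow> G x y = G y x"
  shows "reversible t (jump_sum X G (ennreal t)) (jump_sum X G (ennreal t))"
proof -
  \<comment> \<open>W compares the embedded points, as \<open>jump_sum_eq\<close> delivers it; W'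
    compares their inverse images and is thus a Borel composition. They agree on the range, where
    the inverse is injective, and left limits and values lie there.\<close>
  define W where "W = (\<lambda>p. if fst p = snd p then 0 else G (inv emb (fst p)) (inv emb (snd p)))"
  define W' where "W' = (\<lambda>p. (\<lambda>(x, y). if x = y then 0 else G x y) (inv emb (fst p), inv emb (snd p)))"
  define R where "R = range emb \<times> range emb"
  have "(\<lambda>p. (inv emb (fst p), inv emb (snd p))) \<in> borel \<Otimes>\<^sub>M borel \<rightarrow>\<^sub>M borel \<Otimes>\<^sub>M borel" by measurable
  then have "W' \<in> borel_measurable (borel \<Otimes>\<^sub>M borel)"
    unfolding W'_def by (rule measurable_compose[OF _ G])
  then have m': "W' \<in> Borel" by (simp add: borel_prod)
  have "reversible t (\<lambda>w. SUP n. big_jump_sum t (1 / real (Suc n)) W' w) (\<lambda>w. SUP n. big_jump_sum t (1 / real (Suc n)) (W' \<circ> prod.swap) w)"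
    using rev_jumps_measurable[OF t _ m'] by (intro reversible_SUP) (simp add: rev_jumps_def del: of_nat_Suc)
  moreover have "W' \<circ> prod.swap = W'"
    using sym by (auto simp: W'_def fun_eq_iff)
  ultimately have "reversible t (\<lambda>w. SUP n. big_jump_sum t (1 / real (Suc n)) W' w) (\<lambda>w. SUP n. big_jump_sum t (1 / real (Suc n)) W' w)"
    by simp
  then show ?thesis
  proof (rule reversible_cong)
    have *: "jump_sum X G (ennreal t) w = (SUP n. big_jump_sum t (1 / real (Suc n)) W' w)"
      if cad: "cadlag_on t (zpath w)" and alive: "alive t w"
        and range: "\<And>s. 0 < s \<Longrightarrow> s \<le> t \<Longrightarrow> left_lim (zpath w) s \<in> range emb" for w
    proof -
      have "big_jump_sum t (1 / real (Suc n)) W w = big_jump_sum t (1 / real (Suc n)) W' w" for n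
        unfolding big_jump_sum_def
      proof (intro sum.cong refl)
        fix s assume "s \<in> jumps t (1 / real (Suc n)) (zpath w)"
        then have "left_lim (zpath w) s \<in> range emb" "zpath w s \<in> range emb" using range by (auto simp: jumps_def zpath_def)
        then show "W (left_lim (zpath w) s, zpath w s) = W' (left_lim (zpath w) s, zpath w s)"
          by (auto simp: W_def W'_def inj_emb inj_eq)
      qed
      then show ?thesis using jump_sum_eq[OF t cad alive range, of G] by (simp add: W_def)
    qed
    show "AE w in PP. alive t w \<longrightarrow> jump_sum X G (ennreal t) w = (SUP n. big_jump_sum t (1 / real (Suc n)) W' w)
        \<and> jump_sum X G (ennreal t) w = (SUP n. big_jump_sum t (1 / real (Suc n)) W' w)"
      using AE_cadlag[OF t] AE_left_lim_range[OF t] by eventually_elim (use * in blast)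
  qed
qed

end

section \<open>The Feynman-Kac semigroup\<close>

subsection \<open>Multiplicativity of the Feynman-Kac weight\<close>

lemma enn_exp_ge_1: "1 \<le> enn_exp a"
  by (auto simp: enn_exp_def intro: ennreal_leI[of 1, simplified])

lemma enn_exp_pos: "0 < enn_exp a"
  using enn_exp_ge_1[of a] by (rule less_le_trans[rotated]) simp

lemma enn_exp_add: "enn_exp (a + b) = enn_exp a * enn_exp b"
proof (cases "a = \<top> \<or> b = \<top>")
  case True
  then have "enn_exp a * enn_exp b = \<top>"
    using enn_exp_pos[of a] enn_exp_pos[of b] by (auto simp: ennreal_mult_eq_top_iff enn_exp_def)
  then show ?thesis using True by (auto simp: enn_exp_def)
next
  case False
  then have "a < \<top>" "b < \<top>" by (simp_all add: less_top)
  then show ?thesis using False by (simp add: enn_exp_def enn2real_plus exp_add ennreal_mult)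
qed

text \<open>Inversion in [0,\<infinity>] is multiplicative unless 0 meets \<infinity>, and the
  positivity of \<open>enn_exp\<close> rules this out, also when a functional is infinite.\<close>

lemma enn_exp_quotient_add:
  "enn_exp (a + b) / enn_exp (c + d) = (enn_exp a / enn_exp c) * (enn_exp b / enn_exp d)"
proof -
  have "inverse (enn_exp c * enn_exp d) = inverse (enn_exp c) * inverse (enn_exp d)"
    using enn_exp_pos by (intro ennreal_inverse_mult') auto
  then show ?thesis by (simp add: enn_exp_add divide_ennreal_def mult_ac)
qed

lemma enn_exp_measurable[measurable]: "enn_exp \<in> Borel"
  unfolding enn_exp_def[abs_def] by measurable

lemma filtermap_at_left_shift: "filtermap (\<lambda>x. x - d) (at_left a) = at_left (a - d)" for a d :: real
  by (simp add: filter_eq_iff eventually_filtermap eventually_at_filter filtermap_nhds_shift[symmetric])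

context borel_right_process
begin

text \<open>Convergence to l is equivalent on both sides for every l, so the two values agree even
  where no limit exists.\<close>

lemma left_limit_shift:
  assumes s: "0 \<le> s" and r: "0 < r"
  shows "left_limit X r (\<theta> (ennreal s) w) = left_limit X (s + r) w"
proof -
  have at: "at_left (s + r) = filtermap (\<lambda>x. x + s) (at_left r)"
    using filtermap_at_left_shift[of "- s" r] by (simp add: add.commute)
  have "\<forall>\<^sub>F u in at_left r. 0 < u" using r by (auto simp: eventually_at_left_field intro!: exI[of _ 0])
  then have ev: "\<forall>\<^sub>F u in at_left r. the (XX u (\<theta> (ennreal s) w)) = the (XX (u + s) w)"
    by eventually_elim (use s in \<open>simp add: X_shift add.commute flip: ennreal_plus\<close>)
  have "((\<lambda>u. the (XX u (\<theta> (ennreal s) w))) \<longlongrightarrow> l) (at_left r)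
     \<longleftrightarrow> ((\<lambda>u. the (XX u w)) \<longlongrightarrow> l) (at_left (s + r))" for l
    unfolding at filterlim_filtermap using ev by (rule filterlim_cong[OF refl refl])
  then show ?thesis unfolding left_limit_def t2_space_class.Lim_def by simp
qed

text \<open>The jumps in (s, s + t] are those of the shifted path in (0, t], translated by
  s.\<close>

lemma jump_sum_shift:
  assumes s: "0 \<le> s" and t: "0 \<le> t"
  shows "jump_sum X G (ennreal (s + t)) w = jump_sum X G (ennreal s) w + jump_sum X G (ennreal t) (\<theta> (ennreal s) w)"
proof -
  define J where "J t w = {u. 0 < u \<and> ennreal u \<le> ennreal t \<and> alive u w \<and> left_limit X u w \<noteq> the (XX u w)}" for t w
  define f where "f w u = G (left_limit X u w) (the (XX u w))" for w u
  have J: "J t w = {u. 0 < u \<and> u \<le> t \<and> alive u w \<and> left_limit X u w \<noteq> the (XX u w)}" if "0 \<le> t" for t w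
    using that by (auto simp: J_def)
  have X: "XX u (\<theta> (ennreal s) w) = XX (s + u) w" if "0 < u" for u
    using that s by (simp add: X_shift flip: ennreal_plus)
  have fs: "f (\<theta> (ennreal s) w) u = f w (s + u)" if "0 < u" for u
    using that s by (simp add: f_def X left_limit_shift)
  have split: "J (s + t) w = J s w \<union> (+) s ` J t (\<theta> (ennreal s) w)"
  proof (intro set_eqI iffI)
    fix u assume u: "u \<in> J (s + t) w"
    show "u \<in> J s w \<union> (+) s ` J t (\<theta> (ennreal s) w)"
    proof (cases "u \<le> s")
      case True
      then show ?thesis using u s t by (simp add: J)
    next
      case False
      have "u - s \<in> J t (\<theta> (ennreal s) w)" using u s t False X[of "u - s"] left_limit_shift[OF s, of "u - s" w] by (simp add: J)
      then show ?thesis by (intro UnI2 image_eqI[of _ _ "u - s"]) simp_all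
    qed
  next
    fix u assume "u \<in> J s w \<union> (+) s ` J t (\<theta> (ennreal s) w)"
    then show "u \<in> J (s + t) w" using s t by (auto simp: J X left_limit_shift)
  qed
  have disj: "J s w \<inter> (+) s ` J t (\<theta> (ennreal s) w) = {}" using s t by (auto simp: J)
  have "infsum (f w) (J (s + t) w) = infsum (f w) (J s w) + infsum (f w) ((+) s ` J t (\<theta> (ennreal s) w))"
    unfolding split by (intro infsum_Un_disjoint disj nonneg_summable_on_complete) auto
  also have "infsum (f w) ((+) s ` J t (\<theta> (ennreal s) w)) = infsum (f w \<circ> (+) s) (J t (\<theta> (ennreal s) w))"
    by (rule infsum_reindex) simp
  also have "\<dots> = infsum (f (\<theta> (ennreal s) w)) (J t (\<theta> (ennreal s) w))"
    using t by (intro infsum_cong) (simp add: J fs)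
  finally show ?thesis unfolding jump_sum_def J_def f_def .
qed

lemma pcaf_additive:
  assumes "pcaf_strict P X \<theta> A"
  shows "AE w in P (Some x). \<forall>s<\<top>. \<forall>t<\<top>. A (s + t) w = A s w + A t (\<theta> s w)"
proof -
  obtain L where "\<forall>x. AE w in P (Some x). w \<in> L" and L: "\<And>w. w \<in> L \<Longrightarrow> \<forall>s<\<top>. \<forall>t<\<top>. A (s + t) w = A s w + A t (\<theta> s w)"
    using assms unfolding pcaf_strict_def by blast
  then have "AE w in P (Some x). w \<in> L" by blast
  then show ?thesis by eventually_elim (rule L)
qed

end

text \<open>Expansion of (a v - b u)^2 / (u v) \<ge> 0; if a or b is infinite, so is the right-hand
  side. In Schur's test the weights are the values of h at the two end points.\<close>

lemma young_ennreal:
  fixes a b u v :: ennreal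
  assumes "0 < u" "u < \<top>" "0 < v" "v < \<top>"
  shows "2 * (a * b) \<le> a\<^sup>2 * inverse u * v + u * (b\<^sup>2 * inverse v)"
proof -
  obtain u' where u: "u = ennreal u'" "0 < u'" using assms(1,2) by (cases u) auto
  obtain v' where v: "v = ennreal v'" "0 < v'" using assms(3,4) by (cases v) auto
  show ?thesis
  proof (cases "a = \<top> \<or> b = \<top>")
    case True
    have "inverse u \<noteq> 0" "inverse v \<noteq> 0" using assms by auto
    then have eq: "a\<^sup>2 * inverse u * v + u * (b\<^sup>2 * inverse v) = \<top>"
      using True assms by (auto simp: power2_eq_square ennreal_mult_eq_top_iff ennreal_top_mult)
    show ?thesis unfolding eq by (rule top_greatest)
  next
    case False
    obtain a' where a: "a = ennreal a'" "0 \<le> a'" using False by (cases a) auto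
    obtain b' where b: "b = ennreal b'" "0 \<le> b'" using False by (cases b) auto
    have "0 \<le> (a' * v' - b' * u')\<^sup>2 / (u' * v')" using u v by simp
    also have "\<dots> = a'\<^sup>2 * inverse u' * v' + u' * (b'\<^sup>2 * inverse v') - 2 * (a' * b')"
      using u v by (simp add: power2_eq_square field_simps)
    finally have "2 * (a' * b') \<le> a'\<^sup>2 * inverse u' * v' + u' * (b'\<^sup>2 * inverse v')" by simp
    then have "ennreal (2 * (a' * b')) \<le> ennreal (a'\<^sup>2 * inverse u' * v' + u' * (b'\<^sup>2 * inverse v'))" by (rule ennreal_leI)
    moreover have "ennreal (2 * (a' * b')) = 2 * (a * b)" using a b by (simp add: ennreal_mult)
    moreover have "ennreal (a'\<^sup>2 * inverse u' * v' + u' * (b'\<^sup>2 * inverse v')) = a\<^sup>2 * inverse u * v + u * (b\<^sup>2 * inverse v)"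
      using a b u v by (simp add: ennreal_mult ennreal_power inverse_ennreal)
    ultimately show ?thesis by simp
  qed
qed

lemma ext0_add: "ext0 (\<lambda>y. f y + g y) z = ext0 f z + ext0 g z"
  by (cases z) simp_all

lemma ext0_cmult: "ext0 (\<lambda>y. c * f y) z = c * ext0 f z"
  by (cases z) simp_all

lemma ext0_SUP: "ext0 (\<lambda>y. SUP i. f i y) z = (SUP i. ext0 (f i) z)"
  by (cases z) simp_all

lemma sigma_finite_completion:
  assumes "sigma_finite_measure M"
  shows "sigma_finite_measure (completion M)"
proof
  obtain A :: "nat \<Rightarrow> 'a set" where A: "range A \<subseteq> sets M" "(\<Union>i. A i) = space M" "\<And>i. emeasure M (A i) \<noteq> \<infinity>"
    using sigma_finite_measure.sigma_finite[OF assms] by metis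
  show "\<exists>A. countable A \<and> A \<subseteq> sets (completion M) \<and> \<Union> A = space (completion M) \<and> (\<forall>a\<in>A. emeasure (completion M) a \<noteq> \<infinity>)"
    using A by (intro exI[of _ "range A"]) auto
qed

section \<open>Feynman-Kac operators and their Borel versions\<close>

locale perturbed_process = lusin_symmetric_process P X \<theta> m emb
  for P :: "'a::t2_space option \<Rightarrow> 'w measure"
    and X :: "ennreal \<Rightarrow> 'w \<Rightarrow> 'a option"
    and \<theta> :: "ennreal \<Rightarrow> 'w \<Rightarrow> 'w"
    and m :: "'a measure"
    and emb :: "'a \<Rightarrow> nat \<Rightarrow> real" +
  fixes Bp Bm :: "ennreal \<Rightarrow> 'w \<Rightarrow> ennreal" and F :: "'a \<Rightarrow> 'a \<Rightarrow> real"
  assumes Bp: "pcaf_strict P X \<theta> Bp" and Bm: "pcaf_strict P X \<theta> Bm" and F: "bounded_symmetric_off_diagonal F"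
begin

definition Z :: "real \<Rightarrow> 'w \<Rightarrow> ennreal" where
  "Z t \<omega> = enn_exp (additive_functional X Bp (F_plus F) (ennreal t) \<omega>) / enn_exp (additive_functional X Bm (F_minus F) (ennreal t) \<omega>)"

definition K :: "real \<Rightarrow> ('a \<Rightarrow> ennreal) \<Rightarrow> 'a \<Rightarrow> ennreal" where
  "K = feynman_kac (\<lambda>x. P (Some x)) X (additive_functional X Bp (F_plus F)) (additive_functional X Bm (F_minus F))"

lemma additive_functional_reversible:
  assumes "0 < t"
  shows "reversible t (additive_functional X Bp (F_plus F) (ennreal t)) (additive_functional X Bp (F_plus F) (ennreal t))"
    and "reversible t (additive_functional X Bm (F_minus F) (ennreal t)) (additive_functional X Bm (F_minus F) (ennreal t))"
proof -
  have Fm[measurable]: "(\<lambda>(x, y). if x = y then 0 else F x y) \<in> borel_measurable (borel \<Otimes>\<^sub>M borel)"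
    and sym: "\<And>x y. x \<noteq> y \<Longrightarrow> F x y = F y x"
    using F by (auto simp: bounded_symmetric_off_diagonal_def)
  have "(\<lambda>p. ennreal (max ((\<lambda>(x, y). if x = y then 0 else F x y) p) 0)) \<in> borel_measurable (borel \<Otimes>\<^sub>M borel)" by measurable
  moreover have "(\<lambda>p. ennreal (max ((\<lambda>(x, y). if x = y then 0 else F x y) p) 0)) = (\<lambda>(x, y). if x = y then 0 else ennreal (F_plus F x y))"
    by (auto simp: F_plus_def)
  ultimately have mp: "(\<lambda>(x, y). if x = y then 0 else ennreal (F_plus F x y)) \<in> borel_measurable (borel \<Otimes>\<^sub>M borel)" by (simp only:)
  have "(\<lambda>p. ennreal (- min ((\<lambda>(x, y). if x = y then 0 else F x y) p) 0)) \<in> borel_measurable (borel \<Otimes>\<^sub>M borel)" by measurable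
  moreover have "(\<lambda>p. ennreal (- min ((\<lambda>(x, y). if x = y then 0 else F x y) p) 0)) = (\<lambda>(x, y). if x = y then 0 else ennreal (F_minus F x y))"
    by (auto simp: F_minus_def)
  ultimately have mm: "(\<lambda>(x, y). if x = y then 0 else ennreal (F_minus F x y)) \<in> borel_measurable (borel \<Otimes>\<^sub>M borel)" by (simp only:)
  have "reversible t (jump_sum X (\<lambda>x y. ennreal (F_plus F x y)) (ennreal t)) (jump_sum X (\<lambda>x y. ennreal (F_plus F x y)) (ennreal t))"
    by (rule jump_sum_reversible[OF assms mp]) (simp add: F_plus_def sym)
  from reversible_add[OF pcaf_reversible'[OF Bp assms] this]
  show "reversible t (additive_functional X Bp (F_plus F) (ennreal t)) (additive_functional X Bp (F_plus F) (ennreal t))"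
    by (simp add: additive_functional_def[abs_def])
  have "reversible t (jump_sum X (\<lambda>x y. ennreal (F_minus F x y)) (ennreal t)) (jump_sum X (\<lambda>x y. ennreal (F_minus F x y)) (ennreal t))"
    by (rule jump_sum_reversible[OF assms mm]) (simp add: F_minus_def sym)
  from reversible_add[OF pcaf_reversible'[OF Bm assms] this]
  show "reversible t (additive_functional X Bm (F_minus F) (ennreal t)) (additive_functional X Bm (F_minus F) (ennreal t))"
    by (simp add: additive_functional_def[abs_def])
qed

lemma Z_reversible: "0 < t \<Longrightarrow> reversible t (Z t) (Z t)"
  unfolding Z_def[abs_def]
  by (rule reversible_comp2[where G="\<lambda>a b. enn_exp a / enn_exp b"]) (auto intro: additive_functional_reversible)

text \<open>Z is tied to the augmented filtration; this is a Borel function of the dyadic path that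
  represents it along the path and, with the same value, along the reversed path.\<close>

definition \<zeta> :: "real \<Rightarrow> (real \<Rightarrow> 'a) \<Rightarrow> ennreal" where
  "\<zeta> t = (SOME \<psi>. \<psi> \<in> BP \<and> (AE \<omega> in PP. alive t \<omega> \<longrightarrow>
     Z t \<omega> = \<psi> (path t \<omega>) \<and> Z t \<omega> = \<psi> (reverse_path (path t \<omega>))))"

lemma \<zeta>:
  assumes "0 < t"
  shows "\<zeta> t \<in> BP"
    and "AE w in PP. alive t w \<longrightarrow> Z t w = \<zeta> t (path t w) \<and> Z t w = \<zeta> t (reverse_path (path t w))"
proof -
  have "\<exists>h. h \<in> BP \<and> (AE w in PP. alive t w \<longrightarrow>
     Z t w = h (path t w) \<and> Z t w = h (reverse_path (path t w)))"
    using Z_reversible[OF assms] unfolding reversible_def by blast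
  from someI_ex[OF this] show "\<zeta> t \<in> BP"
    and "AE w in PP. alive t w \<longrightarrow> Z t w = \<zeta> t (path t w) \<and> Z t w = \<zeta> t (reverse_path (path t w))"
    unfolding \<zeta>_def[symmetric] by (rule conjunct1, rule conjunct2)
qed

text \<open>A version of \<open>K\<close> with a Borel weight under the uncompleted laws. Linearity
  and monotone convergence hold at every point; null sets enter where \<zeta> has to be identified
  with Z.\<close>

definition K0 :: "real \<Rightarrow> ('a \<Rightarrow> ennreal) \<Rightarrow> 'a \<Rightarrow> ennreal" where
  "K0 t f x = EE (\<lambda>\<omega>. ext0 f (XX t \<omega>) * \<zeta> t (path t \<omega>)) x"

lemma integrand_measurable:
  assumes "0 < t" and [measurable]: "f \<in> Borel"
  shows "(\<lambda>w. ext0 f (XX t w) * \<zeta> t (path t w)) \<in> BF"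
proof -
  note [measurable] = \<zeta>(1)[OF assms(1)]
  show ?thesis by measurable
qed

lemma integrand_measurable_P:
  assumes "0 < t" "f \<in> Borel"
  shows "(\<lambda>w. ext0 f (XX t w) * \<zeta> t (path t w)) \<in> borel_measurable (P z)"
  using integrand_measurable[OF assms] by (simp add: measurable_cong_sets[OF sets_P refl])

lemma K0_measurable[measurable (raw)]:
  "0 < t \<Longrightarrow> f \<in> Borel \<Longrightarrow> K0 t f \<in> Borel"
  unfolding K0_def[abs_def] by (intro nn_integral_kernel_measurable integrand_measurable)

lemma K0_add:
  assumes "0 < t" "f \<in> Borel" "g \<in> Borel"
  shows "K0 t (\<lambda>y. f y + g y) x = K0 t f x + K0 t g x"
  unfolding K0_def ext0_add distrib_right by (intro nn_integral_add integrand_measurable_P assms)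

lemma K0_cmult:
  assumes "0 < t" "f \<in> Borel"
  shows "K0 t (\<lambda>y. c * f y) x = c * K0 t f x"
  unfolding K0_def ext0_cmult mult.assoc by (intro nn_integral_cmult integrand_measurable_P assms)

lemma K0_SUP:
  assumes "0 < t" "\<And>i::nat. f i \<in> Borel" "incseq f"
  shows "K0 t (\<lambda>y. SUP i. f i y) x = (SUP i. K0 t (f i) x)"
  unfolding K0_def ext0_SUP SUP_mult_right_ennreal
proof (intro nn_integral_monotone_convergence_SUP integrand_measurable_P assms)
  have "ext0 (f i) z \<le> ext0 (f j) z" if "i \<le> j" for i j z
    using incseqD[OF assms(3) that] by (cases z) (auto simp: le_fun_def)
  then show "incseq (\<lambda>i w. ext0 (f i) (XX t w) * \<zeta> t (path t w))"
    by (auto simp: incseq_def le_fun_def intro: mult_right_mono)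
qed

text \<open>\<open>reversal\<close> produces the weight along the reversed path, and almost surely
  \<zeta> has the same value there while the path is alive; otherwise \<open>ext0 f\<close> is
  0.\<close>

lemma K0_symmetric:
  assumes t: "0 < t" and [measurable]: "f \<in> Borel" "g \<in> Borel"
  shows "(\<integral>\<^sup>+x. f x * K0 t g x \<partial>m) = (\<integral>\<^sup>+x. K0 t f x * g x \<partial>m)"
proof -
  have "(\<integral>\<^sup>+x. f x * K0 t g x \<partial>m) = (\<integral>\<^sup>+x. g x * EE (\<lambda>w. ext0 f (XX t w) * \<zeta> t (reverse_path (path t w))) x \<partial>m)"
    unfolding K0_def by (rule reversal[OF t assms(2,3) \<zeta>(1)[OF t]])
  also have "\<dots> = (\<integral>\<^sup>+x. K0 t f x * g x \<partial>m)"
  proof (rule nn_integral_cong_AE)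
    show "AE x in m. g x * EE (\<lambda>w. ext0 f (XX t w) * \<zeta> t (reverse_path (path t w))) x = K0 t f x * g x"
      using AE_PP_D[OF \<zeta>(2)[OF t]]
    proof eventually_elim
      case (elim x)
      have "EE (\<lambda>w. ext0 f (XX t w) * \<zeta> t (reverse_path (path t w))) x = K0 t f x"
        unfolding K0_def
      proof (rule nn_integral_cong_AE)
        show "AE w in P (Some x). ext0 f (XX t w) * \<zeta> t (reverse_path (path t w)) = ext0 f (XX t w) * \<zeta> t (path t w)"
          using elim
        proof eventually_elim
          case (elim w)
          then show ?case by (cases "XX t w") auto
        qed
      qed
      then show ?case by (simp add: mult.commute)
    qed
  qed
  finally show ?thesis .
qed

lemma Z_multiplicative:
  assumes s: "0 \<le> s" and t: "0 \<le> t"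
  shows "AE w in P (Some x). Z (s + t) w = Z s w * Z t (\<theta> (ennreal s) w)"
  using pcaf_additive[OF Bp, of x] pcaf_additive[OF Bm, of x]
proof eventually_elim
  case (elim w)
  have "Bp (ennreal (s + t)) w = Bp (ennreal s) w + Bp (ennreal t) (\<theta> (ennreal s) w)"
    "Bm (ennreal (s + t)) w = Bm (ennreal s) w + Bm (ennreal t) (\<theta> (ennreal s) w)"
    using elim s t by (simp_all add: ennreal_plus)
  then have "additive_functional X Bp (F_plus F) (ennreal (s + t)) w = additive_functional X Bp (F_plus F) (ennreal s) w + additive_functional X Bp (F_plus F) (ennreal t) (\<theta> (ennreal s) w)"
    "additive_functional X Bm (F_minus F) (ennreal (s + t)) w = additive_functional X Bm (F_minus F) (ennreal s) w + additive_functional X Bm (F_minus F) (ennreal t) (\<theta> (ennreal s) w)"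
    unfolding additive_functional_def jump_sum_shift[OF s t] by (simp_all add: ac_simps)
  then show ?case unfolding Z_def by (simp only: enn_exp_quotient_add)
qed

text \<open>Multiplicativity is known for Z, so \<zeta> is exchanged for Z three times: on [0,s], on
  the path after s, and on [0,s+t]. The exchange on the shifted path rests on
  \<open>AE_PP_shift\<close>.\<close>

lemma K0_semigroup:
  assumes s: "0 < s" and t: "0 < t" and f: "f \<in> Borel"
  shows "AE x in m. K0 s (K0 t f) x = K0 (s + t) f x"
proof -
  define G where "G w = ext0 f (XX t w) * \<zeta> t (path t w)" for w
  define V where "V w = \<zeta> s (path s w)" for w
  have G: "G \<in> BF" unfolding G_def[abs_def] by (rule integrand_measurable[OF t f])
  have V: "V \<in> borel_measurable (\<F> (ennreal s))"
    unfolding V_def[abs_def] using s by (intro measurable_compose[OF path_measurable_\<F> \<zeta>(1)]) auto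
  have inner: "ext0 (K0 t f) (XX s w) = (\<integral>\<^sup>+w'. G w' \<partial>P (XX s w))" for w
  proof (cases "XX s w")
    case None
    have "(\<integral>\<^sup>+w'. G w' \<partial>P None) = (\<integral>\<^sup>+w'. 0 \<partial>P None)"
      by (rule nn_integral_cong_AE) (use P_None[of "ennreal t"] in \<open>eventually_elim, simp add: G_def\<close>)
    then show ?thesis using None by simp
  next
    case (Some y)
    then show ?thesis by (simp add: K0_def G_def)
  qed
  have outer: "K0 s (K0 t f) x = EE (\<lambda>w. V w * G (\<theta> (ennreal s) w)) x" for x
  proof -
    have "K0 s (K0 t f) x = (\<integral>\<^sup>+w. V w * (\<integral>\<^sup>+w'. G w' \<partial>P (XX s w)) \<partial>P (Some x))"
      unfolding K0_def[of s] inner V_def by (simp only: mult.commute)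
    also have "\<dots> = EE (\<lambda>w. V w * G (\<theta> (ennreal s) w)) x"
      by (rule Markov[symmetric, OF _ V G]) simp
    finally show ?thesis .
  qed
  have st: "0 < s + t" using s t by simp
  have X: "XX t (\<theta> (ennreal s) w) = XX (s + t) w" for w
    using s t by (simp add: X_shift ennreal_plus)
  have al: "alive s w" if "alive (s + t) w" for w
    using alive_mono[OF _ that, of "ennreal s"] t by (simp add: ennreal_leI)
  have "AE x in m. AE w in P (Some x). alive s w \<longrightarrow> (XX t (\<theta> (ennreal s) w) \<noteq> None \<longrightarrow>
      Z t (\<theta> (ennreal s) w) = \<zeta> t (path t (\<theta> (ennreal s) w)) \<and> Z t (\<theta> (ennreal s) w) = \<zeta> t (reverse_path (path t (\<theta> (ennreal s) w))))"
    using AE_PP_D[OF AE_PP_shift[OF \<zeta>(2)[OF t], of s]] s by simp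
  then show ?thesis
    using AE_PP_D[OF \<zeta>(2)[OF s]] AE_PP_D[OF \<zeta>(2)[OF st]]
  proof eventually_elim
    case (elim x)
    show ?case
      unfolding outer unfolding K0_def
    proof (rule nn_integral_cong_AE)
      show "AE w in P (Some x). V w * G (\<theta> (ennreal s) w) = ext0 f (XX (s + t) w) * \<zeta> (s + t) (path (s + t) w)"
        using elim(1) elim(2) elim(3) Z_multiplicative[OF less_imp_le[OF s] less_imp_le[OF t], of x]
      proof eventually_elim
        case (elim w)
        show ?case
        proof (cases "XX (s + t) w = None")
          case True
          then show ?thesis by (simp add: G_def X)
        next
          case False
          then have "\<zeta> t (path t (\<theta> (ennreal s) w)) = Z t (\<theta> (ennreal s) w)" "\<zeta> s (path s w) = Z s w" "\<zeta> (s + t) (path (s + t) w) = Z (s + t) w"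
            using elim(1-3) al[OF False] by (simp_all add: X)
          then show ?thesis using elim(4) by (simp add: V_def G_def X mult_ac)
        qed
      qed
    qed
  qed
qed

text \<open>Schur's test with the superharmonic function \<open>h\<close>.\<close>

lemma K0_contraction:
  assumes t: "0 < t" and [measurable]: "h \<in> Borel" and h: "\<And>x. 0 < h x" "\<And>x. h x < \<top>"
    and super: "AE x in m. K0 t h x \<le> h x" and [measurable]: "f \<in> Borel" "g \<in> Borel"
  shows "2 * (\<integral>\<^sup>+x. f x * K0 t g x \<partial>m) \<le> (\<integral>\<^sup>+x. (f x)\<^sup>2 \<partial>m) + (\<integral>\<^sup>+x. (g x)\<^sup>2 \<partial>m)"
proof -
  \<comment> \<open>Chosen so that h q = g^2; once K0 is moved over to h, the second term of the
    estimate is bounded by the squared norm of g.\<close>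
  define q where "q y = (g y)\<^sup>2 * inverse (h y)" for y
  have [measurable]: "q \<in> Borel" unfolding q_def[abs_def] by measurable
  note [measurable] = K0_measurable[OF t]
  have hinv: "inverse (h x) * h x = 1" for x
    using h[of x] ennreal_divide_self[of "h x"] by (simp add: divide_ennreal_def mult.commute)
  \<comment> \<open>Young's inequality for f x and g y, with the weights h x and h y at the two ends
    of the path.\<close>
  have pt: "2 * (f x * K0 t g x) \<le> (f x)\<^sup>2 * inverse (h x) * K0 t h x + h x * K0 t q x" for x
  proof -
    have "2 * (f x * K0 t g x) = K0 t (\<lambda>y. (2 * f x) * g y) x" using K0_cmult[OF t, of g "2 * f x" x] by (simp add: mult_ac)
    also have "\<dots> \<le> K0 t (\<lambda>y. (f x)\<^sup>2 * inverse (h x) * h y + h x * q y) x"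
      unfolding K0_def
    proof (intro nn_integral_mono mult_right_mono)
      fix w
      have "2 * f x * g y \<le> (f x)\<^sup>2 * inverse (h x) * h y + h x * q y" for y
        using young_ennreal[OF h h, of "f x" "g y" x y] by (simp add: q_def mult_ac)
      then show "ext0 (\<lambda>y. 2 * f x * g y) (XX t w) \<le> ext0 (\<lambda>y. (f x)\<^sup>2 * inverse (h x) * h y + h x * q y) (XX t w)"
        by (cases "XX t w") simp_all
    qed simp
    also have "\<dots> = K0 t (\<lambda>y. (f x)\<^sup>2 * inverse (h x) * h y) x + K0 t (\<lambda>y. h x * q y) x"
      by (intro K0_add t) measurable
    also have "\<dots> = (f x)\<^sup>2 * inverse (h x) * K0 t h x + h x * K0 t q x"
      by (simp add: K0_cmult[OF t])
    finally show ?thesis .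
  qed
  have "2 * (\<integral>\<^sup>+x. f x * K0 t g x \<partial>m) = (\<integral>\<^sup>+x. 2 * (f x * K0 t g x) \<partial>m)"
    by (rule nn_integral_cmult[symmetric]) measurable
  also have "\<dots> \<le> (\<integral>\<^sup>+x. (f x)\<^sup>2 * inverse (h x) * K0 t h x + h x * K0 t q x \<partial>m)" by (intro nn_integral_mono pt)
  also have "\<dots> = (\<integral>\<^sup>+x. (f x)\<^sup>2 * inverse (h x) * K0 t h x \<partial>m) + (\<integral>\<^sup>+x. h x * K0 t q x \<partial>m)"
    by (rule nn_integral_add) measurable
  also have "(\<integral>\<^sup>+x. h x * K0 t q x \<partial>m) = (\<integral>\<^sup>+x. K0 t h x * q x \<partial>m)" by (rule K0_symmetric[OF t]) measurable
  also have "(\<integral>\<^sup>+x. (f x)\<^sup>2 * inverse (h x) * K0 t h x \<partial>m) \<le> (\<integral>\<^sup>+x. (f x)\<^sup>2 \<partial>m)"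
  proof (rule nn_integral_mono_AE)
    show "AE x in m. (f x)\<^sup>2 * inverse (h x) * K0 t h x \<le> (f x)\<^sup>2"
      using super
    proof eventually_elim
      case (elim x)
      have "(f x)\<^sup>2 * inverse (h x) * K0 t h x \<le> (f x)\<^sup>2 * inverse (h x) * h x" using elim by (intro mult_left_mono) auto
      also have "\<dots> = (f x)\<^sup>2" by (simp add: mult.assoc hinv)
      finally show ?case .
    qed
  qed
  also have "(\<integral>\<^sup>+x. K0 t h x * q x \<partial>m) \<le> (\<integral>\<^sup>+x. (g x)\<^sup>2 \<partial>m)"
  proof (rule nn_integral_mono_AE)
    show "AE x in m. K0 t h x * q x \<le> (g x)\<^sup>2"
      using super
    proof eventually_elim
      case (elim x)
      have "K0 t h x * q x \<le> h x * q x" using elim by (intro mult_right_mono) auto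
      also have "\<dots> = (g x)\<^sup>2 * (inverse (h x) * h x)" by (simp add: q_def mult_ac)
      also have "\<dots> = (g x)\<^sup>2" by (simp add: hinv)
      finally show ?case .
    qed
  qed
  finally show ?thesis by (simp add: add_mono)
qed

lemma Borel_version:
  assumes "f \<in> borel_measurable (completion m)"
  shows "\<exists>f0\<in>Borel. AE x in m. f x = (f0 x :: ennreal)"
  using completion_ex_borel_measurable[OF assms] by (simp add: measurable_cong_sets[OF sets_m refl])

text \<open>Two replacements are made: f by f0 at the position at time t, which by
  \<open>AE_PP_law\<close> avoids null sets, and the weight Z by \<zeta>.\<close>

lemma K_eq_K0:
  assumes t: "0 < t" and f0: "f0 \<in> Borel" and f: "AE x in m. f x = f0 x"
  shows "AE x in m. K t f x = K0 t f0 x"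
proof -
  have "AE w in PP. ext0 f (XX t w) * Z t w = ext0 f0 (XX t w) * \<zeta> t (path t w)"
    using AE_PP_law[OF f less_imp_le[OF t]] \<zeta>(2)[OF t]
  proof eventually_elim
    case (elim w)
    then show ?case by (cases "XX t w") auto
  qed
  from AE_PP_D[OF this] show ?thesis
  proof eventually_elim
    case (elim x)
    then show ?case
      unfolding K_def feynman_kac_def K0_def Z_def[symmetric] nn_integral_completion by (rule nn_integral_cong_AE)
  qed
qed

text \<open>Every law for \<open>K\<close> is carried over from \<open>K0\<close> along Borel
  versions of the arguments; the superharmonic h serves the contraction.\<close>

lemma K_symmetric_semigroup:
  assumes h: "h \<in> borel_measurable (completion m)" "AE x in m. 0 < h x \<and> h x < \<top>"
    and super: "\<And>t. 0 < t \<Longrightarrow> AE x in m. K t h x \<le> h x"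
  shows "symmetric_semigroup (completion m) K"
proof -
  have cm: "complete_measure (completion m)" ..
  have sf: "sigma_finite_measure (completion m)" using sigma_finite_m by (rule sigma_finite_completion)
  obtain h1 where h1[measurable]: "h1 \<in> Borel" and h1': "AE x in m. h x = h1 x"
    using Borel_version[OF h(1)] by blast
  \<comment> \<open>Schur's test wants a weight that is positive and finite everywhere; the value 1
    replaces h1 on a null set.\<close>
  define h0 where "h0 x = (if 0 < h1 x \<and> h1 x < \<top> then h1 x else 1)" for x
  have h0[measurable]: "h0 \<in> Borel" unfolding h0_def[abs_def] by measurable
  have h0pos: "0 < h0 x" "h0 x < \<top>" for x by (auto simp: h0_def)
  have hh0: "AE x in m. h x = h0 x" using h1' h(2) by eventually_elim (simp add: h0_def)
  have super0: "AE x in m. K0 t h0 x \<le> h0 x" if "0 < t" for t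
    using K_eq_K0[OF that h0 hh0] hh0 super[OF that] by eventually_elim simp
  have C: "(AE x in completion m. p x) \<longleftrightarrow> (AE x in m. p x)" for p by (rule AE_completion_iff)
  have Int: "(\<integral>\<^sup>+x. p x \<partial>completion m) = (\<integral>\<^sup>+x. p x \<partial>m)" for p by (rule nn_integral_completion)
  show ?thesis
  proof (intro symmetric_semigroup.intro symmetric_semigroup_axioms.intro cm sf)
    fix t :: real and f :: "'a \<Rightarrow> ennreal" assume t: "0 < t" and f: "f \<in> borel_measurable (completion m)"
    obtain f0 where f0[measurable]: "f0 \<in> Borel" and ff0: "AE x in m. f x = f0 x"
      using Borel_version[OF f] by blast
    note Kf = K_eq_K0[OF t f0 ff0]
    show "K t f \<in> borel_measurable (completion m)"
    proof (rule complete_measure.borel_measurable_AE_cong[OF cm])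
      have "K0 t f0 \<in> borel_measurable m" using K0_measurable[OF t f0] by (simp add: measurable_cong_sets[OF sets_m refl])
      then show "K0 t f0 \<in> borel_measurable (completion m)" by (rule measurable_completion)
      show "AE x in completion m. K0 t f0 x = K t f x" unfolding C using Kf by eventually_elim simp
    qed
    show "AE x in completion m. K t (\<lambda>y. c * f y) x = c * K t f x" for c
    proof -
      have "AE x in m. c * f x = c * f0 x" using ff0 by eventually_elim simp
      from K_eq_K0[OF t _ this] have "AE x in m. K t (\<lambda>y. c * f y) x = K0 t (\<lambda>y. c * f0 y) x" by measurable
      then show ?thesis unfolding C using Kf by eventually_elim (simp add: K0_cmult[OF t f0])
    qed
    show "AE x in completion m. K s (K t f) x = K (s + t) f x" if s: "0 < s" for s
    proof -
      have "AE x in m. K s (K t f) x = K0 s (K0 t f0) x" by (rule K_eq_K0[OF s K0_measurable[OF t f0] Kf])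
      moreover have "AE x in m. K (s + t) f x = K0 (s + t) f0 x" using s t by (intro K_eq_K0 f0 ff0) simp
      ultimately show ?thesis unfolding C using K0_semigroup[OF s t f0] by eventually_elim simp
    qed
    fix g :: "'a \<Rightarrow> ennreal" assume g: "g \<in> borel_measurable (completion m)"
    obtain g0 where g0[measurable]: "g0 \<in> Borel" and gg0: "AE x in m. g x = g0 x"
      using Borel_version[OF g] by blast
    note Kg = K_eq_K0[OF t g0 gg0]
    show "AE x in completion m. K t (\<lambda>y. f y + g y) x = K t f x + K t g x"
    proof -
      have "AE x in m. f x + g x = f0 x + g0 x" using ff0 gg0 by eventually_elim simp
      from K_eq_K0[OF t _ this] have "AE x in m. K t (\<lambda>y. f y + g y) x = K0 t (\<lambda>y. f0 y + g0 y) x" by measurable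
      then show ?thesis unfolding C using Kf Kg by eventually_elim (simp add: K0_add[OF t f0 g0])
    qed
    show "AE x in completion m. K t f x = K t g x" if "AE x in completion m. f x = g x"
    proof -
      have "AE x in m. f x = g0 x" using that[unfolded C] gg0 by eventually_elim simp
      from K_eq_K0[OF t g0 this] show ?thesis unfolding C using Kg by eventually_elim simp
    qed
    have fKg: "(\<integral>\<^sup>+x. f x * K t g x \<partial>m) = (\<integral>\<^sup>+x. f0 x * K0 t g0 x \<partial>m)"
      by (rule nn_integral_cong_AE) (use ff0 Kg in \<open>eventually_elim, simp\<close>)
    have "(\<integral>\<^sup>+x. K t f x * g x \<partial>m) = (\<integral>\<^sup>+x. K0 t f0 x * g0 x \<partial>m)"
      by (rule nn_integral_cong_AE) (use gg0 Kf in \<open>eventually_elim, simp\<close>)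
    then show "(\<integral>\<^sup>+x. f x * K t g x \<partial>completion m) = (\<integral>\<^sup>+x. K t f x * g x \<partial>completion m)"
      unfolding Int fKg using K0_symmetric[OF t f0 g0] by simp
    have "(\<integral>\<^sup>+x. (f x)\<^sup>2 \<partial>m) = (\<integral>\<^sup>+x. (f0 x)\<^sup>2 \<partial>m)" "(\<integral>\<^sup>+x. (g x)\<^sup>2 \<partial>m) = (\<integral>\<^sup>+x. (g0 x)\<^sup>2 \<partial>m)"
      by (rule nn_integral_cong_AE, use ff0 in \<open>eventually_elim, simp\<close>, rule nn_integral_cong_AE, use gg0 in \<open>eventually_elim, simp\<close>)
    then show "2 * (\<integral>\<^sup>+x. f x * K t g x \<partial>completion m) \<le> (\<integral>\<^sup>+x. (f x)\<^sup>2 \<partial>completion m) + (\<integral>\<^sup>+x. (g x)\<^sup>2 \<partial>completion m)"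
      unfolding Int fKg using K0_contraction[OF t h0 h0pos super0[OF t] f0 g0] by simp
  next
    fix t :: real and f :: "nat \<Rightarrow> 'a \<Rightarrow> ennreal"
    assume t: "0 < t" and f: "\<And>i. f i \<in> borel_measurable (completion m)" and inc: "incseq f"
    have "\<exists>f1. \<forall>i. f1 i \<in> Borel \<and> (AE x in m. f i x = f1 i x)"
      by (rule choice, rule allI) (use Borel_version[OF f] in blast)
    then obtain f1 where f1[measurable]: "\<And>i. f1 i \<in> Borel" and "\<And>i. AE x in m. f i x = f1 i x" by blast
    then have ff1: "AE x in m. \<forall>i. f i x = f1 i x" unfolding AE_all_countable by blast
    \<comment> \<open>The chosen versions increase only almost everywhere. Their running maxima
      increase everywhere and are still versions.\<close>
    define f0 where "f0 i x = (SUP j\<in>{..i}. f1 j x)" for i x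
    have f0[measurable]: "f0 i \<in> Borel" for i unfolding f0_def[abs_def] by measurable
    have inc0: "incseq f0" by (auto simp: incseq_def le_fun_def f0_def intro!: SUP_subset_mono)
    have ff0: "AE x in m. f i x = f0 i x" for i
      using ff1
    proof eventually_elim
      case (elim x)
      have "f0 i x = (SUP j\<in>{..i}. f j x)" using elim by (simp add: f0_def)
      also have "\<dots> = f i x"
        using inc by (intro antisym SUP_least SUP_upper) (auto simp: incseq_def le_fun_def)
      finally show ?case by simp
    qed
    then have "AE x in m. \<forall>i. f i x = f0 i x" unfolding AE_all_countable by blast
    then have "AE x in m. (SUP i. f i x) = (SUP i. f0 i x)" by eventually_elim simp
    from K_eq_K0[OF t _ this] have 1: "AE x in m. K t (\<lambda>y. SUP i. f i y) x = K0 t (\<lambda>y. SUP i. f0 i y) x" by measurable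
    have "AE x in m. \<forall>i. K t (f i) x = K0 t (f0 i) x"
      unfolding AE_all_countable using K_eq_K0[OF t f0 ff0] by blast
    with 1 show "AE x in completion m. K t (\<lambda>y. SUP i. f i y) x = (SUP i. K t (f i) x)"
      unfolding C by eventually_elim (simp add: K0_SUP[OF t f0 inc0])
  qed
qed

end

section \<open>Exceptional sets and quasi-continuous functions\<close>

text \<open>A strictly positive u in L2 is a limit of form functions, and these are limits of
  functions vanishing off some K k. So the integral of u^2 over the common complement of the K k is
  zero.\<close>

lemma exceptional_AE:
  assumes sf: "sigma_finite_measure M" and D: "dirichlet_form M \<E> D" and borel: "sets borel \<subseteq> sets M"
    and S: "exceptional M \<E> D S"
  shows "AE x in M. x \<notin> S"
proof -
  obtain K where K: "nest M \<E> D K" "S \<subseteq> (\<Inter>k. - K k)" using S by (auto simp: exceptional_def)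
  define N where "N = (\<Inter>k. - K k) \<inter> space M"
  have DL2: "D \<subseteq> L2 M" and lin: "\<And>u v a b. u \<in> D \<Longrightarrow> v \<in> D \<Longrightarrow> (\<lambda>x. a * u x + b * v x) \<in> D"
    and pos: "\<And>u. u \<in> D \<Longrightarrow> 0 \<le> \<E> u u"
    and dense: "\<And>u e. u \<in> L2 M \<Longrightarrow> 0 < e \<Longrightarrow> \<exists>v\<in>D. (\<integral>x. (u x - v x)\<^sup>2 \<partial>M) < e"
    using D unfolding dirichlet_form_def by blast+
  have K_closed: "closed (K k)" for k using K(1) by (simp add: nest_def)
  have Kk: "- K k \<inter> space M \<in> sets M" for k
  proof -
    have "- K k \<in> sets borel" using K_closed[of k] by (simp add: borel_open open_Compl)
    then show ?thesis using borel by blast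
  qed
  have N[measurable]: "N \<in> sets M"
  proof -
    have "(\<Inter>k. - K k \<inter> space M) \<in> sets M" using Kk by (intro sets.countable_INT') auto
    moreover have "(\<Inter>k. - K k \<inter> space M) = N" by (auto simp: N_def)
    ultimately show ?thesis by simp
  qed
  obtain u :: "'a \<Rightarrow> real" where [measurable]: "u \<in> borel_measurable M" and u: "\<And>x. 0 < u x" "\<And>x. u x \<le> 1" and iu: "integrable M u"
    using sigma_finite_measure.obtain_positive_integrable_function[OF sf] by metis
  have "u \<in> L2 M"
  proof -
    have "integrable M (\<lambda>x. (u x)\<^sup>2)"
    proof (rule Bochner_Integration.integrable_bound[OF iu])
      have "\<bar>u x ^ 2\<bar> \<le> \<bar>u x\<bar>" for x using u[of x] by (simp add: power2_eq_square mult_left_le)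
      then show "AE x in M. norm ((u x)\<^sup>2) \<le> norm (u x)" by simp
    qed simp
    then show ?thesis by (simp add: L2_def)
  qed
  \<comment> \<open>On N the function w vanishes, so u = (u - v) + (v - w) there. Squaring costs a
    factor 2 and each of the two squared errors is below e, whence 4 e.\<close>
  have small: "(\<integral>\<^sup>+x. ennreal ((u x)\<^sup>2) * indicator N x \<partial>M) \<le> ennreal (4 * e)" if e: "0 < e" for e
  proof -
    obtain v where v: "v \<in> D" "(\<integral>x. (u x - v x)\<^sup>2 \<partial>M) < e" using dense[OF \<open>u \<in> L2 M\<close> e] by blast
    obtain k w where w: "w \<in> D" "AE x in M. x \<notin> K k \<longrightarrow> w x = 0" "form1 M \<E> (\<lambda>x. v x - w x) (\<lambda>x. v x - w x) < e"
      using K(1) v(1) e unfolding nest_def by blast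
    have L2: "f \<in> borel_measurable M" "integrable M (\<lambda>x. (f x)\<^sup>2)" if "f \<in> L2 M" for f using that by (auto simp: L2_def)
    have diff: "integrable M (\<lambda>x. (f x - g x)\<^sup>2)" if f: "f \<in> L2 M" and g: "g \<in> L2 M" for f g
    proof (rule Bochner_Integration.integrable_bound)
      show "integrable M (\<lambda>x. 2 * (f x)\<^sup>2 + 2 * (g x)\<^sup>2)" using L2(2)[OF f] L2(2)[OF g] by simp
      show "(\<lambda>x. (f x - g x)\<^sup>2) \<in> borel_measurable M" using L2(1)[OF f] L2(1)[OF g] by simp
      have "(f x - g x)\<^sup>2 \<le> 2 * (f x)\<^sup>2 + 2 * (g x)\<^sup>2" for x
        using zero_le_power2[of "f x + g x"] by (simp add: power2_eq_square algebra_simps)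
      then show "AE x in M. norm ((f x - g x)\<^sup>2) \<le> norm (2 * (f x)\<^sup>2 + 2 * (g x)\<^sup>2)" by simp
    qed
    have vw: "(\<lambda>x. v x - w x) \<in> D" using lin[OF v(1) w(1), of 1 "-1"] by simp
    have "(\<integral>x. (v x - w x)\<^sup>2 \<partial>M) \<le> form1 M \<E> (\<lambda>x. v x - w x) (\<lambda>x. v x - w x)"
      using pos[OF vw] by (simp add: form1_def power2_eq_square)
    then have vw': "(\<integral>x. (v x - w x)\<^sup>2 \<partial>M) < e" using w(3) by simp
    have vL: "v \<in> L2 M" "w \<in> L2 M" using DL2 v(1) w(1) by auto
    note i1 = diff[OF \<open>u \<in> L2 M\<close> vL(1)] and i2 = diff[OF vL]
    have "(\<integral>\<^sup>+x. ennreal ((u x)\<^sup>2) * indicator N x \<partial>M) \<le> (\<integral>\<^sup>+x. ennreal (2 * (u x - v x)\<^sup>2 + 2 * (v x - w x)\<^sup>2) \<partial>M)"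
    proof (rule nn_integral_mono_AE)
      show "AE x in M. ennreal ((u x)\<^sup>2) * indicator N x \<le> ennreal (2 * (u x - v x)\<^sup>2 + 2 * (v x - w x)\<^sup>2)"
        using w(2)
      proof eventually_elim
        case (elim x)
        show ?case
        proof (cases "x \<in> N")
          case True
          then have "w x = 0" using elim by (simp add: N_def)
          then have "(u x)\<^sup>2 \<le> 2 * (u x - v x)\<^sup>2 + 2 * (v x - w x)\<^sup>2"
            using zero_le_power2[of "u x - 2 * v x"] by (simp add: power2_eq_square algebra_simps)
          then have "ennreal ((u x)\<^sup>2) \<le> ennreal (2 * (u x - v x)\<^sup>2 + 2 * (v x - w x)\<^sup>2)" by (rule ennreal_leI)
          then show ?thesis using True by (simp only: indicator_simps mult_1_right)
        qed simp
      qed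
    qed
    also have "\<dots> = ennreal (\<integral>x. 2 * (u x - v x)\<^sup>2 + 2 * (v x - w x)\<^sup>2 \<partial>M)"
      using i1 i2 by (intro nn_integral_eq_integral) auto
    also have "(\<integral>x. 2 * (u x - v x)\<^sup>2 + 2 * (v x - w x)\<^sup>2 \<partial>M) = 2 * (\<integral>x. (u x - v x)\<^sup>2 \<partial>M) + 2 * (\<integral>x. (v x - w x)\<^sup>2 \<partial>M)"
      using i1 i2 by simp
    also have "ennreal \<dots> \<le> ennreal (4 * e)" using v(2) vw' by (intro ennreal_leI) simp
    finally show ?thesis .
  qed
  have "(\<integral>\<^sup>+x. ennreal ((u x)\<^sup>2) * indicator N x \<partial>M) \<le> 0"
  proof (rule ennreal_le_epsilon)
    fix e :: real assume "0 < e"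
    then show "(\<integral>\<^sup>+x. ennreal ((u x)\<^sup>2) * indicator N x \<partial>M) \<le> 0 + ennreal e" using small[of "e / 4"] by simp
  qed
  then have "(\<integral>\<^sup>+x. ennreal ((u x)\<^sup>2) * indicator N x \<partial>M) = 0" by simp
  then have "AE x in M. ennreal ((u x)\<^sup>2) * indicator N x = 0"
    by (subst (asm) nn_integral_0_iff_AE) auto
  then have "AE x in M. x \<notin> N"
  proof eventually_elim
    case (elim x)
    then show ?case using u(1)[of x] by (auto simp: indicator_def split: if_splits)
  qed
  moreover have "AE x in M. x \<in> space M" by (rule AE_space)
  ultimately show ?thesis by eventually_elim (use K(2) in \<open>auto simp: N_def\<close>)
qed

text \<open>On each closed set of the nest the function is continuous; the part of a preimage
  outside all of them lies in a null set and is measurable by completeness.\<close>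

lemma quasi_continuous_measurable:
  assumes c: "complete_measure M" and sf: "sigma_finite_measure M" and D: "dirichlet_form M \<E> D"
    and borel: "sets borel \<subseteq> sets M" and h: "quasi_continuous M \<E> D h"
  shows "h \<in> borel_measurable M"
proof -
  interpret complete_measure M by fact
  obtain K where K: "nest M \<E> D K" "\<And>k. continuous_on (K k) h" using h by (auto simp: quasi_continuous_def)
  have "UNIV \<in> sets (borel :: 'a measure)" using sets.top[of borel] by simp
  then have "UNIV \<in> sets M" using borel by blast
  then have sp: "space M = UNIV" using sets.sets_into_space by blast
  have "AE x in M. x \<notin> (\<Inter>k. - K k)"
    using K(1) by (intro exceptional_AE[OF sf D borel]) (auto simp: exceptional_def)
  then obtain N where "N \<in> null_sets M" "{x \<in> space M. \<not> x \<notin> (\<Inter>k. - K k)} \<subseteq> N"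
    unfolding eventually_ae_filter by blast
  then have N: "N \<in> null_sets M" "(\<Inter>k. - K k) \<subseteq> N" using sp by auto
  show ?thesis
  proof (rule measurableI)
    fix A :: "'b set" assume A: "A \<in> sets borel"
    have "h -` A \<inter> K k \<in> sets M" for k
    proof -
      have Kb: "K k \<in> sets borel" using K(1) by (simp add: nest_def borel_closed)
      have "h \<in> borel_measurable (restrict_space borel (K k))"
        using K(2) by (rule borel_measurable_continuous_on_restrict)
      from measurable_sets[OF this A] have "h -` A \<inter> K k \<in> sets (restrict_space borel (K k))" by (simp add: space_restrict_space)
      then have "h -` A \<inter> K k \<in> sets borel" using Kb by (auto simp: sets_restrict_space)
      then show ?thesis using borel by blast
    qed
    then have "(\<Union>k. h -` A \<inter> K k) \<in> sets M" by blast
    moreover have "h -` A \<inter> (\<Inter>k. - K k) \<in> sets M" using N by (intro complete[of _ N]) auto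
    moreover have "h -` A \<inter> space M = (\<Union>k. h -` A \<inter> K k) \<union> h -` A \<inter> (\<Inter>k. - K k)" by (auto simp: sp)
    ultimately show "h -` A \<inter> space M \<in> sets M" by (metis sets.Un)
  qed simp
qed

theorem proposition3p5:
  fixes m :: "'a::t2_space measure"
    and P :: "'a option \<Rightarrow> 'w measure"
    and X :: "ennreal \<Rightarrow> 'w \<Rightarrow> 'a option"
    and \<theta> :: "ennreal \<Rightarrow> 'w \<Rightarrow> 'w"
    and \<E> \<E>A :: "'a form"
    and D DA :: "('a \<Rightarrow> real) set"
    and N :: "'a \<Rightarrow> 'a measure"
    and H A\<mu>p A\<mu>m Ap Am :: "ennreal \<Rightarrow> 'w \<Rightarrow> ennreal"
    and \<mu>p \<mu>m \<mu>H \<rho>p \<rho>m :: "'a measure"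
    and F :: "'a \<Rightarrow> 'a \<Rightarrow> real"
    and Q :: "'a \<Rightarrow> 'w measure"
    and PA :: "real \<Rightarrow> ('a \<Rightarrow> ennreal) \<Rightarrow> 'a \<Rightarrow> ennreal"
    and Hplus :: "('a \<Rightarrow> ennreal) set"
  assumes "lusin_space (euclidean :: 'a topology)"
    and "sets m = sets borel" "sigma_finite_measure m" "full_support m"
    and "right_process P X \<theta>"
    and Q: "Q = (\<lambda>x. P (Some x))"
    and "symmetric_process m Q X"
    and "dirichlet_form (completion m) \<E> D" "quasi_regular (completion m) \<E> D"
    and "associated m Q X \<E> D"
    and "irreducible_semigroup (completion m) (real_op (process_semigroup Q X))"
    and "transient_form (completion m) \<E> D"
    and "strong_feller Q X"
    and "levy_system P X \<theta> N H" "revuz m Q X H \<mu>H"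
    and "signed_smooth (completion m) \<E> D \<mu>p \<mu>m"
    and "pcaf_strict P X \<theta> A\<mu>p" "revuz m Q X A\<mu>p \<mu>p"
    and "pcaf_strict P X \<theta> A\<mu>m" "revuz m Q X A\<mu>m \<mu>m"
    and "bounded_symmetric_off_diagonal F"
    and Ap: "Ap = additive_functional X A\<mu>p (F_plus F)"
    and Am: "Am = additive_functional X A\<mu>m (F_minus F)"
    and \<rho>p: "\<rho>p = rho \<mu>p N \<mu>H (G_plus F)"
    and \<rho>m: "\<rho>m = rho \<mu>m N \<mu>H (G_minus F)"
    and "dynkin_class m Q X \<rho>m"
    and "extended_kato_class m (killed_law Q) (killed_path X Am) \<rho>p"
    and PA: "PA = feynman_kac Q X Ap Am"
    and \<E>A: "\<E>A = semigroup_form (completion m) (real_op PA)"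
    and DA: "DA = semigroup_dom (completion m) (real_op PA)"
    and Hplus: "Hplus = superharmonic (completion m) \<E> D PA"
  shows "((\<exists>h\<in>Hplus. recurrent_form (h_measure (completion m) h) (h_form \<E>A h) (h_dom DA h))
            \<longrightarrow> (\<forall>h\<in>Hplus. recurrent_form (h_measure (completion m) h) (h_form \<E>A h) (h_dom DA h)))
       \<and> ((\<exists>h\<in>Hplus. transient_form (h_measure (completion m) h) (h_form \<E>A h) (h_dom DA h))
            \<longrightarrow> (\<forall>h\<in>Hplus. transient_form (h_measure (completion m) h) (h_form \<E>A h) (h_dom DA h)))"
proof -
  obtain emb :: "'a \<Rightarrow> nat \<Rightarrow> real" where emb: "borel_embedding emb"
    using lusin_space_embedding[OF assms(1)] by blast
  have "emeasure m UNIV \<noteq> 0" using assms(4) by (auto simp: full_support_def dest!: spec[of _ UNIV])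
  interpret perturbed_process P X \<theta> m emb A\<mu>p A\<mu>m F
  proof (intro perturbed_process.intro lusin_symmetric_process.intro symmetric_right_process.intro borel_right_process.intro
      symmetric_right_process_axioms.intro lusin_symmetric_process_axioms.intro perturbed_process_axioms.intro)
    show "symmetric_process m (\<lambda>x. P (Some x)) X" using assms(7) by (simp add: Q)
  qed fact+
  have sub: "sets borel \<subseteq> sets (completion m)" using assms(2) by auto
  have sf: "sigma_finite_measure (completion m)" using assms(3) by (rule sigma_finite_completion)
  have c: "complete_measure (completion m)" ..
  have PK: "PA = K" unfolding PA Ap Am Q K_def ..
  have hm: "h \<in> borel_measurable (completion m)" and h0: "AE x in completion m. 0 < h x \<and> h x < \<infinity>"
    and super: "\<And>t. 0 < t \<Longrightarrow> AE x in completion m. K t h x \<le> h x" if h: "h \<in> Hplus" for h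
  proof -
    show "h \<in> borel_measurable (completion m)"
      using h by (intro quasi_continuous_measurable[OF c sf assms(8) sub]) (simp add: Hplus superharmonic_def)
    have "exceptional (completion m) \<E> D {x. \<not> (0 < h x \<and> h x < \<infinity>)}"
      using h unfolding Hplus superharmonic_def quasi_everywhere_def by blast
    from exceptional_AE[OF sf assms(8) sub this] show "AE x in completion m. 0 < h x \<and> h x < \<infinity>"
      by (simp only: mem_Collect_eq not_not)
    show "AE x in completion m. K t h x \<le> h x" if "0 < t" for t
    proof -
      have "exceptional (completion m) \<E> D {x. \<not> K t h x \<le> h x}"
        using h that unfolding Hplus superharmonic_def quasi_everywhere_def PK by blast
      from exceptional_AE[OF sf assms(8) sub this] show ?thesis
        by (simp only: mem_Collect_eq not_not)
    qed
  qed
  \<comment> \<open>Each h in \<open>Hplus\<close> certifies the contraction for the same operators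
    \<open>K\<close>. In the semigroup obtained from one h the criteria for h and for h' become the
    same statement about \<open>R 0\<close>.\<close>
  have semi: "symmetric_semigroup (completion m) K" if h: "h \<in> Hplus" for h
    using hm[OF h] h0[OF h] super[OF h] by (intro K_symmetric_semigroup[of h]) (simp_all add: AE_completion_iff)
  have "recurrent_form (h_measure (completion m) h') (h_form \<E>A h') (h_dom DA h')"
    if "h \<in> Hplus" "h' \<in> Hplus" "recurrent_form (h_measure (completion m) h) (h_form \<E>A h) (h_dom DA h)" for h h'
    using that(3) unfolding \<E>A DA PK
    by (simp only: symmetric_semigroup.recurrent_h_form_iff[OF semi[OF that(1)] hm[OF that(1)] h0[OF that(1)]]
        symmetric_semigroup.recurrent_h_form_iff[OF semi[OF that(1)] hm[OF that(2)] h0[OF that(2)]])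
  moreover have "transient_form (h_measure (completion m) h') (h_form \<E>A h') (h_dom DA h')"
    if "h \<in> Hplus" "h' \<in> Hplus" "transient_form (h_measure (completion m) h) (h_form \<E>A h) (h_dom DA h)" for h h'
    using that(3) unfolding \<E>A DA PK
    by (simp only: symmetric_semigroup.transient_h_form_iff[OF semi[OF that(1)] hm[OF that(1)] h0[OF that(1)]]
        symmetric_semigroup.transient_h_form_iff[OF semi[OF that(1)] hm[OF that(2)] h0[OF that(2)]])
  ultimately show ?thesis by blast
qed

end
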